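(* Let $\omega_0=\chi_{\{y\ge 0\}}$ be the characteristic function of the upper half-plane $\{(x,y)\in\mathbb{R}^2: y\ge 0\}$. Then there exist two sequences of compactly supported initial data $\{\omega_0^{i,n}\}_{n\ge1}$, $i=1,2$, with $\omega_0^{i,n}\to\omega_0$ in $L^2_{loc}(\mathbb{R}^2)$ as $n\to\infty$ for $i=1,2$, such that the corresponding unique Yudovich solutions $\omega^{i,n}(t)$ of the 2D Euler equation converge in $L^2_{loc}(\mathbb{R}^2)$ to different functions (for $i=1$ and $i=2$) at $t=1$. In fact, there are infinitely many solutions of the 2D Euler equation which are initially $\omega_0$ and which can be realized as a limit of compactly supported smooth solutions.
   Context: The 2D Euler equation in vorticity form on $\mathbb{R}^2$ is $\partial_t\omega+u\cdot\nabla\omega=0$ with $\nabla\cdot u=0$ and $\nabla\times u=\partial_1u_2-\partial_2u_1=\omega$. For $\omega_0\in L^1\cap L^\infty(\mathbb{R}^2)$ the Yudovich solution is the unique global solution with $\omega\in L^\infty([0,\infty);L^1\cap L^\infty)$, where $u(x)=\frac1{2\pi}\int_{\mathbb{R}^2}\frac{(x-y)^\perp}{|x-y|^2}\omega(y)\,dy$ and $(x_1,x_2)^\perp=(-x_2,x_1)$. In the last sentence of the claim, "solutions" are understood in the weak (distributional) sense, with $u$ a divergence-free field whose curl is $\omega$ (not necessarily given by the Biot–Savart integral $\frac1{2\pi}\int_{\mathbb{R}^2}\frac{(x-y)^\perp}{|x-y|^2}\omega(y)\,dy$); "compactly supported smooth solutions" are solutions whose vorticity is smooth and compactly supported; and limits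 are taken in $L^2_{loc}$. *)

theory Defs
  imports "HOL-Analysis.Analysis"
begin

text \<open>
  Time-dependent fields are curried functions \<open>\<omega> t x\<close>; only their values at times \<open>t \<ge> 0\<close> matter.
  Elements of Lebesgue spaces are represented by Borel functions, identified almost everywhere.
\<close>

definition perp :: "real^2 \<Rightarrow> real^2" where
  "perp x = vector [- (x $ 2), x $ 1]"

text \<open>The integrand is \<open>0\<close> at \<open>y = x\<close> by the convention on division by zero.\<close>

definition biot_savart :: "(real^2 \<Rightarrow> real) \<Rightarrow> real^2 \<Rightarrow> real^2" where
  "biot_savart w x =
     (1 / (2 * pi)) *\<^sub>R (LINT y|lborel. (w y / (norm (x - y))\<^sup>2) *\<^sub>R perp (x - y))"

primrec Ck :: "nat \<Rightarrow> ('a::euclidean_space \<Rightarrow> real) \<Rightarrow> bool" where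
  "Ck 0 f \<longleftrightarrow> continuous_on UNIV f"
| "Ck (Suc k) f \<longleftrightarrow>
     (\<forall>x. f differentiable (at x)) \<and> (\<forall>v. Ck k (\<lambda>x. frechet_derivative f (at x) v))"

definition smooth :: "('a::euclidean_space \<Rightarrow> real) \<Rightarrow> bool" where
  "smooth f \<longleftrightarrow> (\<forall>k. Ck k f)"

definition compactly_supported :: "('a::euclidean_space \<Rightarrow> real) \<Rightarrow> bool" where
  "compactly_supported f \<longleftrightarrow> (\<exists>K. compact K \<and> (\<forall>x. x \<notin> K \<longrightarrow> f x = 0))"

definition test_function :: "('a::euclidean_space \<Rightarrow> real) \<Rightarrow> bool" where
  "test_function \<phi> \<longleftrightarrow> smooth \<phi> \<and> compactly_supported \<phi>"

definition partial :: "2 \<Rightarrow> (real^2 \<Rightarrow> real) \<Rightarrow> real^2 \<Rightarrow> real" where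
  "partial i f x = frechet_derivative f (at x) (axis i 1)"

definition grad :: "(real^2 \<Rightarrow> real) \<Rightarrow> real^2 \<Rightarrow> real^2" where
  "grad f x = (\<chi> i. partial i f x)"

definition locally_integrable_on ::
    "'a::euclidean_space set \<Rightarrow> ('a \<Rightarrow> 'b::euclidean_space) \<Rightarrow> bool" where
  "locally_integrable_on S f \<longleftrightarrow> (\<forall>K. compact K \<and> K \<subseteq> S \<longrightarrow> set_integrable lborel K f)"

definition distr_div_free :: "(real^2 \<Rightarrow> real^2) \<Rightarrow> bool" where
  "distr_div_free v \<longleftrightarrow> (\<forall>\<psi>. test_function \<psi> \<longrightarrow> (LINT x|lborel. v x \<bullet> grad \<psi> x) = 0)"

text \<open>\<open>\<partial>\<^sub>1 v\<^sub>2 - \<partial>\<^sub>2 v\<^sub>1 = w\<close> in the sense of distributions.\<close>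

definition distr_curl :: "(real^2 \<Rightarrow> real^2) \<Rightarrow> (real^2 \<Rightarrow> real) \<Rightarrow> bool" where
  "distr_curl v w \<longleftrightarrow> (\<forall>\<psi>. test_function \<psi> \<longrightarrow>
     (LINT x|lborel. v x $ 1 * partial 2 \<psi> x - v x $ 2 * partial 1 \<psi> x)
       = (LINT x|lborel. w x * \<psi> x))"

text \<open>
  Weak form of \<open>\<partial>\<^sub>t \<omega> + u \<cdot> \<nabla>\<omega> = 0\<close> on \<open>[0,\<infinity>) \<times> \<real>\<^sup>2\<close>, for divergence-free \<open>u\<close>, with \<open>\<omega>(0) = w0\<close>.
  Asking for the identity on \<open>[0,T]\<close> for every \<open>T\<close>, not only almost every one, selects the
  weakly continuous representative in time, so that \<open>\<omega>(t)\<close> has a meaning for each fixed \<open>t\<close>.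
\<close>

definition weak_vorticity_eq ::
    "(real^2 \<Rightarrow> real) \<Rightarrow> (real \<Rightarrow> real^2 \<Rightarrow> real) \<Rightarrow> (real \<Rightarrow> real^2 \<Rightarrow> real^2) \<Rightarrow> bool" where
  "weak_vorticity_eq w0 \<omega> u \<longleftrightarrow>
     locally_integrable_on ({0..} \<times> UNIV) (\<lambda>(t, x). \<omega> t x) \<and>
     locally_integrable_on ({0..} \<times> UNIV) (\<lambda>(t, x). u t x) \<and>
     locally_integrable_on ({0..} \<times> UNIV) (\<lambda>(t, x). \<omega> t x *\<^sub>R u t x) \<and>
     (\<forall>t\<ge>0. locally_integrable_on UNIV (\<omega> t) \<and> locally_integrable_on UNIV (u t)) \<and>
     (AE x in lborel. \<omega> 0 x = w0 x) \<and>
     (\<forall>\<phi>. test_function \<phi> \<longrightarrow> (\<forall>T\<ge>0.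
        (LINT x|lborel. \<omega> T x * \<phi> (T, x)) - (LINT x|lborel. \<omega> 0 x * \<phi> (0, x)) =
        (LINT (t, x):{0..T} \<times> UNIV|lborel.
           \<omega> t x * (deriv (\<lambda>s. \<phi> (s, x)) t + u t x \<bullet> grad (\<lambda>y. \<phi> (t, y)) x))))"

text \<open>The velocity is any field with the right divergence and curl.\<close>

definition euler_weak_solution ::
    "(real^2 \<Rightarrow> real) \<Rightarrow> (real \<Rightarrow> real^2 \<Rightarrow> real) \<Rightarrow> (real \<Rightarrow> real^2 \<Rightarrow> real^2) \<Rightarrow> bool" where
  "euler_weak_solution w0 \<omega> u \<longleftrightarrow>
     weak_vorticity_eq w0 \<omega> u \<and> (\<forall>t\<ge>0. distr_div_free (u t) \<and> distr_curl (u t) (\<omega> t))"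

definition L1_Linf_bound :: "real \<Rightarrow> (real^2 \<Rightarrow> real) \<Rightarrow> bool" where
  "L1_Linf_bound C w \<longleftrightarrow>
     integrable lborel w \<and> (LINT x|lborel. \<bar>w x\<bar>) \<le> C \<and> (AE x in lborel. \<bar>w x\<bar> \<le> C)"

definition L1_Linf :: "(real^2 \<Rightarrow> real) \<Rightarrow> bool" where
  "L1_Linf w \<longleftrightarrow> (\<exists>C. L1_Linf_bound C w)"

definition in_yudovich_class :: "(real^2 \<Rightarrow> real) \<Rightarrow> (real \<Rightarrow> real^2 \<Rightarrow> real) \<Rightarrow> bool" where
  "in_yudovich_class w0 \<omega> \<longleftrightarrow>
     (\<exists>C. \<forall>t\<ge>0. L1_Linf_bound C (\<omega> t)) \<and> weak_vorticity_eq w0 \<omega> (\<lambda>t. biot_savart (\<omega> t))"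

definition yudovich_solution :: "(real^2 \<Rightarrow> real) \<Rightarrow> (real \<Rightarrow> real^2 \<Rightarrow> real) \<Rightarrow> bool" where
  "yudovich_solution w0 \<omega> \<longleftrightarrow>
     in_yudovich_class w0 \<omega> \<and>
     (\<forall>\<omega>'. in_yudovich_class w0 \<omega>' \<longrightarrow> (\<forall>t\<ge>0. AE x in lborel. \<omega>' t x = \<omega> t x))"

definition L2_loc :: "(real^2 \<Rightarrow> real) \<Rightarrow> bool" where
  "L2_loc f \<longleftrightarrow> f \<in> borel_measurable lborel \<and> locally_integrable_on UNIV (\<lambda>x. (f x)\<^sup>2)"

definition L2_loc_tendsto :: "(nat \<Rightarrow> real^2 \<Rightarrow> real) \<Rightarrow> (real^2 \<Rightarrow> real) \<Rightarrow> bool" where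
  "L2_loc_tendsto f g \<longleftrightarrow>
     (\<forall>n. L2_loc (f n)) \<and> L2_loc g \<and>
     (\<forall>K. compact K \<longrightarrow> (\<lambda>n. LINT x:K|lborel. (f n x - g x)\<^sup>2) \<longlonglongrightarrow> 0)"

text \<open>
  Smoothness up to \<open>t = 0\<close> is expressed by a smooth extension to all times; the spatial support
  is compact, uniformly on bounded time intervals.
\<close>

definition smooth_compact_vorticity :: "(real \<Rightarrow> real^2 \<Rightarrow> real) \<Rightarrow> bool" where
  "smooth_compact_vorticity \<omega> \<longleftrightarrow>
     (\<exists>W :: real \<times> (real^2) \<Rightarrow> real. smooth W \<and> (\<forall>t\<ge>0. \<forall>x. \<omega> t x = W (t, x))) \<and>
     (\<forall>T\<ge>0. \<exists>K. compact K \<and> (\<forall>t\<in>{0..T}. \<forall>x. x \<notin> K \<longrightarrow> \<omega> t x = 0))"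

text \<open>
  Here the velocity is the decaying one given by the Biot-Savart integral, which excludes merely
  changing to a moving frame.
\<close>

definition smooth_compact_euler_solution ::
    "(real \<Rightarrow> real^2 \<Rightarrow> real) \<Rightarrow> bool" where
  "smooth_compact_euler_solution \<omega> \<longleftrightarrow>
     smooth_compact_vorticity \<omega> \<and>
     euler_weak_solution (\<omega> 0) \<omega> (\<lambda>t. biot_savart (\<omega> t))"

definition half_plane :: "real^2 \<Rightarrow> real" where
  "half_plane = indicator {x. x $ 2 \<ge> 0}"

end

theory Submission
  imports Defs
begin

text \<open>
  A disc of vorticity \<open>1\<close> and radius \<open>m\<close> tangent to the horizontal axis at the origin approximates the
  half-plane. Surround it at distance of order \<open>m\<close> by compensating vorticity, so that it has circulation
  \<open>0\<close> and produces no velocity outside, and place it in the core of a much larger background vortex of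
  constant vorticity \<open>2 v / m\<close>, in which the fluid rotates rigidly around a point at distance \<open>m\<close> from
  the centre of the disc. The background carries the disc along a circle of radius \<open>m\<close> with speed \<open>v\<close>, and
  the radially symmetric disc changes neither itself nor the background: the superposition is an exact
  solution, also when everything is smoothed. As \<open>m\<close> tends to infinity the background vorticity vanishes,
  and the limit is the half-plane moving upwards with speed \<open>v\<close>, for every \<open>v\<close>.

  That the superposition is the only solution in the Yudovich class follows from an energy estimate for the
  difference of the velocities, whose \<open>L\<^sup>2\<close> norm is controlled by duality: the nonlinear term
  is the divergence of a quadratic stress tensor in this difference plus terms bounded by the gradient of the
  smooth velocity. Only the weak equation tested with functions of space on short time intervals is used.
\<close>

subsection \<open>Smooth functions\<close>

text \<open>The half-plane is not integrable, so its vorticity leaves a uniform velocity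
  undetermined; the drift \<open>v\<close> is what the ever larger background leaves behind. Only
  vorticities are passed to the limit: the limiting velocity \<open>shear_velocity\<close> is
  written down and checked directly. The turning rate \<open>v / m\<close> is half the background
  vorticity, and up to a fixed time the disc is displaced sideways by a distance of order
  \<open>1 / m\<close>. Each approximant is smooth, and zero circulation makes its velocity a test
  field. Uniqueness is therefore weak-strong uniqueness around a Lipschitz flow, and no
  log-Lipschitz estimate enters. The obstacle is the competitor: the difference of the two
  velocities is known to be bounded and continuous, but square integrability is not given. It is
  extracted from the equation: increments in time are paired with test fields, and duality yields
  membership in L^2 and Lipschitz continuity in time at once. The energy is not differentiated; its
  values at the ends of short intervals are compared, with an error quadratic in the length, and a
  discrete Gronwall argument concludes.\<close>

lemma Ck_SucI:
  assumes "\<And>x. (f has_derivative f' x) (at x)" and "\<And>v. Ck k (\<lambda>x. f' x v)"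
  shows "Ck (Suc k) f"
proof -
  have "frechet_derivative f (at x) = f' x" for x
    using frechet_derivative_at[OF assms(1)] by simp
  then show ?thesis
    using assms by (auto simp: differentiable_def)
qed

lemma Ck_has_derivative:
  "Ck (Suc k) f \<Longrightarrow> (f has_derivative frechet_derivative f (at x)) (at x)"
  by (simp add: frechet_derivative_works)

lemma Ck_SucD: "Ck (Suc k) f \<Longrightarrow> Ck k f"
proof (induction k arbitrary: f)
  case 0
  then show ?case
    by (auto simp: continuous_on_eq_continuous_at intro: differentiable_imp_continuous_within)
next
  case (Suc k)
  then show ?case by (metis Ck.simps(2))
qed

lemma Ck_const: "Ck k (\<lambda>x. c)"
proof (induction k arbitrary: c)
  case (Suc k)
  show ?case by (rule Ck_SucI[where f' = "\<lambda>x v. 0"]) (auto intro: Suc)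
qed simp

lemma Ck_add: "Ck k f \<Longrightarrow> Ck k g \<Longrightarrow> Ck k (\<lambda>x. f x + g x)"
proof (induction k arbitrary: f g)
  case (Suc k)
  show ?case
    by (rule Ck_SucI, rule has_derivative_add[OF Ck_has_derivative[OF Suc.prems(1)] Ck_has_derivative[OF Suc.prems(2)]])
      (use Suc in auto)
qed (auto intro: continuous_intros)

lemma Ck_mult: "Ck k f \<Longrightarrow> Ck k g \<Longrightarrow> Ck k (\<lambda>x. f x * g x)"
proof (induction k arbitrary: f g)
  case (Suc k)
  have fg: "Ck k f" "Ck k g"
    using Suc.prems Ck_SucD by blast+
  show ?case
    by (rule Ck_SucI, rule has_derivative_mult[OF Ck_has_derivative[OF Suc.prems(1)] Ck_has_derivative[OF Suc.prems(2)]])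
      (use Suc.prems fg in \<open>auto intro!: Ck_add Suc.IH\<close>)
qed (auto intro: continuous_intros)

lemma Ck_linear: "bounded_linear f \<Longrightarrow> Ck k (f :: 'a::euclidean_space \<Rightarrow> real)"
proof (cases k)
  case 0
  then show "bounded_linear f \<Longrightarrow> Ck k f"
    by (simp add: linear_continuous_on)
next
  case (Suc n)
  then show "bounded_linear f \<Longrightarrow> Ck k f"
    using Ck_SucI[of f "\<lambda>x. f" n] Ck_const bounded_linear_imp_has_derivative by blast
qed

lemma Ck_affine:
  fixes L :: "'b::euclidean_space \<Rightarrow> 'a::euclidean_space"
  assumes "bounded_linear L"
  shows "Ck k f \<Longrightarrow> Ck k (\<lambda>x. f (a + L x))"
proof (induction k arbitrary: f)
  case 0
  then show ?case
    by (auto intro!: continuous_on_compose2[of UNIV f] continuous_on_add continuous_on_const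
        linear_continuous_on[OF assms])
next
  case (Suc k)
  have L: "((\<lambda>x. a + L x) has_derivative L) (at x)" for x
    using bounded_linear_imp_has_derivative[OF assms] by (auto intro!: derivative_eq_intros)
  show ?case
    by (rule Ck_SucI, rule has_derivative_compose[OF L Ck_has_derivative[OF Suc.prems]])
      (use Suc in auto)
qed

lemma frechet_derivative_real:
  fixes g :: "real \<Rightarrow> real"
  assumes "g differentiable (at x)"
  shows "frechet_derivative g (at x) v = v * frechet_derivative g (at x) 1"
  using linear_frechet_derivative[OF assms] linear_cmul[of "frechet_derivative g (at x)" v 1]
  by simp

text \<open>The outer function is real, so its derivative is multiplication by a number: the chain
  rule becomes a product, to which \<open>Ck_mult\<close> and the induction hypothesis
  apply.\<close>

lemma Ck_compose:
  fixes f :: "'a::euclidean_space \<Rightarrow> real"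
  shows "Ck k g \<Longrightarrow> Ck k f \<Longrightarrow> Ck k (\<lambda>x. g (f x))"
proof (induction k arbitrary: f g)
  case 0
  then show ?case
    by (auto intro: continuous_on_compose2)
next
  case (Suc k)
  have f: "Ck k f"
    using Suc.prems Ck_SucD by blast
  have "Ck k (\<lambda>x. frechet_derivative f (at x) v * frechet_derivative g (at (f x)) 1)" for v
    by (rule Ck_mult) (use Suc f in auto)
  moreover have "(\<lambda>x. frechet_derivative g (at (f x)) (frechet_derivative f (at x) v)) =
      (\<lambda>x. frechet_derivative f (at x) v * frechet_derivative g (at (f x)) 1)" for v
    by (rule ext, rule frechet_derivative_real) (use Suc.prems in auto)
  ultimately have "Ck k (\<lambda>x. frechet_derivative g (at (f x)) (frechet_derivative f (at x) v))" for v
    by simp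
  then show ?case
    by (rule Ck_SucI[rotated]) (rule has_derivative_compose[OF Ck_has_derivative[OF Suc.prems(2)]
      Ck_has_derivative[OF Suc.prems(1)]])
qed

text \<open>The derivative of \<open>inverse (f x)\<close> is again built from
  \<open>inverse (f x)\<close> and a derivative of \<open>f\<close>, so the induction closes on the
  statement itself.\<close>

lemma Ck_inverse:
  fixes f :: "'a::euclidean_space \<Rightarrow> real"
  assumes "\<And>x. f x \<noteq> 0"
  shows "Ck k f \<Longrightarrow> Ck k (\<lambda>x. inverse (f x))"
proof (induction k)
  case 0
  then show ?case using assms by (auto intro!: continuous_intros)
next
  case (Suc k)
  have "Ck k (\<lambda>x. inverse (f x))"
    using Suc Ck_SucD by blast
  then have "Ck k (\<lambda>x. - 1 * (inverse (f x) * frechet_derivative f (at x) v * inverse (f x)))" for v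
    using Suc.prems by (intro Ck_mult Ck_const) auto
  then have "Ck k (\<lambda>x. - (inverse (f x) * frechet_derivative f (at x) v * inverse (f x)))" for v
    by simp
  then show ?case
    by (rule Ck_SucI[rotated]) (rule Deriv.has_derivative_inverse[OF assms Ck_has_derivative[OF Suc.prems]])
qed

named_theorems smooth_intros

lemma smooth_const [smooth_intros]: "smooth (\<lambda>x. c)"
  by (simp add: smooth_def Ck_const)

lemma smooth_add [smooth_intros]: "smooth f \<Longrightarrow> smooth g \<Longrightarrow> smooth (\<lambda>x. f x + g x)"
  by (simp add: smooth_def Ck_add)

lemma smooth_mult [smooth_intros]: "smooth f \<Longrightarrow> smooth g \<Longrightarrow> smooth (\<lambda>x. f x * g x)"
  by (simp add: smooth_def Ck_mult)

lemma smooth_uminus [smooth_intros]: "smooth f \<Longrightarrow> smooth (\<lambda>x. - f x)"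
  using smooth_mult[OF smooth_const[of "-1"], of f] by simp

lemma smooth_diff [smooth_intros]: "smooth f \<Longrightarrow> smooth g \<Longrightarrow> smooth (\<lambda>x. f x - g x)"
  using smooth_add[OF _ smooth_uminus, of f g] by simp

lemma smooth_linear: "bounded_linear f \<Longrightarrow> smooth (f :: 'a::euclidean_space \<Rightarrow> real)"
  by (simp add: smooth_def Ck_linear)

lemma smooth_ident [smooth_intros]: "smooth (\<lambda>x::real. x)"
  by (rule smooth_linear) (rule bounded_linear_ident)

lemma smooth_nth [smooth_intros]: "smooth (\<lambda>x::real^'n. x $ i)"
  by (rule smooth_linear) (rule bounded_linear_vec_nth)

lemma smooth_compose: "smooth g \<Longrightarrow> smooth f \<Longrightarrow> smooth (\<lambda>x. g (f x))"
  for f :: "'a::euclidean_space \<Rightarrow> real"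
  by (simp add: smooth_def Ck_compose)

lemma smooth_affine:
  fixes L :: "'b::euclidean_space \<Rightarrow> 'a::euclidean_space"
  shows "bounded_linear L \<Longrightarrow> smooth f \<Longrightarrow> smooth (\<lambda>x. f (a + L x))"
  by (simp add: smooth_def Ck_affine)

lemma smooth_divide:
  fixes f :: "'a::euclidean_space \<Rightarrow> real"
  shows "smooth g \<Longrightarrow> smooth f \<Longrightarrow> (\<And>x. f x \<noteq> 0) \<Longrightarrow> smooth (\<lambda>x. g x / f x)"
  unfolding divide_inverse by (rule smooth_mult) (auto simp: smooth_def intro!: Ck_inverse)

lemma smooth_frechet_derivative [smooth_intros]:
  "smooth f \<Longrightarrow> smooth (\<lambda>x. frechet_derivative f (at x) v)"
  unfolding smooth_def by (metis Ck.simps(2))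

lemma smooth_differentiable: "smooth f \<Longrightarrow> f differentiable (at x)"
  unfolding smooth_def by (metis Ck.simps(2))

lemma smooth_has_derivative:
  "smooth f \<Longrightarrow> (f has_derivative frechet_derivative f (at x)) (at x)"
  using smooth_differentiable frechet_derivative_works by blast

lemma smooth_continuous_on: "smooth f \<Longrightarrow> continuous_on S f"
  unfolding smooth_def by (metis Ck.simps(1) continuous_on_subset subset_UNIV)

lemma smooth_sin_cos: "Ck k (sin :: real \<Rightarrow> real) \<and> Ck k (cos :: real \<Rightarrow> real)"
proof (induction k)
  case (Suc k)
  have "Ck k (\<lambda>x. v * cos x)" "Ck k (\<lambda>x::real. - v * sin x)" for v
    by (intro Ck_mult Ck_const, use Suc in blast)+
  moreover have "(sin has_derivative (\<lambda>v. v * cos x)) (at x)"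
    "(cos has_derivative (\<lambda>v. - v * sin x)) (at x)" for x :: real
    by (auto intro!: derivative_eq_intros)
  ultimately show ?case
    using Ck_SucI[of sin "\<lambda>x v. v * cos x"] Ck_SucI[of cos "\<lambda>x v. - v * sin x"] by blast
qed (auto intro: continuous_intros)

lemma smooth_sin [smooth_intros]: "smooth f \<Longrightarrow> smooth (\<lambda>x. sin (f x))"
  and smooth_cos [smooth_intros]: "smooth f \<Longrightarrow> smooth (\<lambda>x. cos (f x))"
  for f :: "'a::euclidean_space \<Rightarrow> real"
  using smooth_compose[of sin f] smooth_compose[of cos f] smooth_sin_cos by (auto simp: smooth_def)

section \<open>A smooth step built from \<open>exp (- (1 / x))\<close>\<close>

definition flat_exp :: "nat \<Rightarrow> real \<Rightarrow> real" where
  "flat_exp j x = (if x > 0 then (1 / x) ^ j * exp (- (1 / x)) else 0)"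

lemma flat_exp_tendsto: "(flat_exp j \<longlongrightarrow> 0) (at 0)"
proof -
  have "((\<lambda>x::real. inverse x ^ j / exp (inverse x)) \<longlongrightarrow> 0) (at_right 0)"
    by (rule filterlim_compose[OF tendsto_power_div_exp_0 filterlim_inverse_at_top_right])
  then have "(flat_exp j \<longlongrightarrow> 0) (at_right 0)"
    by (rule Lim_transform_eventually)
      (auto simp: flat_exp_def exp_minus field_simps eventually_at_filter)
  moreover have "(flat_exp j \<longlongrightarrow> 0) (at_left 0)"
    by (rule tendsto_eventually) (auto simp: flat_exp_def eventually_at_filter)
  ultimately show ?thesis
    by (simp add: filterlim_split_at)
qed

text \<open>The powers \<open>(1 / x) ^ j\<close> are carried along because differentiation maps the
  family to combinations of members with larger \<open>j\<close>; \<open>Ck_flat_exp\<close> is then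
  an induction on the order for all \<open>j\<close> together.\<close>

lemma flat_exp_has_derivative:
  "(flat_exp j has_field_derivative flat_exp (j + 2) x - real j * flat_exp (j + 1) x) (at x)"
proof (cases x "0::real" rule: linorder_cases)
  case less
  have "(flat_exp j has_field_derivative 0) (at x)"
    by (rule has_field_derivative_transform_within_open[of "\<lambda>x. 0" _ _ "{..<0}"])
      (use less in \<open>auto simp: flat_exp_def\<close>)
  then show ?thesis using less by (simp add: flat_exp_def)
next
  case equal
  \<comment> \<open>For \<open>h \<noteq> 0\<close> the difference quotient at \<open>0\<close> is
    \<open>flat_exp (j + 1) h\<close> itself.\<close>
  have "((\<lambda>h. flat_exp (j + 1) h) \<longlongrightarrow> 0) (at 0)"
    by (rule flat_exp_tendsto)
  then have "((\<lambda>h. (flat_exp j (0 + h) - flat_exp j 0) / h) \<longlongrightarrow> 0) (at 0)"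
    by (rule Lim_transform_eventually) (auto simp: flat_exp_def eventually_at_filter)
  then show ?thesis using equal by (simp add: DERIV_def flat_exp_def)
next
  case greater
  \<comment> \<open>For \<open>j = 0\<close> the exponent \<open>j - Suc 0\<close> is truncated, but
    there the factor \<open>real j\<close> vanishes.\<close>
  have j: "real j * (inverse x) ^ (j - Suc 0) * (inverse x) ^ 2 = real j * (inverse x) ^ (j + 1)"
    by (cases j) (auto simp: power2_eq_square)
  have "((\<lambda>x. inverse x ^ j * exp (- inverse x)) has_field_derivative
      inverse x ^ (j + 2) * exp (- inverse x) - real j * inverse x ^ (j + 1) * exp (- inverse x)) (at x)"
    unfolding j[symmetric] using greater
    by (auto intro!: derivative_eq_intros simp: power2_eq_square algebra_simps)
  then show ?thesis
    by (rule has_field_derivative_transform_within_open[of _ _ _ "{0<..}", THEN DERIV_cong])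
      (use greater in \<open>auto simp: flat_exp_def inverse_eq_divide\<close>)
qed

lemma Ck_flat_exp: "Ck k (flat_exp j)"
proof (induction k arbitrary: j)
  case 0
  show ?case
    by (simp add: continuous_on_eq_continuous_at) (meson DERIV_isCont flat_exp_has_derivative)
next
  case (Suc k)
  have "Ck k (\<lambda>x. (flat_exp (j + 2) x + - real j * flat_exp (j + 1) x) * v)" for v
    by (intro Ck_mult Ck_add Ck_const Suc)
  moreover have "(flat_exp j has_derivative (\<lambda>v. (flat_exp (j + 2) x + - real j * flat_exp (j + 1) x) * v)) (at x)" for x
    using flat_exp_has_derivative[of j x] by (simp add: has_field_derivative_def)
  ultimately show ?case
    using Ck_SucI[of "flat_exp j"
        "\<lambda>x v. (flat_exp (j + 2) x + - real j * flat_exp (j + 1) x) * v" k] by blast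
qed

text \<open>The descent from \<open>1\<close> to \<open>0\<close> lies in
  \<open>-1 \<le> x \<le> 0\<close>, so a shifted step vanishes exactly from its shift on. At every
  \<open>x\<close> one of \<open>- x\<close> and \<open>x + 1\<close> is positive, which keeps the
  denominator away from \<open>0\<close>.\<close>

definition smooth_step :: "real \<Rightarrow> real" where
  "smooth_step x = flat_exp 0 (- x) / (flat_exp 0 (- x) + flat_exp 0 (x + 1))"

lemma smooth_step_denominator: "flat_exp 0 (- x) + flat_exp 0 (x + 1) > 0"
  using exp_gt_zero by (cases "x < 0"; cases "x > -1") (auto simp: flat_exp_def intro: add_pos_pos)

lemma smooth_smooth_step: "smooth smooth_step"
proof -
  have "smooth (flat_exp 0)"
    by (simp add: smooth_def Ck_flat_exp)
  then have "smooth (\<lambda>x::real. flat_exp 0 (- x))" "smooth (\<lambda>x::real. flat_exp 0 (x + 1))"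
    using smooth_compose[of "flat_exp 0" "\<lambda>x::real. - x"]
      smooth_compose[of "flat_exp 0" "\<lambda>x::real. x + 1"]
    by (simp_all add: smooth_uminus smooth_ident smooth_const smooth_add)
  moreover have "flat_exp 0 (- x) + flat_exp 0 (x + 1) \<noteq> 0" for x
    by (rule less_imp_neq[OF smooth_step_denominator, THEN not_sym])
  ultimately have "smooth (\<lambda>x. flat_exp 0 (- x) / (flat_exp 0 (- x) + flat_exp 0 (x + 1)))"
    by (intro smooth_divide smooth_add)
  then show ?thesis
    by (simp add: smooth_step_def[abs_def])
qed

lemma smooth_step_eq_1: "x \<le> - 1 \<Longrightarrow> smooth_step x = 1"
  by (simp add: smooth_step_def flat_exp_def)

lemma smooth_step_eq_0: "x \<ge> 0 \<Longrightarrow> smooth_step x = 0"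
  by (simp add: smooth_step_def flat_exp_def)

lemma smooth_step_bounds: "0 \<le> smooth_step x" "smooth_step x \<le> 1"
proof -
  have "0 \<le> flat_exp 0 (- x)" "0 \<le> flat_exp 0 (x + 1)"
    by (simp_all add: flat_exp_def)
  then show "0 \<le> smooth_step x" "smooth_step x \<le> 1"
    using smooth_step_denominator[of x] by (auto simp: smooth_step_def)
qed

subsection \<open>Compactly supported functions and integration by parts\<close>

lemma compactly_supportedI:
  "(\<And>x. norm x \<ge> R \<Longrightarrow> f x = 0) \<Longrightarrow> compactly_supported f"
  unfolding compactly_supported_def by (rule exI[of _ "cball 0 R"]) auto

lemma compactly_supportedE:
  assumes "compactly_supported f"
  obtains R where "R > 0" "\<And>x. norm x \<ge> R \<Longrightarrow> f x = 0"
proof -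
  obtain K where K: "compact K" "\<And>x. x \<notin> K \<Longrightarrow> f x = 0"
    using assms by (auto simp: compactly_supported_def)
  then obtain b where "b > 0" "\<forall>x\<in>K. norm x \<le> b"
    using compact_imp_bounded bounded_pos by blast
  with K(2) show ?thesis
    by (intro that[of "b + 1"]) force+
qed

lemma integrable_continuous_cs:
  fixes f :: "'a::euclidean_space \<Rightarrow> 'b::euclidean_space"
  assumes "continuous_on UNIV f" and "\<And>x. norm x \<ge> R \<Longrightarrow> f x = 0"
  shows "integrable lborel f"
proof -
  have "integrable lborel (\<lambda>x. indicator (cball 0 R) x *\<^sub>R f x)"
    by (rule borel_integrable_compact) (use continuous_on_subset[OF assms(1)] in auto)
  moreover have "(\<lambda>x. indicator (cball 0 R) x *\<^sub>R f x) = f"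
    using assms(2) by (auto simp: indicator_def fun_eq_iff)
  ultimately show ?thesis by simp
qed

lemma continuous_cs_bounded:
  fixes f :: "'a::euclidean_space \<Rightarrow> 'b::real_normed_vector"
  assumes "continuous_on UNIV f" and "\<And>x. norm x \<ge> R \<Longrightarrow> f x = 0"
  obtains B where "B > 0" "\<And>x. norm (f x) \<le> B"
proof -
  have "compact (f ` cball 0 R)"
    using assms(1) by (intro compact_continuous_image) (auto intro: continuous_on_subset)
  then obtain B where B: "B > 0" "\<And>x. norm x \<le> R \<Longrightarrow> norm (f x) \<le> B"
    using compact_imp_bounded[of "f ` cball 0 R"] by (auto simp: bounded_pos)
  have "norm (f x) \<le> B" for x
    using B assms(2)[of x] by (cases "norm x \<le> R") auto
  with B(1) that show ?thesis by blast
qed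

lemma continuous_cs_uniformly_continuous:
  fixes f :: "'a::euclidean_space \<Rightarrow> 'b::real_normed_vector"
  assumes "continuous_on UNIV f" and zero: "\<And>x. norm x \<ge> R \<Longrightarrow> f x = 0" and "e > 0"
  obtains d where "d > 0" "\<And>x y. norm (y - x) < d \<Longrightarrow> norm (f y - f x) < e"
proof -
  have "uniformly_continuous_on (cball 0 (R + 1)) f"
    using assms(1) by (intro compact_uniformly_continuous) (auto intro: continuous_on_subset)
  then obtain d where d: "d > 0"
    "\<And>x y. norm x \<le> R + 1 \<Longrightarrow> norm y \<le> R + 1 \<Longrightarrow> norm (y - x) < d \<Longrightarrow> norm (f y - f x) < e"
    using \<open>e > 0\<close> unfolding uniformly_continuous_on_def by (force simp: dist_norm)
  have "norm (f y - f x) < e" if "norm (y - x) < min d 1" for x y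
  proof (cases "norm x \<le> R + 1 \<and> norm y \<le> R + 1")
    case True
    then show ?thesis using d that by auto
  next
    case False
    have "norm y \<le> norm x + norm (y - x)" "norm x \<le> norm y + norm (y - x)"
      using norm_triangle_sub[of y x] norm_triangle_sub[of x y] by (auto simp: norm_minus_commute)
    then have "norm x \<ge> R" "norm y \<ge> R"
      using False that by auto
    then show ?thesis using zero \<open>e > 0\<close> by simp
  qed
  then show ?thesis using that[of "min d 1"] d(1) by auto
qed

lemma frechet_derivative_eq_0_outside:
  fixes f :: "'a::euclidean_space \<Rightarrow> real"
  assumes "\<And>x. norm x \<ge> R \<Longrightarrow> f x = 0" and "norm x > R"
  shows "frechet_derivative f (at x) v = 0"
proof -
  have "open {x::'a. norm x > R}"
    by (intro open_Collect_less continuous_intros)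
  then have "(f has_derivative (\<lambda>v. 0)) (at x)"
    by (rule has_derivative_transform_within_open[OF has_derivative_const[of 0]])
      (use assms in auto)
  then show ?thesis
    using frechet_derivative_at by metis
qed

lemma test_function_derivative:
  assumes "test_function f"
  shows "test_function (\<lambda>x. frechet_derivative f (at x) v)"
proof -
  obtain R where R: "\<And>x. norm x \<ge> R \<Longrightarrow> f x = 0"
    using assms compactly_supportedE unfolding test_function_def by metis
  have "compactly_supported (\<lambda>x. frechet_derivative f (at x) v)"
    by (rule compactly_supportedI[of "R + 1"], rule frechet_derivative_eq_0_outside[of R f])
      (use R in auto)
  then show ?thesis
    using assms by (simp add: test_function_def smooth_frechet_derivative)
qed

lemma test_function_mult:
  assumes "smooth g" "test_function f"
  shows "test_function (\<lambda>x. g x * f x)" "test_function (\<lambda>x. f x * g x)"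
  using assms unfolding test_function_def compactly_supported_def
  by (auto intro!: smooth_mult)

lemma test_function_add:
  assumes "test_function f" "test_function g"
  shows "test_function (\<lambda>x. f x + g x)"
proof -
  obtain R S where "\<And>x. norm x \<ge> R \<Longrightarrow> f x = 0" "\<And>x. norm x \<ge> S \<Longrightarrow> g x = 0"
    using assms compactly_supportedE unfolding test_function_def by metis
  then have "compactly_supported (\<lambda>x. f x + g x)"
    by (intro compactly_supportedI[of "max R S"]) auto
  then show ?thesis
    using assms by (simp add: test_function_def smooth_add)
qed

lemma test_function_smooth: "test_function f \<Longrightarrow> smooth f"
  by (simp add: test_function_def)

lemma test_function_continuous: "test_function f \<Longrightarrow> continuous_on S f"
  by (simp add: test_function_def smooth_continuous_on)

text \<open>The radius is enlarged by \<open>1\<close> because the derivative is known to vanish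
  only strictly outside the ball; after that, function and derivatives share one closed
  exterior.\<close>

lemma test_function_supportE:
  assumes "test_function f"
  obtains R where "R > 0" "\<And>x. norm x \<ge> R \<Longrightarrow> f x = 0"
    "\<And>x v. norm x \<ge> R \<Longrightarrow> frechet_derivative f (at x) v = 0"
proof -
  obtain R where R: "R > 0" "\<And>x. norm x \<ge> R \<Longrightarrow> f x = 0"
    using assms compactly_supportedE unfolding test_function_def by metis
  show ?thesis
    by (rule that[of "R + 1"], use R in simp, use R in simp, rule frechet_derivative_eq_0_outside[of R f])
      (use R in auto)
qed

lemma test_function_boundedE:
  assumes "test_function f"
  obtains B where "B > 0" "\<And>x. \<bar>f x\<bar> \<le> B"
proof -
  obtain R where "\<And>x. norm x \<ge> R \<Longrightarrow> f x = 0"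
    using assms test_function_supportE by metis
  from continuous_cs_bounded[OF test_function_continuous[OF assms] this] that show ?thesis
    by auto
qed

lemma test_function_integrable: "test_function f \<Longrightarrow> integrable lborel f"
  by (metis test_function_supportE integrable_continuous_cs test_function_continuous)

lemma test_function_measurable [measurable_dest]: "test_function f \<Longrightarrow> f \<in> borel_measurable borel"
  by (intro borel_measurable_continuous_onI test_function_continuous)

text \<open>Writes the derivative as the pairing with one gradient vector, so that its continuity in
  \<open>x\<close> becomes uniform over all directions \<open>v\<close>.\<close>

lemma frechet_derivative_basis_sum:
  fixes f :: "'a::euclidean_space \<Rightarrow> real"
  assumes "f differentiable (at x)"
  shows "frechet_derivative f (at x) v = (\<Sum>b\<in>Basis. frechet_derivative f (at x) b *\<^sub>R b) \<bullet> v"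
proof -
  have "linear (frechet_derivative f (at x))"
    using assms by (rule linear_frechet_derivative)
  then have "frechet_derivative f (at x) (\<Sum>b\<in>Basis. (v \<bullet> b) *\<^sub>R b) =
      (\<Sum>b\<in>Basis. (v \<bullet> b) * frechet_derivative f (at x) b)"
    by (simp add: linear_sum linear_cmul)
  then have "frechet_derivative f (at x) v = (\<Sum>b\<in>Basis. (v \<bullet> b) * frechet_derivative f (at x) b)"
    by (simp only: euclidean_representation)
  then show ?thesis
    by (simp add: inner_sum_left inner_sum_right inner_commute mult.commute)
qed

lemma directional_mvt:
  fixes f :: "'a::euclidean_space \<Rightarrow> real"
  assumes "\<And>x. f differentiable (at x)"
  obtains s where "0 \<le> s" "s \<le> 1" "f (x + v) - f x = frechet_derivative f (at (x + s *\<^sub>R v)) v"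
proof -
  have "((\<lambda>s. f (x + s *\<^sub>R v)) has_derivative
      (\<lambda>h. frechet_derivative f (at (x + s *\<^sub>R v)) (h *\<^sub>R v))) (at s within {0..1})" for s :: real
    by (rule has_derivative_compose[of "\<lambda>s. x + s *\<^sub>R v"])
      (use assms in \<open>auto intro!: derivative_eq_intros simp: frechet_derivative_works\<close>)
  from mvt_very_simple[of 0 1, OF _ this] show ?thesis
    using that by auto
qed

lemma directional_DERIV:
  fixes f :: "'a::euclidean_space \<Rightarrow> real"
  assumes "f differentiable (at (x + s *\<^sub>R v))"
  shows "((\<lambda>s. f (x + s *\<^sub>R v)) has_field_derivative frechet_derivative f (at (x + s *\<^sub>R v)) v) (at s)"
proof -
  have "((\<lambda>s. f (x + s *\<^sub>R v)) has_derivative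
      (\<lambda>h. frechet_derivative f (at (x + s *\<^sub>R v)) (h *\<^sub>R v))) (at s)"
    by (rule has_derivative_compose[of "\<lambda>s. x + s *\<^sub>R v"])
      (use assms in \<open>auto intro!: derivative_eq_intros simp: frechet_derivative_works\<close>)
  then show ?thesis
    using linear_cmul[OF linear_frechet_derivative[OF assms]]
    by (simp add: has_field_derivative_def mult.commute[of _ "frechet_derivative f _ _"])
qed

section \<open>Translation invariance and integration by parts\<close>

lemma
  fixes f :: "'a::euclidean_space \<Rightarrow> 'b::euclidean_space"
  assumes [measurable]: "f \<in> borel_measurable borel"
  shows integral_translation: "(LINT x|lborel. f (c + x)) = (LINT x|lborel. f x)"
    and integral_reflection: "(LINT x|lborel. f (c - x)) = (LINT x|lborel. f x)"
proof -
  have "(LINT x|lborel. f x) = (LINT x|distr lborel borel ((+) c). f x)"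
    by (simp add: lborel_distr_plus)
  then show "(LINT x|lborel. f (c + x)) = (LINT x|lborel. f x)"
    by (simp add: integral_distr)
  have "lborel = distr lborel borel (\<lambda>x::'a. c + (- 1) *\<^sub>R x)"
    by (subst lborel_affine[of "-1" c]) (auto simp: density_1)
  then have "(LINT x|lborel. f x) = (LINT x|distr lborel borel (\<lambda>x. c + (- 1) *\<^sub>R x). f x)"
    by simp
  then show "(LINT x|lborel. f (c - x)) = (LINT x|lborel. f x)"
    by (simp add: integral_distr)
qed

text \<open>Difference quotients along \<open>e\<close> are shifted from \<open>\<phi>\<close> to
  \<open>g\<close> by translation invariance, and both sides converge by dominated convergence. The
  Lipschitz bound along \<open>e\<close> makes an almost everywhere derivative sufficient; this
  covers the truncated kernel \<open>reg_kern\<close> and the kinked function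
  \<open>ramp\<close>.\<close>

lemma integral_by_parts_lipschitz:
  fixes \<phi> g Dg :: "'a::euclidean_space \<Rightarrow> real"
  assumes \<phi>: "test_function \<phi>" and g: "continuous_on UNIV g"
    and lip: "\<And>x h. \<bar>g (x + h *\<^sub>R e) - g x\<bar> \<le> L * \<bar>h\<bar>"
    and Dg [measurable]: "Dg \<in> borel_measurable borel"
    and der: "AE x in lborel. ((\<lambda>h. (g (x + h *\<^sub>R e) - g x) / h) \<longlongrightarrow> Dg x) (at 0)"
  shows "(LINT x|lborel. g x * frechet_derivative \<phi> (at x) e) = - (LINT x|lborel. Dg x * \<phi> x)"
proof -
  obtain R where R: "R > 0" "\<And>x. norm x \<ge> R \<Longrightarrow> \<phi> x = 0"
    using test_function_supportE[OF \<phi>] by metis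
  obtain M where M: "M > 0" "\<And>x. \<bar>frechet_derivative \<phi> (at x) e\<bar> \<le> M"
    using test_function_boundedE[OF test_function_derivative[OF \<phi>]] by metis
  obtain P where P: "P > 0" "\<And>x. \<bar>\<phi> x\<bar> \<le> P"
    using test_function_boundedE[OF \<phi>] by metis
  have [measurable]: "g \<in> borel_measurable borel" "\<phi> \<in> borel_measurable borel"
    "(\<lambda>x. frechet_derivative \<phi> (at x) e) \<in> borel_measurable borel"
    using g \<phi> by (auto intro: borel_measurable_continuous_onI test_function_continuous
        test_function_derivative)
  \<comment> \<open>Shifts by \<open>h n *\<^sub>R e\<close> with \<open>h n \<le> 1\<close> move
    the support of \<open>\<phi>\<close> by at most \<open>norm e\<close>, so a single ball carries
    all the integrands.\<close>
  define R' where "R' = R + norm e"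
  have "compact (g ` cball 0 R')"
    using g by (intro compact_continuous_image) (auto intro: continuous_on_subset)
  then obtain B where B: "B > 0" "\<And>x. norm x \<le> R' \<Longrightarrow> \<bar>g x\<bar> \<le> B"
    using compact_imp_bounded[of "g ` cball 0 R'"] by (auto simp: bounded_pos)
  define h where "h n = inverse (real (Suc n))" for n
  have h: "0 < h n" "h n \<le> 1" for n
    by (auto simp: h_def field_simps)
  have h0: "h \<longlonglongrightarrow> 0"
    unfolding h_def by (rule LIMSEQ_inverse_real_of_nat)
  have hlim: "filterlim h (at 0) sequentially"
    using h0 by (rule filterlim_atI) (use h in \<open>auto simp: less_imp_neq[THEN not_sym]\<close>)
  have hlim': "filterlim (\<lambda>n. - h n) (at 0) sequentially"
    using tendsto_minus[OF h0]
    by (intro filterlim_atI) (use h in \<open>auto simp: less_imp_neq[THEN not_sym]\<close>)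
  have quot: "\<bar>(\<phi> (x + h n *\<^sub>R e) - \<phi> x) / h n\<bar> \<le> M" for x n
  proof -
    obtain s where "\<phi> (x + h n *\<^sub>R e) - \<phi> x =
        frechet_derivative \<phi> (at (x + s *\<^sub>R (h n *\<^sub>R e))) (h n *\<^sub>R e)"
      using directional_mvt[of \<phi> x "h n *\<^sub>R e"] smooth_differentiable[OF test_function_smooth[OF \<phi>]]
      by metis
    then have "\<phi> (x + h n *\<^sub>R e) - \<phi> x = h n * frechet_derivative \<phi> (at (x + s *\<^sub>R (h n *\<^sub>R e))) e"
      using linear_cmul[OF linear_frechet_derivative[OF smooth_differentiable[OF test_function_smooth[OF \<phi>]]]]
      by simp
    then show ?thesis
      using M(2) h(1)[of n] by (simp add: less_imp_neq[THEN not_sym])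
  qed
  have zero: "\<phi> (x + h n *\<^sub>R e) = 0 \<and> \<phi> x = 0 \<and> frechet_derivative \<phi> (at x) e = 0"
    if "norm x > R'" for x n
  proof -
    have "norm x \<le> norm (x + h n *\<^sub>R e) + norm (h n *\<^sub>R e)"
      using norm_triangle_ineq4[of "x + h n *\<^sub>R e" "h n *\<^sub>R e"] by simp
    also have "norm (h n *\<^sub>R e) \<le> norm e"
      using h[of n] by (simp add: mult_left_le_one_le)
    finally have "norm (x + h n *\<^sub>R e) \<ge> R"
      using that by (simp add: R'_def)
    moreover have "norm x > R"
      using that norm_ge_zero[of e] unfolding R'_def by linarith
    ultimately show ?thesis
      using R(2) frechet_derivative_eq_0_outside[OF R(2)] by auto
  qed
  have lim1: "(\<lambda>n. LINT x|lborel. g x * ((\<phi> (x + h n *\<^sub>R e) - \<phi> x) / h n)) \<longlonglongrightarrow>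
      (LINT x|lborel. g x * frechet_derivative \<phi> (at x) e)"
  proof (rule integral_dominated_convergence[where w = "\<lambda>x. indicator (cball 0 R') x *\<^sub>R (B * M)"])
    show "integrable lborel (\<lambda>x. indicator (cball 0 R') x *\<^sub>R (B * M))"
      by (rule borel_integrable_compact) auto
    show "AE x in lborel. (\<lambda>n. g x * ((\<phi> (x + h n *\<^sub>R e) - \<phi> x) / h n)) \<longlonglongrightarrow>
        g x * frechet_derivative \<phi> (at x) e"
    proof (intro AE_I2 tendsto_mult_left)
      fix x
      have "((\<lambda>s. \<phi> (x + s *\<^sub>R e)) has_field_derivative frechet_derivative \<phi> (at (x + 0 *\<^sub>R e)) e) (at 0)"
        by (rule directional_DERIV) (rule smooth_differentiable[OF test_function_smooth[OF \<phi>]])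
      then show "(\<lambda>n. (\<phi> (x + h n *\<^sub>R e) - \<phi> x) / h n) \<longlonglongrightarrow> frechet_derivative \<phi> (at x) e"
        using hlim unfolding DERIV_def by (auto dest: filterlim_compose)
    qed
    show "AE x in lborel. norm (g x * ((\<phi> (x + h n *\<^sub>R e) - \<phi> x) / h n)) \<le>
        indicator (cball 0 R') x *\<^sub>R (B * M)" for n
    proof (intro AE_I2)
      fix x
      show "norm (g x * ((\<phi> (x + h n *\<^sub>R e) - \<phi> x) / h n)) \<le> indicator (cball 0 R') x *\<^sub>R (B * M)"
      proof (cases "norm x \<le> R'")
        case True
        then show ?thesis
          using mult_mono[OF B(2)[OF True] quot[of x n]] B(1) by (simp add: abs_mult)
      next
        case False
        then show ?thesis
          using zero[of x n] by (simp add: indicator_def)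
      qed
    qed
  qed measurable
  have lim2: "(\<lambda>n. LINT x|lborel. (g (x + (- h n) *\<^sub>R e) - g x) / (- h n) * \<phi> x) \<longlonglongrightarrow>
      (LINT x|lborel. Dg x * \<phi> x)"
  proof (rule integral_dominated_convergence[where w = "\<lambda>x. indicator (cball 0 R') x *\<^sub>R (L * P)"])
    show "integrable lborel (\<lambda>x. indicator (cball 0 R') x *\<^sub>R (L * P))"
      by (rule borel_integrable_compact) auto
    show "AE x in lborel. (\<lambda>n. (g (x + (- h n) *\<^sub>R e) - g x) / (- h n) * \<phi> x) \<longlonglongrightarrow> Dg x * \<phi> x"
      using der
    proof (rule AE_mp, intro AE_I2 impI tendsto_mult_right)
      fix x assume "((\<lambda>h. (g (x + h *\<^sub>R e) - g x) / h) \<longlongrightarrow> Dg x) (at 0)"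
      from filterlim_compose[OF this hlim']
      show "(\<lambda>n. (g (x + (- h n) *\<^sub>R e) - g x) / (- h n)) \<longlonglongrightarrow> Dg x" .
    qed
    show "AE x in lborel. norm ((g (x + (- h n) *\<^sub>R e) - g x) / (- h n) * \<phi> x) \<le>
        indicator (cball 0 R') x *\<^sub>R (L * P)" for n
    proof (intro AE_I2)
      fix x
      show "norm ((g (x + (- h n) *\<^sub>R e) - g x) / (- h n) * \<phi> x) \<le> indicator (cball 0 R') x *\<^sub>R (L * P)"
      proof (cases "norm x \<le> R'")
        case True
        have "\<bar>(g (x + (- h n) *\<^sub>R e) - g x) / (- h n)\<bar> \<le> L"
          using lip[of x "- h n"] h(1)[of n] by (simp add: field_simps)
        moreover have "L \<ge> 0"
          using lip[of x 1] by linarith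
        ultimately have "\<bar>(g (x + (- h n) *\<^sub>R e) - g x) / (- h n)\<bar> * \<bar>\<phi> x\<bar> \<le> L * P"
          by (intro mult_mono P) auto
        then show ?thesis
          using True by (simp only: real_norm_def abs_mult) simp
      next
        case False
        then show ?thesis
          using zero[of x n] by (simp add: indicator_def)
      qed
    qed
  qed measurable
  \<comment> \<open>Summation by parts: translating by \<open>h n *\<^sub>R e\<close> turns the
    forward quotient of \<open>\<phi>\<close> into the backward quotient of \<open>g\<close>, hence
    the increments \<open>- h n\<close> and the minus sign in front.\<close>
  have eq: "(LINT x|lborel. g x * ((\<phi> (x + h n *\<^sub>R e) - \<phi> x) / h n)) =
      - (LINT x|lborel. (g (x + (- h n) *\<^sub>R e) - g x) / (- h n) * \<phi> x)" for n
  proof -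
    have i1: "integrable lborel (\<lambda>x. g x * \<phi> x)"
      by (rule integrable_continuous_cs[of _ R])
        (auto intro!: continuous_intros g test_function_continuous[OF \<phi>] R(2))
    have i2: "integrable lborel (\<lambda>x. g (x + (- h n) *\<^sub>R e) * \<phi> x)"
      by (rule integrable_continuous_cs[of _ R])
        (auto intro!: continuous_intros continuous_on_compose2[OF g] test_function_continuous[OF \<phi>] R(2))
    have c: "continuous_on UNIV (\<lambda>x. \<phi> (x + h n *\<^sub>R e))"
      by (auto intro!: continuous_intros continuous_on_compose2[OF test_function_continuous[OF \<phi>, of UNIV]])
    have i3: "integrable lborel (\<lambda>x. g x * \<phi> (x + h n *\<^sub>R e))"
      by (rule integrable_continuous_cs[of _ "R' + 1"])
        (use zero in \<open>auto intro!: continuous_on_mult g c\<close>)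
    have "(LINT x|lborel. g x * \<phi> (x + h n *\<^sub>R e)) = (LINT x|lborel. g (x + (- h n) *\<^sub>R e) * \<phi> x)"
      using integral_translation[of "\<lambda>x. g (x + (- h n) *\<^sub>R e) * \<phi> x" "h n *\<^sub>R e"]
      by (simp add: add.commute)
    then have "(LINT x|lborel. g x * \<phi> (x + h n *\<^sub>R e) - g x * \<phi> x) =
        (LINT x|lborel. g (x + (- h n) *\<^sub>R e) * \<phi> x - g x * \<phi> x)"
      using i1 i2 i3 by simp
    then have "(LINT x|lborel. (g x * \<phi> (x + h n *\<^sub>R e) - g x * \<phi> x) / h n) =
        (LINT x|lborel. (g (x + (- h n) *\<^sub>R e) * \<phi> x - g x * \<phi> x) / h n)"
      by simp
    then show ?thesis
      by (subst Bochner_Integration.integral_minus[symmetric])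
        (simp add: algebra_simps diff_divide_distrib)
  qed
  show ?thesis
    using LIMSEQ_unique[OF lim1] tendsto_minus[OF lim2] unfolding eq by blast
qed

lemma integral_frechet_derivative_eq_0:
  assumes "test_function \<phi>"
  shows "(LINT x|lborel. frechet_derivative \<phi> (at x) e) = 0"
  using integral_by_parts_lipschitz[OF assms, of "\<lambda>x. 1" e 0 "\<lambda>x. 0"] by simp

lemma frechet_derivative_mult:
  fixes f g :: "'a::euclidean_space \<Rightarrow> real"
  assumes "smooth f" "smooth g"
  shows "frechet_derivative (\<lambda>x. f x * g x) (at x) v =
    f x * frechet_derivative g (at x) v + frechet_derivative f (at x) v * g x"
  by (simp add: frechet_derivative_at[OF has_derivative_mult[OF smooth_has_derivative[OF assms(1)]
      smooth_has_derivative[OF assms(2)]], symmetric])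

subsection \<open>Convolution with test functions\<close>

text \<open>Meant for convolution kernels with a singularity at the origin; paired with functions of
  compact support they are seen only on centred balls.\<close>

definition loc_int :: "('a::euclidean_space \<Rightarrow> real) \<Rightarrow> bool" where
  "loc_int k \<longleftrightarrow> (\<forall>R. integrable lborel (\<lambda>z. indicator (cball 0 R) z * k z))"

lemma loc_int_measurable:
  fixes k :: "'a::euclidean_space \<Rightarrow> real"
  assumes k: "loc_int k"
  shows "k \<in> borel_measurable borel"
proof -
  have "integrable lborel (\<lambda>z. indicator (cball 0 (real n)) z * k z)" for n
    using k unfolding loc_int_def by blast
  from borel_measurable_integrable[OF this]
  have "(\<lambda>z. indicator (cball 0 (real n)) z * k z) \<in> borel_measurable borel" for n
    unfolding measurable_lborel2 .
  then show ?thesis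
  proof (rule borel_measurable_LIMSEQ_real[rotated])
    fix z :: 'a
    obtain N :: nat where N: "norm z \<le> real N"
      using real_arch_simple by blast
    show "(\<lambda>n. indicator (cball 0 (real n)) z * k z) \<longlonglongrightarrow> k z"
      by (rule tendsto_eventually, rule eventually_sequentiallyI[of N]) (use N in auto)
  qed
qed

lemma loc_int_mult_integrable:
  fixes f :: "'a::euclidean_space \<Rightarrow> real"
  assumes k: "loc_int k" and f: "continuous_on UNIV f" "\<And>x. norm x \<ge> R \<Longrightarrow> f x = 0"
  shows "integrable lborel (\<lambda>z. k z * f z)"
proof -
  note [measurable] = loc_int_measurable[OF k] borel_measurable_continuous_onI[OF f(1)]
  obtain B where B: "B > 0" "\<And>x. norm (f x) \<le> B"
    using continuous_cs_bounded[OF f] by metis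
  have "integrable lborel (\<lambda>z. B * (indicator (cball 0 R) z * k z))"
    using k by (simp add: loc_int_def)
  then show ?thesis
  proof (rule Bochner_Integration.integrable_bound)
    show "AE z in lborel. norm (k z * f z) \<le> norm (B * (indicator (cball 0 R) z * k z))"
    proof (intro AE_I2)
      fix z
      show "norm (k z * f z) \<le> norm (B * (indicator (cball 0 R) z * k z))"
        using B(2)[of z] B(1) f(2)[of z]
        by (cases "norm z \<le> R") (auto simp: abs_mult mult.commute[of B] intro: mult_left_mono)
    qed
  qed measurable
qed

lemma convolution_integrable:
  fixes f :: "'a::euclidean_space \<Rightarrow> real"
  assumes k: "loc_int k" and f: "test_function f"
  shows "integrable lborel (\<lambda>z. k z * f (x - z))"
proof -
  obtain R where R: "\<And>x. norm x \<ge> R \<Longrightarrow> f x = 0"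
    using test_function_supportE[OF f] by metis
  show ?thesis
  proof (rule loc_int_mult_integrable[OF k, of _ "norm x + R"])
    show "continuous_on UNIV (\<lambda>z. f (x - z))"
      by (auto intro!: continuous_intros continuous_on_compose2[OF test_function_continuous[OF f, of UNIV]])
    show "f (x - z) = 0" if "norm z \<ge> norm x + R" for z
      using that norm_triangle_ineq2[of z x] by (intro R) (simp add: norm_minus_commute)
  qed
qed

text \<open>Mean value theorem together with uniform continuity of the gradient. The uniformity in
  \<open>x\<close> allows the remainder to be integrated against a kernel.\<close>

lemma test_function_taylor:
  fixes f :: "'a::euclidean_space \<Rightarrow> real"
  assumes f: "test_function f" and "e > 0"
  obtains d where "d > 0"
    "\<And>x v. norm v < d \<Longrightarrow> \<bar>f (x + v) - f x - frechet_derivative f (at x) v\<bar> \<le> e * norm v"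
proof -
  define G where "G x = (\<Sum>b\<in>Basis. frechet_derivative f (at x) b *\<^sub>R b)" for x
  have diff: "f differentiable (at x)" for x
    by (rule smooth_differentiable[OF test_function_smooth[OF f]])
  have D: "frechet_derivative f (at x) v = G x \<bullet> v" for x v
    unfolding G_def by (rule frechet_derivative_basis_sum[OF diff])
  obtain R where R: "\<And>x v. norm x \<ge> R \<Longrightarrow> frechet_derivative f (at x) v = 0"
    using test_function_supportE[OF f] by metis
  have "continuous_on UNIV G"
    unfolding G_def
    by (intro continuous_intros test_function_continuous test_function_derivative f)
  moreover have "G x = 0" if "norm x \<ge> R" for x
    using R[OF that] by (simp add: G_def)
  ultimately obtain d where d: "d > 0" "\<And>x y. norm (y - x) < d \<Longrightarrow> norm (G y - G x) < e"
    using continuous_cs_uniformly_continuous \<open>e > 0\<close> by metis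
  have "\<bar>f (x + v) - f x - frechet_derivative f (at x) v\<bar> \<le> e * norm v" if v: "norm v < d" for x v
  proof -
    obtain s where s: "0 \<le> s" "s \<le> 1" "f (x + v) - f x = frechet_derivative f (at (x + s *\<^sub>R v)) v"
      using directional_mvt[of f] diff by metis
    then have "\<bar>f (x + v) - f x - frechet_derivative f (at x) v\<bar> = \<bar>(G (x + s *\<^sub>R v) - G x) \<bullet> v\<bar>"
      by (simp add: D inner_diff_left)
    also have "\<dots> \<le> norm (G (x + s *\<^sub>R v) - G x) * norm v"
      by (rule Cauchy_Schwarz_ineq2)
    also have "norm (s *\<^sub>R v) \<le> norm v"
      using s by (simp add: mult_left_le_one_le)
    then have "norm (G (x + s *\<^sub>R v) - G x) * norm v \<le> e * norm v"
      using v by (intro mult_right_mono less_imp_le[OF d(2)]) auto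
    finally show ?thesis .
  qed
  with d(1) that show ?thesis by blast
qed

text \<open>All derivatives fall on the test function, so nothing is asked of the kernel beyond
  local integrability: the uniform Taylor remainder of \<open>f\<close> is integrated against
  it.\<close>

lemma convolution_has_derivative:
  fixes f :: "'a::euclidean_space \<Rightarrow> real"
  assumes k: "loc_int k" and f: "test_function f"
  shows "((\<lambda>x. LINT z|lborel. k z * f (x - z)) has_derivative
    (\<lambda>v. LINT z|lborel. k z * frechet_derivative f (at (x - z)) v)) (at x)"
  unfolding has_derivative_at_alt
proof (intro conjI allI impI)
  note [measurable] = loc_int_measurable[OF k]
  have diff: "f differentiable (at x)" for x
    by (rule smooth_differentiable[OF test_function_smooth[OF f]])
  note lin = linear_frechet_derivative[OF diff]
  note int = convolution_integrable[OF k test_function_derivative[OF f]]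
  note intf = convolution_integrable[OF k f]
  have "linear (\<lambda>v. LINT z|lborel. k z * frechet_derivative f (at (x - z)) v)"
  proof (rule linearI)
    show "(LINT z|lborel. k z * frechet_derivative f (at (x - z)) (v + w)) =
        (LINT z|lborel. k z * frechet_derivative f (at (x - z)) v) +
        (LINT z|lborel. k z * frechet_derivative f (at (x - z)) w)" for v w
      using int by (simp add: linear_add[OF lin] distrib_left)
    show "(LINT z|lborel. k z * frechet_derivative f (at (x - z)) (c *\<^sub>R v)) =
        c *\<^sub>R (LINT z|lborel. k z * frechet_derivative f (at (x - z)) v)" for c v
      by (simp add: linear_cmul[OF lin] mult.left_commute)
  qed
  then show "bounded_linear (\<lambda>v. LINT z|lborel. k z * frechet_derivative f (at (x - z)) v)"
    by (simp add: linear_conv_bounded_linear)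
  fix e :: real assume "e > 0"
  obtain R where R: "\<And>x. norm x \<ge> R \<Longrightarrow> f x = 0" "\<And>x v. norm x \<ge> R \<Longrightarrow> frechet_derivative f (at x) v = 0"
    using test_function_supportE[OF f] by metis
  \<comment> \<open>For \<open>norm (y - x) < 1\<close> and \<open>norm z > S\<close> both
    \<open>x - z\<close> and \<open>y - z\<close> lie outside the support, so only the mass
    \<open>C\<close> of the kernel in this ball enters. The quotient uses \<open>C + 1\<close> to
    allow for \<open>C = 0\<close>.\<close>
  define S where "S = norm x + R + 1"
  define C where "C = (LINT z|lborel. \<bar>indicator (cball 0 S) z * k z\<bar>)"
  have intS: "integrable lborel (\<lambda>z. \<bar>indicator (cball 0 S) z * k z\<bar>)"
    using k by (auto simp: loc_int_def)
  have "C \<ge> 0"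
    unfolding C_def by simp
  obtain d where d: "d > 0"
    "\<And>x v. norm v < d \<Longrightarrow> \<bar>f (x + v) - f x - frechet_derivative f (at x) v\<bar> \<le> e / (C + 1) * norm v"
    using test_function_taylor[OF f, of "e / (C + 1)"] \<open>e > 0\<close> \<open>C \<ge> 0\<close> by auto
  show "\<exists>d>0. \<forall>y. norm (y - x) < d \<longrightarrow>
      norm ((LINT z|lborel. k z * f (y - z)) - (LINT z|lborel. k z * f (x - z)) -
        (LINT z|lborel. k z * frechet_derivative f (at (x - z)) (y - x))) \<le> e * norm (y - x)"
  proof (intro exI[of _ "min d 1"] conjI allI impI)
    fix y assume y: "norm (y - x) < min d 1"
    have "(LINT z|lborel. k z * f (y - z)) - (LINT z|lborel. k z * f (x - z)) -
        (LINT z|lborel. k z * frechet_derivative f (at (x - z)) (y - x)) =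
      (LINT z|lborel. k z * (f (y - z) - f (x - z) - frechet_derivative f (at (x - z)) (y - x)))"
      using int intf by (simp add: right_diff_distrib)
    also have "norm \<dots> \<le> (LINT z|lborel. \<bar>indicator (cball 0 S) z * k z\<bar> * (e / (C + 1) * norm (y - x)))"
    proof (rule Bochner_Integration.integral_norm_bound_integral)
      show "integrable lborel (\<lambda>z. k z * (f (y - z) - f (x - z) - frechet_derivative f (at (x - z)) (y - x)))"
        using int intf by (simp add: right_diff_distrib)
      show "integrable lborel (\<lambda>z. \<bar>indicator (cball 0 S) z * k z\<bar> * (e / (C + 1) * norm (y - x)))"
        using intS by simp
      fix z
      have "\<bar>f (y - z) - f (x - z) - frechet_derivative f (at (x - z)) (y - x)\<bar> \<le> e / (C + 1) * norm (y - x)"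
        using d(2)[of "y - x" "x - z"] y by simp
      moreover have "f (y - z) = 0 \<and> f (x - z) = 0 \<and> frechet_derivative f (at (x - z)) (y - x) = 0"
        if "norm z > S"
      proof -
        have "norm z \<le> norm (x - z) + norm x" "norm z \<le> norm (y - z) + norm (y - x) + norm x"
          by norm+
        then have "norm (x - z) \<ge> R" "norm (y - z) \<ge> R"
          using that y by (auto simp: S_def)
        then show ?thesis using R by auto
      qed
      ultimately show "norm (k z * (f (y - z) - f (x - z) - frechet_derivative f (at (x - z)) (y - x)))
          \<le> \<bar>indicator (cball 0 S) z * k z\<bar> * (e / (C + 1) * norm (y - x))"
        by (cases "norm z \<le> S") (auto simp: abs_mult simp del: times_divide_eq_left intro!: mult_left_mono)
    qed
    also have "\<dots> = C / (C + 1) * (e * norm (y - x))"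
      by (simp add: C_def)
    also have "\<dots> \<le> 1 * (e * norm (y - x))"
      using \<open>C \<ge> 0\<close> \<open>e > 0\<close> by (intro mult_right_mono) auto
    finally show "norm ((LINT z|lborel. k z * f (y - z)) - (LINT z|lborel. k z * f (x - z)) -
        (LINT z|lborel. k z * frechet_derivative f (at (x - z)) (y - x))) \<le> e * norm (y - x)"
      by simp
  qed (use d in auto)
qed

lemma frechet_derivative_convolution:
  assumes "loc_int k" "test_function f"
  shows "frechet_derivative (\<lambda>x. LINT z|lborel. k z * f (x - z)) (at x) v =
    (LINT z|lborel. k z * frechet_derivative f (at (x - z)) v)"
  by (simp add: frechet_derivative_at[OF convolution_has_derivative[OF assms], symmetric])

lemma convolution_smooth:
  assumes k: "loc_int k" and f: "test_function f"
  shows "smooth (\<lambda>x. LINT z|lborel. k z * f (x - z))"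
  unfolding smooth_def
proof
  fix n
  \<comment> \<open>The induction runs one order higher than the goal: its base case already
    contains a derivative, and differentiability supplies the continuity asked for there.\<close>
  have "Ck (Suc n) (\<lambda>x. LINT z|lborel. k z * f (x - z))"
    using f
  proof (induction n arbitrary: f)
    case 0
    show ?case
    proof (rule Ck_SucI[OF convolution_has_derivative[OF k 0]], unfold Ck.simps)
      fix v
      show "continuous_on UNIV (\<lambda>x. LINT z|lborel. k z * frechet_derivative f (at (x - z)) v)"
        using convolution_has_derivative[OF k test_function_derivative[OF 0]]
        by (auto simp: continuous_on_eq_continuous_at intro: has_derivative_continuous)
    qed
  next
    case (Suc n)
    show ?case
      by (rule Ck_SucI[OF convolution_has_derivative[OF k Suc.prems]])
        (rule Suc.IH[OF test_function_derivative[OF Suc.prems]])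
  qed
  then show "Ck n (\<lambda>x. LINT z|lborel. k z * f (x - z))"
    by (rule Ck_SucD)
qed

subsection \<open>The Biot-Savart kernel\<close>

text \<open>The components of the gradient of \<open>ln (norm z) / (2 * pi)\<close>, the fundamental
  solution of the Laplacian in the plane; at the origin division by zero gives the value
  \<open>0\<close>.\<close>

definition kern :: "2 \<Rightarrow> real^2 \<Rightarrow> real" where
  "kern i z = z $ i / (2 * pi * (norm z)\<^sup>2)"

lemma kern_measurable [measurable]: "kern i \<in> borel_measurable borel"
  unfolding kern_def[abs_def] by measurable

lemma kern_minus: "kern i (- z) = - kern i z"
  by (simp add: kern_def)

lemma kern_bound: "\<bar>kern i z\<bar> \<le> 1 / (2 * pi) * (1 / norm z)"
proof (cases "z = 0")
  case False
  have "\<bar>z $ i\<bar> \<le> norm z"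
    by (rule component_le_norm_cart)
  then show ?thesis
    using False by (simp add: kern_def abs_mult divide_simps power2_eq_square)
qed (simp add: kern_def)

text \<open>In the annulus \<open>(1 / 2) ^ (n + 1) \<le> norm z < (1 / 2) ^ n\<close> the single
  term with index \<open>n\<close> already dominates \<open>1 / norm z\<close>. Together with the
  areas of discs this replaces polar coordinates.\<close>

lemma inverse_norm_le_dyadic_sum:
  fixes z :: "'a::real_normed_vector"
  shows "ennreal (indicator (ball 0 1) z * (1 / norm z)) \<le>
    (\<Sum>n. ennreal (2 ^ (n + 1)) * indicator (ball 0 ((1 / 2) ^ n)) z)"
proof (cases "z = 0 \<or> norm z \<ge> 1")
  case False
  then have z: "norm z > 0" "norm z < 1" by auto
  define n where "n = (LEAST n. (1 / 2) ^ (n + 1) \<le> norm z)"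
  obtain m where "(1 / 2) ^ m < norm z"
    using real_arch_pow_inv[OF z(1), of "1 / 2"] by auto
  moreover have "(1 / 2 :: real) ^ (m + 1) \<le> (1 / 2) ^ m" by simp
  ultimately have "(1 / 2) ^ (m + 1) \<le> norm z" by linarith
  then have n1: "(1 / 2) ^ (n + 1) \<le> norm z"
    unfolding n_def by (rule LeastI)
  have n2: "norm z < (1 / 2) ^ n"
  proof (cases n)
    case 0
    then show ?thesis using z by simp
  next
    case (Suc k)
    then have "\<not> (1 / 2) ^ (k + 1) \<le> norm z"
      using not_less_Least[of k "\<lambda>n. (1 / 2) ^ (n + 1) \<le> norm z"] by (simp add: n_def)
    then show ?thesis using Suc by simp
  qed
  have "1 / norm z \<le> 2 ^ (n + 1)"
    using n1 z(1) by (simp add: power_divide field_simps)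
  then have "ennreal (indicator (ball 0 1) z * (1 / norm z)) \<le>
      ennreal (2 ^ (n + 1)) * indicator (ball 0 ((1 / 2) ^ n)) z"
    using z n2 by (simp add: ennreal_leI)
  also have "\<dots> \<le> (\<Sum>n. ennreal (2 ^ (n + 1)) * indicator (ball 0 ((1 / 2) ^ n)) z)"
  proof -
    define F where "F = (\<lambda>n. ennreal (2 ^ (n + 1)) * indicator (ball 0 ((1 / 2) ^ n)) z)"
    have "sum F {n} \<le> suminf F"
      by (rule sum_le_suminf) auto
    then show ?thesis unfolding F_def by (simp only: sum.insert finite.emptyI empty_iff not_False_eq_True sum.empty add_0_right)
  qed
  finally show ?thesis .
next
  case True
  then have "indicator (ball 0 1) z * (1 / norm z) = 0"
    by auto
  then show ?thesis
    by (simp only: ennreal_0 zero_le)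
qed

text \<open>In the unit ball the dyadic bound integrates to the geometric series of
  \<open>2 * pi * (1 / 2) ^ n\<close>; elsewhere \<open>1 / norm z \<le> 1\<close> is dominated by
  the indicator of the ball of radius \<open>R\<close>.\<close>

lemma loc_int_inverse_norm: "loc_int (\<lambda>z::real^2. 1 / norm z)"
  unfolding loc_int_def
proof
  fix R :: real
  have "(\<integral>\<^sup>+z. ennreal (indicator (ball 0 1) z * (1 / norm (z::real^2))) \<partial>lborel) \<le>
      (\<integral>\<^sup>+z. (\<Sum>n. ennreal (2 ^ (n + 1)) * indicator (ball (0::real^2) ((1 / 2) ^ n)) z) \<partial>lborel)"
    by (intro nn_integral_mono inverse_norm_le_dyadic_sum)
  also have "\<dots> = (\<Sum>n. \<integral>\<^sup>+z. ennreal (2 ^ (n + 1)) * indicator (ball (0::real^2) ((1 / 2) ^ n)) z \<partial>lborel)"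
    by (rule nn_integral_suminf) (intro borel_measurable_times_ennreal borel_measurable_indicator; simp)
  also have "\<dots> = (\<Sum>n. ennreal (2 * pi * (1 / 2) ^ n))"
  proof (rule suminf_cong)
    fix n
    have "(\<integral>\<^sup>+z. ennreal (2 ^ (n + 1)) * indicator (ball (0::real^2) ((1 / 2) ^ n)) z \<partial>lborel) =
        ennreal (2 ^ (n + 1)) * ennreal (pi * ((1 / 2) ^ n) ^ 2)"
      by (subst nn_integral_cmult_indicator) (simp_all add: emeasure_ball unit_ball_vol_2)
    also have "\<dots> = ennreal (2 ^ (n + 1) * (pi * ((1 / 2) ^ n) ^ 2))"
      by (rule ennreal_mult[symmetric]) simp_all
    also have "2 ^ (n + 1) * (pi * ((1 / 2) ^ n) ^ 2) = 2 * pi * (1 / 2) ^ n"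
      by (simp add: power2_eq_square power_divide)
    finally show "(\<integral>\<^sup>+z. ennreal (2 ^ (n + 1)) * indicator (ball (0::real^2) ((1 / 2) ^ n)) z \<partial>lborel) =
        ennreal (2 * pi * (1 / 2) ^ n)" .
  qed
  also have "\<dots> < \<infinity>"
  proof -
    have "summable (\<lambda>n. 2 * pi * (1 / 2) ^ n)"
      by (intro summable_mult summable_geometric) simp
    then have "(\<Sum>n. ennreal (2 * pi * (1 / 2) ^ n)) \<noteq> top"
      by (rule ennreal_suminf_neq_top) simp
    then show ?thesis
      by (simp only: less_top infinity_ennreal_def)
  qed
  finally have "integrable lborel (\<lambda>z::real^2. indicator (ball 0 1) z * (1 / norm z))"
    by (intro integrableI_bounded borel_measurable_times borel_measurable_indicator) (simp_all add: abs_mult)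
  moreover have "integrable lborel (\<lambda>z::real^2. indicator (cball 0 R) z :: real)"
    using borel_integrable_compact[of "cball (0::real^2) R" "\<lambda>_. 1::real"] by simp
  ultimately have "integrable lborel
      (\<lambda>z::real^2. indicator (ball 0 1) z * (1 / norm z) + (indicator (cball 0 R) z :: real))"
    by (rule Bochner_Integration.integrable_add)
  then show "integrable lborel (\<lambda>z::real^2. indicator (cball 0 R) z * (1 / norm z))"
  proof (rule Bochner_Integration.integrable_bound)
    show "AE z::real^2 in lborel. norm (indicator (cball 0 R) z * (1 / norm z)) \<le>
        norm (indicator (ball 0 1) z * (1 / norm z) + (indicator (cball 0 R) z :: real))"
      by (auto simp: indicator_def divide_simps intro!: AE_I2)
  qed (intro borel_measurable_times borel_measurable_indicator; simp)
qed

lemma loc_int_kern: "loc_int (kern i)"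
  unfolding loc_int_def
proof
  fix R
  have "integrable lborel (\<lambda>z::real^2. 1 / (2 * pi) * (indicator (cball 0 R) z * (1 / norm z)))"
    using loc_int_inverse_norm by (simp only: loc_int_def integrable_mult_right)
  then show "integrable lborel (\<lambda>z. indicator (cball 0 R) z * kern i z)"
  proof (rule Bochner_Integration.integrable_bound)
    show "AE z in lborel. norm (indicator (cball 0 R) z * kern i z) \<le>
        norm (1 / (2 * pi) * (indicator (cball 0 R) z * (1 / norm z)))"
      using kern_bound[of i] by (auto simp: indicator_def intro!: AE_I2)
  qed (intro borel_measurable_times borel_measurable_indicator; simp add: kern_measurable)
qed

text \<open>The field of a unit mass spread uniformly over the disc of radius
  \<open>\<epsilon>\<close>: linear inside and equal to \<open>kern\<close> outside. It is
  Lipschitz, so it can be integrated by parts, and its divergence is the normalised indicator of the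
  disc.\<close>

definition reg_kern :: "real \<Rightarrow> 2 \<Rightarrow> real^2 \<Rightarrow> real" where
  "reg_kern \<epsilon> i z = z $ i / (2 * pi * max ((norm z)\<^sup>2) (\<epsilon>\<^sup>2))"

definition reg_kern_deriv :: "real \<Rightarrow> 2 \<Rightarrow> 2 \<Rightarrow> real^2 \<Rightarrow> real" where
  "reg_kern_deriv \<epsilon> i j z =
    (if norm z < \<epsilon> then (if i = j then 1 else 0) / (2 * pi * \<epsilon>\<^sup>2)
     else ((if i = j then 1 else 0) * (norm z)\<^sup>2 - 2 * z $ i * z $ j) / (2 * pi * (norm z)^4))"

lemma reg_kern_continuous: "\<epsilon> > 0 \<Longrightarrow> continuous_on S (reg_kern \<epsilon> i)"
  unfolding reg_kern_def[abs_def]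
  by (intro continuous_intros) (auto simp: max_def)

lemma reg_kern_lipschitz:
  assumes "\<epsilon> > 0"
  shows "\<bar>reg_kern \<epsilon> i w - reg_kern \<epsilon> i z\<bar> \<le> 3 / (2 * pi * \<epsilon>\<^sup>2) * norm (w - z)"
proof -
  define a where "a = max (norm z) \<epsilon>"
  define b where "b = max (norm w) \<epsilon>"
  have ab: "a \<ge> \<epsilon>" "b \<ge> \<epsilon>" "norm z \<le> a" "norm w \<le> b" "a > 0" "b > 0"
    using assms by (auto simp: a_def b_def)
  have sq: "max ((norm z)\<^sup>2) (\<epsilon>\<^sup>2) = a\<^sup>2" "max ((norm w)\<^sup>2) (\<epsilon>\<^sup>2) = b\<^sup>2"
    using assms unfolding a_def b_def by (auto simp: max_def power2_le_iff_abs_le abs_le_square_iff[symmetric])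
  have comp: "\<bar>w $ i - z $ i\<bar> \<le> norm (w - z)" "\<bar>w $ i\<bar> \<le> b"
    using component_le_norm_cart[of "w - z" i] component_le_norm_cart[of w i] ab by auto
  have "\<bar>a - b\<bar> \<le> norm (w - z)"
    using norm_triangle_ineq3[of w z] unfolding a_def b_def by (auto simp: max_def)
  \<comment> \<open>One term comes from the numerators and two from
    \<open>1 / b\<^sup>2 - 1 / a\<^sup>2\<close>; each contributes at most
    \<open>norm (w - z) / \<epsilon>\<^sup>2\<close>, which explains the factor
    \<open>3\<close>.\<close>
  have "w $ i / b\<^sup>2 - z $ i / a\<^sup>2 = (w $ i - z $ i) / a\<^sup>2 + w $ i / b * ((a - b) * (1 / (a * b) + 1 / a\<^sup>2))"
    using ab by (simp add: field_simps power2_eq_square)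
  also have "\<bar>\<dots>\<bar> \<le> \<bar>(w $ i - z $ i) / a\<^sup>2\<bar> + \<bar>w $ i / b * ((a - b) * (1 / (a * b) + 1 / a\<^sup>2))\<bar>"
    by (rule abs_triangle_ineq)
  also have "\<bar>(w $ i - z $ i) / a\<^sup>2\<bar> \<le> norm (w - z) / \<epsilon>\<^sup>2"
    using comp ab assms by (auto simp: intro!: frac_le power_mono)
  also have "\<bar>w $ i / b * ((a - b) * (1 / (a * b) + 1 / a\<^sup>2))\<bar> \<le> 1 * (norm (w - z) * (1 / \<epsilon>\<^sup>2 + 1 / \<epsilon>\<^sup>2))"
    unfolding abs_mult
  proof (intro mult_mono)
    show "\<bar>w $ i / b\<bar> \<le> 1" using comp ab by simp
    have "1 / (a * b) \<le> 1 / \<epsilon>\<^sup>2" "1 / a\<^sup>2 \<le> 1 / \<epsilon>\<^sup>2"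
      unfolding power2_eq_square using ab assms by (auto intro!: divide_left_mono mult_mono)
    then show "\<bar>1 / (a * b) + 1 / a\<^sup>2\<bar> \<le> 1 / \<epsilon>\<^sup>2 + 1 / \<epsilon>\<^sup>2"
      using ab by simp
  qed (use \<open>\<bar>a - b\<bar> \<le> norm (w - z)\<close> in auto)
  finally have "\<bar>w $ i / b\<^sup>2 - z $ i / a\<^sup>2\<bar> \<le> 3 / \<epsilon>\<^sup>2 * norm (w - z)"
    by (simp add: algebra_simps)
  then have "1 / (2 * pi) * \<bar>w $ i / b\<^sup>2 - z $ i / a\<^sup>2\<bar> \<le> 1 / (2 * pi) * (3 / \<epsilon>\<^sup>2 * norm (w - z))"
    by (intro mult_left_mono) auto
  moreover have "reg_kern \<epsilon> i w - reg_kern \<epsilon> i z = 1 / (2 * pi) * (w $ i / b\<^sup>2 - z $ i / a\<^sup>2)"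
    by (simp add: reg_kern_def sq field_simps)
  ultimately show ?thesis
    by (simp add: abs_mult)
qed

lemma reg_kern_has_derivative:
  assumes "\<epsilon> > 0" and "norm z \<noteq> \<epsilon>"
  shows "((\<lambda>h. (reg_kern \<epsilon> i (z + h *\<^sub>R axis j 1) - reg_kern \<epsilon> i z) / h) \<longlongrightarrow> reg_kern_deriv \<epsilon> i j z) (at 0)"
proof -
  define p where "p h = z + h *\<^sub>R axis j 1" for h :: real
  have pc: "continuous_on UNIV p"
    unfolding p_def by (intro continuous_intros)
  have pi: "((\<lambda>h. p h $ i) has_field_derivative (if i = j then 1 else 0)) (at h)" for h
    unfolding p_def by (auto simp: axis_def intro!: derivative_eq_intros)
  have n: "(norm x)\<^sup>2 = (x $ 1)\<^sup>2 + (x $ 2)\<^sup>2" for x :: "real^2"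
    by (simp add: norm_vec_def L2_set_def sum_2)
  have p0: "p 0 = z" by (simp add: p_def)
  have "((\<lambda>h. reg_kern \<epsilon> i (p h)) has_field_derivative reg_kern_deriv \<epsilon> i j z) (at 0)"
  proof (cases "norm z < \<epsilon>")
    case True
    have "((\<lambda>h. p h $ i / (2 * pi * \<epsilon>\<^sup>2)) has_field_derivative reg_kern_deriv \<epsilon> i j z) (at 0)"
      using DERIV_cdivide[OF pi, of "2 * pi * \<epsilon>\<^sup>2" 0] True by (simp add: reg_kern_deriv_def)
    moreover have "open {h. norm (p h) < \<epsilon>}"
      by (intro open_Collect_less continuous_intros continuous_on_norm pc)
    ultimately show ?thesis
      by (rule has_field_derivative_transform_within_open)
        (use True in \<open>auto simp: p0 reg_kern_def max_def abs_le_square_iff[symmetric]\<close>)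
  next
    case False
    then have z: "norm z > \<epsilon>" "norm z > 0" using assms by auto
    have "((\<lambda>h. p h $ i / (2 * pi * (norm (p h))\<^sup>2)) has_field_derivative reg_kern_deriv \<epsilon> i j z) (at 0)"
    proof -
      have "((\<lambda>h. (norm (p h))\<^sup>2) has_field_derivative 2 * z $ j) (at 0)"
      proof -
        have "((\<lambda>h. (p h $ 1)\<^sup>2 + (p h $ 2)\<^sup>2) has_field_derivative 2 * z $ j) (at 0)"
          unfolding p_def using exhaust_2[of j] by (auto simp: axis_def intro!: derivative_eq_intros)
        then show ?thesis by (simp add: n)
      qed
      from DERIV_divide[OF pi[of 0] DERIV_cmult[OF this, of "2 * pi"]]
      have "((\<lambda>h. p h $ i / (2 * pi * (norm (p h))\<^sup>2)) has_field_derivative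
          ((if i = j then 1 else 0) * (2 * pi * (norm z)\<^sup>2) - z $ i * (2 * pi * (2 * z $ j))) /
          ((2 * pi * (norm z)\<^sup>2) * (2 * pi * (norm z)\<^sup>2))) (at 0)"
        unfolding p0 using z by force
      moreover have "((if i = j then 1 else 0) * (2 * pi * (norm z)\<^sup>2) - z $ i * (2 * pi * (2 * z $ j))) /
          ((2 * pi * (norm z)\<^sup>2) * (2 * pi * (norm z)\<^sup>2)) = reg_kern_deriv \<epsilon> i j z"
        using z by (simp add: reg_kern_deriv_def field_simps power2_eq_square power4_eq_xxxx)
      ultimately show ?thesis by simp
    qed
    moreover have "open {h. norm (p h) > \<epsilon>}"
      by (intro open_Collect_less continuous_intros continuous_on_norm pc)
    ultimately show ?thesis
    proof (rule has_field_derivative_transform_within_open)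
      fix h assume "h \<in> {h. norm (p h) > \<epsilon>}"
      then have "\<epsilon>\<^sup>2 \<le> (norm (p h))\<^sup>2"
        using assms by (intro power_mono) auto
      then show "p h $ i / (2 * pi * (norm (p h))\<^sup>2) = reg_kern \<epsilon> i (p h)"
        by (simp add: reg_kern_def max_def)
    qed (use z p0 in auto)
  qed
  then show ?thesis
    by (simp add: DERIV_def p_def)
qed

lemma reg_kern_by_parts:
  assumes "\<epsilon> > 0" and "test_function f"
  shows "(LINT z|lborel. reg_kern \<epsilon> i z * partial j f z) = - (LINT z|lborel. reg_kern_deriv \<epsilon> i j z * f z)"
  unfolding partial_def
proof (rule integral_by_parts_lipschitz[OF assms(2)])
  show "continuous_on UNIV (reg_kern \<epsilon> i)"
    by (rule reg_kern_continuous[OF assms(1)])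
  show "\<bar>reg_kern \<epsilon> i (x + h *\<^sub>R axis j 1) - reg_kern \<epsilon> i x\<bar> \<le> 3 / (2 * pi * \<epsilon>\<^sup>2) * \<bar>h\<bar>" for x h
    using reg_kern_lipschitz[OF assms(1), of i "x + h *\<^sub>R axis j 1" x] by simp
  show "reg_kern_deriv \<epsilon> i j \<in> borel_measurable borel"
    unfolding reg_kern_deriv_def[abs_def] by measurable
  have "sphere (0::real^2) \<epsilon> \<in> null_sets lborel"
    using negligible_sphere[of "0::real^2" \<epsilon>]
    by (auto simp: null_sets_completion_iff negligible_iff_null_sets)
  then have "AE z::real^2 in lborel. norm z \<noteq> \<epsilon>"
    by (rule AE_I') auto
  then show "AE x in lborel. ((\<lambda>h. (reg_kern \<epsilon> i (x + h *\<^sub>R axis j 1) - reg_kern \<epsilon> i x) / h) \<longlongrightarrow>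
      reg_kern_deriv \<epsilon> i j x) (at 0)"
    using reg_kern_has_derivative[OF assms(1)] by auto
qed

lemma test_function_partial: "test_function f \<Longrightarrow> test_function (partial j f)"
  unfolding partial_def[abs_def] by (rule test_function_derivative)

lemma kern_mult_integrable: "test_function f \<Longrightarrow> integrable lborel (\<lambda>z. kern i z * f z)"
  by (metis loc_int_mult_integrable loc_int_kern test_function_supportE test_function_continuous)

text \<open>Truncation only decreases the modulus of the kernel and changes nothing at a given
  \<open>z \<noteq> 0\<close> once the radius is below \<open>norm z\<close>, so \<open>kern\<close>
  itself is the dominating kernel.\<close>

lemma reg_kern_tendsto:
  assumes f: "test_function f"
  shows "(\<lambda>n. LINT z|lborel. reg_kern (inverse (real (Suc n))) i z * f z) \<longlonglongrightarrow>
    (LINT z|lborel. kern i z * f z)"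
proof (rule integral_dominated_convergence[where w = "\<lambda>z. \<bar>kern i z * f z\<bar>"])
  note [measurable] = test_function_measurable[OF f]
  show "integrable lborel (\<lambda>z. \<bar>kern i z * f z\<bar>)"
    using kern_mult_integrable[OF f] by (rule integrable_abs)
  show "(\<lambda>z. kern i z * f z) \<in> borel_measurable lborel" by measurable
  show "(\<lambda>z. reg_kern (inverse (real (Suc n))) i z * f z) \<in> borel_measurable lborel" for n
    unfolding reg_kern_def by measurable
  have z: "\<bar>reg_kern \<epsilon> i z\<bar> \<le> \<bar>kern i z\<bar>" for \<epsilon> z
  proof (cases "z = 0")
    case False
    then have "0 < (norm z)\<^sup>2" by simp
    then have "0 < max ((norm z)\<^sup>2) (\<epsilon>\<^sup>2)" by (rule less_le_trans) simp
    with False show ?thesis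
      by (auto simp: reg_kern_def kern_def abs_mult intro!: divide_left_mono mult_left_mono mult_pos_pos)
  qed (simp add: reg_kern_def)
  show "AE z in lborel. norm (reg_kern (inverse (real (Suc n))) i z * f z) \<le> \<bar>kern i z * f z\<bar>" for n
    using z by (auto simp: abs_mult intro!: AE_I2 mult_right_mono)
  have "(\<lambda>n. reg_kern (inverse (real (Suc n))) i z * f z) \<longlonglongrightarrow> kern i z * f z" for z
  proof (cases "z = 0")
    case False
    have "eventually (\<lambda>n. inverse (real (Suc n)) < norm z) sequentially"
      using LIMSEQ_inverse_real_of_nat False by (intro order_tendstoD) auto
    then have "eventually (\<lambda>n. reg_kern (inverse (real (Suc n))) i z * f z = kern i z * f z) sequentially"
    proof eventually_elim
      case (elim n)
      then have "(inverse (real (Suc n)))\<^sup>2 \<le> (norm z)\<^sup>2"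
        by (intro power_mono) auto
      then show ?case
        by (simp add: reg_kern_def kern_def max_def)
    qed
    then show ?thesis by (rule tendsto_eventually)
  qed (simp add: reg_kern_def kern_def)
  then show "AE z in lborel. (\<lambda>n. reg_kern (inverse (real (Suc n))) i z * f z) \<longlonglongrightarrow> kern i z * f z"
    by simp
qed

lemma reg_kern_deriv_measurable [measurable]: "reg_kern_deriv \<epsilon> i j \<in> borel_measurable borel"
  unfolding reg_kern_deriv_def[abs_def] by measurable

text \<open>The matrix \<open>reg_kern_deriv\<close> is symmetric; integrating by parts and letting
  the truncation radius tend to \<open>0\<close> transfers this to \<open>kern\<close>.\<close>

lemma kern_curl_free:
  assumes f: "test_function f"
  shows "(LINT z|lborel. kern 1 z * partial 2 f z) = (LINT z|lborel. kern 2 z * partial 1 f z)"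
proof -
  have "reg_kern_deriv \<epsilon> 1 2 z = reg_kern_deriv \<epsilon> 2 1 z" for \<epsilon> z
    by (simp add: reg_kern_deriv_def mult.commute mult.left_commute)
  then have eq: "(\<lambda>n. LINT z|lborel. reg_kern (inverse (real (Suc n))) 1 z * partial 2 f z) =
      (\<lambda>n. LINT z|lborel. reg_kern (inverse (real (Suc n))) 2 z * partial 1 f z)"
    by (simp add: reg_kern_by_parts[OF _ f])
  show ?thesis
    using reg_kern_tendsto[OF test_function_partial[OF f], of 1 2]
      reg_kern_tendsto[OF test_function_partial[OF f], of 2 1] LIMSEQ_unique
    unfolding eq by blast
qed

text \<open>The divergence of \<open>kern\<close> is the Dirac measure at the origin. For the
  truncated kernel integration by parts leaves minus the mean of \<open>f\<close> over the ball of
  radius \<open>\<epsilon> n\<close>, which tends to \<open>- f 0\<close> by continuity.\<close>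

lemma kern_divergence:
  assumes f: "test_function f"
  shows "(LINT z|lborel. kern 1 z * partial 1 f z) + (LINT z|lborel. kern 2 z * partial 2 f z) = - f 0"
proof -
  define \<epsilon> where "\<epsilon> n = inverse (real (Suc n))" for n
  have \<epsilon>: "\<epsilon> n > 0" for n by (simp add: \<epsilon>_def)
  have bnd: "\<bar>reg_kern_deriv (\<epsilon> n) i i z * f z\<bar> \<le> 3 / (2 * pi * (\<epsilon> n)\<^sup>2) * \<bar>f z\<bar>" for n i z
  proof -
    have "\<bar>reg_kern_deriv (\<epsilon> n) i i z\<bar> \<le> 3 / (2 * pi * (\<epsilon> n)\<^sup>2)"
    proof (cases "norm z < \<epsilon> n")
      case True
      then show ?thesis using \<epsilon>[of n] by (simp add: reg_kern_deriv_def divide_simps)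
    next
      case False
      then have z: "norm z \<ge> \<epsilon> n" "norm z > 0" using \<epsilon>[of n] by auto
      have "(z $ i)\<^sup>2 \<le> (norm z)\<^sup>2"
        using component_le_norm_cart[of z i] by (simp add: abs_le_square_iff[symmetric])
      then have "\<bar>(norm z)\<^sup>2 - 2 * (z $ i)\<^sup>2\<bar> \<le> 3 * (norm z)\<^sup>2"
        using zero_le_power2[of "z $ i"] by linarith
      then have "\<bar>(norm z)\<^sup>2 - 2 * (z $ i)\<^sup>2\<bar> / (2 * pi * (norm z)^4) \<le> 3 * (norm z)\<^sup>2 / (2 * pi * (norm z)^4)"
        by (intro divide_right_mono) auto
      also have "\<dots> = 3 / (2 * pi * (norm z)\<^sup>2)"
        using z by (simp add: field_simps power2_eq_square power4_eq_xxxx)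
      also have "\<dots> \<le> 3 / (2 * pi * (\<epsilon> n)\<^sup>2)"
        using z \<epsilon>[of n] by (intro divide_left_mono mult_left_mono power_mono mult_pos_pos) auto
      finally show ?thesis
        using False by (simp add: reg_kern_deriv_def power2_eq_square mult.assoc)
    qed
    then show ?thesis unfolding abs_mult by (rule mult_right_mono) simp
  qed
  have int: "integrable lborel (\<lambda>z. reg_kern_deriv (\<epsilon> n) i i z * f z)" for n i
  proof (rule Bochner_Integration.integrable_bound)
    note [measurable] = test_function_measurable[OF f]
    show "integrable lborel (\<lambda>z. 3 / (2 * pi * (\<epsilon> n)\<^sup>2) * \<bar>f z\<bar>)"
      using integrable_abs[OF test_function_integrable[OF f]] by simp
    show "(\<lambda>z. reg_kern_deriv (\<epsilon> n) i i z * f z) \<in> borel_measurable lborel"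
      by measurable
    show "AE z in lborel. norm (reg_kern_deriv (\<epsilon> n) i i z * f z) \<le> norm (3 / (2 * pi * (\<epsilon> n)\<^sup>2) * \<bar>f z\<bar>)"
      using bnd by (auto intro!: AE_I2 order_trans[OF bnd])
  qed
  \<comment> \<open>Outside the ball the trace is
    \<open>2 * (norm z)\<^sup>2 - 2 * (norm z)\<^sup>2 = 0\<close> up to a factor; inside, two equal
    diagonal entries add up to \<open>1 / (pi * (\<epsilon> n)\<^sup>2)\<close>.\<close>
  have sum: "reg_kern_deriv (\<epsilon> n) 1 1 z + reg_kern_deriv (\<epsilon> n) 2 2 z = indicator (ball 0 (\<epsilon> n)) z / (pi * (\<epsilon> n)\<^sup>2)"
    for n z
  proof -
    have "(norm z)\<^sup>2 = z $ 1 * z $ 1 + z $ 2 * z $ 2"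
      by (simp add: norm_vec_def L2_set_def sum_2 power2_eq_square)
    then show ?thesis
      by (simp add: reg_kern_deriv_def indicator_def add_divide_distrib[symmetric])
  qed
  have eq: "(LINT z|lborel. reg_kern (\<epsilon> n) 1 z * partial 1 f z) +
      (LINT z|lborel. reg_kern (\<epsilon> n) 2 z * partial 2 f z) =
      - ((LINT z|lborel. indicator (ball 0 (\<epsilon> n)) z * f z) / (pi * (\<epsilon> n)\<^sup>2))" for n
  proof -
    have "(LINT z|lborel. reg_kern (\<epsilon> n) 1 z * partial 1 f z) +
      (LINT z|lborel. reg_kern (\<epsilon> n) 2 z * partial 2 f z) =
      - (LINT z|lborel. reg_kern_deriv (\<epsilon> n) 1 1 z * f z + reg_kern_deriv (\<epsilon> n) 2 2 z * f z)"
      using int by (simp add: reg_kern_by_parts[OF \<epsilon> f])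
    also have "\<dots> = - (LINT z|lborel. indicator (ball 0 (\<epsilon> n)) z * f z / (pi * (\<epsilon> n)\<^sup>2))"
      by (simp only: distrib_right[symmetric] sum) simp
    finally show ?thesis by simp
  qed
  have "(\<lambda>n. (LINT z|lborel. indicator (ball 0 (\<epsilon> n)) z * f z) / (pi * (\<epsilon> n)\<^sup>2)) \<longlonglongrightarrow> f 0"
  proof (rule LIMSEQ_I)
    fix r :: real assume "r > 0"
    have "r / 2 > 0"
      using \<open>r > 0\<close> by simp
    then have "\<exists>d>0. \<forall>z\<in>UNIV. dist z 0 < d \<longrightarrow> dist (f z) (f 0) < r / 2"
      using test_function_continuous[OF f, of UNIV] unfolding continuous_on_iff by blast
    then obtain d where d: "d > 0" "\<And>z. norm z < d \<Longrightarrow> \<bar>f z - f 0\<bar> < r / 2"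
      by (auto simp: dist_norm)
    obtain N where N: "\<And>n. n \<ge> N \<Longrightarrow> \<epsilon> n < d"
      using order_tendstoD(2)[OF LIMSEQ_inverse_real_of_nat d(1)]
      by (auto simp: eventually_sequentially \<epsilon>_def)
    have "norm ((LINT z|lborel. indicator (ball 0 (\<epsilon> n)) z * f z) / (pi * (\<epsilon> n)\<^sup>2) - f 0) < r" if "n \<ge> N" for n
    proof -
      have m: "measure lborel (ball (0::real^2) (\<epsilon> n)) = pi * (\<epsilon> n)\<^sup>2"
        using \<epsilon>[of n] by (simp add: content_ball unit_ball_vol_2)
      have iball: "integrable lborel (\<lambda>z::real^2. indicator (ball 0 (\<epsilon> n)) z * (c::real))" for c
        by (simp add: emeasure_ball less_imp_le[OF \<epsilon>])
      have iball': "integrable lborel (\<lambda>z::real^2. indicator (ball 0 (\<epsilon> n)) z * f z)"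
        using integrable_mult_indicator[of "ball 0 (\<epsilon> n)" lborel f] test_function_integrable[OF f] by simp
      have "(LINT z|lborel. indicator (ball 0 (\<epsilon> n)) z * f z) - pi * (\<epsilon> n)\<^sup>2 * f 0 =
          (LINT z|lborel. indicator (ball 0 (\<epsilon> n)) z * (f z - f 0))"
        using iball iball' by (simp add: right_diff_distrib m)
      also have "\<bar>\<dots>\<bar> \<le> (LINT z::real^2|lborel. indicator (ball 0 (\<epsilon> n)) z * (r / 2))"
      proof (rule integral_abs_bound_integral)
        show "integrable lborel (\<lambda>z. indicator (ball 0 (\<epsilon> n)) z * (f z - f 0))"
          using iball iball' by (simp add: right_diff_distrib)
        show "\<bar>indicator (ball 0 (\<epsilon> n)) z * (f z - f 0)\<bar> \<le> indicator (ball 0 (\<epsilon> n)) z * (r / 2)" for z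
          using d(2)[of z] N[OF that] by (auto simp: indicator_def abs_mult)
      qed (rule iball)
      also have "\<dots> = pi * (\<epsilon> n)\<^sup>2 * (r / 2)"
        by (simp add: m)
      finally have "\<bar>(LINT z|lborel. indicator (ball 0 (\<epsilon> n)) z * f z) / (pi * (\<epsilon> n)\<^sup>2) - f 0\<bar> \<le> r / 2"
        using \<epsilon>[of n] by (simp add: field_simps abs_mult)
      then show ?thesis using \<open>r > 0\<close> by simp
    qed
    then show "\<exists>N. \<forall>n\<ge>N. norm ((LINT z|lborel. indicator (ball 0 (\<epsilon> n)) z * f z) / (pi * (\<epsilon> n)\<^sup>2) - f 0) < r"
      by blast
  qed
  from tendsto_minus[OF this]
  have "(\<lambda>n. (LINT z|lborel. reg_kern (\<epsilon> n) 1 z * partial 1 f z) +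
      (LINT z|lborel. reg_kern (\<epsilon> n) 2 z * partial 2 f z)) \<longlonglongrightarrow> - f 0"
    unfolding eq .
  moreover have "(\<lambda>n. (LINT z|lborel. reg_kern (\<epsilon> n) 1 z * partial 1 f z) +
      (LINT z|lborel. reg_kern (\<epsilon> n) 2 z * partial 2 f z)) \<longlonglongrightarrow>
      (LINT z|lborel. kern 1 z * partial 1 f z) + (LINT z|lborel. kern 2 z * partial 2 f z)"
    unfolding \<epsilon>_def by (intro tendsto_add reg_kern_tendsto test_function_partial f)
  ultimately show ?thesis
    using LIMSEQ_unique by blast
qed

subsection \<open>The gradient of the Newtonian potential\<close>

text \<open>The partial derivative in direction \<open>i\<close> of the Newtonian potential of
  \<open>f\<close>, that is of the inverse Laplacian applied to \<open>f\<close>. The Biot-Savart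
  velocity is the rotation by a right angle of the field with these components.\<close>

definition newt :: "2 \<Rightarrow> (real^2 \<Rightarrow> real) \<Rightarrow> real^2 \<Rightarrow> real" where
  "newt i f x = (LINT y|lborel. kern i (x - y) * f y)"

lemma newt_conv:
  assumes [measurable]: "f \<in> borel_measurable borel"
  shows "newt i f x = (LINT z|lborel. kern i z * f (x - z))"
  using integral_reflection[of "\<lambda>y. kern i (x - y) * f y" x] by (simp add: newt_def)

lemma newt_conv_test:
  assumes "test_function f"
  shows "newt i f = (\<lambda>x. LINT z|lborel. kern i z * f (x - z))"
  by (intro ext newt_conv test_function_measurable assms)

lemma newt_smooth: "test_function f \<Longrightarrow> smooth (newt i f)"
  by (simp add: newt_conv_test convolution_smooth loc_int_kern)

lemma partial_newt: "test_function f \<Longrightarrow> partial j (newt i f) x = newt i (partial j f) x"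
  by (simp add: newt_conv_test test_function_partial)
    (simp add: partial_def frechet_derivative_convolution loc_int_kern)

lemma newt_add: "test_function f \<Longrightarrow> test_function g \<Longrightarrow> newt i (\<lambda>x. f x + g x) x = newt i f x + newt i g x"
  using convolution_integrable[OF loc_int_kern[of i], of _ x]
  by (simp add: newt_conv_test test_function_add distrib_left)

lemma newt_diff: "test_function f \<Longrightarrow> test_function g \<Longrightarrow> newt i (\<lambda>x. f x - g x) x = newt i f x - newt i g x"
  using convolution_integrable[OF loc_int_kern[of i], of _ x]
  by (simp add: newt_conv right_diff_distrib test_function_measurable)

lemma
  assumes f: "test_function (f :: real^2 \<Rightarrow> real)"
  shows test_function_reflection: "test_function (\<lambda>z. f (x - z))"
    and partial_reflection: "partial j (\<lambda>z. f (x - z)) z = - partial j f (x - z)"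
proof -
  obtain R where R: "\<And>x. norm x \<ge> R \<Longrightarrow> f x = 0"
    using test_function_supportE[OF f] by metis
  have "smooth (\<lambda>z. f (x + (- z)))"
    by (rule smooth_affine[of uminus]) (auto intro: bounded_linear_minus bounded_linear_ident test_function_smooth f)
  moreover have "compactly_supported (\<lambda>z. f (x - z))"
  proof (rule compactly_supportedI[of "norm x + R"])
    show "f (x - z) = 0" if "norm z \<ge> norm x + R" for z
      using that norm_triangle_ineq2[of z x] by (intro R) (simp add: norm_minus_commute)
  qed
  ultimately show "test_function (\<lambda>z. f (x - z))"
    by (simp add: test_function_def)
  have "((\<lambda>z. f (x - z)) has_derivative (\<lambda>v. frechet_derivative f (at (x - z)) (- v))) (at z)"
    by (rule has_derivative_compose[of "\<lambda>z. x - z"])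
      (auto intro!: derivative_eq_intros smooth_has_derivative test_function_smooth f)
  then have "frechet_derivative (\<lambda>z. f (x - z)) (at z) = (\<lambda>v. frechet_derivative f (at (x - z)) (- v))"
    by (rule frechet_derivative_at[symmetric])
  then show "partial j (\<lambda>z. f (x - z)) z = - partial j f (x - z)"
    using linear_neg[OF linear_frechet_derivative[OF smooth_differentiable[OF test_function_smooth[OF f]]]]
    by (simp add: partial_def)
qed

lemma newt_curl_free:
  assumes f: "test_function f"
  shows "newt 1 (partial 2 f) x = newt 2 (partial 1 f) x"
  using kern_curl_free[OF test_function_reflection[OF f, of x]]
  by (simp add: newt_conv_test[OF test_function_partial[OF f]] partial_reflection[OF f])

text \<open>\<open>kern_divergence\<close> is tested with the reflection of \<open>f\<close> at
  \<open>x\<close>; the reflection flips the sign of each partial derivative and so removes the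
  minus sign there. Since \<open>newt\<close> commutes with derivatives, this expresses that the
  Laplacian of the potential is \<open>f\<close>.\<close>

lemma newt_divergence:
  assumes f: "test_function f"
  shows "newt 1 (partial 1 f) x + newt 2 (partial 2 f) x = f x"
  using kern_divergence[OF test_function_reflection[OF f, of x]]
  by (simp add: newt_conv_test[OF test_function_partial[OF f]] partial_reflection[OF f])

text \<open>For \<open>norm x > 2 * R\<close> every point of the support is at distance at least
  \<open>norm x / 2\<close> from \<open>x\<close>, and the kernel is of order
  \<open>1 / norm x\<close>; on the remaining ball continuity gives a bound.\<close>

lemma newt_decay:
  assumes f: "test_function f"
  obtains C where "C > 0" "\<And>x. \<bar>newt i f x\<bar> \<le> C / (1 + norm x)"
proof -
  obtain R0 where R0: "\<And>x. norm x \<ge> R0 \<Longrightarrow> f x = 0"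
    using test_function_supportE[OF f] by metis
  define R where "R = max R0 1"
  have R: "R \<ge> 1" "\<And>x. norm x \<ge> R \<Longrightarrow> f x = 0"
    using R0 by (auto simp: R_def)
  define I where "I = (LINT y|lborel. \<bar>f y\<bar>)"
  have "I \<ge> 0" by (simp add: I_def)
  have "compact (newt i f ` cball 0 (2 * R))"
    by (intro compact_continuous_image smooth_continuous_on newt_smooth f) simp
  then obtain B where B: "B > 0" "\<And>x. norm x \<le> 2 * R \<Longrightarrow> \<bar>newt i f x\<bar> \<le> B"
    using compact_imp_bounded[of "newt i f ` cball 0 (2 * R)"] by (auto simp: bounded_pos)
  \<comment> \<open>The summand \<open>2 * I\<close> serves the exterior, where
    \<open>1 / norm x \<le> 2 / (1 + norm x)\<close>; the other serves the ball, where
    \<open>1 + norm x \<le> 1 + 2 * R\<close>.\<close>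
  define C where "C = 2 * I + B * (1 + 2 * R)"
  have "C > 0"
    using \<open>I \<ge> 0\<close> B(1) R(1) by (simp add: C_def add_nonneg_pos)
  have "\<bar>newt i f x\<bar> \<le> C / (1 + norm x)" for x
  proof (cases "norm x \<le> 2 * R")
    case True
    have "\<bar>newt i f x\<bar> * (1 + norm x) \<le> B * (1 + 2 * R)"
      using True B by (intro mult_mono) auto
    then show ?thesis
      using \<open>I \<ge> 0\<close> by (simp add: C_def pos_le_divide_eq add_pos_nonneg)
  next
    case False
    then have x: "norm x > 2 * R" "norm x > 1" using R(1) by auto
    have "\<bar>kern i (x - y) * f y\<bar> \<le> 1 / norm x * \<bar>f y\<bar>" for y
    proof (cases "norm y \<ge> R")
      case True
      then show ?thesis using R(2) by simp
    next
      case False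
      have xy: "norm (x - y) \<ge> norm x / 2"
        using False x norm_triangle_ineq2[of x y] by simp
      then have p: "norm (x - y) > 0" using x by linarith
      have "\<bar>kern i (x - y)\<bar> \<le> 1 / (2 * pi) * (1 / norm (x - y))"
        by (rule kern_bound)
      also have "\<dots> \<le> 1 / 2 * (1 / (norm x / 2))"
        using xy x p pi_gt3 by (intro mult_mono divide_left_mono mult_pos_pos) auto
      finally show ?thesis
        unfolding abs_mult by (intro mult_right_mono) auto
    qed
    note le = this
    note [measurable] = test_function_measurable[OF f]
    have int: "integrable lborel (\<lambda>y. 1 / norm x * \<bar>f y\<bar>)"
      by (intro integrable_mult_right integrable_abs test_function_integrable f)
    then have "integrable lborel (\<lambda>y. kern i (x - y) * f y)"
      by (rule Bochner_Integration.integrable_bound) (use le in \<open>simp_all add: abs_mult\<close>)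
    then have "\<bar>newt i f x\<bar> \<le> (LINT y|lborel. 1 / norm x * \<bar>f y\<bar>)"
      unfolding newt_def using int le by (rule integral_abs_bound_integral)
    also have "\<dots> = I / norm x" by (simp add: I_def)
    also have "\<dots> \<le> 2 * I / (1 + norm x)"
      using x \<open>I \<ge> 0\<close> mult_left_mono[of 1 "norm x" I] by (simp add: divide_simps algebra_simps)
    also have "\<dots> \<le> C / (1 + norm x)"
      using B(1) R(1) by (intro divide_right_mono) (auto simp: C_def)
    finally show ?thesis .
  qed
  with \<open>C > 0\<close> that show ?thesis by blast
qed

lemma newt_derivative_decay:
  assumes f: "test_function f"
  obtains C where "C > 0" "\<And>x. \<bar>newt i f x\<bar> \<le> C / (1 + norm x)"
    "\<And>x. \<bar>partial 1 (newt i f) x\<bar> \<le> C / (1 + norm x)" "\<And>x. \<bar>partial 2 (newt i f) x\<bar> \<le> C / (1 + norm x)"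
proof -
  obtain A where A: "A > 0" "\<And>x. \<bar>newt i f x\<bar> \<le> A / (1 + norm x)"
    using newt_decay[OF f] by metis
  obtain B where B: "B > 0" "\<And>x. \<bar>newt i (partial 1 f) x\<bar> \<le> B / (1 + norm x)"
    using newt_decay[OF test_function_partial[OF f]] by metis
  obtain C where C: "C > 0" "\<And>x. \<bar>newt i (partial 2 f) x\<bar> \<le> C / (1 + norm x)"
    using newt_decay[OF test_function_partial[OF f]] by metis
  have le: "A / (1 + norm x) \<le> (A + B + C) / (1 + norm x)" "B / (1 + norm x) \<le> (A + B + C) / (1 + norm x)"
    "C / (1 + norm x) \<le> (A + B + C) / (1 + norm x)" for x :: "real^2"
    using A(1) B(1) C(1) by (auto intro!: divide_right_mono)
  show ?thesis
    using that[of "A + B + C"] A(1) B(1) C(1) order_trans[OF A(2) le(1)] order_trans[OF B(2) le(2)]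
      order_trans[OF C(2) le(3)]
    by (simp add: partial_newt[OF f])
qed

subsection \<open>Smooth functions: mixed partial derivatives and cutoffs\<close>

text \<open>The second difference of \<open>f\<close> along \<open>h *\<^sub>R u\<close> and
  \<open>h *\<^sub>R v\<close> is symmetric in \<open>u\<close> and \<open>v\<close>. Two mean value
  theorems write it as \<open>h * h\<close> times a mixed derivative at a nearby point, in either
  order; dividing and letting \<open>h\<close> tend to \<open>0\<close> gives the claim.\<close>

lemma smooth_mixed_derivatives:
  fixes f :: "'a::euclidean_space \<Rightarrow> real"
  assumes f: "smooth f"
  shows "frechet_derivative (\<lambda>x. frechet_derivative f (at x) u) (at x) v =
    frechet_derivative (\<lambda>x. frechet_derivative f (at x) v) (at x) u"
proof -
  define D where "D u v x = frechet_derivative (\<lambda>x. frechet_derivative f (at x) u) (at x) v" for u v x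
  have diff: "f differentiable (at x)" for x
    by (rule smooth_differentiable[OF f])
  have diff': "(\<lambda>x. frechet_derivative f (at x) u) differentiable (at x)" for u x
    by (intro smooth_differentiable smooth_frechet_derivative f)
  define Q where "Q u v h s t \<longleftrightarrow> 0 \<le> s \<and> s \<le> 1 \<and> 0 \<le> t \<and> t \<le> 1 \<and>
      f (x + h *\<^sub>R u + h *\<^sub>R v) - f (x + h *\<^sub>R u) - f (x + h *\<^sub>R v) + f x =
      h * (h * D u v (x + (s * h) *\<^sub>R u + (t * h) *\<^sub>R v))" for u v and h s t :: real
  have quad: "\<exists>s t. Q u v h s t" for u v h
  proof -
    define g where "g y = f (h *\<^sub>R v + y) - f y" for y
    have gd: "(g has_derivative (\<lambda>w. frechet_derivative f (at (h *\<^sub>R v + y)) w - frechet_derivative f (at y) w)) (at y)" for y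
    proof -
      have "((\<lambda>y. h *\<^sub>R v + y) has_derivative (\<lambda>w. w)) (at y)"
        by (auto intro!: derivative_eq_intros)
      from has_derivative_compose[OF this smooth_has_derivative[OF f]] smooth_has_derivative[OF f]
      show ?thesis
        unfolding g_def by (rule has_derivative_diff)
    qed
    then have "g differentiable (at y)" for y
      unfolding differentiable_def by blast
    then obtain s where s: "0 \<le> s" "s \<le> 1" "g (x + h *\<^sub>R u) - g x =
        frechet_derivative g (at (x + s *\<^sub>R (h *\<^sub>R u))) (h *\<^sub>R u)"
      using directional_mvt[of g] by metis
    define y where "y = x + s *\<^sub>R (h *\<^sub>R u)"
    have "g (x + h *\<^sub>R u) - g x = frechet_derivative f (at (h *\<^sub>R v + y)) (h *\<^sub>R u) - frechet_derivative f (at y) (h *\<^sub>R u)"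
      using s(3) frechet_derivative_at[OF gd[of y]] by (simp add: y_def fun_eq_iff)
    also have "\<dots> = h * (frechet_derivative f (at (y + h *\<^sub>R v)) u - frechet_derivative f (at y) u)"
      by (simp add: linear_cmul[OF linear_frechet_derivative[OF diff]] add.commute right_diff_distrib)
    finally have eq: "g (x + h *\<^sub>R u) - g x =
        h * (frechet_derivative f (at (y + h *\<^sub>R v)) u - frechet_derivative f (at y) u)" .
    obtain t where t: "0 \<le> t" "t \<le> 1" "frechet_derivative f (at (y + h *\<^sub>R v)) u - frechet_derivative f (at y) u =
        D u v (y + t *\<^sub>R (h *\<^sub>R v)) * h"
      using directional_mvt[of "\<lambda>x. frechet_derivative f (at x) u" y "h *\<^sub>R v", OF diff']
      by (metis D_def linear_cmul[OF linear_frechet_derivative[OF diff']] real_scaleR_def mult.commute)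
    have "f (x + h *\<^sub>R u + h *\<^sub>R v) - f (x + h *\<^sub>R u) - f (x + h *\<^sub>R v) + f x = g (x + h *\<^sub>R u) - g x"
      by (simp add: g_def add_ac)
    also have "\<dots> = h * (h * D u v (y + t *\<^sub>R (h *\<^sub>R v)))"
      unfolding eq t(3) by simp
    finally show ?thesis
      using s t by (intro exI[of _ s] exI[of _ t]) (simp add: Q_def y_def)
  qed
  have lim: "(\<lambda>n. D u v (x + (s n * h n) *\<^sub>R u + (t n * h n) *\<^sub>R v)) \<longlonglongrightarrow> D u v x"
    if "\<And>n. 0 \<le> s n \<and> s n \<le> 1 \<and> 0 \<le> t n \<and> t n \<le> 1" "h \<longlonglongrightarrow> 0" for u v and h s t :: "nat \<Rightarrow> real"
  proof -
    have "(\<lambda>n. s n * h n) \<longlonglongrightarrow> 0" "(\<lambda>n. t n * h n) \<longlonglongrightarrow> 0"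
      using that by (auto intro!: tendsto_mult_right_zero Lim_null_comparison[OF _ that(2)[THEN tendsto_rabs_zero]]
          always_eventually simp: abs_mult intro!: mult_left_le_one_le)
    then have "(\<lambda>n. x + (s n * h n) *\<^sub>R u + (t n * h n) *\<^sub>R v) \<longlonglongrightarrow> x + 0 *\<^sub>R u + 0 *\<^sub>R v"
      by (intro tendsto_intros)
    moreover have "continuous_on UNIV (D u v)"
      unfolding D_def[abs_def] by (intro smooth_continuous_on smooth_frechet_derivative f)
    then have "isCont (D u v) (x + 0 *\<^sub>R u + 0 *\<^sub>R v)"
      by (simp add: continuous_on_eq_continuous_at)
    ultimately show ?thesis
      using isCont_tendsto_compose by fastforce
  qed
  define h where "h n = inverse (real (Suc n))" for n
  have h0: "h \<longlonglongrightarrow> 0" "h n \<noteq> 0" for n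
    using LIMSEQ_inverse_real_of_nat by (auto simp: h_def[abs_def])
  have choice: "\<exists>s t. \<forall>n. Q u v (h n) (s n) (t n)" for u v
  proof -
    have "\<forall>n. \<exists>p. Q u v (h n) (fst p) (snd p)"
      using quad[of u v] by (metis fst_conv snd_conv)
    from choice[OF this] obtain p where "\<forall>n. Q u v (h n) (fst (p n)) (snd (p n))" ..
    then show ?thesis
      by (intro exI[of _ "\<lambda>n. fst (p n)"] exI[of _ "\<lambda>n. snd (p n)"])
  qed
  obtain s t where st: "\<And>n. Q u v (h n) (s n) (t n)"
    using choice[of u v] by blast
  obtain s' t' where st': "\<And>n. Q v u (h n) (s' n) (t' n)"
    using choice[of v u] by blast
  have "D u v (x + (s n * h n) *\<^sub>R u + (t n * h n) *\<^sub>R v) = D v u (x + (s' n * h n) *\<^sub>R v + (t' n * h n) *\<^sub>R u)" for n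
  proof -
    have "h n * (h n * D u v (x + (s n * h n) *\<^sub>R u + (t n * h n) *\<^sub>R v)) =
        h n * (h n * D v u (x + (s' n * h n) *\<^sub>R v + (t' n * h n) *\<^sub>R u))"
    proof -
      have "x + h n *\<^sub>R u + h n *\<^sub>R v = x + h n *\<^sub>R v + h n *\<^sub>R u"
        by simp
      with st[of n] st'[of n] show ?thesis
        unfolding Q_def by (smt (verit))
    qed
    then show ?thesis using h0(2)[of n] by simp
  qed
  moreover have "(\<lambda>n. D u v (x + (s n * h n) *\<^sub>R u + (t n * h n) *\<^sub>R v)) \<longlonglongrightarrow> D u v x"
    using st h0(1) by (intro lim) (auto simp: Q_def)
  moreover have "(\<lambda>n. D v u (x + (s' n * h n) *\<^sub>R v + (t' n * h n) *\<^sub>R u)) \<longlonglongrightarrow> D v u x"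
    using st' h0(1) by (intro lim) (auto simp: Q_def)
  ultimately have "D u v x = D v u x"
    using LIMSEQ_unique by simp
  then show ?thesis by (simp add: D_def)
qed

lemma partial_commute: "smooth f \<Longrightarrow> partial i (partial j f) x = partial j (partial i f) x"
  unfolding partial_def[abs_def] by (rule smooth_mixed_derivatives)

lemma smooth_partial [smooth_intros]: "smooth f \<Longrightarrow> smooth (partial j f)"
  unfolding partial_def[abs_def] by (rule smooth_frechet_derivative)

lemma partial_mult:
  "smooth f \<Longrightarrow> smooth g \<Longrightarrow> partial j (\<lambda>x. f x * g x) x = f x * partial j g x + partial j f x * g x"
  by (simp add: partial_def frechet_derivative_mult)

lemma partial_add:
  "smooth f \<Longrightarrow> smooth g \<Longrightarrow> partial j (\<lambda>x. f x + g x) x = partial j f x + partial j g x"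
  unfolding partial_def
  by (simp add: frechet_derivative_at[OF has_derivative_add[OF smooth_has_derivative smooth_has_derivative], symmetric])

lemma partial_diff:
  "smooth f \<Longrightarrow> smooth g \<Longrightarrow> partial j (\<lambda>x. f x - g x) x = partial j f x - partial j g x"
  unfolding partial_def
  by (simp add: frechet_derivative_at[OF has_derivative_diff[OF smooth_has_derivative smooth_has_derivative], symmetric])

lemma integral_partial_eq_0: "test_function f \<Longrightarrow> (LINT x|lborel. partial j f x) = 0"
  unfolding partial_def by (rule integral_frechet_derivative_eq_0)

text \<open>A function of the squared norm, hence smooth at the origin: it is \<open>1\<close> for
  \<open>norm x \<le> m\<close> and \<open>0\<close> from squared norm \<open>2 * m\<^sup>2\<close>
  on.\<close>

definition cutoff :: "real \<Rightarrow> real^2 \<Rightarrow> real" where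
  "cutoff m x = smooth_step ((x $ 1 * x $ 1 + x $ 2 * x $ 2) / m\<^sup>2 - 2)"

lemma norm_power2_real2: "(norm x)\<^sup>2 = x $ 1 * x $ 1 + x $ 2 * x $ 2" for x :: "real^2"
  by (simp add: norm_vec_def L2_set_def sum_2 power2_eq_square)

lemma cutoff_bounds: "0 \<le> cutoff m x" "cutoff m x \<le> 1"
  by (simp_all add: cutoff_def smooth_step_bounds)

lemma cutoff_eq_1: "norm x \<le> m \<Longrightarrow> m > 0 \<Longrightarrow> cutoff m x = 1"
  using power_mono[of "norm x" m 2] unfolding cutoff_def norm_power2_real2[symmetric]
  by (intro smooth_step_eq_1) simp

lemma cutoff_eq_0:
  assumes "norm x \<ge> 2 * m" "m > 0"
  shows "cutoff m x = 0"
  unfolding cutoff_def norm_power2_real2[symmetric]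
proof (rule smooth_step_eq_0)
  have "(2 * m)\<^sup>2 \<le> (norm x)\<^sup>2"
    using assms by (intro power_mono) auto
  then have "4 * m\<^sup>2 \<le> (norm x)\<^sup>2"
    by (simp add: power_mult_distrib)
  then have "2 * m\<^sup>2 \<le> (norm x)\<^sup>2"
    using zero_le_power2[of m] by linarith
  then show "(norm x)\<^sup>2 / m\<^sup>2 - 2 \<ge> 0"
    using assms by (simp add: field_simps)
qed

lemma test_function_cutoff: "m > 0 \<Longrightarrow> test_function (cutoff m)"
proof -
  assume m: "m > 0"
  have "smooth (\<lambda>x::real^2. (x $ 1 * x $ 1 + x $ 2 * x $ 2) * (1 / m\<^sup>2) - 2)"
    by (intro smooth_intros)
  from smooth_compose[OF smooth_smooth_step this]
  have "smooth (cutoff m)" by (simp add: cutoff_def[abs_def])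
  moreover have "compactly_supported (cutoff m)"
    by (rule compactly_supportedI[of "2 * m"]) (simp add: cutoff_eq_0 m)
  ultimately show ?thesis by (simp add: test_function_def)
qed

lemma cutoff_scaling: "m > 0 \<Longrightarrow> cutoff m x = cutoff 1 ((1 / m) *\<^sub>R x)"
  by (simp add: cutoff_def field_simps power2_eq_square)

text \<open>By the scaling \<open>cutoff m x = cutoff 1 ((1 / m) *\<^sub>R x)\<close> one constant
  \<open>K\<close> serves all \<open>m\<close>. The gradient lives in the annulus between
  \<open>m\<close> and \<open>2 * m\<close>, where a decay like \<open>1 / norm x\<close> can be
  exchanged for a factor \<open>1 / m\<close>.\<close>

lemma partial_cutoff_bound:
  obtains K where "K > 0" "\<And>j m x. m > 0 \<Longrightarrow> \<bar>partial j (cutoff m) x\<bar> \<le> K / m"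
    "\<And>j m x. m > 0 \<Longrightarrow> norm x < m \<Longrightarrow> partial j (cutoff m) x = 0"
    "\<And>j m x. m > 0 \<Longrightarrow> norm x > 2 * m \<Longrightarrow> partial j (cutoff m) x = 0"
proof -
  have t1: "test_function (cutoff 1)" by (simp add: test_function_cutoff)
  obtain K1 where K1: "K1 > 0" "\<And>x. \<bar>partial 1 (cutoff 1) x\<bar> \<le> K1"
    using test_function_boundedE[OF test_function_partial[OF t1]] by metis
  obtain K2 where K2: "K2 > 0" "\<And>x. \<bar>partial 2 (cutoff 1) x\<bar> \<le> K2"
    using test_function_boundedE[OF test_function_partial[OF t1]] by metis
  have K: "\<bar>partial j (cutoff 1) x\<bar> \<le> K1 + K2" for j x
    using K1 K2 exhaust_2[of j] by (metis add_increasing add_increasing2 less_imp_le)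
  show ?thesis
  proof (rule that[of "K1 + K2"])
    fix j :: 2 and m :: real and x :: "real^2"
    assume m: "m > 0"
    have "((\<lambda>x. cutoff 1 ((1 / m) *\<^sub>R x)) has_derivative
        (\<lambda>v. frechet_derivative (cutoff 1) (at ((1 / m) *\<^sub>R x)) ((1 / m) *\<^sub>R v))) (at x)"
      by (rule has_derivative_compose[of "\<lambda>x. (1 / m) *\<^sub>R x"])
        (auto intro!: derivative_eq_intros smooth_has_derivative test_function_smooth t1)
    moreover have "(\<lambda>x. cutoff 1 ((1 / m) *\<^sub>R x)) = cutoff m"
      by (rule ext) (rule cutoff_scaling[OF m, symmetric])
    ultimately have "partial j (cutoff m) x = frechet_derivative (cutoff 1) (at ((1 / m) *\<^sub>R x)) ((1 / m) *\<^sub>R axis j 1)"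
      by (simp add: partial_def frechet_derivative_at[symmetric])
    also have "\<dots> = (1 / m) * partial j (cutoff 1) ((1 / m) *\<^sub>R x)"
      using linear_cmul[OF linear_frechet_derivative[OF smooth_differentiable[OF test_function_smooth[OF t1]]]]
      by (simp add: partial_def)
    finally show "\<bar>partial j (cutoff m) x\<bar> \<le> (K1 + K2) / m"
      using K[of j "(1 / m) *\<^sub>R x"] m by (simp add: abs_mult divide_right_mono)
    show "partial j (cutoff m) x = 0" if x: "norm x < m"
    proof -
      have "(cutoff m has_derivative (\<lambda>v. 0)) (at x)"
        by (rule has_derivative_transform_within_open[OF has_derivative_const[of 1] open_ball[of 0 m]])
          (use x m in \<open>auto simp: cutoff_eq_1\<close>)
      then show ?thesis
        by (simp add: partial_def frechet_derivative_at[symmetric])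
    qed
    show "partial j (cutoff m) x = 0" if "norm x > 2 * m"
      unfolding partial_def by (rule frechet_derivative_eq_0_outside[OF _ that]) (simp add: cutoff_eq_0 m)
  qed (use K1 K2 in auto)
qed

subsection \<open>The Biot-Savart integral of bounded integrable functions\<close>

text \<open>The share of the singularity in kernel estimates; it is finite, and it tends to
  \<open>0\<close> with the radius by dominated convergence.\<close>

definition kern_mass :: "real \<Rightarrow> real" where
  "kern_mass \<epsilon> = (LINT z::real^2|lborel. indicator (cball 0 \<epsilon>) z * (1 / norm z))"

lemma kern_mass_nonneg: "kern_mass \<epsilon> \<ge> 0"
  unfolding kern_mass_def by (rule integral_nonneg_AE) auto

lemma kern_mass_tendsto: "(\<lambda>n. kern_mass (inverse (real (Suc n)))) \<longlonglongrightarrow> 0"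
proof -
  have int: "integrable lborel (\<lambda>z::real^2. indicator (cball 0 R) z * (1 / norm z))" for R
    using loc_int_inverse_norm by (simp add: loc_int_def)
  have "(\<lambda>n. LINT z::real^2|lborel. indicator (cball 0 (inverse (real (Suc n)))) z * (1 / norm z)) \<longlonglongrightarrow>
      (LINT z::real^2|lborel. 0)"
  proof (rule integral_dominated_convergence[OF _ _ int[of 1]])
    show "(\<lambda>z::real^2. indicator (cball 0 (inverse (real (Suc n)))) z * (1 / norm z)) \<in> borel_measurable lborel" for n
      using int by (rule borel_measurable_integrable)
    show "AE z::real^2 in lborel. (\<lambda>n. indicator (cball 0 (inverse (real (Suc n)))) z * (1 / norm z)) \<longlonglongrightarrow> 0"
    proof (rule AE_I2)
      fix z :: "real^2"
      show "(\<lambda>n. indicator (cball 0 (inverse (real (Suc n)))) z * (1 / norm z)) \<longlonglongrightarrow> 0"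
      proof (cases "z = 0")
        case False
        have "eventually (\<lambda>n. inverse (real (Suc n)) < norm z) sequentially"
          using LIMSEQ_inverse_real_of_nat False by (intro order_tendstoD) auto
        then have "eventually (\<lambda>n. indicator (cball 0 (inverse (real (Suc n)))) z * (1 / norm z) = 0) sequentially"
          by eventually_elim (simp add: indicator_def)
        then show ?thesis
          by (rule tendsto_eventually)
      qed simp
    qed
    show "AE z::real^2 in lborel. norm (indicator (cball 0 (inverse (real (Suc n)))) z * (1 / norm z)) \<le>
        indicator (cball 0 1) z * (1 / norm z)" for n
    proof (intro AE_I2)
      fix z :: "real^2"
      have "inverse (real (Suc n)) \<le> 1" by (simp add: field_simps)
      then show "norm (indicator (cball 0 (inverse (real (Suc n)))) z * (1 / norm z)) \<le>
          indicator (cball 0 1) z * (1 / norm z)"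
        by (cases "norm z \<le> inverse (real (Suc n))") (auto simp del: of_nat_Suc)
    qed
  qed simp
  then show ?thesis by (simp add: kern_mass_def)
qed

lemma integrable_reflection:
  fixes f :: "'a::euclidean_space \<Rightarrow> real"
  assumes f: "integrable lborel f"
  shows "integrable lborel (\<lambda>x. f (c - x))"
proof -
  have [measurable]: "f \<in> borel_measurable borel"
    using borel_measurable_integrable[OF f] by (simp only: measurable_lborel2)
  have eq: "distr lborel borel (\<lambda>x::'a. c + (- 1) *\<^sub>R x) = lborel"
    by (subst lborel_affine[of "-1" c]) (auto simp: density_1)
  have "integrable (distr lborel borel (\<lambda>x::'a. c + (- 1) *\<^sub>R x)) f"
    unfolding eq by (rule f)
  then show ?thesis
    by (subst (asm) integrable_distr_eq) auto
qed

text \<open>The integral is split at distance \<open>\<epsilon>\<close> from \<open>x\<close>: near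
  the singularity the sup bound \<open>A\<close> is used, away from it the L^1 bound
  \<open>B\<close>. The radius stays free: the value \<open>1\<close> gives a uniform velocity
  bound, while a small radius with a still smaller \<open>B\<close> gives uniform
  approximation.\<close>

lemma newt_split_bound:
  assumes w: "integrable lborel w" and A: "AE y in lborel. \<bar>w y\<bar> \<le> A"
    and B: "(LINT y|lborel. \<bar>w y\<bar>) \<le> B" and \<epsilon>: "\<epsilon> > 0" and "A \<ge> 0"
  shows newt_integrable: "integrable lborel (\<lambda>y. kern i (x - y) * w y)"
    and newt_abs_bound: "(LINT y|lborel. \<bar>kern i (x - y) * w y\<bar>) \<le> A * kern_mass \<epsilon> + B / \<epsilon>"
    and newt_bound: "\<bar>newt i w x\<bar> \<le> A * kern_mass \<epsilon> + B / \<epsilon>"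
proof -
  have [measurable]: "w \<in> borel_measurable borel"
    using borel_measurable_integrable[OF w] by (simp only: measurable_lborel2)
  define g where "g y = indicator (cball 0 \<epsilon>) (x - y) * (1 / norm (x - y))" for y :: "real^2"
  have "integrable lborel (\<lambda>z::real^2. indicator (cball 0 \<epsilon>) z * (1 / norm z))"
    using loc_int_inverse_norm by (simp add: loc_int_def)
  then have g: "integrable lborel g"
    unfolding g_def by (rule integrable_reflection)
  have gint: "(LINT y|lborel. g y) = kern_mass \<epsilon>"
    unfolding g_def kern_mass_def
    by (rule integral_reflection[of "\<lambda>z. indicator (cball 0 \<epsilon>) z * (1 / norm z)" x])
      (intro borel_measurable_times borel_measurable_indicator; simp)
  have rhs: "integrable lborel (\<lambda>y. A * g y + (1 / \<epsilon>) * \<bar>w y\<bar>)"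
    using g w by (intro Bochner_Integration.integrable_add integrable_mult_right integrable_abs)
  have bound: "AE y in lborel. \<bar>kern i (x - y) * w y\<bar> \<le> A * g y + (1 / \<epsilon>) * \<bar>w y\<bar>"
    using A
  proof eventually_elim
    case (elim y)
    have k: "\<bar>kern i (x - y)\<bar> \<le> 1 / norm (x - y)"
      using order_trans[OF kern_bound[of i "x - y"] mult_right_mono[of "1 / (2 * pi)" 1]] pi_gt3
      by simp
    show ?case
    proof (cases "norm (x - y) \<le> \<epsilon>")
      case True
      have "\<bar>kern i (x - y) * w y\<bar> \<le> 1 / norm (x - y) * A"
        unfolding abs_mult using k elim \<open>A \<ge> 0\<close> by (intro mult_mono) auto
      also have "\<dots> = A * g y"
        using True by (simp add: g_def indicator_def)
      also have "\<dots> \<le> A * g y + (1 / \<epsilon>) * \<bar>w y\<bar>"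
        using \<epsilon> by simp
      finally show ?thesis .
    next
      case False
      then have "1 / norm (x - y) \<le> 1 / \<epsilon>"
        using \<epsilon> by (intro divide_left_mono mult_pos_pos) linarith+
      then have "\<bar>kern i (x - y) * w y\<bar> \<le> 1 / \<epsilon> * \<bar>w y\<bar>"
        unfolding abs_mult using k by (intro mult_right_mono) auto
      moreover have "A * g y \<ge> 0"
        using \<open>A \<ge> 0\<close> by (simp add: g_def)
      ultimately show ?thesis by linarith
    qed
  qed
  show int: "integrable lborel (\<lambda>y. kern i (x - y) * w y)"
    using rhs by (rule Bochner_Integration.integrable_bound) (use bound in \<open>auto elim!: eventually_mono\<close>)
  have "(LINT y|lborel. \<bar>kern i (x - y) * w y\<bar>) \<le> (LINT y|lborel. A * g y + (1 / \<epsilon>) * \<bar>w y\<bar>)"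
    using integrable_abs[OF int] rhs bound by (rule integral_mono_AE)
  also have "\<dots> = A * kern_mass \<epsilon> + (LINT y|lborel. \<bar>w y\<bar>) / \<epsilon>"
    using g w by (simp add: gint)
  also have "\<dots> \<le> A * kern_mass \<epsilon> + B / \<epsilon>"
    using B \<epsilon> by (simp add: divide_right_mono)
  finally show "(LINT y|lborel. \<bar>kern i (x - y) * w y\<bar>) \<le> A * kern_mass \<epsilon> + B / \<epsilon>" .
  then show "\<bar>newt i w x\<bar> \<le> A * kern_mass \<epsilon> + B / \<epsilon>"
    unfolding newt_def by (rule order_trans[OF integral_abs_bound])
qed

section \<open>Velocities of bounded integrable vorticities\<close>

lemma L1_Linf_boundD:
  assumes "L1_Linf_bound C w"
  shows "integrable lborel w" "AE y in lborel. \<bar>w y\<bar> \<le> C" "(LINT y|lborel. \<bar>w y\<bar>) \<le> C" "C \<ge> 0"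
    "w \<in> borel_measurable borel"
proof -
  show w: "integrable lborel w" "AE y in lborel. \<bar>w y\<bar> \<le> C" "(LINT y|lborel. \<bar>w y\<bar>) \<le> C"
    using assms by (auto simp: L1_Linf_bound_def)
  have "(LINT y|lborel. \<bar>w y\<bar>) \<ge> 0" by simp
  with w(3) show "C \<ge> 0" by linarith
  show "w \<in> borel_measurable borel"
    using borel_measurable_integrable[OF w(1)] by (simp only: measurable_lborel2)
qed

lemma L1_Linf_bound_diff:
  assumes "L1_Linf_bound C w" "L1_Linf_bound D w'"
  shows "L1_Linf_bound (C + D) (\<lambda>x. w x - w' x)"
  unfolding L1_Linf_bound_def
proof (intro conjI)
  note w = L1_Linf_boundD[OF assms(1)] and w' = L1_Linf_boundD[OF assms(2)]
  show int: "integrable lborel (\<lambda>x. w x - w' x)"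
    using w w' by simp
  have "(LINT x|lborel. \<bar>w x - w' x\<bar>) \<le> (LINT x|lborel. \<bar>w x\<bar> + \<bar>w' x\<bar>)"
    using int w w' by (intro integral_mono) auto
  also have "\<dots> \<le> C + D" using w w' by simp
  finally show "(LINT x|lborel. \<bar>w x - w' x\<bar>) \<le> C + D" .
  show "AE x in lborel. \<bar>w x - w' x\<bar> \<le> C + D"
    using w(2) w'(2) by eventually_elim auto
qed

lemma newt_L1_Linf_bound:
  "L1_Linf_bound C w \<Longrightarrow> \<bar>newt i w x\<bar> \<le> C * (kern_mass 1 + 1)"
  using newt_bound[of w C C 1 i x] L1_Linf_boundD[of C w] by (simp add: distrib_left)

lemma newt_L1_Linf_integrable:
  "L1_Linf_bound C w \<Longrightarrow> integrable lborel (\<lambda>y. kern i (x - y) * w y)"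
  using newt_integrable[of w C C 1 i x] L1_Linf_boundD[of C w] by simp

lemma newt_measurable [measurable]:
  assumes [measurable]: "w \<in> borel_measurable borel"
  shows "newt i w \<in> borel_measurable borel"
  unfolding newt_def[abs_def] by measurable

lemma newt_L1_Linf_diff:
  assumes "L1_Linf_bound C w" "L1_Linf_bound D w'"
  shows "newt i (\<lambda>x. w x - w' x) x = newt i w x - newt i w' x"
  using newt_L1_Linf_integrable[OF assms(1)] newt_L1_Linf_integrable[OF assms(2)]
  by (simp add: newt_def right_diff_distrib)

lemma biot_savart_eq:
  assumes "L1_Linf_bound C w"
  shows "biot_savart w x = vector [- newt 2 w x, newt 1 w x]"
proof -
  have tk: "2 * pi * (kern i z * c) = z $ i / (norm z)\<^sup>2 * c" for i z c
    by (simp add: kern_def)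
  have eq: "(w y / (norm (x - y))\<^sup>2) *\<^sub>R perp (x - y) =
      (- (2 * pi * (kern 2 (x - y) * w y))) *\<^sub>R axis 1 1 + (2 * pi * (kern 1 (x - y) * w y)) *\<^sub>R axis 2 1" for y
    unfolding tk
    by (simp add: vec_eq_iff forall_2 perp_def axis_def vector_2 algebra_simps diff_divide_distrib)
  show ?thesis
    unfolding biot_savart_def eq
    using newt_L1_Linf_integrable[OF assms]
    by (simp add: newt_def vec_eq_iff forall_2 axis_def vector_2)
qed

lemma L1_Linf_bound_test:
  assumes "test_function f"
  obtains C where "L1_Linf_bound C f"
proof -
  obtain B where "\<And>x. \<bar>f x\<bar> \<le> B" using test_function_boundedE[OF assms] by metis
  then have "L1_Linf_bound (max B (LINT x|lborel. \<bar>f x\<bar>)) f"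
    using test_function_integrable[OF assms] by (auto simp: L1_Linf_bound_def le_max_iff_disj)
  then show ?thesis by (rule that)
qed

text \<open>Fubini's theorem and the oddness of the kernel. The uniform bound \<open>M\<close> on
  the inner integrals, integrated against \<open>\<bar>h x\<bar>\<close>, supplies the integrability
  on the product space.\<close>

lemma newt_antisym:
  assumes w: "L1_Linf_bound C w" and h: "test_function h"
  shows "(LINT x|lborel. newt i w x * h x) = - (LINT y|lborel. w y * newt i h y)"
    and "integrable lborel (\<lambda>x. newt i w x * h x)"
proof -
  note [measurable] = L1_Linf_boundD(5)[OF w] test_function_measurable[OF h]
  define f where "f x y = kern i (x - y) * w y * h x" for x y
  have meas: "case_prod f \<in> borel_measurable (lborel \<Otimes>\<^sub>M lborel)"
    unfolding f_def by measurable
  define M where "M = C * kern_mass 1 + C / 1"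
  have M: "(LINT y|lborel. \<bar>kern i (x - y) * w y\<bar>) \<le> M" for x
    unfolding M_def by (intro newt_abs_bound L1_Linf_boundD[OF w]) simp
  have norm_eq: "(LINT y|lborel. norm (f x y)) = (LINT y|lborel. \<bar>kern i (x - y) * w y\<bar>) * \<bar>h x\<bar>" for x
    by (simp add: f_def abs_mult)
  have "integrable lborel (\<lambda>x. LINT y|lborel. norm (f x y))"
  proof (rule Bochner_Integration.integrable_bound)
    show "integrable lborel (\<lambda>x. M * \<bar>h x\<bar>)"
      using test_function_integrable[OF h] by simp
    show "(\<lambda>x. LINT y|lborel. norm (f x y)) \<in> borel_measurable lborel"
      unfolding f_def by measurable
    show "AE x in lborel. norm (LINT y|lborel. norm (f x y)) \<le> norm (M * \<bar>h x\<bar>)"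
      unfolding norm_eq using M order_trans[OF integral_nonneg_AE M]
      by (auto simp: abs_mult intro!: mult_right_mono AE_I2 order_trans[OF M abs_ge_self])
  qed
  moreover have "AE x in lborel. integrable lborel (\<lambda>y. f x y)"
    unfolding f_def using newt_L1_Linf_integrable[OF w] by simp
  ultimately have int: "integrable (lborel \<Otimes>\<^sub>M lborel) (case_prod f)"
    using meas by (intro lborel_pair.Fubini_integrable) auto
  have "(LINT x|lborel. newt i w x * h x) = (LINT x|lborel. LINT y|lborel. f x y)"
    by (simp add: newt_def f_def)
  also have "\<dots> = (LINT y|lborel. LINT x|lborel. f x y)"
    using lborel_pair.Fubini_integral[OF int] by simp
  also have "(\<lambda>y. LINT x|lborel. f x y) = (\<lambda>y. - (w y * newt i h y))"
  proof
    fix y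
    have "f x y = - (w y * (kern i (y - x) * h x))" for x
      using kern_minus[of i "y - x"] by (simp add: f_def)
    then show "(LINT x|lborel. f x y) = - (w y * newt i h y)"
      by (simp add: newt_def)
  qed
  finally show "(LINT x|lborel. newt i w x * h x) = - (LINT y|lborel. w y * newt i h y)"
    by simp
  have "integrable lborel (\<lambda>x. LINT y|lborel. f x y)"
    using lborel_pair.integrable_fst[OF int] by simp
  then show "integrable lborel (\<lambda>x. newt i w x * h x)"
    by (simp add: newt_def f_def)
qed

subsection \<open>Square integrable vector fields\<close>

definition L2_field :: "(real^2 \<Rightarrow> real^2) \<Rightarrow> bool" where
  "L2_field F \<longleftrightarrow> F \<in> borel_measurable borel \<and> integrable lborel (\<lambda>x. (norm (F x))\<^sup>2)"

definition L2_size :: "(real^2 \<Rightarrow> real^2) \<Rightarrow> real" where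
  "L2_size F = sqrt (LINT x|lborel. (norm (F x))\<^sup>2)"

lemma L2_size_nonneg: "L2_size F \<ge> 0"
  by (simp add: L2_size_def)

lemma L2_size_power2: "(L2_size F)\<^sup>2 = (LINT x|lborel. (norm (F x))\<^sup>2)"
  by (simp add: L2_size_def)

lemma L2_field_inner:
  assumes "L2_field F" "L2_field G"
  shows "integrable lborel (\<lambda>x. F x \<bullet> G x)"
proof (rule Bochner_Integration.integrable_bound)
  show "integrable lborel (\<lambda>x. (norm (F x))\<^sup>2 + (norm (G x))\<^sup>2)"
    using assms by (simp add: L2_field_def)
  have [measurable]: "F \<in> borel_measurable borel" "G \<in> borel_measurable borel"
    using assms by (auto simp: L2_field_def)
  show "(\<lambda>x. F x \<bullet> G x) \<in> borel_measurable lborel" by measurable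
  show "AE x in lborel. norm (F x \<bullet> G x) \<le> norm ((norm (F x))\<^sup>2 + (norm (G x))\<^sup>2)"
  proof (rule AE_I2)
    fix x
    have "\<bar>F x \<bullet> G x\<bar> \<le> norm (F x) * norm (G x)"
      by (rule Cauchy_Schwarz_ineq2)
    also have "\<dots> \<le> (norm (F x))\<^sup>2 + (norm (G x))\<^sup>2"
      using sum_squares_bound[of "norm (F x)" "norm (G x)"] zero_le_power2[of "norm (F x)"]
        zero_le_power2[of "norm (G x)"] mult_nonneg_nonneg[OF norm_ge_zero[of "F x"] norm_ge_zero[of "G x"]]
      by linarith
    finally show "norm (F x \<bullet> G x) \<le> norm ((norm (F x))\<^sup>2 + (norm (G x))\<^sup>2)" by simp
  qed
qed

lemma L2_field_add_scale:
  assumes F: "L2_field F" and G: "L2_field G"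
  shows L2_field_combination: "L2_field (\<lambda>x. F x + c *\<^sub>R G x)"
    and L2_size_combination: "(LINT x|lborel. (norm (F x + c *\<^sub>R G x))\<^sup>2) =
      (L2_size F)\<^sup>2 + 2 * c * (LINT x|lborel. F x \<bullet> G x) + c\<^sup>2 * (L2_size G)\<^sup>2"
proof -
  have [measurable]: "F \<in> borel_measurable borel" "G \<in> borel_measurable borel"
    using assms by (auto simp: L2_field_def)
  have eq: "(norm (F x + c *\<^sub>R G x))\<^sup>2 = (norm (F x))\<^sup>2 + 2 * c * (F x \<bullet> G x) + c\<^sup>2 * (norm (G x))\<^sup>2" for x
    unfolding power2_norm_eq_inner by (simp add: inner_add inner_commute power2_eq_square)
  have i: "integrable lborel (\<lambda>x. (norm (F x))\<^sup>2)" "integrable lborel (\<lambda>x. (norm (G x))\<^sup>2)"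
    using assms by (auto simp: L2_field_def)
  note i' = L2_field_inner[OF assms]
  show "L2_field (\<lambda>x. F x + c *\<^sub>R G x)"
    unfolding L2_field_def eq using i i' by simp
  show "(LINT x|lborel. (norm (F x + c *\<^sub>R G x))\<^sup>2) =
      (L2_size F)\<^sup>2 + 2 * c * (LINT x|lborel. F x \<bullet> G x) + c\<^sup>2 * (L2_size G)\<^sup>2"
    unfolding eq L2_size_power2 using i i' by simp
qed

lemma L2_field_add: "L2_field F \<Longrightarrow> L2_field G \<Longrightarrow> L2_field (\<lambda>x. F x + G x)"
  using L2_field_combination[of F G 1] by simp

lemma L2_field_diff: "L2_field F \<Longrightarrow> L2_field G \<Longrightarrow> L2_field (\<lambda>x. F x - G x)"
  using L2_field_combination[of F G "-1"] by simp

lemma L2_cauchy_schwarz: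
  assumes F: "L2_field F" and G: "L2_field G"
  shows "\<bar>LINT x|lborel. F x \<bullet> G x\<bar> \<le> L2_size F * L2_size G"
proof -
  define a where "a = (LINT x|lborel. F x \<bullet> G x)"
  define f where "f = L2_size F"
  define g where "g = L2_size G"
  have fg: "f \<ge> 0" "g \<ge> 0" by (auto simp: f_def g_def L2_size_nonneg)
  have q: "f\<^sup>2 + 2 * c * a + c\<^sup>2 * g\<^sup>2 \<ge> 0" for c
    using L2_size_combination[OF F G, of c] integral_nonneg_AE[of "\<lambda>x. (norm (F x + c *\<^sub>R G x))\<^sup>2" lborel]
    by (simp add: a_def f_def g_def)
  have "\<bar>a\<bar> \<le> f * g"
  proof (cases "g = 0")
    case True
    have "a = 0"
    proof (rule ccontr)
      assume "a \<noteq> 0"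
      \<comment> \<open>For \<open>g = 0\<close> the nonnegative expression is affine in
        \<open>c\<close>, and the chosen \<open>c\<close> gives it the value
        \<open>-1\<close>.\<close>
      then show False
        using q[of "- (f\<^sup>2 + 1) / (2 * a)"] True by (simp add: field_simps)
    qed
    then show ?thesis using True by simp
  next
    case False
    then have "g\<^sup>2 > 0" by simp
    have "f\<^sup>2 + 2 * (- a / g\<^sup>2) * a + (- a / g\<^sup>2)\<^sup>2 * g\<^sup>2 = f\<^sup>2 - a\<^sup>2 / g\<^sup>2"
      using False by (simp add: power2_eq_square)
    then have "f\<^sup>2 - a\<^sup>2 / g\<^sup>2 \<ge> 0"
      using q[of "- a / g\<^sup>2"] by simp
    then have "a\<^sup>2 \<le> (f * g)\<^sup>2"
      using \<open>g\<^sup>2 > 0\<close> by (simp add: field_simps power_mult_distrib)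
    then show ?thesis
      using fg by (simp add: abs_le_square_iff[symmetric])
  qed
  then show ?thesis by (simp add: a_def f_def g_def)
qed

lemma L2_triangle:
  assumes F: "L2_field F" and G: "L2_field G"
  shows "L2_size (\<lambda>x. F x + G x) \<le> L2_size F + L2_size G"
proof (rule power2_le_imp_le)
  have "(L2_size (\<lambda>x. F x + G x))\<^sup>2 = (L2_size F)\<^sup>2 + 2 * (LINT x|lborel. F x \<bullet> G x) + (L2_size G)\<^sup>2"
    using L2_size_combination[OF F G, of 1] by (simp add: L2_size_power2)
  also have "\<dots> \<le> (L2_size F)\<^sup>2 + 2 * (L2_size F * L2_size G) + (L2_size G)\<^sup>2"
    using L2_cauchy_schwarz[OF F G] by auto
  also have "\<dots> = (L2_size F + L2_size G)\<^sup>2"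
    by (simp add: power2_sum)
  finally show "(L2_size (\<lambda>x. F x + G x))\<^sup>2 \<le> (L2_size F + L2_size G)\<^sup>2" .
qed (simp add: L2_size_nonneg)

lemma L2_field_bounded_cs:
  fixes F :: "real^2 \<Rightarrow> real^2"
  assumes c: "continuous_on UNIV F" and z: "\<And>x. norm x \<ge> R \<Longrightarrow> F x = 0"
  shows "L2_field F"
  unfolding L2_field_def
proof
  show "F \<in> borel_measurable borel"
    using c by (rule borel_measurable_continuous_onI)
  show "integrable lborel (\<lambda>x. (norm (F x))\<^sup>2)"
    by (rule integrable_continuous_cs[of _ R]) (use z in \<open>auto intro!: continuous_intros c\<close>)
qed

lemma L2_size_mono:
  assumes F: "F \<in> borel_measurable borel" and G: "L2_field G" and le: "\<And>x. norm (F x) \<le> norm (G x)"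
  shows "L2_field F" "L2_size F \<le> L2_size G"
proof -
  note [measurable] = F
  have g: "integrable lborel (\<lambda>x. (norm (G x))\<^sup>2)"
    using G by (simp add: L2_field_def)
  then have f: "integrable lborel (\<lambda>x. (norm (F x))\<^sup>2)"
    by (rule Bochner_Integration.integrable_bound) (use le in \<open>auto intro!: power_mono AE_I2\<close>)
  then show "L2_field F" using F by (simp add: L2_field_def)
  have "(LINT x|lborel. (norm (F x))\<^sup>2) \<le> (LINT x|lborel. (norm (G x))\<^sup>2)"
    using f g le by (intro integral_mono power_mono) auto
  then show "L2_size F \<le> L2_size G" by (simp add: L2_size_def)
qed

section \<open>Removing cutoffs in the limit\<close>

lemma cutoff_measurable [measurable]: "cutoff m \<in> borel_measurable borel"
proof -
  define c where "c = 1 / m\<^sup>2"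
  have "continuous_on UNIV (\<lambda>x::real^2. smooth_step ((x $ 1 * x $ 1 + x $ 2 * x $ 2) * c - 2))" (is "continuous_on _ ?f")
    by (rule continuous_on_compose2[OF smooth_continuous_on[OF smooth_smooth_step, of UNIV]])
      (auto intro!: continuous_intros)
  then have "?f \<in> borel_measurable borel"
    by (rule borel_measurable_continuous_onI)
  then show ?thesis
    by (simp add: cutoff_def[abs_def] c_def)
qed

lemma cutoff_Suc_tendsto: "(\<lambda>n. cutoff (real (Suc n)) x) \<longlonglongrightarrow> 1"
proof -
  obtain N where "norm x \<le> real N" using real_arch_simple by blast
  then show ?thesis
    by (intro tendsto_eventually eventually_sequentiallyI[of N] cutoff_eq_1) auto
qed

lemma cutoff_integral_tendsto:
  fixes f :: "real^2 \<Rightarrow> real"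
  assumes f: "integrable lborel f"
  shows "(\<lambda>n. LINT x|lborel. cutoff (real (Suc n)) x * f x) \<longlonglongrightarrow> (LINT x|lborel. f x)"
    and "integrable lborel (\<lambda>x. cutoff (real (Suc n)) x * f x)"
proof -
  have [measurable]: "f \<in> borel_measurable borel"
    using borel_measurable_integrable[OF f] by (simp only: measurable_lborel2)
  have le: "\<bar>cutoff (real (Suc n)) x * f x\<bar> \<le> \<bar>f x\<bar>" for n x
    using cutoff_bounds[of "real (Suc n)" x] by (simp add: abs_mult mult_left_le_one_le)
  show "(\<lambda>n. LINT x|lborel. cutoff (real (Suc n)) x * f x) \<longlonglongrightarrow> (LINT x|lborel. f x)"
  proof (rule integral_dominated_convergence[where w = "\<lambda>x. \<bar>f x\<bar>"])
    show "AE x in lborel. (\<lambda>n. cutoff (real (Suc n)) x * f x) \<longlonglongrightarrow> f x"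
      using tendsto_mult_right[OF cutoff_Suc_tendsto] by auto
    show "AE x in lborel. norm (cutoff (real (Suc n)) x * f x) \<le> \<bar>f x\<bar>" for n
      using le[of n] by simp
  qed (use f in auto)
  show "integrable lborel (\<lambda>x. cutoff (real (Suc n)) x * f x)"
    using f by (rule Bochner_Integration.integrable_bound) (use le in auto)
qed

text \<open>Fatou's lemma with any bound on the convergent sequence \<open>B\<close> gives
  integrability; once that is known, dominated convergence improves the bound to the limit
  \<open>B0\<close>.\<close>

lemma integrable_by_cutoff:
  fixes f :: "real^2 \<Rightarrow> real"
  assumes [measurable]: "f \<in> borel_measurable borel" and nonneg: "\<And>x. f x \<ge> 0"
    and int: "\<And>n. integrable lborel (\<lambda>x. cutoff (real (Suc n)) x * f x)"
    and le: "\<And>n. (LINT x|lborel. cutoff (real (Suc n)) x * f x) \<le> B n" and lim: "B \<longlonglongrightarrow> B0"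
  shows "integrable lborel f" and "(LINT x|lborel. f x) \<le> B0"
proof -
  obtain M where M: "\<And>n. \<bar>B n\<bar> \<le> M"
    using Bseq_def convergent_imp_Bseq[of B] lim convergentI by (metis real_norm_def)
  have "(\<integral>\<^sup>+x. ennreal (f x) \<partial>lborel) =
      (\<integral>\<^sup>+x. liminf (\<lambda>n. ennreal (cutoff (real (Suc n)) x * f x)) \<partial>lborel)"
  proof (rule nn_integral_cong)
    fix x
    have "(\<lambda>n. ennreal (cutoff (real (Suc n)) x * f x)) \<longlonglongrightarrow> ennreal (1 * f x)"
      by (intro tendsto_ennrealI tendsto_mult_right cutoff_Suc_tendsto)
    from lim_imp_Liminf[OF _ this]
    show "ennreal (f x) = liminf (\<lambda>n. ennreal (cutoff (real (Suc n)) x * f x))" by simp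
  qed
  also have "\<dots> \<le> liminf (\<lambda>n. \<integral>\<^sup>+x. ennreal (cutoff (real (Suc n)) x * f x) \<partial>lborel)"
    by (rule nn_integral_liminf) (use borel_measurable_integrable[OF int] in auto)
  also have "\<dots> \<le> ennreal M"
  proof (rule order_trans[OF Liminf_le_Limsup[OF sequentially_bot] Limsup_bounded], rule always_eventually, rule allI)
    fix n
    have "(\<integral>\<^sup>+x. ennreal (cutoff (real (Suc n)) x * f x) \<partial>lborel) =
        ennreal (LINT x|lborel. cutoff (real (Suc n)) x * f x)"
      using int cutoff_bounds nonneg by (intro nn_integral_eq_integral) auto
    also have "\<dots> \<le> ennreal M"
      using le[of n] M[of n] by (intro ennreal_leI) linarith
    finally show "(\<integral>\<^sup>+x. ennreal (cutoff (real (Suc n)) x * f x) \<partial>lborel) \<le> ennreal M" .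
  qed
  also have "\<dots> < \<infinity>" by simp
  finally show "integrable lborel f"
    using nonneg by (intro integrableI_bounded) auto
  from LIMSEQ_le[OF cutoff_integral_tendsto(1)[OF this] lim] le
  show "(LINT x|lborel. f x) \<le> B0" by blast
qed

subsection \<open>Helmholtz decomposition of test fields\<close>

lemma perp_nth [simp]: "perp x $ 1 = - x $ 2" "perp x $ 2 = x $ 1"
  by (simp_all add: perp_def vector_2)

lemma inner_real2: "x \<bullet> y = x $ 1 * y $ 1 + x $ 2 * y $ 2" for x y :: "real^2"
  by (simp add: inner_vec_def sum_2)

lemma norm_perp [simp]: "norm (perp x) = norm x"
  by (simp add: norm_eq_sqrt_inner inner_real2 add.commute)

lemma perp_linear: "linear perp"
  by (rule linearI) (simp_all add: vec_eq_iff forall_2)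

lemma perp_continuous [continuous_intros]:
  "continuous_on S f \<Longrightarrow> continuous_on S (\<lambda>x. perp (f x))"
  by (rule bounded_linear.continuous_on[OF linear_conv_bounded_linear[THEN iffD1, OF perp_linear]])

lemma grad_nth [simp]: "grad f x $ i = partial i f x"
  by (simp add: grad_def)

lemma grad_continuous: "smooth f \<Longrightarrow> continuous_on S (grad f)"
  unfolding grad_def[abs_def] by (intro continuous_on_vec_lambda smooth_continuous_on smooth_partial)

lemma norm_real2_le: "norm x \<le> \<bar>x $ 1\<bar> + \<bar>x $ 2\<bar>" for x :: "real^2"
  using norm_le_l1_cart[of x] by (simp add: sum_2)

definition test_field :: "(real^2 \<Rightarrow> real^2) \<Rightarrow> bool" where
  "test_field h \<longleftrightarrow> (\<forall>i. test_function (\<lambda>x. h x $ i))"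

text \<open>The inverse Laplacian of the curl of \<open>h\<close>, that is the stream function of
  the divergence-free part of \<open>h\<close>.\<close>

definition stream_pot :: "(real^2 \<Rightarrow> real^2) \<Rightarrow> real^2 \<Rightarrow> real" where
  "stream_pot h x = newt 1 (\<lambda>x. h x $ 2) x - newt 2 (\<lambda>x. h x $ 1) x"

lemma test_field_continuous: "test_field h \<Longrightarrow> continuous_on S h"
  using continuous_on_vec_lambda[of S "\<lambda>i x. h x $ i"]
  by (auto simp: test_field_def test_function_continuous)

lemma test_field_supportE:
  assumes "test_field h"
  obtains R where "\<And>x. norm x \<ge> R \<Longrightarrow> h x = 0"
proof -
  have t: "test_function (\<lambda>x. h x $ i)" for i
    using assms by (simp add: test_field_def)
  obtain R where R: "\<And>x. norm x \<ge> R \<Longrightarrow> h x $ 1 = 0"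
    using test_function_supportE[OF t[of 1]] by metis
  obtain S where S: "\<And>x. norm x \<ge> S \<Longrightarrow> h x $ 2 = 0"
    using test_function_supportE[OF t[of 2]] by metis
  from R S have "h x = 0" if "norm x \<ge> max R S" for x
    using that by (simp add: vec_eq_iff forall_2)
  then show ?thesis by (rule that)
qed

lemma test_field_L2: "test_field h \<Longrightarrow> L2_field h"
  by (metis test_field_supportE test_field_continuous L2_field_bounded_cs)

lemma test_field_grad: "test_function g \<Longrightarrow> test_field (grad g)"
  by (simp add: test_field_def test_function_partial)

lemma test_field_perp_grad: "test_function g \<Longrightarrow> test_field (\<lambda>x. perp (grad g x))"
  using test_function_mult(1)[OF smooth_const[of "-1"] test_function_partial[of g 2]]
  by (auto simp: test_field_def forall_2 test_function_partial)

lemma stream_pot_grad: "test_function g \<Longrightarrow> stream_pot (grad g) x = 0"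
  using newt_curl_free[of g x] by (simp add: stream_pot_def)

lemma stream_pot_perp_grad:
  assumes g: "test_function g"
  shows "stream_pot (\<lambda>x. perp (grad g x)) x = g x"
proof -
  have "newt 2 (\<lambda>x. - partial 2 g x) x = - newt 2 (partial 2 g) x"
    by (simp add: newt_def)
  then show ?thesis
    using newt_divergence[OF g, of x] by (simp add: stream_pot_def)
qed

text \<open>\<open>b\<close> is the inverse Laplacian of the divergence of \<open>h\<close>.
  Potentials and gradients decay at least like \<open>1 / norm x\<close>, since all of them are
  combinations of \<open>newt\<close> applied to test functions; this is the decay that the cutoff
  arguments consume.\<close>

lemma helmholtz:
  assumes h: "test_field h"
  obtains b C where "smooth (stream_pot h)" "smooth b" "C > 0"
    "\<And>x. \<bar>stream_pot h x\<bar> \<le> C / (1 + norm x)" "\<And>x. \<bar>b x\<bar> \<le> C / (1 + norm x)"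
    "\<And>x j. \<bar>partial j (stream_pot h) x\<bar> \<le> C / (1 + norm x)" "\<And>x j. \<bar>partial j b x\<bar> \<le> C / (1 + norm x)"
    "\<And>x. h x = grad b x + perp (grad (stream_pot h) x)"
proof -
  define h1 where "h1 x = h x $ 1" for x
  define h2 where "h2 x = h x $ 2" for x
  have t: "test_function h1" "test_function h2"
    using h by (auto simp: test_field_def h1_def[abs_def] h2_def[abs_def])
  note s = newt_smooth[OF t(1)] newt_smooth[OF t(2)]
  define b where "b x = newt 1 h1 x + newt 2 h2 x" for x
  have a: "stream_pot h = (\<lambda>x. newt 1 h2 x - newt 2 h1 x)"
    by (simp add: stream_pot_def[abs_def] h1_def[abs_def] h2_def[abs_def])
  obtain C1 where C1: "C1 > 0" "\<And>x. \<bar>newt 1 h1 x\<bar> \<le> C1 / (1 + norm x)"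
    "\<And>x. \<bar>partial 1 (newt 1 h1) x\<bar> \<le> C1 / (1 + norm x)" "\<And>x. \<bar>partial 2 (newt 1 h1) x\<bar> \<le> C1 / (1 + norm x)"
    using newt_derivative_decay[OF t(1), of 1] by metis
  obtain C2 where C2: "C2 > 0" "\<And>x. \<bar>newt 2 h1 x\<bar> \<le> C2 / (1 + norm x)"
    "\<And>x. \<bar>partial 1 (newt 2 h1) x\<bar> \<le> C2 / (1 + norm x)" "\<And>x. \<bar>partial 2 (newt 2 h1) x\<bar> \<le> C2 / (1 + norm x)"
    using newt_derivative_decay[OF t(1), of 2] by metis
  obtain C3 where C3: "C3 > 0" "\<And>x. \<bar>newt 1 h2 x\<bar> \<le> C3 / (1 + norm x)"
    "\<And>x. \<bar>partial 1 (newt 1 h2) x\<bar> \<le> C3 / (1 + norm x)" "\<And>x. \<bar>partial 2 (newt 1 h2) x\<bar> \<le> C3 / (1 + norm x)"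
    using newt_derivative_decay[OF t(2), of 1] by metis
  obtain C4 where C4: "C4 > 0" "\<And>x. \<bar>newt 2 h2 x\<bar> \<le> C4 / (1 + norm x)"
    "\<And>x. \<bar>partial 1 (newt 2 h2) x\<bar> \<le> C4 / (1 + norm x)" "\<And>x. \<bar>partial 2 (newt 2 h2) x\<bar> \<le> C4 / (1 + norm x)"
    using newt_derivative_decay[OF t(2), of 2] by metis
  define C where "C = C1 + C2 + C3 + C4"
  have add: "\<bar>p + q\<bar> \<le> C / (1 + norm x)" "\<bar>p - q\<bar> \<le> C / (1 + norm x)"
    if "\<bar>p\<bar> \<le> A / (1 + norm x)" "\<bar>q\<bar> \<le> B / (1 + norm x)" "A + B \<le> C"
    for p q A B and x :: "real^2"
  proof -
    have "\<bar>p\<bar> + \<bar>q\<bar> \<le> A / (1 + norm x) + B / (1 + norm x)"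
      using that by linarith
    also have "\<dots> \<le> C / (1 + norm x)"
      using that(3) by (simp add: add_divide_distrib[symmetric] divide_right_mono)
    finally show "\<bar>p + q\<bar> \<le> C / (1 + norm x)" "\<bar>p - q\<bar> \<le> C / (1 + norm x)"
      by linarith+
  qed
  have pa: "partial j (stream_pot h) x = partial j (newt 1 h2) x - partial j (newt 2 h1) x" for j x
    unfolding a by (rule partial_diff[OF s(2) s(1)])
  have pb: "partial j b x = partial j (newt 1 h1) x + partial j (newt 2 h2) x" for j x
    unfolding b_def[abs_def] by (rule partial_add[OF s(1) s(2)])
  show ?thesis
  proof (rule that[of b C])
    show "smooth (stream_pot h)" "smooth b"
      unfolding a b_def[abs_def] by (intro smooth_intros s)+
    show "C > 0" using C1 C2 C3 C4 by (simp add: C_def)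
    have le: "C3 + C2 \<le> C" "C1 + C4 \<le> C"
      using C1 C2 C3 C4 by (auto simp: C_def)
    show "\<bar>stream_pot h x\<bar> \<le> C / (1 + norm x)" "\<bar>b x\<bar> \<le> C / (1 + norm x)" for x
      unfolding a b_def using add(2)[OF C3(2) C2(2) le(1)] add(1)[OF C1(2) C4(2) le(2)] by auto
    show "\<bar>partial j (stream_pot h) x\<bar> \<le> C / (1 + norm x)" for x j
      unfolding pa using exhaust_2[of j] add(2)[OF C3(3) C2(3) le(1)] add(2)[OF C3(4) C2(4) le(1)] by auto
    show "\<bar>partial j b x\<bar> \<le> C / (1 + norm x)" for x j
      unfolding pb using exhaust_2[of j] add(1)[OF C1(3) C4(3) le(2)] add(1)[OF C1(4) C4(4) le(2)] by auto
    show "h x = grad b x + perp (grad (stream_pot h) x)" for x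
      using newt_divergence[OF t(1), of x] newt_divergence[OF t(2), of x]
        newt_curl_free[OF t(1), of x] newt_curl_free[OF t(2), of x]
      by (simp add: vec_eq_iff forall_2 pa pb partial_newt[OF t(1)] partial_newt[OF t(2)])
        (simp add: h1_def h2_def)
  qed
qed

text \<open>A function that is not integrable has integral \<open>0\<close> by convention, so the
  estimate can be applied without checking integrability.\<close>

lemma integral_ball_bound:
  fixes f :: "real^2 \<Rightarrow> real"
  assumes "\<And>x. \<bar>f x\<bar> \<le> c" "\<And>x. norm x > r \<Longrightarrow> f x = 0" "r \<ge> 0"
  shows "\<bar>LINT x|lborel. f x\<bar> \<le> c * (pi * r\<^sup>2)"
proof -
  have c: "c \<ge> 0" using assms(1)[of 0] by linarith
  have m: "measure lborel (cball (0::real^2) r) = pi * r\<^sup>2"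
    using assms(3) by (simp add: content_cball unit_ball_vol_2)
  show ?thesis
  proof (cases "integrable lborel f")
    case True
    have int: "integrable lborel (\<lambda>x::real^2. indicator (cball 0 r) x *\<^sub>R c)"
      by (rule borel_integrable_compact) auto
    have "\<bar>LINT x|lborel. f x\<bar> \<le> (LINT x::real^2|lborel. indicator (cball 0 r) x *\<^sub>R c)"
    proof (rule integral_abs_bound_integral[OF True int])
      fix x
      show "\<bar>f x\<bar> \<le> indicator (cball 0 r) x *\<^sub>R c"
        using assms(1)[of x] assms(2)[of x] by (cases "norm x \<le> r") auto
    qed
    also have "\<dots> = c * (pi * r\<^sup>2)" by (simp add: m)
    finally show ?thesis .
  next
    case False
    then show ?thesis using c by (simp add: not_integrable_integral_eq)
  qed
qed

lemma cutoff_gradient_decay: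
  fixes C :: real
  assumes K: "\<And>x. \<bar>partial j (cutoff m) x\<bar> \<le> K / m"
    "\<And>x. norm x < m \<Longrightarrow> partial j (cutoff m) x = 0" and m: "m > 0" and C: "C > 0" "\<And>x. \<bar>g x\<bar> \<le> C / (1 + norm x)"
  shows "\<bar>g x * partial j (cutoff m) x\<bar> \<le> C * K / m\<^sup>2"
proof (cases "norm x < m")
  case True
  have "K \<ge> 0"
    using order_trans[OF abs_ge_zero K(1)[of 0]] m by (simp add: zero_le_divide_iff)
  then show ?thesis using True K(2) C(1) by simp
next
  case False
  then have "C / (1 + norm x) \<le> C / m"
    using C m by (intro divide_left_mono mult_pos_pos) auto
  then have "\<bar>g x\<bar> \<le> C / m"
    using C(2)[of x] by linarith
  then have "\<bar>g x\<bar> * \<bar>partial j (cutoff m) x\<bar> \<le> (C / m) * (K / m)"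
    using K(1)[of x] C m by (intro mult_mono) auto
  then show ?thesis by (simp add: abs_mult power2_eq_square)
qed

text \<open>The two parts of the Helmholtz decomposition are orthogonal, so neither is larger than
  \<open>h\<close>. With a cutoff, orthogonality fails by a term of size \<open>m^(-3)\<close> on a
  disc of area of order \<open>m^2\<close>, hence by \<open>O(1 / m)\<close>;
  \<open>integrable_by_cutoff\<close> then yields integrability together with the bound.\<close>

lemma stream_pot_energy:
  assumes h: "test_field h"
  shows "L2_field (grad (stream_pot h))" and "L2_size (grad (stream_pot h)) \<le> L2_size h"
proof -
  obtain b C where hb: "smooth (stream_pot h)" "smooth b" "C > 0"
    "\<And>x. \<bar>stream_pot h x\<bar> \<le> C / (1 + norm x)" "\<And>x. \<bar>b x\<bar> \<le> C / (1 + norm x)"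
    "\<And>x j. \<bar>partial j (stream_pot h) x\<bar> \<le> C / (1 + norm x)" "\<And>x j. \<bar>partial j b x\<bar> \<le> C / (1 + norm x)"
    "\<And>x. h x = grad b x + perp (grad (stream_pot h) x)"
    using helmholtz[OF h] by metis
  define a where "a = stream_pot h"
  obtain K where K: "K > 0" "\<And>j m x. m > 0 \<Longrightarrow> \<bar>partial j (cutoff m) x\<bar> \<le> K / m"
    "\<And>j m x. m > 0 \<Longrightarrow> norm x < m \<Longrightarrow> partial j (cutoff m) x = 0"
    "\<And>j m x. m > 0 \<Longrightarrow> norm x > 2 * m \<Longrightarrow> partial j (cutoff m) x = 0"
    using partial_cutoff_bound by metis
  have sa: "smooth a" using hb by (simp add: a_def)
  have pa: "\<bar>partial j a x\<bar> \<le> C" for j x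
  proof -
    have "C / (1 + norm x) \<le> C / 1"
      using hb(3) by (intro divide_left_mono) (auto intro: add_pos_nonneg)
    then show ?thesis using hb(6)[of j x] by (simp add: a_def)
  qed
  \<comment> \<open>\<open>cr\<close> is the inner product of \<open>grad b\<close> and
    \<open>perp (grad a)\<close>, a Jacobian determinant and therefore a divergence. After
    multiplication by the cutoff its integral reduces to that of \<open>- y m\<close>, in which a
    derivative falls on the cutoff.\<close>
  define cr where "cr x = partial 2 b x * partial 1 a x - partial 1 b x * partial 2 a x" for x
  define y where "y m x = b x * partial 2 (cutoff m) x * partial 1 a x - b x * partial 1 (cutoff m) x * partial 2 a x" for m x
  have ybound: "\<bar>LINT x|lborel. y m x\<bar> \<le> 8 * pi * C\<^sup>2 * K / m" if m: "m \<ge> 1" for m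
  proof -
    have m0: "m > 0" using m by simp
    have "\<bar>y m x\<bar> \<le> 2 * (C * (C * K / m\<^sup>2) / m)" for x
    proof (cases "norm x < m")
      case True
      then show ?thesis using K(3)[OF m0] m0 hb(3) K(1) by (simp add: y_def)
    next
      case False
      have "C / (1 + norm x) \<le> C / m"
        using hb(3) m0 False by (intro divide_left_mono mult_pos_pos) auto
      then have p: "\<bar>partial j a x\<bar> \<le> C / m" for j
        using hb(6)[of j x] by (simp add: a_def)
      have q: "\<bar>b x * partial j (cutoff m) x\<bar> \<le> C * K / m\<^sup>2" for j
        by (rule cutoff_gradient_decay[OF K(2)[OF m0] K(3)[OF m0] m0 hb(3,5)])
      have "\<bar>b x * partial j (cutoff m) x * partial k a x\<bar> \<le> (C * K / m\<^sup>2) * (C / m)" for j k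
        unfolding abs_mult[of "b x * partial j (cutoff m) x"]
        using p q hb(3) K(1) m0 by (intro mult_mono) auto
      moreover have "(C * K / m\<^sup>2) * (C / m) = C * (C * K / m\<^sup>2) / m"
        by simp
      ultimately have "\<bar>b x * partial 2 (cutoff m) x * partial 1 a x\<bar> \<le> C * (C * K / m\<^sup>2) / m"
        "\<bar>b x * partial 1 (cutoff m) x * partial 2 a x\<bar> \<le> C * (C * K / m\<^sup>2) / m"
        by metis+
      then show ?thesis
        unfolding y_def by linarith
    qed
    moreover have "y m x = 0" if "norm x > 2 * m" for x
      using K(4)[OF m0 that] by (simp add: y_def)
    ultimately have "\<bar>LINT x|lborel. y m x\<bar> \<le> 2 * (C * (C * K / m\<^sup>2) / m) * (pi * (2 * m)\<^sup>2)"
      using m0 by (intro integral_ball_bound) auto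
    also have "\<dots> = 8 * pi * C\<^sup>2 * K / m"
      using m0 by (simp add: power2_eq_square)
    finally show ?thesis .
  qed
  have csm: "smooth (cutoff m)" if "m > 0" for m
    using test_function_cutoff[OF that] by (rule test_function_smooth)
  have int_cut: "integrable lborel (\<lambda>x. cutoff m x * f x)" if "m > 0" "continuous_on UNIV f" for m f
    by (rule integrable_continuous_cs[of _ "2 * m"])
      (use that cutoff_eq_0 in \<open>auto intro!: continuous_on_mult[OF smooth_continuous_on[OF csm]]\<close>)
  have int_pcut: "integrable lborel (\<lambda>x. partial j (cutoff m) x * f x)" if "m > 0" "continuous_on UNIV f" for m f j
    by (rule integrable_continuous_cs[of _ "2 * m + 1"])
      (use that K(4) in \<open>auto intro!: continuous_on_mult[OF smooth_continuous_on[OF smooth_partial[OF csm]]]\<close>)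
  note cont = smooth_continuous_on[OF smooth_partial[OF sa]] smooth_continuous_on[OF smooth_partial[OF hb(2)]]
    smooth_continuous_on[OF hb(2)]
  have crc: "continuous_on UNIV cr"
    unfolding cr_def[abs_def] by (intro continuous_intros cont)
  \<comment> \<open>The integrals of \<open>partial 2 (p 1)\<close> and
    \<open>partial 1 (p 2)\<close> vanish; in their difference the second derivatives of
    \<open>a\<close> cancel because they commute.\<close>
  have cross: "(LINT x|lborel. cutoff m x * cr x) = - (LINT x|lborel. y m x)" if m: "m > 0" for m
  proof -
    define p where "p j x = cutoff m x * (b x * partial j a x)" for j x
    have tp: "test_function (p j)" for j
      unfolding p_def[abs_def] by (intro test_function_mult(2) test_function_cutoff m smooth_intros hb(2) sa)
    have dp: "partial i (p j) x = cutoff m x * (b x * partial i (partial j a) x + partial i b x * partial j a x)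
        + partial i (cutoff m) x * (b x * partial j a x)" for i j x
      unfolding p_def[abs_def] by (simp add: partial_mult csm m smooth_intros hb(2) sa)
    have "0 = (LINT x|lborel. partial 2 (p 1) x) - (LINT x|lborel. partial 1 (p 2) x)"
      by (simp add: integral_partial_eq_0 tp)
    also have "\<dots> = (LINT x|lborel. partial 2 (p 1) x - partial 1 (p 2) x)"
      by (simp add: test_function_integrable test_function_partial tp)
    also have "\<dots> = (LINT x|lborel. cutoff m x * cr x + y m x)"
      by (rule Bochner_Integration.integral_cong)
        (simp_all add: dp partial_commute[OF sa, of 2 1] cr_def y_def algebra_simps)
    also have "\<dots> = (LINT x|lborel. cutoff m x * cr x) + (LINT x|lborel. y m x)"
    proof (rule Bochner_Integration.integral_add)
      show "integrable lborel (\<lambda>x. cutoff m x * cr x)"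
        by (rule int_cut[OF m crc])
      have "integrable lborel (\<lambda>x. partial 2 (cutoff m) x * (b x * partial 1 a x) -
          partial 1 (cutoff m) x * (b x * partial 2 a x))"
        by (intro Bochner_Integration.integrable_diff int_pcut m continuous_intros cont)
      then show "integrable lborel (y m)"
        by (simp add: y_def[abs_def] mult_ac)
    qed
    finally show ?thesis by linarith
  qed
  have h2: "integrable lborel (\<lambda>x. (norm (h x))\<^sup>2)"
    using test_field_L2[OF h] by (simp add: L2_field_def)
  have hc: "continuous_on UNIV (\<lambda>x. (norm (h x))\<^sup>2)"
    by (intro continuous_intros test_field_continuous h)
  have ac: "continuous_on UNIV (\<lambda>x. (norm (grad a x))\<^sup>2)"
    by (intro continuous_intros grad_continuous sa)
  have le: "(LINT x|lborel. cutoff (real (Suc n)) x * (norm (grad a x))\<^sup>2) \<le>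
      (LINT x|lborel. (norm (h x))\<^sup>2) + 16 * pi * C\<^sup>2 * K * inverse (real (Suc n))" for n
  proof -
    define m where "m = real (Suc n)"
    have m: "m \<ge> 1" "m > 0" by (auto simp: m_def)
    have "cutoff m x * (norm (grad a x))\<^sup>2 \<le> cutoff m x * (norm (h x))\<^sup>2 - 2 * (cutoff m x * cr x)" for x
    proof -
      have "(norm (h x))\<^sup>2 = (norm (grad a x))\<^sup>2 + (norm (grad b x))\<^sup>2 + 2 * cr x"
        unfolding hb(8)[of x] by (simp add: norm_power2_real2 cr_def a_def[symmetric] algebra_simps)
      then have "cutoff m x * (norm (grad a x))\<^sup>2 + cutoff m x * (norm (grad b x))\<^sup>2 =
          cutoff m x * (norm (h x))\<^sup>2 - 2 * (cutoff m x * cr x)"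
        by (simp add: algebra_simps)
      moreover have "cutoff m x * (norm (grad b x))\<^sup>2 \<ge> 0"
        by (simp add: cutoff_bounds)
      ultimately show ?thesis by linarith
    qed
    then have "(LINT x|lborel. cutoff m x * (norm (grad a x))\<^sup>2) \<le>
        (LINT x|lborel. cutoff m x * (norm (h x))\<^sup>2 - 2 * (cutoff m x * cr x))"
      using m by (intro integral_mono Bochner_Integration.integrable_diff integrable_mult_right int_cut hc ac crc)
    also have "\<dots> = (LINT x|lborel. cutoff m x * (norm (h x))\<^sup>2) + 2 * (LINT x|lborel. y m x)"
      using cross[OF m(2)] int_cut[OF m(2) hc] int_cut[OF m(2) crc] by simp
    also have "(LINT x|lborel. cutoff m x * (norm (h x))\<^sup>2) \<le> (LINT x|lborel. (norm (h x))\<^sup>2)"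
      using int_cut[OF m(2) hc] h2 cutoff_bounds by (intro integral_mono) (auto intro: mult_left_le_one_le)
    also have "2 * (LINT x|lborel. y m x) \<le> 16 * pi * C\<^sup>2 * K * inverse m"
      using abs_le_D1[OF ybound[OF m(1)]] by (simp add: divide_inverse mult_ac)
    finally show ?thesis by (simp add: m_def)
  qed
  have lim: "(\<lambda>n. (LINT x|lborel. (norm (h x))\<^sup>2) + 16 * pi * C\<^sup>2 * K * inverse (real (Suc n))) \<longlonglongrightarrow>
      (LINT x|lborel. (norm (h x))\<^sup>2)"
    using tendsto_add[OF tendsto_const tendsto_mult_right_zero[OF LIMSEQ_inverse_real_of_nat]] by simp
  have meas: "(\<lambda>x. (norm (grad a x))\<^sup>2) \<in> borel_measurable borel"
    by (rule borel_measurable_continuous_onI[OF ac])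
  note c = integrable_by_cutoff[OF meas _ int_cut[OF _ ac] le lim]
  show "L2_field (grad (stream_pot h))"
    using c(1) sa by (simp add: L2_field_def a_def borel_measurable_continuous_onI grad_continuous)
  show "L2_size (grad (stream_pot h)) \<le> L2_size h"
    using c(2) by (simp add: L2_size_def a_def)
qed

text \<open>Antisymmetry of \<open>newt\<close>, component by component: testing a velocity with
  \<open>h\<close> amounts to testing its vorticity with \<open>- stream_pot h\<close>. This dual
  potential decays but need not have compact support, so using it in the weak equation calls for a
  cutoff.\<close>

lemma biot_savart_inner:
  assumes w: "L1_Linf_bound C w" and h: "test_field h"
  shows "(LINT x|lborel. biot_savart w x \<bullet> h x) = - (LINT x|lborel. w x * stream_pot h x)"
    and "integrable lborel (\<lambda>x. w x * stream_pot h x)" "integrable lborel (\<lambda>x. biot_savart w x \<bullet> h x)"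
proof -
  have t: "test_function (\<lambda>x. h x $ i)" for i
    using h by (simp add: test_field_def)
  have int: "integrable lborel (\<lambda>x. w x * newt i (\<lambda>x. h x $ j) x)" for i j
  proof -
    obtain D where D: "D > 0" "\<And>x. \<bar>newt i (\<lambda>x. h x $ j) x\<bar> \<le> D / (1 + norm x)"
      using newt_decay[OF t] by metis
    have D': "\<bar>newt i (\<lambda>x. h x $ j) x\<bar> \<le> D" for x
    proof -
      have "D / (1 + norm x) \<le> D / 1" using D(1) by (intro divide_left_mono) (auto intro: add_pos_nonneg)
      then show ?thesis using D(2)[of x] by simp
    qed
    have [measurable]: "w \<in> borel_measurable borel" "newt i (\<lambda>x. h x $ j) \<in> borel_measurable borel"
      using L1_Linf_boundD[OF w] t by (auto intro: newt_measurable test_function_measurable)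
    have "integrable lborel (\<lambda>x. D * w x)" using L1_Linf_boundD[OF w] by simp
    then show ?thesis
    proof (rule Bochner_Integration.integrable_bound)
      show "AE x in lborel. norm (w x * newt i (\<lambda>x. h x $ j) x) \<le> norm (D * w x)"
        using D D' by (auto simp: abs_mult mult.commute[of D] intro!: AE_I2 mult_left_mono)
    qed measurable
  qed
  have eq: "biot_savart w x \<bullet> h x = newt 1 w x * h x $ 2 - newt 2 w x * h x $ 1" for x
    by (simp add: biot_savart_eq[OF w] inner_real2 vector_2)
  show "integrable lborel (\<lambda>x. w x * stream_pot h x)"
    using int by (simp add: stream_pot_def right_diff_distrib)
  show "integrable lborel (\<lambda>x. biot_savart w x \<bullet> h x)"
    unfolding eq by (intro Bochner_Integration.integrable_diff newt_antisym[OF w t])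
  show "(LINT x|lborel. biot_savart w x \<bullet> h x) = - (LINT x|lborel. w x * stream_pot h x)"
    unfolding eq using int newt_antisym[OF w t] by (simp add: stream_pot_def right_diff_distrib)
qed

text \<open>The velocity is orthogonal to the gradient of \<open>cutoff m x * b x\<close>, a test
  function. The part in which the derivative falls on the cutoff has L^2 norm of order
  \<open>1 / m\<close>, so a square integrable velocity is orthogonal to \<open>grad b\<close> as
  well.\<close>

lemma L2_biot_savart_helmholtz:
  assumes w: "L1_Linf_bound D w" and v: "L2_field (biot_savart w)" and h: "test_field h"
  shows "(LINT x|lborel. biot_savart w x \<bullet> h x) = (LINT x|lborel. biot_savart w x \<bullet> perp (grad (stream_pot h) x))"
proof -
  define v where "v = biot_savart w"
  have v: "L2_field v" using v by (simp add: v_def)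
  obtain b C where hb: "smooth (stream_pot h)" "smooth b" "C > 0"
    "\<And>x. \<bar>stream_pot h x\<bar> \<le> C / (1 + norm x)" "\<And>x. \<bar>b x\<bar> \<le> C / (1 + norm x)"
    "\<And>x j. \<bar>partial j (stream_pot h) x\<bar> \<le> C / (1 + norm x)" "\<And>x j. \<bar>partial j b x\<bar> \<le> C / (1 + norm x)"
    "\<And>x. h x = grad b x + perp (grad (stream_pot h) x)"
    using helmholtz[OF h] by metis
  obtain K where K: "K > 0" "\<And>j m x. m > 0 \<Longrightarrow> \<bar>partial j (cutoff m) x\<bar> \<le> K / m"
    "\<And>j m x. m > 0 \<Longrightarrow> norm x < m \<Longrightarrow> partial j (cutoff m) x = 0"
    "\<And>j m x. m > 0 \<Longrightarrow> norm x > 2 * m \<Longrightarrow> partial j (cutoff m) x = 0"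
    using partial_cutoff_bound by metis
  have pg: "L2_field (\<lambda>x. perp (grad (stream_pot h) x))"
    by (rule L2_size_mono[OF _ stream_pot_energy(1)[OF h]])
      (auto intro!: borel_measurable_continuous_onI perp_continuous grad_continuous hb(1))
  have gb: "L2_field (grad b)"
  proof -
    have "grad b = (\<lambda>x. h x - perp (grad (stream_pot h) x))"
      using hb(8) by (auto simp: fun_eq_iff)
    then show ?thesis using L2_field_diff[OF test_field_L2[OF h] pg] by simp
  qed
  define G where "G m x = b x *\<^sub>R grad (cutoff m) x" for m x
  have csm: "smooth (cutoff m)" if "m > 0" for m
    using test_function_cutoff[OF that] by (rule test_function_smooth)
  have G0: "G m x = 0" if "m > 0" "norm x > 2 * m" for m x
    using K(4)[OF that] by (simp add: G_def vec_eq_iff)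
  have GL: "L2_field (G m)" if "m > 0" for m
    by (rule L2_field_bounded_cs[of _ "2 * m + 1"])
      (use G0[OF that] in \<open>auto simp: G_def[abs_def] intro!: continuous_on_scaleR[OF smooth_continuous_on[OF hb(2)] grad_continuous[OF csm]] that\<close>)
  have Gs: "L2_size (G m) \<le> 4 * C * K * sqrt pi / m" if m: "m > 0" for m
  proof -
    have "norm (G m x) \<le> 2 * (C * K / m\<^sup>2)" for x
    proof -
      have "\<bar>b x * partial j (cutoff m) x\<bar> \<le> C * K / m\<^sup>2" for j
        by (rule cutoff_gradient_decay[OF K(2)[OF m] K(3)[OF m] m hb(3,5)])
      from this[of 1] this[of 2] norm_real2_le[of "G m x"] show ?thesis
        by (simp add: G_def)
    qed
    then have "(norm (G m x))\<^sup>2 \<le> (2 * (C * K / m\<^sup>2))\<^sup>2" for x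
      by (intro power_mono) auto
    then have "\<bar>LINT x|lborel. (norm (G m x))\<^sup>2\<bar> \<le> (2 * (C * K / m\<^sup>2))\<^sup>2 * (pi * (2 * m)\<^sup>2)"
      using m G0[OF m] by (intro integral_ball_bound) auto
    also have "\<dots> = (4 * C * K * sqrt pi / m)\<^sup>2"
      using m by (simp add: power2_eq_square)
    finally show ?thesis
      using hb(3) K(1) m unfolding L2_size_def by (intro real_le_lsqrt) auto
  qed
  have eq: "(LINT x|lborel. cutoff m x * (v x \<bullet> grad b x)) = - (LINT x|lborel. v x \<bullet> G m x)" if m: "m > 0" for m
  proof -
    define g where "g x = cutoff m x * b x" for x
    have tg: "test_function g"
      unfolding g_def[abs_def] by (intro test_function_mult(2) test_function_cutoff m hb(2))
    have gg: "grad g x = cutoff m x *\<^sub>R grad b x + G m x" for x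
      unfolding g_def[abs_def] G_def by (simp add: vec_eq_iff partial_mult csm m hb(2) mult.commute)
    have "(LINT x|lborel. v x \<bullet> grad g x) = 0"
      unfolding v_def biot_savart_inner(1)[OF w test_field_grad[OF tg]] by (simp add: stream_pot_grad[OF tg])
    moreover have "(\<lambda>x. v x \<bullet> grad g x) = (\<lambda>x. cutoff m x * (v x \<bullet> grad b x) + v x \<bullet> G m x)"
      by (simp add: gg inner_add_right fun_eq_iff)
    moreover have "integrable lborel (\<lambda>x. cutoff m x * (v x \<bullet> grad b x))"
    proof -
      have "integrable lborel (\<lambda>x. v x \<bullet> grad g x - v x \<bullet> G m x)"
        by (intro Bochner_Integration.integrable_diff L2_field_inner v GL m test_field_L2 test_field_grad tg)
      then show ?thesis by (simp add: gg inner_add_right)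
    qed
    ultimately show ?thesis
      using L2_field_inner[OF v GL[OF m]] by simp
  qed
  have "(\<lambda>n. - (LINT x|lborel. v x \<bullet> G (real (Suc n)) x)) \<longlonglongrightarrow> (LINT x|lborel. v x \<bullet> grad b x)"
    using cutoff_integral_tendsto(1)[OF L2_field_inner[OF v gb]] eq[of "real (Suc _)"] by simp
  moreover have "(\<lambda>n. - (LINT x|lborel. v x \<bullet> G (real (Suc n)) x)) \<longlonglongrightarrow> 0"
  proof (rule Lim_null_comparison[OF always_eventually])
    show "\<forall>n. norm (- (LINT x|lborel. v x \<bullet> G (real (Suc n)) x)) \<le>
        (L2_size v * (4 * C * K * sqrt pi)) * inverse (real (Suc n))"
    proof
      fix n
      have "\<bar>LINT x|lborel. v x \<bullet> G (real (Suc n)) x\<bar> \<le> L2_size v * L2_size (G (real (Suc n)))"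
        by (intro L2_cauchy_schwarz v GL) simp
      also have "\<dots> \<le> L2_size v * (4 * C * K * sqrt pi / real (Suc n))"
        by (intro mult_left_mono Gs L2_size_nonneg) simp
      finally show "norm (- (LINT x|lborel. v x \<bullet> G (real (Suc n)) x)) \<le>
        (L2_size v * (4 * C * K * sqrt pi)) * inverse (real (Suc n))"
        by (simp add: divide_inverse del: of_nat_Suc)
    qed
    show "(\<lambda>n. (L2_size v * (4 * C * K * sqrt pi)) * inverse (real (Suc n))) \<longlonglongrightarrow> 0"
      by (intro tendsto_mult_right_zero LIMSEQ_inverse_real_of_nat)
  qed
  ultimately have "(LINT x|lborel. v x \<bullet> grad b x) = 0"
    using LIMSEQ_unique by blast
  moreover have "(\<lambda>x. v x \<bullet> h x) = (\<lambda>x. v x \<bullet> grad b x + v x \<bullet> perp (grad (stream_pot h) x))"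
    using hb(8) by (metis inner_add_right)
  ultimately show ?thesis
    using L2_field_inner[OF v gb] L2_field_inner[OF v pg] by (simp add: v_def)
qed

subsection \<open>Density of test functions\<close>

lemma smooth_real_polynomial_function:
  fixes p :: "'a::euclidean_space \<Rightarrow> real"
  shows "real_polynomial_function p \<Longrightarrow> smooth p"
  by (induction rule: real_polynomial_function.induct)
    (simp_all add: smooth_linear smooth_const smooth_add smooth_mult)

text \<open>A polynomial from the Stone-Weierstrass theorem times a cutoff takes the place of
  mollification. The error is measured relative to the cutoff, so the support is controlled along
  with the size.\<close>

lemma test_function_approx:
  assumes g: "continuous_on UNIV g" and m: "m > 0" and e: "e > 0"
  obtains f where "test_function f" "\<And>x. \<bar>f x - cutoff m x * g x\<bar> \<le> e * cutoff m x"
proof -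
  have "\<exists>p. polynomial_function p \<and> (\<forall>x\<in>cball 0 (2 * m). norm (g x - p x) < e)"
    by (intro Stone_Weierstrass_polynomial_function continuous_on_subset[OF g] e) auto
  then obtain p where p: "polynomial_function p" "\<And>x. norm x \<le> 2 * m \<Longrightarrow> \<bar>g x - p x\<bar> < e"
    by auto
  have "test_function (\<lambda>x. cutoff m x * p x)"
    using p(1) by (intro test_function_mult(2) test_function_cutoff m smooth_real_polynomial_function)
      (simp add: real_polynomial_function_eq)
  moreover have "\<bar>cutoff m x * p x - cutoff m x * g x\<bar> \<le> e * cutoff m x" for x
  proof (cases "norm x \<le> 2 * m")
    case True
    have "cutoff m x * p x - cutoff m x * g x = - ((g x - p x) * cutoff m x)"
      by (simp add: algebra_simps)
    then have "\<bar>cutoff m x * p x - cutoff m x * g x\<bar> = \<bar>g x - p x\<bar> * cutoff m x"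
      using cutoff_bounds[of m x] by (simp only: abs_minus_cancel abs_mult abs_of_nonneg)
    also have "\<dots> \<le> e * cutoff m x"
      using p(2)[OF True] cutoff_bounds[of m x] by (intro mult_right_mono) auto
    finally show ?thesis .
  qed (use m cutoff_eq_0 in auto)
  ultimately show ?thesis by (rule that)
qed

lemma test_field_approx:
  fixes g :: "real^2 \<Rightarrow> real^2"
  assumes g: "continuous_on UNIV g" and m: "m > 0" and e: "e > 0"
  obtains h where "test_field h" "\<And>x. norm (h x - cutoff m x *\<^sub>R g x) \<le> e * cutoff m x"
proof -
  have c: "continuous_on UNIV (\<lambda>x. g x $ i)" for i
    by (intro continuous_intros g)
  have e2: "e / 2 > 0" using e by simp
  obtain f1 where f1: "test_function f1" "\<And>x. \<bar>f1 x - cutoff m x * g x $ 1\<bar> \<le> e / 2 * cutoff m x"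
    using test_function_approx[OF c m e2] by metis
  obtain f2 where f2: "test_function f2" "\<And>x. \<bar>f2 x - cutoff m x * g x $ 2\<bar> \<le> e / 2 * cutoff m x"
    using test_function_approx[OF c m e2] by metis
  define h where "h x = (vector [f1 x, f2 x] :: real^2)" for x
  have "test_field h"
    using f1 f2 by (simp add: test_field_def h_def forall_2 vector_2)
  moreover have "norm (h x - cutoff m x *\<^sub>R g x) \<le> e * cutoff m x" for x
    using norm_real2_le[of "h x - cutoff m x *\<^sub>R g x"] f1(2)[of x] f2(2)[of x]
    by (simp add: h_def vector_2)
  ultimately show ?thesis by (rule that)
qed

lemma L2_size_scale: "L2_size (\<lambda>x. c *\<^sub>R F x) = \<bar>c\<bar> * L2_size F"
  by (simp add: L2_size_def power_mult_distrib real_sqrt_mult)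

lemma L2_field_cutoff:
  fixes V :: "real^2 \<Rightarrow> real^2"
  assumes "continuous_on UNIV V" "m > 0"
  shows "L2_field (\<lambda>x. cutoff m x *\<^sub>R V x)"
  by (rule L2_field_bounded_cs[of _ "2 * m"])
    (use assms cutoff_eq_0 in \<open>auto intro!: continuous_on_scaleR test_function_continuous[OF test_function_cutoff]\<close>)

lemma L2_field_measurable: "L2_field F \<Longrightarrow> F \<in> borel_measurable borel"
  by (simp add: L2_field_def)

lemma test_field_L2_approx:
  assumes V: "continuous_on UNIV V" and m: "m > 0" and e: "e > 0"
  obtains h where "test_field h" "L2_size (\<lambda>x. h x - cutoff m x *\<^sub>R V x) \<le> e"
    "\<And>x. norm x \<ge> 2 * m \<Longrightarrow> h x = 0"
proof -
  define c where "c = L2_size (\<lambda>x. cutoff m x *\<^sub>R (axis 1 1 :: real^2))"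
  have c: "c \<ge> 0" by (simp add: c_def L2_size_nonneg)
  obtain h where h: "test_field h" "\<And>x. norm (h x - cutoff m x *\<^sub>R V x) \<le> e / (c + 1) * cutoff m x"
    using test_field_approx[OF V m, of "e / (c + 1)"] c e by (metis add_nonneg_pos divide_pos_pos zero_less_one)
  have L: "L2_field (\<lambda>x. h x - cutoff m x *\<^sub>R V x)"
    by (intro L2_field_diff test_field_L2 h L2_field_cutoff V m)
  have "L2_size (\<lambda>x. h x - cutoff m x *\<^sub>R V x) \<le> L2_size (\<lambda>x. (e / (c + 1)) *\<^sub>R (cutoff m x *\<^sub>R (axis 1 1 :: real^2)))"
  proof (rule L2_size_mono(2)[OF L2_field_measurable[OF L]])
    show "L2_field (\<lambda>x. (e / (c + 1)) *\<^sub>R (cutoff m x *\<^sub>R (axis 1 1 :: real^2)))"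
      using L2_field_cutoff[of "\<lambda>x. (e / (c + 1)) *\<^sub>R axis 1 1" m] m by (simp add: scaleR_left_commute mult.commute)
    show "norm (h x - cutoff m x *\<^sub>R V x) \<le> norm ((e / (c + 1)) *\<^sub>R (cutoff m x *\<^sub>R (axis 1 1 :: real^2)))" for x
      using h(2)[of x] c e cutoff_bounds[of m x] by (simp add: abs_mult)
  qed
  also have "\<dots> = e / (c + 1) * c"
    using c e by (subst L2_size_scale) (simp add: c_def)
  also have "\<dots> \<le> e"
    using c e by (simp add: field_simps)
  finally have "L2_size (\<lambda>x. h x - cutoff m x *\<^sub>R V x) \<le> e" .
  moreover have "h x = 0" if "norm x \<ge> 2 * m" for x
    using h(2)[of x] cutoff_eq_0[OF that m] by simp
  ultimately show ?thesis using that h(1) by blast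
qed

lemma cutoff_L2_tendsto:
  assumes V: "L2_field V"
  shows "(\<lambda>n. L2_size (\<lambda>x. cutoff (real (Suc n)) x *\<^sub>R V x - V x)) \<longlonglongrightarrow> 0"
proof -
  note [measurable] = L2_field_measurable[OF V]
  have eq: "(norm (cutoff m x *\<^sub>R V x - V x))\<^sup>2 = (1 - cutoff m x)\<^sup>2 * (norm (V x))\<^sup>2" for m x
  proof -
    have "cutoff m x *\<^sub>R V x - V x = (cutoff m x - 1) *\<^sub>R V x"
      by (simp add: scaleR_left_diff_distrib)
    then show ?thesis by (simp add: power_mult_distrib power2_commute)
  qed
  have "(\<lambda>n. LINT x|lborel. (norm (cutoff (real (Suc n)) x *\<^sub>R V x - V x))\<^sup>2) \<longlonglongrightarrow> (LINT x::real^2|lborel. 0)"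
  proof (rule integral_dominated_convergence[where w = "\<lambda>x. (norm (V x))\<^sup>2"])
    show "AE x in lborel. (\<lambda>n. (norm (cutoff (real (Suc n)) x *\<^sub>R V x - V x))\<^sup>2) \<longlonglongrightarrow> 0"
    proof (rule AE_I2)
      fix x
      have "(\<lambda>n. (1 - cutoff (real (Suc n)) x)\<^sup>2 * (norm (V x))\<^sup>2) \<longlonglongrightarrow> (1 - 1)\<^sup>2 * (norm (V x))\<^sup>2"
        by (intro tendsto_intros cutoff_Suc_tendsto)
      then show "(\<lambda>n. (norm (cutoff (real (Suc n)) x *\<^sub>R V x - V x))\<^sup>2) \<longlonglongrightarrow> 0"
        unfolding eq by simp
    qed
    show "AE x in lborel. norm ((norm (cutoff (real (Suc n)) x *\<^sub>R V x - V x))\<^sup>2) \<le> (norm (V x))\<^sup>2" for n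
    proof (rule AE_I2)
      fix x
      have "(1 - cutoff (real (Suc n)) x)\<^sup>2 \<le> 1"
        using cutoff_bounds[of "real (Suc n)" x] by (intro power_le_one) auto
      then show "norm ((norm (cutoff (real (Suc n)) x *\<^sub>R V x - V x))\<^sup>2) \<le> (norm (V x))\<^sup>2"
        unfolding eq by (simp add: mult_left_le_one_le abs_mult del: of_nat_Suc)
    qed
  qed (use V in \<open>auto simp: L2_field_def\<close>)
  then have "(\<lambda>n. sqrt (LINT x|lborel. (norm (cutoff (real (Suc n)) x *\<^sub>R V x - V x))\<^sup>2)) \<longlonglongrightarrow> sqrt 0"
    by (intro tendsto_real_sqrt) simp
  then show ?thesis by (simp add: L2_size_def)
qed

lemma test_field_dense:
  assumes Vc: "continuous_on UNIV V" and V: "L2_field V" and e: "e > 0"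
  obtains h where "test_field h" "L2_size (\<lambda>x. h x - V x) \<le> e"
proof -
  have "eventually (\<lambda>n. L2_size (\<lambda>x. cutoff (real (Suc n)) x *\<^sub>R V x - V x) < e / 2) sequentially"
    using cutoff_L2_tendsto[OF V] e by (intro order_tendstoD) auto
  then obtain n where n: "L2_size (\<lambda>x. cutoff (real (Suc n)) x *\<^sub>R V x - V x) < e / 2"
    by (auto simp: eventually_sequentially)
  obtain h where h: "test_field h" "L2_size (\<lambda>x. h x - cutoff (real (Suc n)) x *\<^sub>R V x) \<le> e / 2"
    using test_field_L2_approx[OF Vc, of "real (Suc n)" "e / 2"] e by auto
  have L: "L2_field (\<lambda>x. cutoff (real (Suc n)) x *\<^sub>R V x)"
    by (intro L2_field_cutoff Vc) simp
  have "L2_size (\<lambda>x. (h x - cutoff (real (Suc n)) x *\<^sub>R V x) + (cutoff (real (Suc n)) x *\<^sub>R V x - V x)) \<le> e / 2 + e / 2"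
    by (rule order_trans[OF L2_triangle[OF L2_field_diff[OF test_field_L2[OF h(1)] L] L2_field_diff[OF L V]] add_mono])
      (use n h(2) in linarith)+
  then show ?thesis using that[OF h(1)] by simp
qed

text \<open>\<open>V\<close> is merely continuous, so its norm cannot be tested directly. For
  \<open>y\<close>, the cut-off integral of the squared norm, testing with approximations of
  \<open>cutoff m x *\<^sub>R V x\<close> gives \<open>y \<le> B * sqrt y\<close>, hence
  \<open>y \<le> B\<^sup>2\<close> uniformly in \<open>m\<close>.\<close>

lemma L2_field_by_duality:
  assumes V: "continuous_on UNIV V" and B: "B \<ge> 0"
    and dual: "\<And>h. test_field h \<Longrightarrow> \<bar>LINT x|lborel. V x \<bullet> h x\<bar> \<le> B * L2_size h"
  shows "L2_field V" "L2_size V \<le> B"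
proof -
  have Vm [measurable]: "V \<in> borel_measurable borel"
    using V by (rule borel_measurable_continuous_onI)
  have int: "integrable lborel (\<lambda>x. cutoff m x * (norm (V x))\<^sup>2)" if "m > 0" for m
    by (rule integrable_continuous_cs[of _ "2 * m"])
      (use that cutoff_eq_0 in \<open>auto intro!: continuous_on_mult continuous_on_power continuous_on_norm V
        test_function_continuous[OF test_function_cutoff]\<close>)
  have le: "(LINT x|lborel. cutoff (real (Suc n)) x * (norm (V x))\<^sup>2) \<le> B\<^sup>2" for n
  proof -
    define m where "m = real (Suc n)"
    have m: "m > 0" "2 * m > 0" by (auto simp: m_def)
    define U where "U x = cutoff m x *\<^sub>R V x" for x
    \<comment> \<open>\<open>W\<close> agrees with \<open>V\<close> on the support of
      \<open>h\<close> and of \<open>U\<close> and is known to be square integrable, as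
      \<open>V\<close> is not yet; it is the partner of the error \<open>h x - U x\<close> in the
      Cauchy-Schwarz inequality.\<close>
    define W where "W x = cutoff (2 * m) x *\<^sub>R V x" for x
    have UL: "L2_field U" "L2_field W"
      unfolding U_def W_def by (intro L2_field_cutoff V m)+
    define y where "y = (LINT x|lborel. cutoff m x * (norm (V x))\<^sup>2)"
    have y: "y \<ge> 0" unfolding y_def by (intro integral_nonneg_AE) (auto simp: cutoff_bounds)
    have "(L2_size U)\<^sup>2 \<le> y"
      unfolding L2_size_power2 y_def
    proof (rule integral_mono[OF _ int[OF m(1)]])
      show "integrable lborel (\<lambda>x. (norm (U x))\<^sup>2)"
        using UL by (simp add: L2_field_def)
      show "(norm (U x))\<^sup>2 \<le> cutoff m x * (norm (V x))\<^sup>2" for x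
        using cutoff_bounds[of m x]
        by (simp add: U_def power_mult_distrib power2_eq_square[of "cutoff m x"] mult_right_mono mult_left_le_one_le)
    qed
    then have Us: "L2_size U \<le> sqrt y"
      by (rule real_le_rsqrt)
    have "y \<le> B * sqrt y + e * (B + L2_size W)" if e: "e > 0" for e
    proof -
      obtain h where h: "test_field h" "L2_size (\<lambda>x. h x - U x) \<le> e" "\<And>x. norm x \<ge> 2 * m \<Longrightarrow> h x = 0"
        unfolding U_def using test_field_L2_approx[OF V m(1) e] by metis
      have hU: "L2_field (\<lambda>x. h x - U x)"
        by (intro L2_field_diff test_field_L2 h UL)
      have "V x \<bullet> h x = cutoff m x * (norm (V x))\<^sup>2 + W x \<bullet> (h x - U x)" for x
      proof (cases "norm x \<le> 2 * m")
        case True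
        then have "W x = V x" using m by (simp add: W_def cutoff_eq_1)
        then show ?thesis by (simp add: inner_diff_right U_def power2_norm_eq_inner)
      next
        case False
        then show ?thesis using h(3)[of x] m by (simp add: U_def cutoff_eq_0)
      qed
      then have "(LINT x|lborel. V x \<bullet> h x) = y + (LINT x|lborel. W x \<bullet> (h x - U x))"
        using int[OF m(1)] L2_field_inner[OF UL(2) hU] by (simp add: y_def)
      moreover have "\<bar>LINT x|lborel. W x \<bullet> (h x - U x)\<bar> \<le> L2_size W * e"
        using L2_cauchy_schwarz[OF UL(2) hU] mult_left_mono[OF h(2) L2_size_nonneg[of W]] by linarith
      moreover have "L2_size (\<lambda>x. (h x - U x) + U x) \<le> e + sqrt y"
        using L2_triangle[OF hU UL(1)] h(2) Us by linarith
      then have "B * L2_size h \<le> B * (e + sqrt y)"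
        using B by (intro mult_left_mono) auto
      ultimately show ?thesis
        using dual[OF h(1)] by (simp add: algebra_simps)
    qed
    note ineq = this
    have "y \<le> B * sqrt y"
    proof (rule field_le_epsilon)
      fix e :: real assume "e > 0"
      have p: "B + L2_size W + 1 > 0" using B L2_size_nonneg[of W] by linarith
      have "y \<le> B * sqrt y + e / (B + L2_size W + 1) * (B + L2_size W)"
        using ineq[of "e / (B + L2_size W + 1)"] \<open>e > 0\<close> p by simp
      also have "e / (B + L2_size W + 1) * (B + L2_size W) \<le> e"
        using p \<open>e > 0\<close> by (simp add: field_simps)
      finally show "y \<le> B * sqrt y + e" by simp
    qed
    then have "sqrt y * sqrt y \<le> B * sqrt y"
      using y by simp
    then have "sqrt y \<le> B" if "sqrt y > 0"
      by (rule mult_right_le_imp_le[OF _ that])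
    then have "sqrt y \<le> B"
      using B y by (cases "y = 0") auto
    then have "y \<le> B\<^sup>2"
      by (rule sqrt_le_D)
    then show ?thesis by (simp add: y_def m_def)
  qed
  have meas: "(\<lambda>x. (norm (V x))\<^sup>2) \<in> borel_measurable borel" by measurable
  note c = integrable_by_cutoff[OF meas _ int le tendsto_const]
  show "L2_field V"
    using c(1) Vm by (simp add: L2_field_def)
  show "L2_size V \<le> B"
    using c(2) B unfolding L2_size_def by (intro real_le_lsqrt) auto
qed

section \<open>Approximation of bounded integrable vorticities\<close>

lemma borel_AE_limit_continuous:
  fixes w :: "real^2 \<Rightarrow> real"
  assumes "w \<in> borel_measurable borel"
  obtains g where "\<And>n::nat. continuous_on UNIV (g n)" "AE x in lborel. (\<lambda>n. g n x) \<longlonglongrightarrow> w x"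
proof -
  have "w \<in> borel_measurable lebesgue"
    using assms by (simp add: measurable_completion)
  then have "w measurable_on UNIV"
    using lebesgue_measurable_imp_measurable_on[of w UNIV] by simp
  then obtain N g where g: "negligible N" "\<And>n. continuous_on UNIV (g n)"
    "\<And>x. x \<notin> N \<Longrightarrow> (\<lambda>n. g n x) \<longlonglongrightarrow> w x"
    unfolding measurable_on_def by auto
  have "AE x in lebesgue. x \<notin> N"
    using g(1) by (intro AE_not_in) (simp add: negligible_iff_null_sets)
  then have "AE x in lborel. x \<notin> N"
    by (rule AE_completion_iff[THEN iffD1])
  then have "AE x in lborel. (\<lambda>n. g n x) \<longlonglongrightarrow> w x"
    by (rule eventually_mono) (rule g(3))
  with g(2) show ?thesis using that by blast
qed

text \<open>The three errors come from cutting off, from replacing the function by a continuous one,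
  and from replacing that by a test function. The sup bound \<open>C + 1\<close> survives, as the
  near-field part of \<open>newt_bound\<close> demands.\<close>

lemma L1_dense:
  assumes w: "L1_Linf_bound C w" and e: "e > 0"
  obtains f where "test_function f" "\<And>x. \<bar>f x\<bar> \<le> C + 1" "(LINT x|lborel. \<bar>f x - w x\<bar>) \<le> e"
proof -
  note W = L1_Linf_boundD[OF w]
  note [measurable] = W(5)
  have "(\<lambda>n. LINT x|lborel. \<bar>w x\<bar> - cutoff (real (Suc n)) x * \<bar>w x\<bar>) \<longlonglongrightarrow> 0"
  proof -
    have "(\<lambda>n. (LINT x|lborel. \<bar>w x\<bar>) - (LINT x|lborel. cutoff (real (Suc n)) x * \<bar>w x\<bar>)) \<longlonglongrightarrow> 0"
      using tendsto_diff[OF tendsto_const cutoff_integral_tendsto(1)[OF integrable_abs[OF W(1)]],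
          of "LINT x|lborel. \<bar>w x\<bar>"] by simp
    then show ?thesis
      using cutoff_integral_tendsto(2)[OF integrable_abs[OF W(1)]] W(1) by (simp del: of_nat_Suc)
  qed
  then have "eventually (\<lambda>n. (LINT x|lborel. \<bar>w x\<bar> - cutoff (real (Suc n)) x * \<bar>w x\<bar>) < e / 3) sequentially"
    using e by (intro order_tendstoD) auto
  then obtain N where N: "(LINT x|lborel. \<bar>w x\<bar> - cutoff (real (Suc N)) x * \<bar>w x\<bar>) < e / 3"
    by (auto simp: eventually_sequentially)
  define m where "m = real (Suc N)"
  have m: "m > 0" by (simp add: m_def)
  have tc: "test_function (cutoff m)" by (rule test_function_cutoff[OF m])
  obtain g where g: "\<And>n::nat. continuous_on UNIV (g n)" "AE x in lborel. (\<lambda>n. g n x) \<longlonglongrightarrow> w x"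
    using borel_AE_limit_continuous[OF W(5)] by blast
  \<comment> \<open>Clamping to \<open>[- C, C]\<close> bounds the continuous approximants for
    dominated convergence and keeps the limit, since \<open>w\<close> has its values in this
    interval almost everywhere.\<close>
  define k where "k n x = max (- C) (min C (g n x))" for n x
  have kc: "continuous_on UNIV (k n)" for n
    unfolding k_def[abs_def] by (intro continuous_intros g)
  have [measurable]: "k n \<in> borel_measurable borel" for n
    by (rule borel_measurable_continuous_onI[OF kc])
  have kb: "\<bar>k n x\<bar> \<le> C" for n x using W(4) by (auto simp: k_def)
  have iw: "integrable lborel (\<lambda>x. cutoff m x * w x)"
    using cutoff_integral_tendsto(2)[OF W(1), of N] by (simp add: m_def)
  have ik: "integrable lborel (\<lambda>x. cutoff m x * k n x)" for n
    by (rule integrable_continuous_cs[of _ "2 * m"])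
      (use cutoff_eq_0 m in \<open>auto intro!: continuous_on_mult kc test_function_continuous[OF tc]\<close>)
  have "(\<lambda>n. LINT x|lborel. \<bar>cutoff m x * k n x - cutoff m x * w x\<bar>) \<longlonglongrightarrow> (LINT x::real^2|lborel. 0)"
  proof (rule integral_dominated_convergence[where w = "\<lambda>x. 2 * C * cutoff m x"])
    show "integrable lborel (\<lambda>x. 2 * C * cutoff m x)"
      using test_function_integrable[OF tc] by simp
    show "AE x in lborel. (\<lambda>n. \<bar>cutoff m x * k n x - cutoff m x * w x\<bar>) \<longlonglongrightarrow> 0"
      using g(2) W(2)
    proof eventually_elim
      case (elim x)
      have "(\<lambda>n. max (- C) (min C (g n x))) \<longlonglongrightarrow> max (- C) (min C (w x))"
        by (intro tendsto_max tendsto_min tendsto_const elim)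
      then have "(\<lambda>n. k n x) \<longlonglongrightarrow> w x"
        using elim(2) by (simp add: k_def abs_le_iff max_def min_def split: if_splits)
      then have "(\<lambda>n. \<bar>cutoff m x * k n x - cutoff m x * w x\<bar>) \<longlonglongrightarrow> \<bar>cutoff m x * w x - cutoff m x * w x\<bar>"
        by (intro tendsto_intros)
      then show ?case by simp
    qed
    show "AE x in lborel. norm \<bar>cutoff m x * k n x - cutoff m x * w x\<bar> \<le> 2 * C * cutoff m x" for n
      using W(2)
    proof eventually_elim
      case (elim x)
      have "cutoff m x * k n x - cutoff m x * w x = (k n x - w x) * cutoff m x"
        by (simp add: algebra_simps)
      then have "\<bar>cutoff m x * k n x - cutoff m x * w x\<bar> = \<bar>k n x - w x\<bar> * cutoff m x"
        using cutoff_bounds[of m x] by (simp only: abs_mult abs_of_nonneg)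
      also have "\<dots> \<le> 2 * C * cutoff m x"
        using kb[of n x] elim cutoff_bounds[of m x] by (intro mult_right_mono) auto
      finally show ?case by simp
    qed
  qed simp_all
  then have "eventually (\<lambda>n. (LINT x|lborel. \<bar>cutoff m x * k n x - cutoff m x * w x\<bar>) < e / 3) sequentially"
    using e by (intro order_tendstoD) auto
  then obtain n where n: "(LINT x|lborel. \<bar>cutoff m x * k n x - cutoff m x * w x\<bar>) < e / 3"
    by (auto simp: eventually_sequentially)
  define I where "I = (LINT x|lborel. cutoff m x)"
  have I: "I \<ge> 0" unfolding I_def by (intro integral_nonneg_AE) (simp add: cutoff_bounds)
  \<comment> \<open>The second entry makes the L^1 error at most \<open>e / 3\<close>; the first
    keeps the sup norm of \<open>f\<close> below \<open>C + 1\<close>.\<close>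
  define d where "d = min 1 (e / (3 * (I + 1)))"
  have d: "d > 0" "d \<le> 1" "d * I \<le> e / 3"
  proof -
    show "d > 0" "d \<le> 1" using e I by (auto simp: d_def)
    have "d * I \<le> e / (3 * (I + 1)) * I"
      using I by (intro mult_right_mono) (auto simp: d_def)
    also have "\<dots> \<le> e / 3" using I e by (simp add: field_simps)
    finally show "d * I \<le> e / 3" .
  qed
  obtain f where f: "test_function f" "\<And>x. \<bar>f x - cutoff m x * k n x\<bar> \<le> d * cutoff m x"
    using test_function_approx[OF kc m d(1)] by metis
  have fb: "\<bar>f x\<bar> \<le> C + 1" for x
  proof -
    have "\<bar>cutoff m x * k n x\<bar> \<le> 1 * C"
      unfolding abs_mult using cutoff_bounds[of m x] kb[of n x] by (intro mult_mono) auto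
    moreover have "d * cutoff m x \<le> 1 * 1"
      using cutoff_bounds[of m x] d by (intro mult_mono) auto
    ultimately show ?thesis using f(2)[of x] by linarith
  qed
  have "(LINT x|lborel. \<bar>f x - w x\<bar>) \<le> (LINT x|lborel. d * cutoff m x +
      \<bar>cutoff m x * k n x - cutoff m x * w x\<bar> + (\<bar>w x\<bar> - cutoff m x * \<bar>w x\<bar>))"
  proof (rule integral_mono)
    show "integrable lborel (\<lambda>x. \<bar>f x - w x\<bar>)"
      using test_function_integrable[OF f(1)] W(1) by simp
    show "integrable lborel (\<lambda>x. d * cutoff m x +
      \<bar>cutoff m x * k n x - cutoff m x * w x\<bar> + (\<bar>w x\<bar> - cutoff m x * \<bar>w x\<bar>))"
      using test_function_integrable[OF tc] iw ik[of n] W(1)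
        cutoff_integral_tendsto(2)[OF integrable_abs[OF W(1)], of N, folded m_def]
      by (intro Bochner_Integration.integrable_add Bochner_Integration.integrable_diff integrable_abs integrable_mult_right)
    fix x
    have "\<bar>cutoff m x * w x - w x\<bar> = \<bar>w x\<bar> - cutoff m x * \<bar>w x\<bar>"
    proof -
      have "cutoff m x * w x - w x = - ((1 - cutoff m x) * w x)" by (simp add: algebra_simps)
      then have "\<bar>cutoff m x * w x - w x\<bar> = (1 - cutoff m x) * \<bar>w x\<bar>"
        using cutoff_bounds[of m x] by (simp only: abs_minus_cancel abs_mult)
      then show ?thesis by (simp add: left_diff_distrib)
    qed
    then show "\<bar>f x - w x\<bar> \<le> d * cutoff m x +
      \<bar>cutoff m x * k n x - cutoff m x * w x\<bar> + (\<bar>w x\<bar> - cutoff m x * \<bar>w x\<bar>)"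
      using f(2)[of x] by linarith
  qed
  also have "\<dots> = d * I + (LINT x|lborel. \<bar>cutoff m x * k n x - cutoff m x * w x\<bar>) +
      (LINT x|lborel. \<bar>w x\<bar> - cutoff m x * \<bar>w x\<bar>)"
    using test_function_integrable[OF tc] iw ik[of n] W(1) cutoff_integral_tendsto(2)[OF integrable_abs[OF W(1)], of N]
    by (simp add: I_def m_def del: of_nat_Suc)
  also have "\<dots> \<le> e" using d(3) n N by (simp add: m_def)
  finally show ?thesis using that f(1) fb by blast
qed

text \<open>An L^1 error of \<open>r n * r n\<close> split at the radius \<open>r n\<close>
  contributes \<open>r n\<close> far from the singularity, and near it the sup bound
  \<open>2 * C + 1\<close> is multiplied by the vanishing \<open>kern_mass (r n)\<close>.\<close>

lemma newt_uniform_approx: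
  assumes w: "L1_Linf_bound C w"
  obtains f e where "\<And>n. test_function (f n)" "\<And>n x. \<bar>f n x\<bar> \<le> C + 1"
    "(\<lambda>n. LINT x|lborel. \<bar>f n x - w x\<bar>) \<longlonglongrightarrow> 0" "e \<longlonglongrightarrow> 0"
    "\<And>n i x. \<bar>newt i (f n) x - newt i w x\<bar> \<le> e n"
proof -
  note W = L1_Linf_boundD[OF w]
  define r where "r n = inverse (real (Suc n))" for n
  have r: "r n > 0" for n by (simp add: r_def)
  have r0: "r \<longlonglongrightarrow> 0" unfolding r_def[abs_def] by (rule LIMSEQ_inverse_real_of_nat)
  have "\<exists>f. test_function f \<and> (\<forall>x. \<bar>f x\<bar> \<le> C + 1) \<and> (LINT x|lborel. \<bar>f x - w x\<bar>) \<le> r n * r n" for n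
    using L1_dense[OF w, of "r n * r n"] r[of n] by (metis mult_pos_pos)
  then obtain f where f: "\<And>n. test_function (f n)" "\<And>n x. \<bar>f n x\<bar> \<le> C + 1"
    "\<And>n. (LINT x|lborel. \<bar>f n x - w x\<bar>) \<le> r n * r n"
    by metis
  define e where "e n = (2 * C + 1) * kern_mass (r n) + r n" for n
  show ?thesis
  proof (rule that[of f e])
    show "(\<lambda>n. LINT x|lborel. \<bar>f n x - w x\<bar>) \<longlonglongrightarrow> 0"
      by (rule tendsto_sandwich[OF _ _ tendsto_const tendsto_mult_zero[OF r0 r0]]) (use f(3) in auto)
    have "e \<longlonglongrightarrow> (2 * C + 1) * 0 + 0"
      unfolding e_def[abs_def] using kern_mass_tendsto r0 by (intro tendsto_intros) (simp_all add: r_def[abs_def])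
    then show "e \<longlonglongrightarrow> 0" by simp
    fix n i x
    obtain D where D: "L1_Linf_bound D (f n)" using L1_Linf_bound_test[OF f(1)] by metis
    have "newt i (f n) x - newt i w x = newt i (\<lambda>x. f n x - w x) x"
      using newt_L1_Linf_diff[OF D w] by simp
    moreover have "\<bar>newt i (\<lambda>x. f n x - w x) x\<bar> \<le> (2 * C + 1) * kern_mass (r n) + (r n * r n) / r n"
    proof (rule newt_bound[OF _ _ f(3) r])
      show "integrable lborel (\<lambda>x. f n x - w x)"
        using test_function_integrable[OF f(1)] W(1) by simp
      show "AE y in lborel. \<bar>f n y - w y\<bar> \<le> 2 * C + 1"
        using W(2)
      proof eventually_elim
        case (elim y)
        then show ?case using f(2)[of n y] by linarith
      qed
      show "0 \<le> 2 * C + 1" using W(4) by simp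
    qed
    ultimately show "\<bar>newt i (f n) x - newt i w x\<bar> \<le> e n"
      using r[of n] by (simp add: e_def)
  qed (use f in auto)
qed

lemma newt_continuous:
  assumes w: "L1_Linf_bound C w"
  shows "continuous_on S (newt i w)"
proof -
  obtain f e where f: "\<And>n. test_function (f n)" "e \<longlonglongrightarrow> 0"
    "\<And>n x. \<bar>newt i (f n) x - newt i w x\<bar> \<le> e n"
    using newt_uniform_approx[OF w] by metis
  have "uniform_limit UNIV (\<lambda>n. newt i (f n)) (newt i w) sequentially"
  proof (rule uniform_limitI)
    fix r :: real assume "r > 0"
    then have "eventually (\<lambda>n. e n < r) sequentially"
      using f(2) by (intro order_tendstoD) auto
    then show "\<forall>\<^sub>F n in sequentially. \<forall>x\<in>UNIV. dist (newt i (f n) x) (newt i w x) < r"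
    proof eventually_elim
      case (elim n)
      then show ?case using f(3)[of n] by (auto simp: dist_real_def intro: le_less_trans)
    qed
  qed
  then have "continuous_on UNIV (newt i w)"
    by (rule uniform_limit_theorem[rotated])
      (auto intro!: always_eventually smooth_continuous_on newt_smooth f)
  then show ?thesis using continuous_on_subset by blast
qed

lemma biot_savart_continuous:
  assumes "L1_Linf_bound C w"
  shows "continuous_on S (biot_savart w)"
proof -
  have eq: "biot_savart w = (\<lambda>x. \<chi> i. if i = 1 then - newt 2 w x else newt 1 w x)"
    by (simp add: fun_eq_iff biot_savart_eq[OF assms] vec_eq_iff forall_2 vector_2)
  have "continuous_on S (\<lambda>x. if i = 1 then - newt 2 w x else newt 1 w x)" for i :: 2
    by (cases "i = 1") (auto intro!: continuous_intros newt_continuous[OF assms])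
  then show ?thesis
    unfolding eq by (intro continuous_on_vec_lambda)
qed

lemma biot_savart_bound:
  assumes "L1_Linf_bound C w"
  shows "norm (biot_savart w x) \<le> 2 * C * (kern_mass 1 + 1)"
  using norm_real2_le[of "biot_savart w x"] newt_L1_Linf_bound[OF assms, of 1 x] newt_L1_Linf_bound[OF assms, of 2 x]
  by (simp add: biot_savart_eq[OF assms] vector_2)

text \<open>The dual potential of \<open>perp (grad g)\<close> is \<open>g\<close>, so
  \<open>w\<close> is orthogonal to every test function. An L^1 approximation \<open>f\<close> then
  bounds the integral of \<open>w x * w x\<close> by that of
  \<open>C * \<bar>f x - w x\<bar>\<close>.\<close>

lemma biot_savart_eq_0_imp:
  assumes w: "L1_Linf_bound C w"
    and v: "\<And>h. test_field h \<Longrightarrow> (LINT x|lborel. biot_savart w x \<bullet> h x) = 0"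
  shows "AE x in lborel. w x = 0"
proof -
  note W = L1_Linf_boundD[OF w]
  note [measurable] = W(5)
  have orth: "(LINT x|lborel. w x * g x) = 0" if g: "test_function g" for g
    using biot_savart_inner(1)[OF w test_field_perp_grad[OF g]] v[OF test_field_perp_grad[OF g]]
    by (simp add: stream_pot_perp_grad[OF g])
  have wf: "integrable lborel (\<lambda>x. w x * f x)" if "\<And>x. \<bar>f x\<bar> \<le> B" "f \<in> borel_measurable borel" for f B
  proof (rule Bochner_Integration.integrable_bound)
    note [measurable] = that(2)
    show "integrable lborel (\<lambda>x. B * \<bar>w x\<bar>)" using W(1) by simp
    show "(\<lambda>x. w x * f x) \<in> borel_measurable lborel" by measurable
    show "AE x in lborel. norm (w x * f x) \<le> norm (B * \<bar>w x\<bar>)"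
      using that(1) by (auto simp: abs_mult mult.commute[of B] intro!: AE_I2 mult_left_mono order_trans[OF that(1) abs_ge_self])
  qed
  have ww: "integrable lborel (\<lambda>x. w x * w x)"
  proof (rule Bochner_Integration.integrable_bound)
    show "integrable lborel (\<lambda>x. C * \<bar>w x\<bar>)" using W(1) by simp
    show "(\<lambda>x. w x * w x) \<in> borel_measurable lborel" by measurable
    show "AE x in lborel. norm (w x * w x) \<le> norm (C * \<bar>w x\<bar>)"
      using W(2)
    proof eventually_elim
      case (elim x)
      then have "\<bar>w x\<bar> * \<bar>w x\<bar> \<le> C * \<bar>w x\<bar>"
        by (intro mult_right_mono) auto
      then show ?case
        using W(4) by (simp only: real_norm_def abs_mult abs_abs abs_of_nonneg)
    qed
  qed
  have "(LINT x|lborel. w x * w x) \<le> C * e" if e: "e > 0" for e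
  proof -
    obtain f where f: "test_function f" "\<And>x. \<bar>f x\<bar> \<le> C + 1" "(LINT x|lborel. \<bar>f x - w x\<bar>) \<le> e"
      using L1_dense[OF w e] by metis
    note wfi = wf[OF f(2) test_function_measurable[OF f(1)]]
    have "(LINT x|lborel. w x * w x) = (LINT x|lborel. w x * w x - w x * f x)"
      using ww wfi orth[OF f(1)] by simp
    also have "\<dots> \<le> (LINT x|lborel. C * \<bar>f x - w x\<bar>)"
    proof (rule integral_mono_AE)
      show "integrable lborel (\<lambda>x. w x * w x - w x * f x)" using ww wfi by simp
      show "integrable lborel (\<lambda>x. C * \<bar>f x - w x\<bar>)"
        using W(1) test_function_integrable[OF f(1)] by simp
      show "AE x in lborel. w x * w x - w x * f x \<le> C * \<bar>f x - w x\<bar>"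
        using W(2)
      proof eventually_elim
        case (elim x)
        have "w x * w x - w x * f x \<le> \<bar>w x\<bar> * \<bar>f x - w x\<bar>"
          using abs_ge_self[of "w x * (w x - f x)"]
          by (simp only: abs_mult right_diff_distrib[symmetric] abs_minus_commute[of "f x"])
        also have "\<dots> \<le> C * \<bar>f x - w x\<bar>"
          using elim by (intro mult_right_mono) auto
        finally show ?case .
      qed
    qed
    also have "\<dots> \<le> C * e"
      using f(3) W(4) by (simp add: mult_left_mono)
    finally show ?thesis .
  qed
  note ineq = this
  have "(LINT x|lborel. w x * w x) \<le> 0"
  proof (rule field_le_epsilon)
    fix e :: real assume "e > 0"
    have "(LINT x|lborel. w x * w x) \<le> C * (e / (C + 1))"
      using ineq[of "e / (C + 1)"] W(4) \<open>e > 0\<close> by simp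
    also have "\<dots> \<le> e" using W(4) \<open>e > 0\<close> by (simp add: field_simps)
    finally show "(LINT x|lborel. w x * w x) \<le> 0 + e" by simp
  qed
  moreover have "(LINT x|lborel. w x * w x) \<ge> 0" by simp
  ultimately have "(LINT x|lborel. w x * w x) = 0" by linarith
  then have "AE x in lborel. w x * w x = 0"
    using integral_nonneg_eq_0_iff_AE[OF ww] by simp
  then show ?thesis by simp
qed

subsection \<open>The stress tensor estimate\<close>

lemma partial_const [simp]: "partial j (\<lambda>x. c) x = 0"
  by (simp add: partial_def)

text \<open>The gradient of \<open>u\<close> contracted with the stress tensor of the vector
  \<open>(a, b)\<close>: diagonal entries \<open>(a * a - b * b) / 2\<close> and its negative,
  off-diagonal entries \<open>a * b\<close>.\<close>

definition stress_form :: "(real^2 \<Rightarrow> real^2) \<Rightarrow> real^2 \<Rightarrow> real \<Rightarrow> real \<Rightarrow> real" where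
  "stress_form u x a b =
    partial 1 (\<lambda>x. u x $ 1) x * ((a * a - b * b) / 2) + partial 1 (\<lambda>x. u x $ 2) x * (a * b) +
    partial 2 (\<lambda>x. u x $ 2) x * ((b * b - a * a) / 2) + partial 2 (\<lambda>x. u x $ 1) x * (a * b)"

lemma stress_form_bound:
  assumes "\<And>i j. \<bar>partial j (\<lambda>x. u x $ i) x\<bar> \<le> L"
  shows "\<bar>stress_form u x a b\<bar> \<le> 2 * L * (a * a + b * b)"
proof -
  define s where "s = (a * a + b * b) / 2"
  have sq: "a * a \<ge> 0" "b * b \<ge> 0" by auto
  have "\<bar>(a * a - b * b) / 2\<bar> \<le> s" "\<bar>(b * b - a * a) / 2\<bar> \<le> s"
    using sq by (auto simp: s_def abs_le_iff)
  moreover have "0 \<le> (a - b) * (a - b)" "0 \<le> (a + b) * (a + b)" by auto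
  then have "\<bar>a * b\<bar> \<le> s"
    by (simp add: s_def abs_le_iff algebra_simps)
  moreover have "s \<ge> 0" using sq by (simp add: s_def)
  moreover have "\<bar>d * y\<bar> \<le> L * s" if "\<bar>d\<bar> \<le> L" "\<bar>y\<bar> \<le> s" for d y
    unfolding abs_mult using that \<open>s \<ge> 0\<close> by (intro mult_mono) auto
  ultimately have "\<bar>partial 1 (\<lambda>x. u x $ 1) x * ((a * a - b * b) / 2)\<bar> \<le> L * s"
    "\<bar>partial 1 (\<lambda>x. u x $ 2) x * (a * b)\<bar> \<le> L * s"
    "\<bar>partial 2 (\<lambda>x. u x $ 2) x * ((b * b - a * a) / 2)\<bar> \<le> L * s"
    "\<bar>partial 2 (\<lambda>x. u x $ 1) x * (a * b)\<bar> \<le> L * s"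
    using assms by blast+
  then have "\<bar>stress_form u x a b\<bar> \<le> 4 * (L * s)"
    unfolding stress_form_def by linarith
  also have "4 * (L * s) = 2 * L * (a * a + b * b)"
    by (simp add: s_def)
  finally show ?thesis .
qed

text \<open>With \<open>a = - newt 2 f\<close> and \<open>b = newt 1 f\<close>, the field \<open>v = (a, b)\<close> has divergence \<open>0\<close> and curl \<open>f\<close>,
  and \<open>f\<close> times \<open>perp v\<close> is the divergence of the stress tensor \<open>v \<otimes> v - \<bar>v\<bar>\<^sup>2/2\<close>.\<close>

lemma stress_identity:
  assumes u: "test_field u" and f: "test_function f"
  shows "(LINT x|lborel. f x * (u x $ 2 * (- newt 2 f x) - u x $ 1 * newt 1 f x)) =
      - (LINT x|lborel. stress_form u x (- newt 2 f x) (newt 1 f x))"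
proof -
  define P where "P = newt 2 f"
  define q where "q = newt 1 f"
  define U where "U = (\<lambda>x. u x $ 1)"
  define V where "V = (\<lambda>x. u x $ 2)"
  have tU: "test_function U" "test_function V"
    using u by (auto simp: test_field_def U_def V_def)
  note s = test_function_smooth[OF tU(1)] test_function_smooth[OF tU(2)] newt_smooth[OF f, of 2, folded P_def]
    newt_smooth[OF f, of 1, folded q_def]
  have curl: "f x = partial 1 q x + partial 2 P x" for x
    using newt_divergence[OF f, of x] by (simp add: P_def q_def partial_newt[OF f])
  have dv: "partial 1 P x = partial 2 q x" for x
    using newt_curl_free[OF f, of x] by (simp add: P_def q_def partial_newt[OF f])
  \<comment> \<open>\<open>A\<close> and \<open>B\<close> are twice the components of the stress
    tensor applied to \<open>u\<close>; their divergence consists of the force term and the gradient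
    terms of \<open>stress_form\<close>.\<close>
  define A where "A x = U x * (P x * P x - q x * q x) - (V x + V x) * (P x * q x)" for x
  define B where "B x = V x * (q x * q x - P x * P x) - (U x + U x) * (P x * q x)" for x
  have tA: "test_function A" "test_function B"
  proof -
    have "test_function (\<lambda>x. U x * (P x * P x - q x * q x) + (- 1) * ((V x + V x) * (P x * q x)))"
      "test_function (\<lambda>x. V x * (q x * q x - P x * P x) + (- 1) * ((U x + U x) * (P x * q x)))"
      by (intro test_function_add test_function_mult(2) tU test_function_mult(1)[of "\<lambda>x. - 1"] smooth_intros s)+
    then show "test_function A" "test_function B"
      by (simp_all add: A_def[abs_def] B_def[abs_def])
  qed
  have pA: "partial 1 A x = U x * (P x * partial 1 P x + partial 1 P x * P x - (q x * partial 1 q x + partial 1 q x * q x))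
      + partial 1 U x * (P x * P x - q x * q x) - ((V x + V x) * (P x * partial 1 q x + partial 1 P x * q x)
      + (partial 1 V x + partial 1 V x) * (P x * q x))" for x
    unfolding A_def[abs_def]
    by (simp only: partial_mult partial_diff partial_add smooth_mult smooth_add smooth_diff s)
  have pB: "partial 2 B x = V x * (q x * partial 2 q x + partial 2 q x * q x - (P x * partial 2 P x + partial 2 P x * P x))
      + partial 2 V x * (q x * q x - P x * P x) - ((U x + U x) * (P x * partial 2 q x + partial 2 P x * q x)
      + (partial 2 U x + partial 2 U x) * (P x * q x))" for x
    unfolding B_def[abs_def]
    by (simp only: partial_mult partial_diff partial_add smooth_mult smooth_add smooth_diff s)
  have eq: "(partial 1 A x + partial 2 B x) / 2 = f x * (V x * (- P x) - U x * q x) + stress_form u x (- P x) (q x)" for x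
    unfolding pA pB curl[of x] dv[of x] stress_form_def U_def[symmetric] V_def[symmetric]
    by (simp add: field_simps)
  have i1: "integrable lborel (\<lambda>x. f x * (V x * (- P x) - U x * q x))"
    by (intro test_function_integrable test_function_mult(2) f smooth_intros s)
  have "integrable lborel (\<lambda>x. (partial 1 A x + partial 2 B x) / 2)"
    by (intro integrable_divide Bochner_Integration.integrable_add test_function_integrable test_function_partial tA)
  from Bochner_Integration.integrable_diff[OF this i1]
  have i2: "integrable lborel (\<lambda>x. stress_form u x (- P x) (q x))"
    unfolding eq add_diff_cancel_left' .
  have "0 = ((LINT x|lborel. partial 1 A x) + (LINT x|lborel. partial 2 B x)) / 2"
    by (simp add: integral_partial_eq_0 tA)
  also have "\<dots> = (LINT x|lborel. (partial 1 A x + partial 2 B x) / 2)"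
    by (simp add: test_function_integrable test_function_partial tA)
  also have "\<dots> = (LINT x|lborel. f x * (V x * (- P x) - U x * q x) + stress_form u x (- P x) (q x))"
    unfolding eq ..
  also have "\<dots> = (LINT x|lborel. f x * (V x * (- P x) - U x * q x)) + (LINT x|lborel. stress_form u x (- P x) (q x))"
    using i1 i2 by (rule Bochner_Integration.integral_add)
  finally show ?thesis
    by (simp add: P_def q_def U_def V_def)
qed

text \<open>The identity for test vorticities passes to the limit, since vorticities converge in L^1
  and velocities uniformly, while \<open>u\<close> confines everything to a ball. What remains is
  quadratic in the velocity and contains no vorticity, so the L^2 norm controls it.\<close>

lemma stress_bound:
  assumes w: "L1_Linf_bound C w" and v: "L2_field (biot_savart w)" and u: "test_field u"
    and L: "\<And>i j x. \<bar>partial j (\<lambda>x. u x $ i) x\<bar> \<le> L"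
  shows "(LINT x|lborel. w x * (u x \<bullet> perp (biot_savart w x))) \<le> 2 * L * (L2_size (biot_savart w))\<^sup>2"
proof -
  note W = L1_Linf_boundD[OF w]
  note [measurable] = W(5)
  define a where "a x = - newt 2 w x" for x
  define b where "b x = newt 1 w x" for x
  have ab: "biot_savart w x = vector [a x, b x]" for x
    by (simp add: biot_savart_eq[OF w] a_def b_def)
  have tu: "test_function (\<lambda>x. u x $ i)" for i
    using u by (simp add: test_field_def)
  obtain R where R: "\<And>x. norm x \<ge> R \<Longrightarrow> u x = 0"
    using test_field_supportE[OF u] by metis
  have pu0: "partial j (\<lambda>x. u x $ i) x = 0" if "norm x > R" for i j x
    unfolding partial_def by (rule frechet_derivative_eq_0_outside[OF _ that]) (simp add: R)
  obtain U1 where U1: "U1 > 0" "\<And>x. \<bar>u x $ 1\<bar> \<le> U1" using test_function_boundedE[OF tu[of 1]] by metis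
  obtain U2 where U2: "U2 > 0" "\<And>x. \<bar>u x $ 2\<bar> \<le> U2" using test_function_boundedE[OF tu[of 2]] by metis
  obtain f e where f: "\<And>n. test_function (f n)" "\<And>n x. \<bar>f n x\<bar> \<le> C + 1"
    "(\<lambda>n. LINT x|lborel. \<bar>f n x - w x\<bar>) \<longlonglongrightarrow> 0" "e \<longlonglongrightarrow> 0"
    "\<And>n i x. \<bar>newt i (f n) x - newt i w x\<bar> \<le> e n"
    using newt_uniform_approx[OF w] by blast
  define an where "an n x = - newt 2 (f n) x" for n x
  define bn where "bn n x = newt 1 (f n) x" for n x
  have an: "\<bar>an n x - a x\<bar> \<le> e n" "\<bar>bn n x - b x\<bar> \<le> e n" for n x
    using f(5)[of 2 n x] f(5)[of 1 n x] by (auto simp: an_def bn_def a_def b_def)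
  have lim_ab: "(\<lambda>n. an n x) \<longlonglongrightarrow> a x" "(\<lambda>n. bn n x) \<longlonglongrightarrow> b x" for x
    using an[of _ x] f(4)
    by (auto intro!: Lim_null_comparison[OF always_eventually f(4), THEN LIM_zero_cancel] simp del: abs_le_iff)
  obtain E where E: "\<And>n. \<bar>e n\<bar> \<le> E"
    using Bseq_def convergent_imp_Bseq[of e] f(4) convergentI by (metis real_norm_def)
  define M where "M = C * (kern_mass 1 + 1) + E"
  have M: "\<bar>a x\<bar> \<le> M" "\<bar>b x\<bar> \<le> M" "\<bar>an n x\<bar> \<le> M" "\<bar>bn n x\<bar> \<le> M" "M \<ge> 0" for n x
    using newt_L1_Linf_bound[OF w, of 2 x] newt_L1_Linf_bound[OF w, of 1 x] an[of n x] E[of n]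
    by (auto simp: M_def a_def b_def abs_le_iff)
  define G where "G x = u x $ 2 * a x - u x $ 1 * b x" for x
  define Gn where "Gn n x = u x $ 2 * an n x - u x $ 1 * bn n x" for n x
  have G: "w x * (u x \<bullet> perp (biot_savart w x)) = w x * G x" for x
    by (simp add: G_def ab inner_real2 vector_2)
  have cont: "continuous_on UNIV (\<lambda>x. u x $ i)" for i by (rule test_function_continuous[OF tu])
  have cab: "continuous_on UNIV a" "continuous_on UNIV b" "continuous_on UNIV (an n)" "continuous_on UNIV (bn n)" for n
    unfolding a_def[abs_def] b_def[abs_def] an_def[abs_def] bn_def[abs_def]
    by (intro continuous_intros newt_continuous[OF w] smooth_continuous_on[OF newt_smooth] f(1))+
  have [measurable]: "G \<in> borel_measurable borel" "Gn n \<in> borel_measurable borel" for n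
    unfolding G_def[abs_def] Gn_def[abs_def]
    by (intro borel_measurable_continuous_onI continuous_intros cont cab)+
  have GnG: "\<bar>Gn n x - G x\<bar> \<le> (U1 + U2) * e n" for n x
  proof -
    have "\<bar>u x $ 2 * (an n x - a x)\<bar> \<le> U2 * e n" "\<bar>u x $ 1 * (bn n x - b x)\<bar> \<le> U1 * e n"
      unfolding abs_mult using U1 U2 an by (auto intro!: mult_mono)
    moreover have "Gn n x - G x = u x $ 2 * (an n x - a x) - u x $ 1 * (bn n x - b x)"
      by (simp add: G_def Gn_def algebra_simps)
    ultimately show ?thesis by (simp add: distrib_right)
  qed
  have Gb: "\<bar>Gn n x\<bar> \<le> (U1 + U2) * M" "\<bar>G x\<bar> \<le> (U1 + U2) * M" for n x
  proof -
    have "\<bar>u x $ 2 * an n x\<bar> \<le> U2 * M" "\<bar>u x $ 1 * bn n x\<bar> \<le> U1 * M"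
      "\<bar>u x $ 2 * a x\<bar> \<le> U2 * M" "\<bar>u x $ 1 * b x\<bar> \<le> U1 * M"
      unfolding abs_mult using U1 U2 M by (auto intro!: mult_mono)
    then show "\<bar>Gn n x\<bar> \<le> (U1 + U2) * M" "\<bar>G x\<bar> \<le> (U1 + U2) * M"
      by (auto simp: G_def Gn_def distrib_right)
  qed
  have bdd_int: "integrable lborel (\<lambda>x. y x * g x)"
    if "integrable lborel y" "\<And>x. \<bar>g x\<bar> \<le> c" "g \<in> borel_measurable borel" for y g :: "real^2 \<Rightarrow> real" and c
  proof (rule Bochner_Integration.integrable_bound)
    show "integrable lborel (\<lambda>x. c * \<bar>y x\<bar>)" using that(1) by simp
    show "(\<lambda>x. y x * g x) \<in> borel_measurable lborel"
      using that(1,3) by simp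
    show "AE x in lborel. norm (y x * g x) \<le> norm (c * \<bar>y x\<bar>)"
      using that(2) by (auto simp: abs_mult mult.commute[of c] intro!: AE_I2 mult_left_mono order_trans[OF that(2) abs_ge_self])
  qed
  have int: "integrable lborel (\<lambda>x. w x * G x)" "integrable lborel (\<lambda>x. f n x * Gn n x)" for n
    using bdd_int[OF W(1) Gb(2)] bdd_int[OF test_function_integrable[OF f(1)] Gb(1)] by simp_all
  have lim1: "(\<lambda>n. LINT x|lborel. f n x * Gn n x) \<longlonglongrightarrow> (LINT x|lborel. w x * G x)"
  proof (rule LIM_zero_cancel, rule Lim_null_comparison[OF always_eventually])
    show "\<forall>n. norm ((LINT x|lborel. f n x * Gn n x) - (LINT x|lborel. w x * G x)) \<le>
        (U1 + U2) * M * (LINT x|lborel. \<bar>f n x - w x\<bar>) + (U1 + U2) * e n * (LINT x|lborel. \<bar>w x\<bar>)"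
    proof
      fix n
      have id: "integrable lborel (\<lambda>x. \<bar>f n x - w x\<bar>)"
        using test_function_integrable[OF f(1)] W(1) by simp
      have "(LINT x|lborel. f n x * Gn n x) - (LINT x|lborel. w x * G x) = (LINT x|lborel. f n x * Gn n x - w x * G x)"
        using int by simp
      also have "\<bar>\<dots>\<bar> \<le> (LINT x|lborel. (U1 + U2) * M * \<bar>f n x - w x\<bar> + (U1 + U2) * e n * \<bar>w x\<bar>)"
      proof (rule integral_abs_bound_integral)
        show "integrable lborel (\<lambda>x. f n x * Gn n x - w x * G x)" using int by simp
        show "integrable lborel (\<lambda>x. (U1 + U2) * M * \<bar>f n x - w x\<bar> + (U1 + U2) * e n * \<bar>w x\<bar>)"
          using id W(1) by simp
        fix x
        \<comment> \<open>Each summand pairs an L^1 quantity with a bounded one: the first is small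
          through its L^1 factor, the second through its bounded factor.\<close>
        have "f n x * Gn n x - w x * G x = (f n x - w x) * Gn n x + w x * (Gn n x - G x)"
          by (simp add: algebra_simps)
        moreover have "\<bar>(f n x - w x) * Gn n x\<bar> \<le> \<bar>f n x - w x\<bar> * ((U1 + U2) * M)"
          unfolding abs_mult by (intro mult_left_mono Gb) simp
        moreover have "\<bar>w x * (Gn n x - G x)\<bar> \<le> \<bar>w x\<bar> * ((U1 + U2) * e n)"
          unfolding abs_mult[of "w x"] by (intro mult_left_mono GnG) simp
        ultimately show "\<bar>f n x * Gn n x - w x * G x\<bar> \<le> (U1 + U2) * M * \<bar>f n x - w x\<bar> + (U1 + U2) * e n * \<bar>w x\<bar>"
          by (simp add: mult_ac)
      qed
      also have "\<dots> = (U1 + U2) * M * (LINT x|lborel. \<bar>f n x - w x\<bar>) + (U1 + U2) * e n * (LINT x|lborel. \<bar>w x\<bar>)"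
        using id W(1) by simp
      finally show "norm ((LINT x|lborel. f n x * Gn n x) - (LINT x|lborel. w x * G x)) \<le>
        (U1 + U2) * M * (LINT x|lborel. \<bar>f n x - w x\<bar>) + (U1 + U2) * e n * (LINT x|lborel. \<bar>w x\<bar>)" by simp
    qed
    have "(\<lambda>n. (U1 + U2) * M * (LINT x|lborel. \<bar>f n x - w x\<bar>) + (U1 + U2) * e n * (LINT x|lborel. \<bar>w x\<bar>)) \<longlonglongrightarrow>
        (U1 + U2) * M * 0 + (U1 + U2) * 0 * (LINT x|lborel. \<bar>w x\<bar>)"
      by (intro tendsto_intros f)
    then show "(\<lambda>n. (U1 + U2) * M * (LINT x|lborel. \<bar>f n x - w x\<bar>) + (U1 + U2) * e n * (LINT x|lborel. \<bar>w x\<bar>)) \<longlonglongrightarrow> 0"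
      by simp
  qed
  have id: "(LINT x|lborel. f n x * Gn n x) = - (LINT x|lborel. stress_form u x (an n x) (bn n x))" for n
    using stress_identity[OF u f(1), of n] by (simp add: Gn_def an_def bn_def)
  have lim2: "(\<lambda>n. LINT x|lborel. stress_form u x (an n x) (bn n x)) \<longlonglongrightarrow> (LINT x|lborel. stress_form u x (a x) (b x))"
  proof (rule integral_dominated_convergence[where w = "\<lambda>x. indicator (cball 0 R) x *\<^sub>R (2 * L * (M * M + M * M))"])
    have sc: "continuous_on UNIV (\<lambda>x. stress_form u x (g x) (k x))" if "continuous_on UNIV g" "continuous_on UNIV k" for g k
      unfolding stress_form_def
      by (intro continuous_intros that test_function_continuous test_function_partial tu) auto
    show "(\<lambda>x. stress_form u x (a x) (b x)) \<in> borel_measurable lborel"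
      "(\<lambda>x. stress_form u x (an n x) (bn n x)) \<in> borel_measurable lborel" for n
      using borel_measurable_continuous_onI[OF sc] cab by simp_all
    show "integrable lborel (\<lambda>x::real^2. indicator (cball 0 R) x *\<^sub>R (2 * L * (M * M + M * M)))"
      by (rule borel_integrable_compact) auto
    show "AE x in lborel. (\<lambda>n. stress_form u x (an n x) (bn n x)) \<longlonglongrightarrow> stress_form u x (a x) (b x)"
      unfolding stress_form_def by (intro AE_I2 tendsto_intros lim_ab) auto
    show "AE x in lborel. norm (stress_form u x (an n x) (bn n x)) \<le> indicator (cball 0 R) x *\<^sub>R (2 * L * (M * M + M * M))" for n
    proof (rule AE_I2)
      fix x
      have "L \<ge> 0" using order_trans[OF abs_ge_zero L] .
      have "an n x * an n x \<le> M * M" "bn n x * bn n x \<le> M * M"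
        using mult_mono[OF M(3)[of n x] M(3)[of n x]] mult_mono[OF M(4)[of n x] M(4)[of n x]] M(5)
        by (simp_all flip: abs_mult)
      then have "2 * L * (an n x * an n x + bn n x * bn n x) \<le> 2 * L * (M * M + M * M)"
        using \<open>L \<ge> 0\<close> by (intro mult_left_mono) auto
      then have "\<bar>stress_form u x (an n x) (bn n x)\<bar> \<le> 2 * L * (M * M + M * M)"
        using stress_form_bound[of u x L "an n x" "bn n x", OF L] by linarith
      moreover have "stress_form u x (an n x) (bn n x) = 0" if "norm x > R"
        using pu0[OF that] by (simp add: stress_form_def)
      ultimately show "norm (stress_form u x (an n x) (bn n x)) \<le> indicator (cball 0 R) x *\<^sub>R (2 * L * (M * M + M * M))"
        by (cases "norm x \<le> R") auto
    qed
  qed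
  have eq: "(LINT x|lborel. w x * G x) = - (LINT x|lborel. stress_form u x (a x) (b x))"
    using lim1 tendsto_minus[OF lim2] unfolding id by (rule LIMSEQ_unique)
  have "\<bar>LINT x|lborel. stress_form u x (a x) (b x)\<bar> \<le> (LINT x|lborel. 2 * L * (norm (biot_savart w x))\<^sup>2)"
  proof -
    have i: "integrable lborel (\<lambda>x. 2 * L * (norm (biot_savart w x))\<^sup>2)"
      using v by (simp add: L2_field_def)
    have le: "\<bar>stress_form u x (a x) (b x)\<bar> \<le> 2 * L * (norm (biot_savart w x))\<^sup>2" for x
      using stress_form_bound[of u x L "a x" "b x", OF L] by (simp add: ab norm_power2_real2 vector_2)
    have "continuous_on UNIV (\<lambda>x. stress_form u x (a x) (b x))"
      unfolding stress_form_def
      by (intro continuous_intros cab test_function_continuous test_function_partial tu) auto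
    then have "integrable lborel (\<lambda>x. stress_form u x (a x) (b x))"
      by (intro Bochner_Integration.integrable_bound[OF i])
        (auto intro!: AE_I2 order_trans[OF le abs_ge_self] borel_measurable_continuous_onI)
    then show ?thesis
      using i le by (rule integral_abs_bound_integral)
  qed
  then show ?thesis
    unfolding G eq L2_size_power2 by simp
qed

text \<open>With \<open>n\<close> steps of length \<open>d = T / real n\<close> the quadratic errors
  add up to at most \<open>T * k' * exp (k * T) * d\<close>, which vanishes as \<open>n\<close>
  grows. Requiring \<open>real n \<ge> T\<close> keeps the steps within the length \<open>1\<close>
  allowed by \<open>step\<close>.\<close>

lemma discrete_gronwall:
  fixes e :: "real \<Rightarrow> real"
  assumes e0: "e 0 = 0" and nonneg: "\<And>t. e t \<ge> 0" and k: "k \<ge> 0" "k' \<ge> 0"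
    and step: "\<And>s T. 0 \<le> s \<Longrightarrow> s \<le> T \<Longrightarrow> T \<le> s + 1 \<Longrightarrow> e T \<le> (1 + k * (T - s)) * e s + k' * (T - s)\<^sup>2"
    and T: "T \<ge> 0"
  shows "e T = 0"
proof -
  have bound: "e T \<le> (T * k' * exp (k * T)) * (T / real n)" if n: "n > 0" "real n \<ge> T" for n :: nat
  proof -
    define d where "d = T / real n"
    have d: "0 \<le> d" "d \<le> 1" "real n * d = T"
      using n T by (auto simp: d_def)
    have "e (real j * d) \<le> real j * (k' * d\<^sup>2) * exp (k * (real j * d))" for j
    proof (induction j)
      case 0
      then show ?case by (simp add: e0)
    next
      case (Suc j)
      have "e (real (Suc j) * d) \<le> (1 + k * d) * e (real j * d) + k' * d\<^sup>2"
        using step[of "real j * d" "real (Suc j) * d"] d by (simp add: algebra_simps)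
      also have "\<dots> \<le> exp (k * d) * (real j * (k' * d\<^sup>2) * exp (k * (real j * d))) + k' * d\<^sup>2 * exp (k * (real (Suc j) * d))"
      proof (rule add_mono)
        show "(1 + k * d) * e (real j * d) \<le> exp (k * d) * (real j * (k' * d\<^sup>2) * exp (k * (real j * d)))"
          using Suc.IH nonneg by (intro mult_mono exp_ge_add_one_self) auto
        show "k' * d\<^sup>2 \<le> k' * d\<^sup>2 * exp (k * (real (Suc j) * d))"
          using k d mult_left_mono[of 1 "exp (k * (real (Suc j) * d))" "k' * d\<^sup>2"] by simp
      qed
      also have "\<dots> = real (Suc j) * (k' * d\<^sup>2) * exp (k * (real (Suc j) * d))"
        by (simp add: exp_add[symmetric] algebra_simps)
      finally show ?case .
    qed
    from this[of n] have "e T \<le> real n * (k' * d\<^sup>2) * exp (k * T)"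
      by (simp add: d(3))
    also have "\<dots> = (real n * d) * k' * exp (k * T) * d"
      by (simp add: power2_eq_square)
    finally show ?thesis by (simp add: d(3)) (simp add: d_def)
  qed
  have "(\<lambda>n. (T * k' * exp (k * T)) * (T / real n)) \<longlonglongrightarrow> 0"
    by (intro tendsto_mult_right_zero tendsto_divide_0[OF tendsto_const] filterlim_at_top_imp_at_infinity filterlim_real_sequentially)
  moreover have "eventually (\<lambda>n. e T \<le> (T * k' * exp (k * T)) * (T / real n)) sequentially"
    using eventually_gt_at_top[of 0] filterlim_real_sequentially[unfolded filterlim_at_top, rule_format, of T]
    by eventually_elim (rule bound)
  ultimately have "e T \<le> 0"
    by (intro tendsto_le[OF sequentially_bot _ tendsto_const])
  with nonneg[of T] show ?thesis by linarith
qed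

subsection \<open>Weak-strong uniqueness\<close>

text \<open>The weak equation admits only test functions of compact support in space and time. A
  time cutoff equal to \<open>1\<close> around \<open>[0, T]\<close> turns a function of space into
  such a function and leaves the integrand alone.\<close>

lemma weak_vorticity_time_independent:
  assumes weak: "weak_vorticity_eq w0 \<omega> u" and \<phi>: "test_function \<phi>" and T: "T \<ge> 0"
  shows "(LINT x|lborel. \<omega> T x * \<phi> x) - (LINT x|lborel. \<omega> 0 x * \<phi> x) =
    (LINT (t, x):{0..T} \<times> UNIV|lborel. \<omega> t x * (u t x \<bullet> grad \<phi> x))"
proof -
  \<comment> \<open>The first factor is \<open>1\<close> up to \<open>T + 1\<close> and
    \<open>0\<close> from \<open>T + 2\<close> on, the second is \<open>1\<close> from
    \<open>-1\<close> on and \<open>0\<close> up to \<open>-2\<close>. The margin around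
    \<open>[0, T]\<close> makes the time derivative vanish at its end points too.\<close>
  define \<eta> where "\<eta> t = smooth_step (t - T - 2) * smooth_step (- t - 2)" for t
  have \<eta>1: "\<eta> t = 1" if "-1 < t" "t < T + 1" for t
    using that by (simp add: \<eta>_def smooth_step_eq_1)
  have \<eta>0: "\<eta> t = 0" if "\<bar>t\<bar> \<ge> T + 3" for t
    using that T by (cases "t \<ge> 0") (simp_all add: \<eta>_def smooth_step_eq_0)
  have s\<eta>: "smooth \<eta>"
  proof -
    have "smooth (\<lambda>t::real. t - T - 2)" "smooth (\<lambda>t::real. - t - 2)"
      by (intro smooth_intros)+
    from smooth_compose[OF smooth_smooth_step this(1)] smooth_compose[OF smooth_smooth_step this(2)]
    show ?thesis unfolding \<eta>_def[abs_def] by (rule smooth_mult)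
  qed
  define \<Phi> where "\<Phi> p = \<eta> (fst p) * \<phi> (snd p)" for p :: "real \<times> (real^2)"
  obtain R where R: "R > 0" "\<And>x. norm x \<ge> R \<Longrightarrow> \<phi> x = 0"
    using test_function_supportE[OF \<phi>] by metis
  have "smooth (\<lambda>p::real \<times> (real^2). \<eta> (0 + fst p))" "smooth (\<lambda>p::real \<times> (real^2). \<phi> (0 + snd p))"
    by (intro smooth_affine bounded_linear_fst bounded_linear_snd s\<eta> test_function_smooth \<phi>)+
  then have "smooth \<Phi>"
    unfolding \<Phi>_def[abs_def] by (intro smooth_mult) simp_all
  moreover have "compactly_supported \<Phi>"
  proof (rule compactly_supportedI[of "T + 3 + R"])
    fix p :: "real \<times> (real^2)" assume "norm p \<ge> T + 3 + R"
    moreover have "norm p \<le> \<bar>fst p\<bar> + norm (snd p)"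
      using norm_Pair_le[of "fst p" "snd p"] by simp
    ultimately have "\<bar>fst p\<bar> \<ge> T + 3 \<or> norm (snd p) \<ge> R" by linarith
    then show "\<Phi> p = 0" using \<eta>0 R(2) by (auto simp: \<Phi>_def)
  qed
  ultimately have "test_function \<Phi>" by (simp add: test_function_def)
  then have "(LINT x|lborel. \<omega> T x * \<Phi> (T, x)) - (LINT x|lborel. \<omega> 0 x * \<Phi> (0, x)) =
        (LINT (t, x):{0..T} \<times> UNIV|lborel.
           \<omega> t x * (deriv (\<lambda>s. \<Phi> (s, x)) t + u t x \<bullet> grad (\<lambda>y. \<Phi> (t, y)) x))"
    using weak T unfolding weak_vorticity_eq_def by blast
  also have "(LINT x|lborel. \<omega> T x * \<Phi> (T, x)) = (LINT x|lborel. \<omega> T x * \<phi> x)"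
    using T \<eta>1[of T] by (simp add: \<Phi>_def)
  also have "(LINT x|lborel. \<omega> 0 x * \<Phi> (0, x)) = (LINT x|lborel. \<omega> 0 x * \<phi> x)"
    using T \<eta>1[of 0] by (simp add: \<Phi>_def)
  also have "(LINT (t, x):{0..T} \<times> UNIV|lborel.
      \<omega> t x * (deriv (\<lambda>s. \<Phi> (s, x)) t + u t x \<bullet> grad (\<lambda>y. \<Phi> (t, y)) x)) =
    (LINT (t, x):{0..T} \<times> UNIV|lborel. \<omega> t x * (u t x \<bullet> grad \<phi> x))"
  proof -
    have *: "\<omega> t x * (deriv (\<lambda>s. \<Phi> (s, x)) t + u t x \<bullet> grad (\<lambda>y. \<Phi> (t, y)) x) = \<omega> t x * (u t x \<bullet> grad \<phi> x)"
      if t: "0 \<le> t" "t \<le> T" for t x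
    proof -
      have "((\<lambda>s. \<Phi> (s, x)) has_field_derivative 0) (at t)"
        by (rule has_field_derivative_transform_within_open[OF DERIV_const[of "\<phi> x"] open_greaterThanLessThan[of "-1" "T + 1"]])
          (use t \<eta>1 in \<open>auto simp: \<Phi>_def\<close>)
      moreover have "(\<lambda>y. \<Phi> (t, y)) = \<phi>"
        using \<eta>1[of t] t by (simp add: \<Phi>_def)
      ultimately show ?thesis
        by (simp add: DERIV_imp_deriv)
    qed
    show ?thesis
      unfolding set_lebesgue_integral_def
      by (intro Bochner_Integration.integral_cong refl) (auto simp: indicator_def *)
  qed
  finally show ?thesis .
qed

text \<open>Difference of the equation at \<open>T\<close> and at \<open>s\<close>, written as an
  integral over time of slices. The local integrability of the flux is applied on a compact cylinder
  over the support of \<open>grad \<phi>\<close>; it justifies Fubini's theorem.\<close>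

lemma weak_vorticity_increment:
  assumes weak: "weak_vorticity_eq w0 \<omega> u" and \<phi>: "test_function \<phi>" and s: "0 \<le> s" "s \<le> T"
  shows "integrable lborel (\<lambda>t. indicator {s<..T} t * (LINT x|lborel. \<omega> t x * (u t x \<bullet> grad \<phi> x)))"
    and "(LINT x|lborel. \<omega> T x * \<phi> x) - (LINT x|lborel. \<omega> s x * \<phi> x) =
      (LINT t|lborel. indicator {s<..T} t * (LINT x|lborel. \<omega> t x * (u t x \<bullet> grad \<phi> x)))"
proof -
  define g where "g = (\<lambda>(t, x). \<omega> t x * (u t x \<bullet> grad \<phi> x))"
  obtain R where R: "R > 0" "\<And>x v. norm x \<ge> R \<Longrightarrow> frechet_derivative \<phi> (at x) v = 0"
    using test_function_supportE[OF \<phi>] by metis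
  have g0: "grad \<phi> x = 0" if "norm x \<ge> R" for x
    using R(2)[OF that] by (simp add: vec_eq_iff partial_def)
  have gc: "continuous_on UNIV (grad \<phi>)"
    by (intro grad_continuous test_function_smooth \<phi>)
  obtain B where B: "B > 0" "\<And>x. norm (grad \<phi> x) \<le> B"
    using continuous_cs_bounded[OF gc g0] by metis
  define K where "K = {0..T} \<times> cball (0::real^2) R"
  define H where "H p = indicator K p *\<^sub>R (case p of (t, x) \<Rightarrow> \<omega> t x *\<^sub>R u t x)" for p
  have "compact K" "K \<subseteq> {0..} \<times> UNIV"
    unfolding K_def by (auto intro: compact_Times)
  then have H: "integrable lborel H"
    using weak unfolding weak_vorticity_eq_def locally_integrable_on_def set_integrable_def H_def[abs_def] by blast
  define G where "G p = grad \<phi> (snd p)" for p :: "real \<times> (real^2)"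
  have [measurable]: "G \<in> borel_measurable borel"
    unfolding G_def[abs_def]
    by (intro borel_measurable_continuous_onI continuous_on_compose2[OF gc]) (auto intro: continuous_intros)
  have [measurable]: "H \<in> borel_measurable borel"
    using borel_measurable_integrable[OF H] by (simp only: measurable_lborel2)
  have "integrable lborel (\<lambda>p. H p \<bullet> G p)"
  proof (rule Bochner_Integration.integrable_bound)
    show "integrable lborel (\<lambda>p. B * norm (H p))" using H by simp
    show "AE p in lborel. norm (H p \<bullet> G p) \<le> norm (B * norm (H p))"
    proof (rule AE_I2)
      fix p
      have "\<bar>H p \<bullet> G p\<bar> \<le> norm (H p) * norm (G p)" by (rule Cauchy_Schwarz_ineq2)
      also have "\<dots> \<le> norm (H p) * B" using B(2) by (intro mult_left_mono) (auto simp: G_def)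
      finally show "norm (H p \<bullet> G p) \<le> norm (B * norm (H p))" using B(1) by (simp add: abs_mult mult.commute)
    qed
  qed simp
  moreover have "(\<lambda>p. H p \<bullet> G p) = (\<lambda>p. indicator ({0..T} \<times> UNIV) p *\<^sub>R g p)"
  proof
    fix p :: "real \<times> (real^2)"
    show "H p \<bullet> G p = indicator ({0..T} \<times> UNIV) p *\<^sub>R g p"
      using g0[of "snd p"] by (cases "norm (snd p) \<ge> R")
        (auto simp: H_def G_def g_def K_def indicator_def split: prod.splits)
  qed
  ultimately have gint: "set_integrable lborel ({0..T} \<times> UNIV) g"
    by (simp add: set_integrable_def)
  have sets: "{0..s} \<times> (UNIV::(real^2) set) \<in> sets lborel" "{s<..T} \<times> (UNIV::(real^2) set) \<in> sets lborel"
    by (simp_all add: borel_Times)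
  have gs: "set_integrable lborel ({0..s} \<times> UNIV) g" "set_integrable lborel ({s<..T} \<times> UNIV) g"
    by (rule set_integrable_subset[OF gint]; use s sets in auto)+
  have split: "{0..T} \<times> (UNIV::(real^2) set) = {0..s} \<times> UNIV \<union> {s<..T} \<times> UNIV"
    using s by auto
  have "(LINT p:{0..T} \<times> UNIV|lborel. g p) = (LINT p:{0..s} \<times> UNIV|lborel. g p) + (LINT p:{s<..T} \<times> UNIV|lborel. g p)"
    unfolding split by (rule set_integral_Un) (use gs in auto)
  then have "(LINT x|lborel. \<omega> T x * \<phi> x) - (LINT x|lborel. \<omega> s x * \<phi> x) = (LINT p:{s<..T} \<times> UNIV|lborel. g p)"
    using weak_vorticity_time_independent[OF weak \<phi>, of T] weak_vorticity_time_independent[OF weak \<phi>, of s] s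
    by (simp add: g_def)
  define f where "f p = indicator ({s<..T} \<times> UNIV) p *\<^sub>R g p" for p
  have fint: "integrable (lborel \<Otimes>\<^sub>M lborel) f"
    using gs(2) unfolding set_integrable_def f_def[abs_def] lborel_prod .
  have fslice: "(LINT x|lborel. f (t, x)) = indicator {s<..T} t * (LINT x|lborel. \<omega> t x * (u t x \<bullet> grad \<phi> x))" for t
  proof -
    have "f (t, x) = indicator {s<..T} t * (\<omega> t x * (u t x \<bullet> grad \<phi> x))" for x
      by (simp add: f_def g_def indicator_def)
    then show ?thesis by simp
  qed
  show "integrable lborel (\<lambda>t. indicator {s<..T} t * (LINT x|lborel. \<omega> t x * (u t x \<bullet> grad \<phi> x)))"
    using lborel_pair.integrable_fst'[OF fint] unfolding fslice .
  have "(LINT p:{s<..T} \<times> UNIV|lborel. g p) = integral\<^sup>L (lborel \<Otimes>\<^sub>M lborel) f"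
    by (simp add: set_lebesgue_integral_def f_def[abs_def] lborel_prod)
  also have "\<dots> = (LINT t|lborel. indicator {s<..T} t * (LINT x|lborel. \<omega> t x * (u t x \<bullet> grad \<phi> x)))"
    using lborel_pair.integral_fst'[OF fint] unfolding fslice ..
  finally show "(LINT x|lborel. \<omega> T x * \<phi> x) - (LINT x|lborel. \<omega> s x * \<phi> x) =
      (LINT t|lborel. indicator {s<..T} t * (LINT x|lborel. \<omega> t x * (u t x \<bullet> grad \<phi> x)))"
    using \<open>_ = (LINT p:{s<..T} \<times> UNIV|lborel. g p)\<close> by simp
qed

section \<open>Energy estimate for a smooth solution and a competitor\<close>

lemma biot_savart_diff:
  assumes "L1_Linf_bound C w" "L1_Linf_bound D w'"
  shows "biot_savart (\<lambda>x. w x - w' x) x = biot_savart w x - biot_savart w' x"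
  by (simp add: biot_savart_eq[OF L1_Linf_bound_diff[OF assms]] biot_savart_eq[OF assms(1)] biot_savart_eq[OF assms(2)]
      newt_L1_Linf_diff[OF assms] vec_eq_iff forall_2 vector_2)

lemma test_field_uminus: "test_field h \<Longrightarrow> test_field (\<lambda>x. - h x)"
  unfolding test_field_def
proof
  fix i assume "\<forall>i. test_function (\<lambda>x. h x $ i)"
  then show "test_function (\<lambda>x. (- h x) $ i)"
    using test_function_mult(1)[OF smooth_const[of "-1"], of "\<lambda>x. h x $ i"] by simp
qed

text \<open>\<open>\<omega>\<close> is the smooth solution: its velocity is a test field with
  gradient bound \<open>L\<close> uniform in time. \<open>\<omega>'\<close> is an arbitrary
  competitor with the same data; about its velocity no more is known than what the class
  provides.\<close>

locale weak_strong =
  fixes w0 :: "real^2 \<Rightarrow> real" and \<omega> \<omega>' :: "real \<Rightarrow> real^2 \<Rightarrow> real" and C L :: real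
  assumes bound: "\<And>t. t \<ge> 0 \<Longrightarrow> L1_Linf_bound C (\<omega> t)" "\<And>t. t \<ge> 0 \<Longrightarrow> L1_Linf_bound C (\<omega>' t)"
    and weak: "weak_vorticity_eq w0 \<omega> (\<lambda>t. biot_savart (\<omega> t))" "weak_vorticity_eq w0 \<omega>' (\<lambda>t. biot_savart (\<omega>' t))"
    and strong: "\<And>t. t \<ge> 0 \<Longrightarrow> test_field (biot_savart (\<omega> t))"
    and lip: "\<And>t i j x. t \<ge> 0 \<Longrightarrow> \<bar>partial j (\<lambda>x. biot_savart (\<omega> t) x $ i) x\<bar> \<le> L"
begin

definition "w t x = \<omega>' t x - \<omega> t x"

definition "v t = biot_savart (w t)"

text \<open>The difference of the two fluxes: \<open>w\<close> satisfies
  \<open>\<partial>\<^sub>t w = - div F\<close> in the weak sense.\<close>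

definition "F t x = \<omega>' t x *\<^sub>R biot_savart (\<omega>' t) x - \<omega> t x *\<^sub>R biot_savart (\<omega> t) x"

text \<open>The product of \<open>2 * C\<close>, which bounds the two vorticities together in L^1
  and almost everywhere, and the sup bound of \<open>biot_savart_bound\<close>.\<close>

definition "M = 2 * C * (2 * C * (kern_mass 1 + 1))"

lemma w_bound: "t \<ge> 0 \<Longrightarrow> L1_Linf_bound (C + C) (w t)"
  unfolding w_def[abs_def] by (intro L1_Linf_bound_diff bound)

lemma v_eq: "t \<ge> 0 \<Longrightarrow> v t x = biot_savart (\<omega>' t) x - biot_savart (\<omega> t) x"
  unfolding v_def w_def[abs_def] by (rule biot_savart_diff[OF bound(2) bound(1)])

lemma v_continuous: "t \<ge> 0 \<Longrightarrow> continuous_on S (v t)"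
  unfolding v_def by (rule biot_savart_continuous[OF w_bound])

lemma C_nonneg: "C \<ge> 0"
  using L1_Linf_boundD(4)[OF bound(1)[of 0]] by simp

lemma M_nonneg: "M \<ge> 0"
  using C_nonneg kern_mass_nonneg[of 1] by (simp add: M_def)

lemma L_nonneg: "L \<ge> 0"
  using order_trans[OF abs_ge_zero lip[of 0]] by simp

lemma F_measurable: "t \<ge> 0 \<Longrightarrow> F t \<in> borel_measurable borel"
  unfolding F_def[abs_def]
  by (intro borel_measurable_diff borel_measurable_scaleR L1_Linf_boundD(5)[OF bound(1)]
      L1_Linf_boundD(5)[OF bound(2)] borel_measurable_continuous_onI biot_savart_continuous[OF bound(1)]
      biot_savart_continuous[OF bound(2)])

lemma F_bounds:
  assumes t: "t \<ge> 0"
  shows "integrable lborel (\<lambda>x. norm (F t x))" "(LINT x|lborel. norm (F t x)) \<le> M" "L2_field (F t)" "L2_size (F t) \<le> M"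
proof -
  define U where "U = 2 * C * (kern_mass 1 + 1)"
  have U: "U \<ge> 0" using C_nonneg kern_mass_nonneg[of 1] by (simp add: U_def)
  note b = L1_Linf_boundD[OF bound(1)[OF t]] and b' = L1_Linf_boundD[OF bound(2)[OF t]]
  have le: "norm (F t x) \<le> (\<bar>\<omega>' t x\<bar> + \<bar>\<omega> t x\<bar>) * U" for x
  proof -
    have "norm (F t x) \<le> \<bar>\<omega>' t x\<bar> * norm (biot_savart (\<omega>' t) x) + \<bar>\<omega> t x\<bar> * norm (biot_savart (\<omega> t) x)"
      unfolding F_def using norm_triangle_ineq4 by (metis norm_scaleR)
    also have "\<dots> \<le> \<bar>\<omega>' t x\<bar> * U + \<bar>\<omega> t x\<bar> * U"
      unfolding U_def by (intro add_mono mult_left_mono biot_savart_bound bound t) auto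
    finally show ?thesis by (simp add: distrib_right)
  qed
  have i: "integrable lborel (\<lambda>x. (\<bar>\<omega>' t x\<bar> + \<bar>\<omega> t x\<bar>) * U)"
    using b(1) b'(1) by simp
  note [measurable] = F_measurable[OF t]
  show int: "integrable lborel (\<lambda>x. norm (F t x))"
    using i by (rule Bochner_Integration.integrable_bound) (auto intro!: AE_I2 order_trans[OF le abs_ge_self])
  have "(LINT x|lborel. norm (F t x)) \<le> (LINT x|lborel. (\<bar>\<omega>' t x\<bar> + \<bar>\<omega> t x\<bar>) * U)"
    using int i le by (rule integral_mono)
  also have "\<dots> = ((LINT x|lborel. \<bar>\<omega>' t x\<bar>) + (LINT x|lborel. \<bar>\<omega> t x\<bar>)) * U"
    using b(1) b'(1) by simp
  also have "\<dots> \<le> (C + C) * U"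
    using b(3) b'(3) U by (intro mult_right_mono add_mono) auto
  finally show L1: "(LINT x|lborel. norm (F t x)) \<le> M"
    by (simp add: M_def U_def)
  \<comment> \<open>The almost everywhere bound by \<open>M\<close> and the L^1 bound by
    \<open>M\<close> combine to an L^2 bound with the same constant.\<close>
  have ae: "AE x in lborel. (norm (F t x))\<^sup>2 \<le> M * norm (F t x)"
    using b(2) b'(2)
  proof eventually_elim
    case (elim x)
    have "(\<bar>\<omega>' t x\<bar> + \<bar>\<omega> t x\<bar>) * U \<le> (C + C) * U"
      using elim U by (intro mult_right_mono) auto
    also have "(C + C) * U = M"
      by (simp add: M_def U_def)
    finally have "norm (F t x) \<le> M"
      using le[of x] by simp
    then show ?case
      unfolding power2_eq_square by (intro mult_right_mono) auto
  qed
  have i2: "integrable lborel (\<lambda>x. M * norm (F t x))"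
    using int by simp
  then have sq: "integrable lborel (\<lambda>x. (norm (F t x))\<^sup>2)"
    by (rule Bochner_Integration.integrable_bound)
      (use ae M_nonneg in \<open>auto elim!: eventually_mono\<close>)
  then show "L2_field (F t)"
    by (simp add: L2_field_def F_measurable t)
  have "(LINT x|lborel. (norm (F t x))\<^sup>2) \<le> (LINT x|lborel. M * norm (F t x))"
    using sq i2 ae by (rule integral_mono_AE)
  also have "\<dots> \<le> M * M"
    using L1 M_nonneg by (simp add: mult_left_mono)
  finally show "L2_size (F t) \<le> M"
    using M_nonneg unfolding L2_size_def by (intro real_le_lsqrt) (simp_all add: power2_eq_square)
qed

lemma F_inner_integrable:
  assumes t: "t \<ge> 0" and G: "G \<in> borel_measurable borel" "\<And>x. norm (G x) \<le> B"
  shows "integrable lborel (\<lambda>x. F t x \<bullet> G x)" "\<bar>LINT x|lborel. F t x \<bullet> G x\<bar> \<le> B * M"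
proof -
  note [measurable] = F_measurable[OF t] G(1)
  have B: "B \<ge> 0" using order_trans[OF norm_ge_zero G(2)] .
  have le: "\<bar>F t x \<bullet> G x\<bar> \<le> B * norm (F t x)" for x
    using order_trans[OF Cauchy_Schwarz_ineq2 mult_left_mono[OF G(2) norm_ge_zero]] by (simp add: mult.commute)
  have i: "integrable lborel (\<lambda>x. B * norm (F t x))"
    using F_bounds(1)[OF t] by simp
  then show int: "integrable lborel (\<lambda>x. F t x \<bullet> G x)"
    by (rule Bochner_Integration.integrable_bound) (auto intro!: AE_I2 order_trans[OF le abs_ge_self])
  have "\<bar>LINT x|lborel. F t x \<bullet> G x\<bar> \<le> (LINT x|lborel. B * norm (F t x))"
    using int i le by (rule integral_abs_bound_integral)
  also have "\<dots> \<le> B * M"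
    using F_bounds(2)[OF t] B by (simp add: mult_left_mono)
  finally show "\<bar>LINT x|lborel. F t x \<bullet> G x\<bar> \<le> B * M" .
qed

lemma vorticity_mult_integrable:
  assumes w: "L1_Linf_bound D y" and g: "g \<in> borel_measurable borel" "\<And>x. \<bar>g x\<bar> \<le> c"
  shows "integrable lborel (\<lambda>x. y x * g x)"
proof (rule Bochner_Integration.integrable_bound)
  note [measurable] = L1_Linf_boundD(5)[OF w] g(1)
  show "integrable lborel (\<lambda>x. c * \<bar>y x\<bar>)" using L1_Linf_boundD(1)[OF w] by simp
  show "(\<lambda>x. y x * g x) \<in> borel_measurable lborel" by measurable
  show "AE x in lborel. norm (y x * g x) \<le> norm (c * \<bar>y x\<bar>)"
    using g(2) by (auto simp: abs_mult mult.commute[of c] intro!: AE_I2 mult_left_mono order_trans[OF g(2) abs_ge_self])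
qed

lemma increment_test:
  assumes s: "0 \<le> s" "s \<le> T" and \<phi>: "test_function \<phi>"
    and B: "\<And>t. s < t \<Longrightarrow> t \<le> T \<Longrightarrow> (LINT x|lborel. F t x \<bullet> grad \<phi> x) \<le> B"
  shows "(LINT x|lborel. w T x * \<phi> x) - (LINT x|lborel. w s x * \<phi> x) \<le> (T - s) * B"
proof -
  have T: "T \<ge> 0" using s by simp
  obtain P where P: "P > 0" "\<And>x. \<bar>\<phi> x\<bar> \<le> P" using test_function_boundedE[OF \<phi>] by metis
  have gc: "continuous_on UNIV (grad \<phi>)" by (intro grad_continuous test_function_smooth \<phi>)
  have int: "integrable lborel (\<lambda>x. \<omega> t x * \<phi> x)" "integrable lborel (\<lambda>x. \<omega>' t x * \<phi> x)" if "t \<ge> 0" for t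
    by (rule vorticity_mult_integrable[OF bound(1)[OF that] test_function_measurable[OF \<phi>] P(2)],
        rule vorticity_mult_integrable[OF bound(2)[OF that] test_function_measurable[OF \<phi>] P(2)])
  have wd: "(LINT x|lborel. w t x * \<phi> x) = (LINT x|lborel. \<omega>' t x * \<phi> x) - (LINT x|lborel. \<omega> t x * \<phi> x)" if "t \<ge> 0" for t
    using int[OF that] by (simp add: w_def left_diff_distrib)
  define S where "S t = (LINT x|lborel. \<omega> t x * (biot_savart (\<omega> t) x \<bullet> grad \<phi> x))" for t
  define S' where "S' t = (LINT x|lborel. \<omega>' t x * (biot_savart (\<omega>' t) x \<bullet> grad \<phi> x))" for t
  note inc = weak_vorticity_increment[OF weak(1) \<phi> s, folded S_def]
    and inc' = weak_vorticity_increment[OF weak(2) \<phi> s, folded S'_def]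
  have diff: "S' t - S t = (LINT x|lborel. F t x \<bullet> grad \<phi> x)" if t: "t \<ge> 0" for t
  proof -
    obtain R where "\<And>x v. norm x \<ge> R \<Longrightarrow> frechet_derivative \<phi> (at x) v = 0"
      using test_function_supportE[OF \<phi>] by metis
    then have g0: "grad \<phi> x = 0" if "norm x \<ge> R" for x
      using that by (simp add: vec_eq_iff partial_def)
    have "integrable lborel (\<lambda>x. y x * (biot_savart y x \<bullet> grad \<phi> x))" if y: "L1_Linf_bound C y" for y
    proof -
      have c: "continuous_on UNIV (\<lambda>x. biot_savart y x \<bullet> grad \<phi> x)"
        by (intro continuous_intros biot_savart_continuous[OF y] gc)
      obtain c where "\<And>x. norm (biot_savart y x \<bullet> grad \<phi> x) \<le> c"
        using continuous_cs_bounded[OF c, of R] g0 by (metis inner_zero_right)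
      then show ?thesis
        by (intro vorticity_mult_integrable[OF y borel_measurable_continuous_onI[OF c]]) simp
    qed
    from this[OF bound(1)[OF t]] this[OF bound(2)[OF t]] show ?thesis
      unfolding S_def S'_def F_def
      by (subst Bochner_Integration.integral_diff[symmetric]) (simp_all add: inner_diff_left)
  qed
  have "(LINT x|lborel. w T x * \<phi> x) - (LINT x|lborel. w s x * \<phi> x) =
      (LINT t|lborel. indicator {s<..T} t * S' t - indicator {s<..T} t * S t)"
    using inc inc' wd[OF T] wd[OF s(1)] by simp
  also have "\<dots> \<le> (LINT t|lborel. indicator {s<..T} t * B)"
  proof (rule integral_mono)
    show "integrable lborel (\<lambda>t. indicator {s<..T} t * S' t - indicator {s<..T} t * S t)"
      using inc(1) inc'(1) by simp
    have "integrable lborel (indicator {s<..T} :: real \<Rightarrow> real)"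
      using s by (intro integrable_real_indicator) auto
    then show "integrable lborel (\<lambda>t. indicator {s<..T} t * B)"
      by simp
    show "indicator {s<..T} t * S' t - indicator {s<..T} t * S t \<le> indicator {s<..T} t * B" for t
      using B[of t] diff[of t] s by (auto simp: indicator_def)
  qed
  also have "\<dots> = (T - s) * B" using s by simp
  finally show ?thesis .
qed

text \<open>Testing the velocity with \<open>h\<close> is testing the vorticity with
  \<open>- stream_pot h\<close>, whence the order of \<open>s\<close> and \<open>T\<close>. The
  potential is multiplied by a cutoff; the resulting change of the gradient is uniformly of order
  \<open>1 / m\<close>, and the flux is integrable.\<close>

lemma increment_field:
  assumes s: "0 \<le> s" "s \<le> T" and h: "test_field h"
    and B: "\<And>t. s < t \<Longrightarrow> t \<le> T \<Longrightarrow> (LINT x|lborel. F t x \<bullet> grad (stream_pot h) x) \<le> B"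
  shows "(LINT x|lborel. v s x \<bullet> h x) - (LINT x|lborel. v T x \<bullet> h x) \<le> (T - s) * B"
proof -
  have T: "T \<ge> 0" using s by simp
  define a where "a = stream_pot h"
  obtain b D where hb: "smooth (stream_pot h)" "smooth b" "D > 0"
    "\<And>x. \<bar>stream_pot h x\<bar> \<le> D / (1 + norm x)" "\<And>x. \<bar>b x\<bar> \<le> D / (1 + norm x)"
    "\<And>x j. \<bar>partial j (stream_pot h) x\<bar> \<le> D / (1 + norm x)" "\<And>x j. \<bar>partial j b x\<bar> \<le> D / (1 + norm x)"
    "\<And>x. h x = grad b x + perp (grad (stream_pot h) x)"
    using helmholtz[OF h] by blast
  obtain K where K: "K > 0" "\<And>j m x. m > 0 \<Longrightarrow> \<bar>partial j (cutoff m) x\<bar> \<le> K / m"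
    "\<And>j m x. m > 0 \<Longrightarrow> norm x < m \<Longrightarrow> partial j (cutoff m) x = 0"
    "\<And>j m x. m > 0 \<Longrightarrow> norm x > 2 * m \<Longrightarrow> partial j (cutoff m) x = 0"
    using partial_cutoff_bound by blast
  have sa: "smooth a" using hb(1) by (simp add: a_def)
  have Dle: "D / (1 + norm x) \<le> D" for x :: "real^2"
    using hb(3) divide_left_mono[of 1 "1 + norm x" D] by (simp add: add_pos_nonneg)
  have aD: "\<bar>a x\<bar> \<le> D" "\<bar>partial j a x\<bar> \<le> D" for x j
    using hb(4)[of x] hb(6)[of j x] Dle[of x] unfolding a_def by linarith+
  have ga: "norm (grad a x) \<le> 2 * D" for x
    using norm_real2_le[of "grad a x"] aD(2)[of 1 x] aD(2)[of 2 x] by simp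
  have ia: "integrable lborel (\<lambda>x. F t x \<bullet> grad a x)" if "t \<ge> 0" for t
    by (rule F_inner_integrable(1)[OF that borel_measurable_continuous_onI[OF grad_continuous[OF sa]] ga])
  have key: "(LINT x|lborel. w T x * (cutoff (real (Suc n)) x * a x)) - (LINT x|lborel. w s x * (cutoff (real (Suc n)) x * a x)) \<le>
      (T - s) * (B + (2 * D + 2 * D * K) * inverse (real (Suc n)) * M)" for n
  proof -
    define m where "m = real (Suc n)"
    have m: "m > 0" "m \<ge> 1" by (auto simp: m_def)
    have sc: "smooth (cutoff m)" using test_function_cutoff[OF m(1)] by (rule test_function_smooth)
    \<comment> \<open>The error of the cutoff in the gradient. It vanishes for
      \<open>norm x < m\<close>, and beyond that the potential and its gradient are at most
      \<open>D / m\<close>.\<close>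
    define G where "G x = grad (\<lambda>x. cutoff m x * a x) x - grad a x" for x
    have tf: "test_function (\<lambda>x. cutoff m x * a x)"
      by (intro test_function_mult(2) test_function_cutoff m sa)
    have gradeq: "grad (\<lambda>x. cutoff m x * a x) x = cutoff m x *\<^sub>R grad a x + a x *\<^sub>R grad (cutoff m) x" for x
    proof -
      have "partial j (\<lambda>x. cutoff m x * a x) x = cutoff m x * partial j a x + a x * partial j (cutoff m) x" for j
        unfolding partial_mult[OF sc sa] by simp
      then show ?thesis by (simp add: vec_eq_iff)
    qed
    have Gb: "norm (G x) \<le> (2 * D + 2 * D * K) * inverse m" for x
    proof (cases "norm x < m")
      case True
      then have "G x = 0"
        using K(3)[OF m(1) True] cutoff_eq_1[of x m] m by (simp add: G_def gradeq vec_eq_iff)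
      then show ?thesis using hb(3) K(1) m by simp
    next
      case False
      have Dm: "D / (1 + norm x) \<le> D / m"
        using False hb(3) m by (intro divide_left_mono mult_pos_pos) auto
      have p1: "\<bar>(cutoff m x - 1) * partial j a x\<bar> \<le> 1 * (D / m)" for j
        unfolding abs_mult using cutoff_bounds[of m x] hb(6)[of j x] Dm hb(3) m
        by (intro mult_mono) (auto simp: a_def)
      have p2: "\<bar>a x * partial j (cutoff m) x\<bar> \<le> D / m * K" for j
      proof -
        have "K / m \<le> K" using K(1) m by (simp add: field_simps mult_left_mono)
        then show ?thesis
          unfolding abs_mult using hb(4)[of x] Dm K(2)[OF m(1), of j x] hb(3) m K(1)
          by (intro mult_mono) (auto simp: a_def)
      qed
      have "G x $ j = (cutoff m x - 1) * partial j a x + a x * partial j (cutoff m) x" for j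
        unfolding G_def gradeq by (simp add: algebra_simps)
      then have "\<bar>G x $ j\<bar> \<le> D / m + D / m * K" for j
        using p1[of j] p2[of j] by simp
      then have "norm (G x) \<le> (D / m + D / m * K) + (D / m + D / m * K)"
        by (intro order_trans[OF norm_real2_le add_mono])
      then show ?thesis by (simp add: divide_inverse algebra_simps)
    qed
    have Gm: "G \<in> borel_measurable borel"
      unfolding G_def[abs_def]
      by (intro borel_measurable_continuous_onI continuous_intros grad_continuous sa test_function_smooth tf)
    have "(LINT x|lborel. F t x \<bullet> grad (\<lambda>x. cutoff m x * a x) x) \<le> B + (2 * D + 2 * D * K) * inverse m * M"
      if t: "s < t" "t \<le> T" for t
    proof -
      have t0: "t \<ge> 0" using t s by simp
      have "(\<lambda>x. F t x \<bullet> grad (\<lambda>x. cutoff m x * a x) x) = (\<lambda>x. F t x \<bullet> grad a x + F t x \<bullet> G x)"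
        by (simp add: G_def inner_diff_right)
      then have "(LINT x|lborel. F t x \<bullet> grad (\<lambda>x. cutoff m x * a x) x) =
          (LINT x|lborel. F t x \<bullet> grad a x) + (LINT x|lborel. F t x \<bullet> G x)"
        using ia[OF t0] F_inner_integrable(1)[OF t0 Gm Gb] by simp
      also have "\<dots> \<le> B + (2 * D + 2 * D * K) * inverse m * M"
        using B[OF t] F_inner_integrable(2)[OF t0 Gm Gb] by (simp add: a_def)
      finally show ?thesis .
    qed
    from increment_test[OF s tf this] show ?thesis
      by (simp add: m_def del: of_nat_Suc)
  qed
  have wa: "integrable lborel (\<lambda>x. w t x * a x)" "(LINT x|lborel. v t x \<bullet> h x) = - (LINT x|lborel. w t x * a x)"
    if "t \<ge> 0" for t
    using biot_savart_inner[OF w_bound[OF that] h] by (simp_all add: a_def v_def)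
  have lim: "(\<lambda>n. LINT x|lborel. w t x * (cutoff (real (Suc n)) x * a x)) \<longlonglongrightarrow> (LINT x|lborel. w t x * a x)" if "t \<ge> 0" for t
    using cutoff_integral_tendsto(1)[OF wa(1)[OF that]] by (simp only: mult.left_commute)
  have "(\<lambda>n. (T - s) * (B + (2 * D + 2 * D * K) * inverse (real (Suc n)) * M)) \<longlonglongrightarrow>
      (T - s) * (B + (2 * D + 2 * D * K) * 0 * M)"
    by (intro tendsto_intros LIMSEQ_inverse_real_of_nat)
  from LIMSEQ_le[OF tendsto_diff[OF lim[OF T] lim[OF s(1)]] this] key
  have "(LINT x|lborel. w T x * a x) - (LINT x|lborel. w s x * a x) \<le> (T - s) * B"
    by simp
  then show ?thesis
    using wa(2)[OF T] wa(2)[OF s(1)] by simp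
qed

text \<open>Duality produces the square integrability of the increment, which is not assumed for
  \<open>v\<close> at either time. The energy bound on \<open>stream_pot\<close> and the L^2 bound
  on the flux give the constant; as \<open>v\<close> vanishes initially, \<open>v t\<close> itself
  is in L^2.\<close>

lemma v_lipschitz:
  assumes s: "0 \<le> s" "s \<le> T"
  shows "L2_field (\<lambda>x. v T x - v s x)" "L2_size (\<lambda>x. v T x - v s x) \<le> M * (T - s)"
proof -
  have T: "T \<ge> 0" using s by simp
  have c: "continuous_on UNIV (\<lambda>x. v T x - v s x)"
    by (intro continuous_intros v_continuous T s)
  have one: "(LINT x|lborel. v s x \<bullet> h x) - (LINT x|lborel. v T x \<bullet> h x) \<le> (T - s) * (M * L2_size h)"
    if h: "test_field h" for h
  proof (rule increment_field[OF s h])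
    fix t assume "s < t" "t \<le> T"
    then have t: "t \<ge> 0" using s by simp
    have "(LINT x|lborel. F t x \<bullet> grad (stream_pot h) x) \<le> L2_size (F t) * L2_size (grad (stream_pot h))"
      using L2_cauchy_schwarz[OF F_bounds(3)[OF t] stream_pot_energy(1)[OF h]] by simp
    also have "\<dots> \<le> M * L2_size h"
      using F_bounds(4)[OF t] stream_pot_energy(2)[OF h] M_nonneg by (intro mult_mono L2_size_nonneg)
    finally show "(LINT x|lborel. F t x \<bullet> grad (stream_pot h) x) \<le> M * L2_size h" .
  qed
  have dual: "\<bar>LINT x|lborel. (v T x - v s x) \<bullet> h x\<bar> \<le> M * (T - s) * L2_size h" if h: "test_field h" for h
  proof -
    have vh: "integrable lborel (\<lambda>x. v t x \<bullet> h x)" if "t \<ge> 0" for t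
      unfolding v_def by (rule biot_savart_inner(3)[OF w_bound[OF that] h])
    have "L2_size (\<lambda>x. - h x) = L2_size h" by (simp add: L2_size_def)
    then show ?thesis
      using one[OF h] one[OF test_field_uminus[OF h]] vh[OF T] vh[OF s(1)]
      by (simp add: inner_diff_left abs_le_iff algebra_simps)
  qed
  show "L2_field (\<lambda>x. v T x - v s x)" "L2_size (\<lambda>x. v T x - v s x) \<le> M * (T - s)"
    using L2_field_by_duality[OF c _ dual] M_nonneg s by auto
qed

lemma v_initial: "v 0 x = 0"
proof -
  have "AE x in lborel. w 0 x = 0"
    using weak unfolding weak_vorticity_eq_def w_def by (auto elim!: eventually_elim2)
  then have "newt i (w 0) x = 0" for i
    unfolding newt_def by (intro integral_eq_zero_AE) (auto elim!: eventually_mono)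
  then show ?thesis
    using biot_savart_eq[OF w_bound[of 0]] by (simp add: v_def vec_eq_iff forall_2 vector_2)
qed

lemma v_L2: "t \<ge> 0 \<Longrightarrow> L2_field (v t)"
  using v_lipschitz(1)[of 0 t] by (simp add: v_initial)

text \<open>The flux difference is \<open>w\<close> times the smooth velocity plus
  \<open>\<omega>'\<close> times \<open>v\<close>. The second part is orthogonal to
  \<open>perp v\<close>, so the rough vorticity drops out and the stress estimate handles the
  rest.\<close>

lemma F_perp_v:
  assumes t: "t \<ge> 0"
  shows "(LINT x|lborel. F t x \<bullet> perp (v t x)) \<le> 2 * L * (L2_size (v t))\<^sup>2"
proof -
  have "F t x \<bullet> perp (v t x) = w t x * (biot_savart (\<omega> t) x \<bullet> perp (v t x))" for x
  proof -
    have "F t x = w t x *\<^sub>R biot_savart (\<omega> t) x + \<omega>' t x *\<^sub>R v t x"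
      by (simp add: F_def w_def v_eq[OF t] algebra_simps)
    moreover have "v t x \<bullet> perp (v t x) = 0" by (simp add: inner_real2)
    ultimately show ?thesis by (simp add: inner_add_left)
  qed
  then show ?thesis
    using stress_bound[OF w_bound[OF t] _ strong[OF t] lip[OF t]] v_L2[OF t] by (simp add: v_def)
qed

lemma perp_L2: "L2_field G \<Longrightarrow> L2_field (\<lambda>x. perp (G x))"
  using borel_measurable_continuous_onI[OF perp_continuous[OF continuous_on_id]]
  by (auto simp: L2_field_def intro: measurable_compose)

lemma perp_size: "L2_size (\<lambda>x. perp (G x)) = L2_size G"
  by (simp add: L2_size_def)

text \<open>The difference of the squared norms is the pairing of \<open>v T - v s\<close> with
  \<open>v T + v s\<close>. The sum does not depend on the intermediate time, so it can be
  approximated by one test field; on each slice it is \<open>2 * v t\<close> up to an error of order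
  \<open>d\<close>.\<close>

lemma energy_step:
  assumes s: "0 \<le> s" "s \<le> T"
  defines "d \<equiv> T - s"
  shows "(L2_size (v T))\<^sup>2 - (L2_size (v s))\<^sup>2 \<le> d * (4 * L * (L2_size (v s) + M * d)\<^sup>2 + M\<^sup>2 * d)"
proof -
  have T: "T \<ge> 0" and d: "d \<ge> 0" using s by (auto simp: d_def)
  define V where "V x = v T x + v s x" for x
  define Dv where "Dv x = v T x - v s x" for x
  have V: "L2_field V" "continuous_on UNIV V"
    unfolding V_def[abs_def] by (intro L2_field_add v_L2 T s continuous_intros v_continuous)+
  have DvL: "L2_field Dv" "L2_size Dv \<le> M * d"
    using v_lipschitz[OF s] by (simp_all add: Dv_def[abs_def] d_def)
  define Q where "Q = 4 * L * (L2_size (v s) + M * d)\<^sup>2 + M\<^sup>2 * d"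
  have slice: "(LINT x|lborel. F t x \<bullet> perp (V x)) \<le> Q" if t: "s < t" "t \<le> T" for t
  proof -
    have t0: "t \<ge> 0" using t s by simp
    note vt = v_L2[OF t0]
    have d1: "L2_field (\<lambda>x. v T x - v t x)" "L2_size (\<lambda>x. v T x - v t x) \<le> M * (T - t)"
      using v_lipschitz[OF t0] t by auto
    have d2: "L2_field (\<lambda>x. v t x - v s x)" "L2_size (\<lambda>x. v t x - v s x) \<le> M * (t - s)"
      using v_lipschitz[OF s(1), of t] t by auto
    \<comment> \<open>\<open>V\<close> equals \<open>2 * v t\<close> plus the increment after
      \<open>t\<close> minus the increment before \<open>t\<close>; the lengths \<open>T - t\<close>
      and \<open>t - s\<close> add up to \<open>d\<close>, which gives the term
      \<open>M\<^sup>2 * d\<close>.\<close>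
    have eq: "F t x \<bullet> perp (V x) = 2 * (F t x \<bullet> perp (v t x)) + F t x \<bullet> perp (v T x - v t x) - F t x \<bullet> perp (v t x - v s x)" for x
      by (simp add: V_def inner_real2 algebra_simps)
    note Fi = L2_field_inner[OF F_bounds(3)[OF t0] perp_L2]
    have "(LINT x|lborel. F t x \<bullet> perp (V x)) = 2 * (LINT x|lborel. F t x \<bullet> perp (v t x)) +
        (LINT x|lborel. F t x \<bullet> perp (v T x - v t x)) - (LINT x|lborel. F t x \<bullet> perp (v t x - v s x))"
      unfolding eq using Fi[OF vt] Fi[OF d1(1)] Fi[OF d2(1)] by simp
    moreover have "\<bar>LINT x|lborel. F t x \<bullet> perp (v T x - v t x)\<bar> \<le> M * (M * (T - t))"
      using L2_cauchy_schwarz[OF F_bounds(3)[OF t0] perp_L2[OF d1(1)]] mult_mono[OF F_bounds(4)[OF t0] d1(2)] M_nonneg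
      by (simp add: perp_size L2_size_nonneg)
    moreover have "\<bar>LINT x|lborel. F t x \<bullet> perp (v t x - v s x)\<bar> \<le> M * (M * (t - s))"
      using L2_cauchy_schwarz[OF F_bounds(3)[OF t0] perp_L2[OF d2(1)]] mult_mono[OF F_bounds(4)[OF t0] d2(2)] M_nonneg
      by (simp add: perp_size L2_size_nonneg)
    moreover have "(L2_size (v t))\<^sup>2 \<le> (L2_size (v s) + M * d)\<^sup>2"
    proof (rule power_mono)
      have "L2_size (v t) \<le> L2_size (v s) + L2_size (\<lambda>x. v t x - v s x)"
        using L2_triangle[OF v_L2[OF s(1)] d2(1)] by simp
      also have "\<dots> \<le> L2_size (v s) + M * d"
        using d2(2) M_nonneg t mult_left_mono[of "t - s" d M] by (simp add: d_def)
      finally show "L2_size (v t) \<le> L2_size (v s) + M * d" .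
    qed (rule L2_size_nonneg)
    then have "2 * L * (L2_size (v t))\<^sup>2 \<le> 2 * L * (L2_size (v s) + M * d)\<^sup>2"
      using L_nonneg by (intro mult_left_mono) auto
    ultimately show ?thesis
      using F_perp_v[OF t0] by (simp add: Q_def d_def power2_eq_square algebra_simps)
  qed
  have ineq: "(L2_size (v T))\<^sup>2 - (L2_size (v s))\<^sup>2 \<le> d * Q + e * (2 * M * d)" if e: "e > 0" for e
  proof -
    obtain h where h: "test_field h" "L2_size (\<lambda>x. h x - V x) \<le> e"
      using test_field_dense[OF V(2,1) e] by metis
    define P where "P x = perp (grad (stream_pot h) x)" for x
    have P: "L2_field P" "L2_size P \<le> L2_size h"
      unfolding P_def using perp_L2[OF stream_pot_energy(1)[OF h(1)]] stream_pot_energy(2)[OF h(1)]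
      by (simp_all add: perp_size)
    have hL: "L2_field h" "L2_field (\<lambda>x. h x - V x)"
      by (intro L2_field_diff test_field_L2 h V)+
    have PV: "L2_field (\<lambda>x. P x - V x)" by (intro L2_field_diff P V)
    have "(LINT x|lborel. v t x \<bullet> h x) = (LINT x|lborel. v t x \<bullet> P x)" if "t \<ge> 0" for t
      using L2_biot_savart_helmholtz[OF w_bound[OF that] _ h(1)] v_L2[OF that] by (simp add: v_def P_def)
    then have Vh: "(LINT x|lborel. h x \<bullet> V x) = (LINT x|lborel. P x \<bullet> V x)"
      using L2_field_inner[OF v_L2[OF T] hL(1)] L2_field_inner[OF v_L2[OF s(1)] hL(1)]
        L2_field_inner[OF v_L2[OF T] P(1)] L2_field_inner[OF v_L2[OF s(1)] P(1)] T s
      by (simp add: V_def inner_add_right inner_commute)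
    \<comment> \<open>The projection \<open>P\<close> has the same inner product with
      \<open>V\<close> as \<open>h\<close> has, and it is not longer than \<open>h\<close>;
      expanding the squares shows that it approximates \<open>V\<close> at least as well.\<close>
    have "(L2_size (\<lambda>x. P x - V x))\<^sup>2 \<le> (L2_size (\<lambda>x. h x - V x))\<^sup>2"
      using L2_size_combination[OF P(1) V(1), of "-1"] L2_size_combination[OF hL(1) V(1), of "-1"] Vh
        power_mono[OF P(2) L2_size_nonneg, of 2]
      by (simp add: L2_size_power2)
    then have PVe: "L2_size (\<lambda>x. P x - V x) \<le> e"
      using h(2) L2_size_nonneg by (meson order_trans power2_le_imp_le)
    \<comment> \<open>\<open>increment_field\<close> bounds the value at \<open>s\<close> minus that
      at \<open>T\<close>, so \<open>- h\<close> is inserted; the gradient of its potential is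
      \<open>perp (P x)\<close>.\<close>
    have "(LINT x|lborel. v s x \<bullet> - h x) - (LINT x|lborel. v T x \<bullet> - h x) \<le> (T - s) * (Q + M * e)"
    proof (rule increment_field[OF s test_field_uminus[OF h(1)]])
      fix t assume t: "s < t" "t \<le> T"
      then have t0: "t \<ge> 0" using s by simp
      have "stream_pot (\<lambda>x. - h x) = (\<lambda>x. - stream_pot h x)"
        by (simp add: stream_pot_def newt_def fun_eq_iff)
      moreover have "partial j (\<lambda>x. - stream_pot h x) x = - partial j (stream_pot h) x" for j x
        using partial_diff[OF smooth_const[of 0], of "stream_pot h" j x] helmholtz[OF h(1)] by fastforce
      ultimately have "grad (stream_pot (\<lambda>x. - h x)) x = perp (V x) + perp (P x - V x)" for x
        by (simp add: vec_eq_iff forall_2 P_def)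
      then have "(LINT x|lborel. F t x \<bullet> grad (stream_pot (\<lambda>x. - h x)) x) =
          (LINT x|lborel. F t x \<bullet> perp (V x)) + (LINT x|lborel. F t x \<bullet> perp (P x - V x))"
        using L2_field_inner[OF F_bounds(3)[OF t0] perp_L2[OF V(1)]] L2_field_inner[OF F_bounds(3)[OF t0] perp_L2[OF PV]]
        by (simp add: inner_add_right)
      moreover have "\<bar>LINT x|lborel. F t x \<bullet> perp (P x - V x)\<bar> \<le> M * e"
        using L2_cauchy_schwarz[OF F_bounds(3)[OF t0] perp_L2[OF PV]] mult_mono[OF F_bounds(4)[OF t0] PVe] M_nonneg
        by (simp add: perp_size L2_size_nonneg)
      ultimately show "(LINT x|lborel. F t x \<bullet> grad (stream_pot (\<lambda>x. - h x)) x) \<le> Q + M * e"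
        using slice[OF t] by linarith
    qed
    then have 1: "(LINT x|lborel. v T x \<bullet> h x) - (LINT x|lborel. v s x \<bullet> h x) \<le> d * (Q + M * e)"
      by (simp add: d_def)
    have "(LINT x|lborel. Dv x \<bullet> h x) = (LINT x|lborel. v T x \<bullet> h x) - (LINT x|lborel. v s x \<bullet> h x)"
      using L2_field_inner[OF v_L2[OF T] hL(1)] L2_field_inner[OF v_L2[OF s(1)] hL(1)]
      by (simp add: Dv_def inner_diff_left)
    moreover have "(LINT x|lborel. Dv x \<bullet> h x) = (LINT x|lborel. Dv x \<bullet> V x) + (LINT x|lborel. Dv x \<bullet> (h x - V x))"
      using L2_field_inner[OF DvL(1) V(1)] L2_field_inner[OF DvL(1) hL(1)]
      by (simp add: inner_diff_right)
    moreover have "(LINT x|lborel. Dv x \<bullet> V x) = (L2_size (v T))\<^sup>2 - (L2_size (v s))\<^sup>2"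
    proof -
      have "Dv x \<bullet> V x = (norm (v T x))\<^sup>2 - (norm (v s x))\<^sup>2" for x
        by (simp add: Dv_def V_def inner_diff_left inner_add_right power2_norm_eq_inner inner_commute[of "v s x" "v T x"])
      then show ?thesis
        using v_L2[OF T] v_L2[OF s(1)] by (simp add: L2_size_power2 L2_field_def)
    qed
    moreover have "\<bar>LINT x|lborel. Dv x \<bullet> (h x - V x)\<bar> \<le> (M * d) * e"
      using L2_cauchy_schwarz[OF DvL(1) hL(2)] mult_mono[OF DvL(2) h(2)] M_nonneg d by (simp add: L2_size_nonneg)
    ultimately show ?thesis
      using 1 by (simp add: algebra_simps)
  qed
  have "(L2_size (v T))\<^sup>2 - (L2_size (v s))\<^sup>2 \<le> d * Q"
  proof (rule field_le_epsilon)
    fix e :: real assume "e > 0"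
    have p: "2 * M * d + 1 > 0" using M_nonneg d by (simp add: add_nonneg_pos)
    have "(L2_size (v T))\<^sup>2 - (L2_size (v s))\<^sup>2 \<le> d * Q + e / (2 * M * d + 1) * (2 * M * d)"
      using ineq[of "e / (2 * M * d + 1)"] \<open>e > 0\<close> p by simp
    also have "e / (2 * M * d + 1) * (2 * M * d) \<le> e"
      using p \<open>e > 0\<close> by (simp add: field_simps)
    finally show "(L2_size (v T))\<^sup>2 - (L2_size (v s))\<^sup>2 \<le> d * Q + e" by simp
  qed
  then show ?thesis by (simp add: Q_def)
qed

lemma v_eq_0: "t \<ge> 0 \<Longrightarrow> L2_size (v t) = 0"
proof -
  assume t: "t \<ge> 0"
  define e where "e t = (L2_size (v t))\<^sup>2" for t
  have "e t = 0"
  proof (rule discrete_gronwall[of e "8 * L" "8 * L * M\<^sup>2 + M\<^sup>2", OF _ _ _ _ _ t])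
    show "e 0 = 0" by (simp add: e_def L2_size_def v_initial)
    show "e t \<ge> 0" for t by (simp add: e_def)
    show "0 \<le> 8 * L" "0 \<le> 8 * L * M\<^sup>2 + M\<^sup>2" using L_nonneg by auto
    fix s T :: real assume s: "0 \<le> s" "s \<le> T" "T \<le> s + 1"
    define d where "d = T - s"
    have d: "0 \<le> d" "d \<le> 1" using s by (auto simp: d_def)
    \<comment> \<open>Splitting the square doubles both squares, which turns \<open>4 * L\<close>
      into the Gronwall constant \<open>8 * L\<close>.\<close>
    have "(L2_size (v s) + M * d)\<^sup>2 \<le> 2 * e s + 2 * (M * d)\<^sup>2"
      using sum_squares_bound[of "L2_size (v s)" "M * d"] by (simp add: e_def power2_sum)
    then have "4 * L * (L2_size (v s) + M * d)\<^sup>2 \<le> 4 * L * (2 * e s + 2 * (M * d)\<^sup>2)"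
      using L_nonneg by (intro mult_left_mono) auto
    then have "d * (4 * L * (L2_size (v s) + M * d)\<^sup>2 + M\<^sup>2 * d) \<le> d * (4 * L * (2 * e s + 2 * (M * d)\<^sup>2) + M\<^sup>2 * d)"
      by (rule mult_left_mono[OF add_right_mono d(1)])
    \<comment> \<open>Here \<open>d \<le> 1\<close> reduces a cubic error to the quadratic one that
      \<open>discrete_gronwall\<close> accepts.\<close>
    moreover have "8 * L * M\<^sup>2 * d\<^sup>2 * d \<le> 8 * L * M\<^sup>2 * d\<^sup>2 * 1"
      using L_nonneg d by (intro mult_left_mono) auto
    ultimately show "e T \<le> (1 + 8 * L * (T - s)) * e s + (8 * L * M\<^sup>2 + M\<^sup>2) * (T - s)\<^sup>2"
      using energy_step[OF s(1,2)] unfolding d_def[symmetric] e_def[symmetric]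
      by (simp add: power2_eq_square algebra_simps)
  qed
  then show ?thesis by (simp add: e_def)
qed

lemma uniqueness:
  assumes t: "t \<ge> 0"
  shows "AE x in lborel. \<omega>' t x = \<omega> t x"
proof -
  have "(LINT x|lborel. biot_savart (w t) x \<bullet> h x) = 0" if h: "test_field h" for h
    using L2_cauchy_schwarz[OF v_L2[OF t] test_field_L2[OF h]] v_eq_0[OF t] by (simp add: v_def)
  from biot_savart_eq_0_imp[OF w_bound[OF t] this]
  show ?thesis by (auto simp: w_def elim!: eventually_mono)
qed

end

subsection \<open>Classical solutions are weak solutions\<close>

definition time_deriv :: "(real \<times> (real^2) \<Rightarrow> real) \<Rightarrow> real \<times> (real^2) \<Rightarrow> real" where
  "time_deriv W p = frechet_derivative W (at p) (1, 0)"

definition space_deriv :: "2 \<Rightarrow> (real \<times> (real^2) \<Rightarrow> real) \<Rightarrow> real \<times> (real^2) \<Rightarrow> real" where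
  "space_deriv j W p = frechet_derivative W (at p) (0, axis j 1)"

lemma smooth_time_deriv: "smooth W \<Longrightarrow> smooth (time_deriv W)"
  unfolding time_deriv_def[abs_def] by (rule smooth_frechet_derivative)

lemma smooth_space_deriv: "smooth W \<Longrightarrow> smooth (space_deriv j W)"
  unfolding space_deriv_def[abs_def] by (rule smooth_frechet_derivative)

lemma test_function_time_deriv: "test_function W \<Longrightarrow> test_function (time_deriv W)"
  unfolding time_deriv_def[abs_def] by (rule test_function_derivative)

lemma time_slice_DERIV:
  assumes W: "smooth W"
  shows "((\<lambda>s. W (s, x)) has_field_derivative time_deriv W (t, x)) (at t)"
  using directional_DERIV[of W "(0, x)" t "(1, 0)"] smooth_differentiable[OF W]
  by (simp add: time_deriv_def)

lemma deriv_time_slice: "smooth W \<Longrightarrow> deriv (\<lambda>s. W (s, x)) t = time_deriv W (t, x)"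
  by (intro DERIV_imp_deriv time_slice_DERIV)

lemma partial_slice:
  assumes W: "smooth W"
  shows "partial j (\<lambda>y. W (t, y)) x = space_deriv j W (t, x)"
proof -
  have "((\<lambda>y. (t, y)) has_derivative (\<lambda>v. (0, v))) (at x)"
    by (auto intro!: derivative_eq_intros)
  from has_derivative_compose[OF this smooth_has_derivative[OF W]]
  show ?thesis
    by (simp add: partial_def space_deriv_def frechet_derivative_at[symmetric])
qed

lemma smooth_slice:
  fixes W :: "real \<times> (real^2) \<Rightarrow> real"
  assumes W: "smooth W"
  shows "smooth (\<lambda>x. W (t, x))"
proof -
  have "bounded_linear (\<lambda>x::real^2. (0::real, x))"
    by (intro bounded_linear_Pair bounded_linear_zero bounded_linear_ident)
  from smooth_affine[OF this W, of "(t, 0)"] show ?thesis by simp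
qed

lemma test_function_slice:
  fixes W :: "real \<times> (real^2) \<Rightarrow> real"
  assumes W: "test_function W"
  shows "test_function (\<lambda>x. W (t, x))"
proof -
  obtain R where R: "\<And>p. norm p \<ge> R \<Longrightarrow> W p = 0"
    using test_function_supportE[OF W] by metis
  have "compactly_supported (\<lambda>x. W (t, x))"
  proof (rule compactly_supportedI[of R])
    show "W (t, x) = 0" if "norm x \<ge> R" for x
      using that norm_snd_le[of x t] by (intro R) linarith
  qed
  then show ?thesis
    using smooth_slice[OF test_function_smooth[OF W]] by (simp add: test_function_def)
qed

text \<open>The weight \<open>g\<close> does not depend on time. It is \<open>1\<close> for
  classical solutions and the indicator of a half-plane at rest for the moving half-plane seen in
  its own frame.\<close>

lemma ftc_fubini:
  fixes \<Psi> :: "real \<times> (real^2) \<Rightarrow> real"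
  assumes \<Psi>: "test_function \<Psi>" and g [measurable]: "g \<in> borel_measurable borel"
    and B: "\<And>x. \<bar>g x\<bar> \<le> B" and T: "T \<ge> 0"
  shows "(LINT t|lborel. indicator {0..T} t * (LINT x|lborel. g x * time_deriv \<Psi> (t, x))) =
    (LINT x|lborel. g x * (\<Psi> (T, x) - \<Psi> (0, x)))"
proof -
  note td = test_function_time_deriv[OF \<Psi>]
  define f where "f t x = indicator {0..T} t * (g x * time_deriv \<Psi> (t, x))" for t x
  have [measurable]: "time_deriv \<Psi> \<in> borel_measurable (borel \<Otimes>\<^sub>M borel)"
    unfolding borel_prod by (rule test_function_measurable[OF td])
  have "case_prod f \<in> borel_measurable (borel \<Otimes>\<^sub>M borel)"
    unfolding f_def split_beta' by measurable
  then have meas: "case_prod f \<in> borel_measurable borel"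
    by (simp only: borel_prod)
  have "integrable lborel (case_prod f)"
  proof (rule Bochner_Integration.integrable_bound)
    show "integrable lborel (\<lambda>p. B * \<bar>time_deriv \<Psi> p\<bar>)"
      using test_function_integrable[OF td] by simp
    show "case_prod f \<in> borel_measurable lborel" using meas by simp
    show "AE p in lborel. norm (case_prod f p) \<le> norm (B * \<bar>time_deriv \<Psi> p\<bar>)"
    proof (rule AE_I2)
      fix p
      have "\<bar>g (snd p) * time_deriv \<Psi> p\<bar> \<le> B * \<bar>time_deriv \<Psi> p\<bar>"
        unfolding abs_mult using B by (intro mult_right_mono) auto
      then show "norm (case_prod f p) \<le> norm (B * \<bar>time_deriv \<Psi> p\<bar>)"
        using order_trans[OF abs_ge_zero B] by (auto simp: f_def indicator_def split: prod.splits)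
    qed
  qed
  then have int: "integrable (lborel \<Otimes>\<^sub>M lborel) (case_prod f)"
    by (simp add: lborel_prod)
  have "(LINT t|lborel. indicator {0..T} t * (LINT x|lborel. g x * time_deriv \<Psi> (t, x))) =
      (LINT t|lborel. LINT x|lborel. f t x)"
    by (simp add: f_def)
  also have "\<dots> = (LINT x|lborel. LINT t|lborel. f t x)"
    using lborel_pair.Fubini_integral[OF int] by simp
  also have "\<dots> = (LINT x|lborel. g x * (\<Psi> (T, x) - \<Psi> (0, x)))"
  proof (rule Bochner_Integration.integral_cong[OF refl])
    fix x :: "real^2"
    have "continuous_on UNIV (\<lambda>t. time_deriv \<Psi> (t, x))"
      by (intro continuous_on_compose2[OF test_function_continuous[OF td, of UNIV]]) (auto intro: continuous_intros)
    then have "(LINT t|lborel. time_deriv \<Psi> (t, x) * indicator {0..T} t) = \<Psi> (T, x) - \<Psi> (0, x)"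
      by (intro integral_FTC_Icc_real T time_slice_DERIV test_function_smooth \<Psi>)
        (simp add: continuous_on_eq_continuous_at)
    moreover have "f t x = g x * (time_deriv \<Psi> (t, x) * indicator {0..T} t)" for t
      by (simp add: f_def)
    ultimately show "(LINT t|lborel. f t x) = g x * (\<Psi> (T, x) - \<Psi> (0, x))" by simp
  qed
  finally show ?thesis .
qed

lemma set_integral_iterated:
  fixes g :: "real \<times> (real^2) \<Rightarrow> real"
  assumes g: "set_integrable lborel ({0..T} \<times> UNIV) g"
  shows "(LINT p:{0..T} \<times> UNIV|lborel. g p) = (LINT t|lborel. indicator {0..T} t * (LINT x|lborel. g (t, x)))"
proof -
  define f where "f p = indicator ({0..T} \<times> UNIV) p *\<^sub>R g p" for p
  have int: "integrable (lborel \<Otimes>\<^sub>M lborel) f"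
    using g unfolding set_integrable_def f_def[abs_def] lborel_prod .
  have slice: "(LINT x|lborel. f (t, x)) = indicator {0..T} t * (LINT x|lborel. g (t, x))" for t
  proof -
    have "f (t, x) = indicator {0..T} t * g (t, x)" for x
      by (simp add: f_def indicator_def)
    then show ?thesis by simp
  qed
  have "(LINT p:{0..T} \<times> UNIV|lborel. g p) = integral\<^sup>L (lborel \<Otimes>\<^sub>M lborel) f"
    by (simp add: set_lebesgue_integral_def f_def[abs_def] lborel_prod)
  also have "\<dots> = (LINT t|lborel. indicator {0..T} t * (LINT x|lborel. g (t, x)))"
    using lborel_pair.integral_fst'[OF int] unfolding slice ..
  finally show ?thesis .
qed

lemma continuous_imp_locally_integrable:
  fixes f :: "'a::euclidean_space \<Rightarrow> 'b::euclidean_space"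
  assumes "continuous_on UNIV f"
  shows "locally_integrable_on S f"
  unfolding locally_integrable_on_def set_integrable_def
  using borel_integrable_compact continuous_on_subset[OF assms] by blast

lemma set_integrable_cs_strip:
  fixes f :: "real \<times> (real^2) \<Rightarrow> real"
  assumes f: "continuous_on UNIV f" and z: "\<And>t x. norm x \<ge> R \<Longrightarrow> f (t, x) = 0"
  shows "set_integrable lborel ({0..T} \<times> UNIV) f"
proof -
  have "integrable lborel (\<lambda>p. indicator ({0..T} \<times> cball 0 R) p *\<^sub>R f p)"
    by (intro borel_integrable_compact continuous_on_subset[OF f] compact_Times) auto
  moreover have "(\<lambda>p. indicator ({0..T} \<times> cball 0 R) p *\<^sub>R f p) = (\<lambda>p. indicator ({0..T} \<times> UNIV) p *\<^sub>R f p)"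
    using z by (auto simp: fun_eq_iff indicator_def)
  ultimately show ?thesis by (simp add: set_integrable_def)
qed

text \<open>For \<open>\<Psi> = W * \<phi>\<close> the transport equation and incompressibility show
  that the weak integrand is \<open>time_deriv \<Psi>\<close> plus the divergence of
  \<open>\<Psi>\<close> times the velocity. The divergence integrates to zero on each slice, and the
  time derivative integrates to the boundary terms.\<close>

lemma classical_solution_weak:
  fixes W U V :: "real \<times> (real^2) \<Rightarrow> real"
  assumes W: "smooth W" and U: "smooth U" and V: "smooth V"
    and div: "\<And>p. space_deriv 1 U p + space_deriv 2 V p = 0"
    and transport: "\<And>p. time_deriv W p + U p * space_deriv 1 W p + V p * space_deriv 2 W p = 0"
  shows "weak_vorticity_eq (\<lambda>x. W (0, x)) (\<lambda>t x. W (t, x)) (\<lambda>t x. vector [U (t, x), V (t, x)])"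
proof -
  define u where "u t x = (vector [U (t, x), V (t, x)] :: real^2)" for t x
  have ueq: "(\<lambda>(t, x). u t x) = (\<lambda>p. \<chi> i. if i = 1 then U p else V p)"
    by (simp add: fun_eq_iff u_def vec_eq_iff forall_2 vector_2)
  have "continuous_on UNIV (\<lambda>p. if i = 1 then U p else V p)" for i :: 2
    by (cases "i = 1") (auto intro!: smooth_continuous_on U V)
  then have uc: "continuous_on UNIV (\<lambda>(t, x). u t x)"
    unfolding ueq by (rule continuous_on_vec_lambda)
  have utc: "continuous_on UNIV (u t)" for t
  proof -
    have "continuous_on UNIV (\<lambda>x::real^2. (t, x))"
      by (intro continuous_intros)
    from continuous_on_compose2[OF uc this] show ?thesis by simp
  qed
  have Weq: "(\<lambda>(t, x). W (t, x)) = W" by auto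
  have Wuc: "continuous_on UNIV (\<lambda>(t, x). W (t, x) *\<^sub>R u t x)"
    using continuous_on_scaleR[OF smooth_continuous_on[OF W] uc] by (simp add: split_beta')
  have weak: "(LINT x|lborel. W (T, x) * \<phi> (T, x)) - (LINT x|lborel. W (0, x) * \<phi> (0, x)) =
        (LINT (t, x):{0..T} \<times> UNIV|lborel.
           W (t, x) * (deriv (\<lambda>s. \<phi> (s, x)) t + u t x \<bullet> grad (\<lambda>y. \<phi> (t, y)) x))"
    if \<phi>: "test_function \<phi>" and T: "T \<ge> 0" for \<phi> T
  proof -
    have s\<phi>: "smooth \<phi>" by (rule test_function_smooth[OF \<phi>])
    obtain R where R: "\<And>p. norm p \<ge> R \<Longrightarrow> \<phi> p = 0" "\<And>p v. norm p \<ge> R \<Longrightarrow> frechet_derivative \<phi> (at p) v = 0"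
      using test_function_supportE[OF \<phi>] by metis
    define g where "g p = W p * (time_deriv \<phi> p + (U p * space_deriv 1 \<phi> p + V p * space_deriv 2 \<phi> p))" for p
    have geq: "W (t, x) * (deriv (\<lambda>s. \<phi> (s, x)) t + u t x \<bullet> grad (\<lambda>y. \<phi> (t, y)) x) = g (t, x)" for t x
      by (simp add: g_def deriv_time_slice[OF s\<phi>] inner_real2 u_def vector_2 partial_slice[OF s\<phi>])
    have gc: "continuous_on UNIV g"
      unfolding g_def[abs_def]
      by (intro continuous_intros smooth_continuous_on W U V smooth_time_deriv smooth_space_deriv s\<phi>)
    have g0: "g (t, x) = 0" if "norm x \<ge> R" for t x
    proof -
      have "norm (t, x) \<ge> R" using that norm_snd_le[of x t] by linarith
      then show ?thesis by (simp add: g_def time_deriv_def space_deriv_def R)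
    qed
    define \<Psi> where "\<Psi> p = W p * \<phi> p" for p
    have t\<Psi>: "test_function \<Psi>"
      unfolding \<Psi>_def[abs_def] by (rule test_function_mult(1)[OF W \<phi>])
    have slice: "(LINT x|lborel. g (t, x)) = (LINT x|lborel. 1 * time_deriv \<Psi> (t, x))" for t
    proof -
      define P where "P x = U (t, x) * \<Psi> (t, x)" for x
      define Q where "Q x = V (t, x) * \<Psi> (t, x)" for x
      have tP: "test_function P" "test_function Q"
        unfolding P_def[abs_def] Q_def[abs_def]
        by (intro test_function_mult(1) smooth_slice U V test_function_slice t\<Psi>)+
      have pw: "space_deriv j \<Psi> p = W p * space_deriv j \<phi> p + space_deriv j W p * \<phi> p" for j p
        unfolding \<Psi>_def[abs_def] space_deriv_def by (rule frechet_derivative_mult[OF W s\<phi>])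
      have tw: "time_deriv \<Psi> p = W p * time_deriv \<phi> p + time_deriv W p * \<phi> p" for p
        unfolding \<Psi>_def[abs_def] time_deriv_def by (rule frechet_derivative_mult[OF W s\<phi>])
      have pP: "partial j P x = U (t, x) * space_deriv j \<Psi> (t, x) + space_deriv j U (t, x) * \<Psi> (t, x)" for j x
        unfolding P_def[abs_def]
        by (simp only: partial_mult[OF smooth_slice[OF U] smooth_slice[OF test_function_smooth[OF t\<Psi>]]]
            partial_slice[OF U] partial_slice[OF test_function_smooth[OF t\<Psi>]])
      have pQ: "partial j Q x = V (t, x) * space_deriv j \<Psi> (t, x) + space_deriv j V (t, x) * \<Psi> (t, x)" for j x
        unfolding Q_def[abs_def]
        by (simp only: partial_mult[OF smooth_slice[OF V] smooth_slice[OF test_function_smooth[OF t\<Psi>]]]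
            partial_slice[OF V] partial_slice[OF test_function_smooth[OF t\<Psi>]])
      have "g (t, x) = time_deriv \<Psi> (t, x) + (partial 1 P x + partial 2 Q x)" for x
      proof -
        define p where "p = (t, x)"
        have "partial 1 P x + partial 2 Q x = U p * space_deriv 1 \<Psi> p + V p * space_deriv 2 \<Psi> p
            + (space_deriv 1 U p + space_deriv 2 V p) * \<Psi> p"
          unfolding pP pQ p_def[symmetric] by (simp add: algebra_simps)
        also have "\<dots> = U p * space_deriv 1 \<Psi> p + V p * space_deriv 2 \<Psi> p"
          by (simp add: div)
        finally have "time_deriv \<Psi> p + (partial 1 P x + partial 2 Q x) = g p +
            (time_deriv W p + U p * space_deriv 1 W p + V p * space_deriv 2 W p) * \<phi> p"
          unfolding g_def pw tw by (simp add: algebra_simps)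
        then show ?thesis by (simp add: transport p_def)
      qed
      moreover have "integrable lborel (\<lambda>x. time_deriv \<Psi> (t, x))"
        by (intro test_function_integrable test_function_slice test_function_time_deriv t\<Psi>)
      ultimately show ?thesis
        by (simp add: test_function_integrable test_function_partial tP integral_partial_eq_0)
    qed
    have int: "integrable lborel (\<lambda>x. \<Psi> (t, x))" for t
      by (intro test_function_integrable test_function_slice t\<Psi>)
    have "(LINT (t, x):{0..T} \<times> UNIV|lborel.
           W (t, x) * (deriv (\<lambda>s. \<phi> (s, x)) t + u t x \<bullet> grad (\<lambda>y. \<phi> (t, y)) x)) = (LINT p:{0..T} \<times> UNIV|lborel. g p)"
      by (simp add: geq split_beta')
    also have "\<dots> = (LINT t|lborel. indicator {0..T} t * (LINT x|lborel. g (t, x)))"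
      by (rule set_integral_iterated[OF set_integrable_cs_strip[OF gc g0]])
    also have "\<dots> = (LINT x|lborel. 1 * (\<Psi> (T, x) - \<Psi> (0, x)))"
      unfolding slice by (rule ftc_fubini[OF t\<Psi> _ _ T, of _ 1]) auto
    also have "\<dots> = (LINT x|lborel. W (T, x) * \<phi> (T, x)) - (LINT x|lborel. W (0, x) * \<phi> (0, x))"
      using int by (simp add: \<Psi>_def)
    finally show ?thesis by simp
  qed
  show ?thesis
    unfolding weak_vorticity_eq_def u_def[symmetric]
    using weak by (auto intro!: continuous_imp_locally_integrable uc utc Wuc smooth_continuous_on[OF W] simp: Weq
        smooth_continuous_on[OF smooth_slice[OF W]])
qed

subsection \<open>Vortices carried by a rigidly rotating background\<close>

lemma smooth_DERIV:
  fixes g :: "real \<Rightarrow> real"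
  assumes g: "smooth g"
  shows "(g has_field_derivative deriv g s) (at s)" and smooth_deriv: "smooth (deriv g)"
proof -
  have d: "(g has_field_derivative frechet_derivative g (at s) 1) (at s)" for s
    using directional_DERIV[of g 0 s 1] smooth_differentiable[OF g] by simp
  then have eq: "deriv g = (\<lambda>s. frechet_derivative g (at s) 1)"
    by (auto intro: DERIV_imp_deriv)
  show "(g has_field_derivative deriv g s) (at s)"
    unfolding eq by (rule d)
  show "smooth (deriv g)"
    unfolding eq by (rule smooth_frechet_derivative[OF g])
qed

lemma deriv_locally_const:
  fixes g :: "real \<Rightarrow> real"
  assumes "open S" "s \<in> S" "\<And>s. s \<in> S \<Longrightarrow> g s = c"
  shows "deriv g s = 0"
  by (rule DERIV_imp_deriv, rule has_field_derivative_transform_within_open[OF DERIV_const[of c] assms(1,2)])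
    (use assms(3) in auto)

lemma frechet_derivative_compose_real:
  fixes f :: "'a::euclidean_space \<Rightarrow> real"
  assumes g: "smooth g" and f: "smooth f"
  shows "frechet_derivative (\<lambda>x. g (f x)) (at x) v = deriv g (f x) * frechet_derivative f (at x) v"
proof -
  have "(g has_derivative (\<lambda>h. deriv g (f x) * h)) (at (f x))"
    using smooth_DERIV(1)[OF g] by (simp add: has_field_derivative_def)
  from has_derivative_compose[OF smooth_has_derivative[OF f] this]
  show ?thesis by (simp add: frechet_derivative_at[symmetric])
qed

lemma frechet_derivative_add_smooth:
  "smooth f \<Longrightarrow> smooth g \<Longrightarrow> frechet_derivative (\<lambda>x. f x + g x) (at x) v =
    frechet_derivative f (at x) v + frechet_derivative g (at x) v"
  by (simp add: frechet_derivative_at[OF has_derivative_add[OF smooth_has_derivative smooth_has_derivative], symmetric])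

definition rel1 :: "(real \<Rightarrow> real) \<Rightarrow> real \<times> (real^2) \<Rightarrow> real" where
  "rel1 a p = snd p $ 1 - a (fst p)"

definition rel2 :: "(real \<Rightarrow> real) \<Rightarrow> real \<times> (real^2) \<Rightarrow> real" where
  "rel2 b p = snd p $ 2 - b (fst p)"

text \<open>Profiles depend on the squared distance to the centre, a polynomial in the position, so
  they compose to functions smooth at the centre as well.\<close>

definition rad2 :: "(real \<Rightarrow> real) \<Rightarrow> (real \<Rightarrow> real) \<Rightarrow> real \<times> (real^2) \<Rightarrow> real" where
  "rad2 a b p = rel1 a p * rel1 a p + rel2 b p * rel2 b p"

text \<open>The vortex with centre \<open>(a t, b t)\<close> has velocity \<open>\<beta> (r\<^sup>2) / 2\<close> times the perpendicular of the
  position relative to the centre, and vorticity \<open>(s \<beta>(s))'\<close> at \<open>s = r\<^sup>2\<close>.\<close>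

definition vel1 :: "(real \<Rightarrow> real) \<Rightarrow> (real \<Rightarrow> real) \<Rightarrow> (real \<Rightarrow> real) \<Rightarrow> real \<times> (real^2) \<Rightarrow> real" where
  "vel1 \<beta> a b p = (- 1 / 2) * (\<beta> (rad2 a b p) * rel2 b p)"

definition vel2 :: "(real \<Rightarrow> real) \<Rightarrow> (real \<Rightarrow> real) \<Rightarrow> (real \<Rightarrow> real) \<Rightarrow> real \<times> (real^2) \<Rightarrow> real" where
  "vel2 \<beta> a b p = (1 / 2) * (\<beta> (rad2 a b p) * rel1 a p)"

definition vort_profile :: "(real \<Rightarrow> real) \<Rightarrow> real \<Rightarrow> real" where
  "vort_profile \<beta> s = \<beta> s + s * deriv \<beta> s"

definition vort :: "(real \<Rightarrow> real) \<Rightarrow> (real \<Rightarrow> real) \<Rightarrow> (real \<Rightarrow> real) \<Rightarrow> real \<times> (real^2) \<Rightarrow> real" where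
  "vort \<beta> a b p = vort_profile \<beta> (rad2 a b p)"

lemma smooth_fst_compose:
  fixes a :: "real \<Rightarrow> real"
  assumes "smooth a"
  shows "smooth (\<lambda>p::real \<times> (real^2). a (fst p))"
  using smooth_affine[OF bounded_linear_fst assms, of 0] by simp

lemma smooth_snd_nth: "smooth (\<lambda>p::real \<times> (real^2). snd p $ i)"
  using smooth_affine[OF bounded_linear_snd smooth_nth[of i], of 0] by simp

lemma smooth_rel:
  assumes "smooth a"
  shows smooth_rel1: "smooth (rel1 a)" and smooth_rel2: "smooth (rel2 a)"
  unfolding rel1_def[abs_def] rel2_def[abs_def]
  by (intro smooth_diff smooth_snd_nth smooth_fst_compose assms)+

lemma smooth_rad2: "smooth a \<Longrightarrow> smooth b \<Longrightarrow> smooth (rad2 a b)"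
  unfolding rad2_def[abs_def] by (intro smooth_add smooth_mult smooth_rel1 smooth_rel2)

lemma smooth_vel:
  assumes "smooth \<beta>" "smooth a" "smooth b"
  shows smooth_vel1: "smooth (vel1 \<beta> a b)" and smooth_vel2: "smooth (vel2 \<beta> a b)"
  unfolding vel1_def[abs_def] vel2_def[abs_def]
  by (intro smooth_mult smooth_const smooth_rel1 smooth_rel2 smooth_compose[OF assms(1) smooth_rad2] assms)+

lemma smooth_vort_profile: "smooth \<beta> \<Longrightarrow> smooth (vort_profile \<beta>)"
  unfolding vort_profile_def[abs_def] by (intro smooth_add smooth_mult smooth_ident smooth_deriv)

lemma smooth_vort: "smooth \<beta> \<Longrightarrow> smooth a \<Longrightarrow> smooth b \<Longrightarrow> smooth (vort \<beta> a b)"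
  unfolding vort_def[abs_def] by (intro smooth_compose[OF smooth_vort_profile smooth_rad2])

lemma frechet_derivative_rel:
  assumes a: "smooth a"
  shows "frechet_derivative (rel1 a) (at p) v = snd v $ 1 - fst v * deriv a (fst p)"
    and "frechet_derivative (rel2 a) (at p) v = snd v $ 2 - fst v * deriv a (fst p)"
proof -
  have a': "((\<lambda>p::real \<times> (real^2). a (fst p)) has_derivative (\<lambda>v. deriv a (fst p) * fst v)) (at p)"
    using has_derivative_compose[OF bounded_linear_imp_has_derivative[OF bounded_linear_fst]
        smooth_DERIV(1)[OF a, unfolded has_field_derivative_def]] .
  have n: "((\<lambda>p::real \<times> (real^2). snd p $ i) has_derivative (\<lambda>v. snd v $ i)) (at p)" for i
    by (rule bounded_linear_imp_has_derivative)
      (rule bounded_linear_compose[OF bounded_linear_vec_nth bounded_linear_snd])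
  show "frechet_derivative (rel1 a) (at p) v = snd v $ 1 - fst v * deriv a (fst p)"
    "frechet_derivative (rel2 a) (at p) v = snd v $ 2 - fst v * deriv a (fst p)"
    using frechet_derivative_at[OF has_derivative_diff[OF n a']]
    unfolding rel1_def[abs_def] rel2_def[abs_def] by (simp_all add: fun_eq_iff mult.commute)
qed

lemma frechet_derivative_rad2:
  assumes "smooth a" "smooth b"
  shows "frechet_derivative (rad2 a b) (at p) v =
    2 * rel1 a p * (snd v $ 1 - fst v * deriv a (fst p)) + 2 * rel2 b p * (snd v $ 2 - fst v * deriv b (fst p))"
  unfolding rad2_def[abs_def]
  by (simp add: frechet_derivative_add_smooth frechet_derivative_mult smooth_mult smooth_rel1 smooth_rel2
      frechet_derivative_rel assms)

lemma space_deriv_vel: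
  assumes "smooth \<beta>" "smooth a" "smooth b"
  shows "space_deriv 1 (vel1 \<beta> a b) p + space_deriv 2 (vel2 \<beta> a b) p = 0"
    and "space_deriv 1 (vel2 \<beta> a b) p - space_deriv 2 (vel1 \<beta> a b) p = vort \<beta> a b p"
proof -
  note s = smooth_compose[OF assms(1) smooth_rad2[OF assms(2,3)]] smooth_rel1[OF assms(2)] smooth_rel2[OF assms(3)]
  have c: "frechet_derivative (\<lambda>p. c * f p) (at p) v = c * frechet_derivative f (at p) v"
    if "smooth f" for c v and f :: "real \<times> (real^2) \<Rightarrow> real"
    using frechet_derivative_mult[OF smooth_const that] by simp
  note d = c[OF smooth_mult[OF s(1) s(2)]] c[OF smooth_mult[OF s(1) s(3)]]
    frechet_derivative_mult[OF s(1) s(2)] frechet_derivative_mult[OF s(1) s(3)]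
    frechet_derivative_compose_real[OF assms(1) smooth_rad2[OF assms(2,3)]] frechet_derivative_rad2[OF assms(2,3)]
    frechet_derivative_rel(1)[OF assms(2)] frechet_derivative_rel(2)[OF assms(3)]
  show "space_deriv 1 (vel1 \<beta> a b) p + space_deriv 2 (vel2 \<beta> a b) p = 0"
    unfolding space_deriv_def vel1_def[abs_def] vel2_def[abs_def] d by (simp add: axis_def)
  show "space_deriv 1 (vel2 \<beta> a b) p - space_deriv 2 (vel1 \<beta> a b) p = vort \<beta> a b p"
    unfolding space_deriv_def vel1_def[abs_def] vel2_def[abs_def] vort_def vort_profile_def d
    by (simp add: axis_def) (simp add: rad2_def field_simps)
qed

lemma frechet_derivative_vort:
  assumes "smooth \<beta>" "smooth a" "smooth b"
  shows "frechet_derivative (vort \<beta> a b) (at p) v = deriv (vort_profile \<beta>) (rad2 a b p) *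
    (2 * rel1 a p * (snd v $ 1 - fst v * deriv a (fst p)) + 2 * rel2 b p * (snd v $ 2 - fst v * deriv b (fst p)))"
  unfolding vort_def[abs_def]
  by (simp add: frechet_derivative_compose_real smooth_vort_profile smooth_rad2 assms frechet_derivative_rad2)

text \<open>With divergence zero, the identities \<open>newt_curl_free\<close> and
  \<open>newt_divergence\<close> for \<open>U\<close> and \<open>V\<close> return the field itself
  from its curl. They are available because the velocity has compact support, the effect of zero
  circulation; no uniqueness theorem for div-curl systems is invoked.\<close>

lemma biot_savart_of_velocity:
  assumes U: "test_function U" and V: "test_function V"
    and div: "\<And>x. partial 1 U x + partial 2 V x = 0"
    and curl: "\<And>x. w x = partial 1 V x - partial 2 U x"
  shows "biot_savart w x = vector [U x, V x]" "test_function w"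
proof -
  note p = test_function_partial[OF U] test_function_partial[OF V]
  have w: "w = (\<lambda>x. partial 1 V x + (-1) * partial 2 U x)"
    using curl by auto
  show "test_function w"
    unfolding w by (intro test_function_add p test_function_mult(1)[of "\<lambda>x. -1"] smooth_const)
  then obtain C where "L1_Linf_bound C w"
    using L1_Linf_bound_test by metis
  then have bs: "biot_savart w x = vector [- newt 2 w x, newt 1 w x]"
    by (rule biot_savart_eq)
  have nw: "newt i w x = newt i (partial 1 V) x - newt i (partial 2 U) x" for i
    using newt_diff[OF p(2) p(1), of i 1 2 x] w by (simp add: curl)
  have n0: "newt i (partial 1 U) x + newt i (partial 2 V) x = 0" for i
  proof -
    have "newt i (\<lambda>x. partial 1 U x + partial 2 V x) x = 0"
      by (simp add: div newt_def)
    then show ?thesis by (simp add: newt_add p)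
  qed
  show "biot_savart w x = vector [U x, V x]"
    unfolding bs nw
    using newt_curl_free[OF V, of x] newt_curl_free[OF U, of x] newt_divergence[OF U, of x]
      newt_divergence[OF V, of x] n0[of 1] n0[of 2]
    by (simp add: vec_eq_iff forall_2 vector_2)
qed

lemma biot_savart_distr:
  assumes w: "L1_Linf_bound C w"
  shows "distr_div_free (biot_savart w)" "distr_curl (biot_savart w) w"
proof -
  show "distr_div_free (biot_savart w)"
    unfolding distr_div_free_def
  proof (intro allI impI)
    fix \<psi> :: "real^2 \<Rightarrow> real" assume t: "test_function \<psi>"
    show "(LINT x|lborel. biot_savart w x \<bullet> grad \<psi> x) = 0"
      using biot_savart_inner(1)[OF w test_field_grad[OF t]] by (simp add: stream_pot_grad[OF t])
  qed
  show "distr_curl (biot_savart w) w"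
    unfolding distr_curl_def
  proof (intro allI impI)
    fix \<psi> :: "real^2 \<Rightarrow> real" assume t: "test_function \<psi>"
    have "biot_savart w x $ 1 * partial 2 \<psi> x - biot_savart w x $ 2 * partial 1 \<psi> x =
        - (biot_savart w x \<bullet> perp (grad \<psi> x))" for x
      by (simp add: inner_real2)
    then show "(LINT x|lborel. biot_savart w x $ 1 * partial 2 \<psi> x - biot_savart w x $ 2 * partial 1 \<psi> x) =
        (LINT x|lborel. w x * \<psi> x)"
      using biot_savart_inner(1)[OF w test_field_perp_grad[OF t]] by (simp add: stream_pot_perp_grad[OF t])
  qed
qed

section \<open>The superposition: exact solution, uniform bounds and uniqueness\<close>

lemma L1_Linf_bound_mono: "L1_Linf_bound C w \<Longrightarrow> C \<le> D \<Longrightarrow> L1_Linf_bound D w"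
  unfolding L1_Linf_bound_def by (auto elim!: eventually_mono)

lemma L1_Linf_bound_cs:
  assumes w: "continuous_on UNIV w" and B: "\<And>x. \<bar>w x\<bar> \<le> B" and R: "\<And>x. norm x > R \<Longrightarrow> w x = 0" "R \<ge> 0"
  shows "L1_Linf_bound (max B (B * (pi * R\<^sup>2))) w"
  unfolding L1_Linf_bound_def
proof (intro conjI)
  show "integrable lborel w"
    by (rule integrable_continuous_cs[OF w, of "R + 1"]) (use R in auto)
  have "\<bar>LINT x|lborel. \<bar>w x\<bar>\<bar> \<le> B * (pi * R\<^sup>2)"
    by (rule integral_ball_bound) (use B R in auto)
  then show "(LINT x|lborel. \<bar>w x\<bar>) \<le> max B (B * (pi * R\<^sup>2))"
    by linarith
  show "AE x in lborel. \<bar>w x\<bar> \<le> max B (B * (pi * R\<^sup>2))"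
    using B by (auto intro!: AE_I2 max.coboundedI1)
qed

lemma partial_translate:
  assumes f: "smooth f"
  shows "partial j (\<lambda>x. f (x - q)) x = partial j f (x - q)"
proof -
  have "((\<lambda>x. x - q) has_derivative (\<lambda>v. v)) (at x)"
    by (auto intro!: derivative_eq_intros)
  from has_derivative_compose[OF this smooth_has_derivative[OF f]]
  show ?thesis
    by (simp add: partial_def frechet_derivative_at[symmetric])
qed

text \<open>\<open>A\<close> is the background profile around \<open>(c1, c2)\<close> with core
  value \<open>\<alpha>\<close>, and \<open>B\<close> is the profile of the vortex moving along
  \<open>(a, b)\<close>. \<open>SA\<close> and \<open>SB\<close> are squared radii beyond which the
  profiles vanish, and \<open>\<rho>\<close> bounds the coordinates of both centres.
  \<open>path\<close> is the rotation about \<open>(c1, c2)\<close> with angular velocity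
  \<open>\<alpha> / 2\<close>. The core condition reaches up to \<open>SB + 1\<close>, past which
  also the derivative of the vorticity profile of \<open>B\<close> is known to be
  \<open>0\<close>.\<close>

locale vortex_pair =
  fixes A B :: "real \<Rightarrow> real" and \<alpha> c1 c2 SA SB \<rho> :: real and a b :: "real \<Rightarrow> real"
  assumes smooth_data: "smooth A" "smooth B" "smooth a" "smooth b"
    and A_supp: "\<And>s. s \<ge> SA \<Longrightarrow> A s = 0" and B_supp: "\<And>s. s \<ge> SB \<Longrightarrow> B s = 0"
    and path: "\<And>t. deriv a t = - (\<alpha> / 2) * (b t - c2)" "\<And>t. deriv b t = (\<alpha> / 2) * (a t - c1)"
    and path_bound: "\<And>t. \<bar>a t\<bar> \<le> \<rho>" "\<And>t. \<bar>b t\<bar> \<le> \<rho>" "\<bar>c1\<bar> \<le> \<rho>" "\<bar>c2\<bar> \<le> \<rho>"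
    and core: "\<And>p. rad2 a b p < SB + 1 \<Longrightarrow> A (rad2 (\<lambda>t. c1) (\<lambda>t. c2) p) = \<alpha>"
      "\<And>p. rad2 a b p < SB + 1 \<Longrightarrow> deriv (vort_profile A) (rad2 (\<lambda>t. c1) (\<lambda>t. c2) p) = 0"
begin

definition "W p = vort A (\<lambda>t. c1) (\<lambda>t. c2) p + vort B a b p"

definition "U p = vel1 A (\<lambda>t. c1) (\<lambda>t. c2) p + vel1 B a b p"

definition "V p = vel2 A (\<lambda>t. c1) (\<lambda>t. c2) p + vel2 B a b p"

lemma smooth_WUV: "smooth W" "smooth U" "smooth V"
  unfolding W_def[abs_def] U_def[abs_def] V_def[abs_def]
  by (intro smooth_add smooth_vort smooth_vel1 smooth_vel2 smooth_data smooth_const)+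

lemma space_deriv_add:
  "smooth f \<Longrightarrow> smooth g \<Longrightarrow> space_deriv j (\<lambda>p. f p + g p) p = space_deriv j f p + space_deriv j g p"
  unfolding space_deriv_def by (rule frechet_derivative_add_smooth)

lemma div_curl:
  "space_deriv 1 U p + space_deriv 2 V p = 0"
  "W p = space_deriv 1 V p - space_deriv 2 U p"
proof -
  note s = smooth_vel1[OF smooth_data(1) smooth_const smooth_const, of c1 c2] smooth_vel2[OF smooth_data(1) smooth_const smooth_const, of c1 c2]
    smooth_vel1[OF smooth_data(2-4)] smooth_vel2[OF smooth_data(2-4)]
  note d = space_deriv_vel[OF smooth_data(1) smooth_const smooth_const, of c1 c2 p] space_deriv_vel[OF smooth_data(2-4), of p]
  have e: "space_deriv j U p = space_deriv j (vel1 A (\<lambda>t. c1) (\<lambda>t. c2)) p + space_deriv j (vel1 B a b) p"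
    "space_deriv j V p = space_deriv j (vel2 A (\<lambda>t. c1) (\<lambda>t. c2)) p + space_deriv j (vel2 B a b) p" for j
    unfolding U_def[abs_def] V_def[abs_def] by (intro space_deriv_add s)+
  show "space_deriv 1 U p + space_deriv 2 V p = 0" "W p = space_deriv 1 V p - space_deriv 2 U p"
    unfolding e W_def using d by linarith+
qed

lemma vort_profile_B: "s \<ge> SB + 1 \<Longrightarrow> deriv (vort_profile B) s = 0"
proof (rule deriv_locally_const[of "{SB<..}"])
  fix s assume "s \<in> {SB<..}"
  then show "vort_profile B s = 0"
    using B_supp deriv_locally_const[of "{SB<..}" s B 0] by (simp add: vort_profile_def)
qed auto

text \<open>In the support of the moving vortex the background vorticity is constant and the background
  velocity is the rigid rotation that moves the centre of the vortex; a vortex does not act on itself.\<close>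

lemma transport: "time_deriv W p + U p * space_deriv 1 W p + V p * space_deriv 2 W p = 0"
proof -
  define X1 where "X1 = rel1 (\<lambda>t. c1) p"
  define X2 where "X2 = rel2 (\<lambda>t. c2) p"
  define r1 where "r1 = rel1 a p"
  define r2 where "r2 = rel2 b p"
  define q where "q = rad2 (\<lambda>t. c1) (\<lambda>t. c2) p"
  define r where "r = rad2 a b p"
  define wA where "wA = deriv (vort_profile A) q"
  define wB where "wB = deriv (vort_profile B) r"
  have sA: "smooth (vort A (\<lambda>t. c1) (\<lambda>t. c2))" and sB: "smooth (vort B a b)"
    by (intro smooth_vort smooth_data smooth_const)+
  have fW: "frechet_derivative W (at p) v = wA * (2 * X1 * (snd v $ 1) + 2 * X2 * (snd v $ 2)) +
      wB * (2 * r1 * (snd v $ 1 - fst v * deriv a (fst p)) + 2 * r2 * (snd v $ 2 - fst v * deriv b (fst p)))" for v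
    unfolding W_def[abs_def] frechet_derivative_add_smooth[OF sA sB]
      frechet_derivative_vort[OF smooth_data(1) smooth_const smooth_const] frechet_derivative_vort[OF smooth_data(2-4)]
    by (simp add: wA_def wB_def X1_def X2_def r1_def r2_def q_def r_def)
  have rel: "X1 = r1 + (a (fst p) - c1)" "X2 = r2 + (b (fst p) - c2)"
    by (simp_all add: X1_def X2_def r1_def r2_def rel1_def rel2_def)
  have UV: "U p = - (1 / 2) * A q * X2 - (1 / 2) * B r * r2" "V p = (1 / 2) * A q * X1 + (1 / 2) * B r * r1"
    by (simp_all add: U_def V_def vel1_def vel2_def X1_def X2_def r1_def r2_def q_def r_def)
  \<comment> \<open>Self-interactions cancel. What is left couples the moving vorticity with the
    deviation of the background from rigid rotation, and the moving velocity with the gradient of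
    the background vorticity; where \<open>B\<close> lives both second factors vanish, elsewhere
    both first ones do.\<close>
  have "time_deriv W p + U p * space_deriv 1 W p + V p * space_deriv 2 W p =
      wB * (\<alpha> - A q) * (r1 * (b (fst p) - c2) - r2 * (a (fst p) - c1)) + wA * B r * (r1 * X2 - r2 * X1)"
    unfolding time_deriv_def space_deriv_def fW UV path rel by (simp add: axis_def field_simps)
  also have "\<dots> = 0"
  proof (cases "r < SB + 1")
    case True
    then show ?thesis using core[of p] by (simp add: r_def q_def wA_def)
  next
    case False
    then show ?thesis using B_supp[of r] vort_profile_B[of r] by (simp add: wB_def)
  qed
  finally show ?thesis .
qed

definition "Wt t x = W (t, x)"

lemma smooth_Wt: "smooth (Wt t)"
  unfolding Wt_def[abs_def] by (rule smooth_slice[OF smooth_WUV(1)])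

text \<open>A common radius of support: \<open>2 * \<rho>\<close> allows for the position of a
  centre, and with \<open>S = \<bar>SA\<bar> + \<bar>SB\<bar>\<close> the distance
  \<open>S + 1\<close> has a square larger than \<open>S\<close>.\<close>

definition "K = 2 * \<rho> + \<bar>SA\<bar> + \<bar>SB\<bar> + 1"

lemma K_pos: "K > 0"
  using path_bound(3) abs_ge_zero[of c1] by (auto simp: K_def intro: add_nonneg_pos)

lemma rad2_large:
  assumes x: "norm x \<ge> K" and kl: "\<bar>k t\<bar> \<le> \<rho>" "\<bar>l t\<bar> \<le> \<rho>"
  shows "rad2 k l (t, x) > \<bar>SA\<bar> + \<bar>SB\<bar>"
proof -
  define S where "S = \<bar>SA\<bar> + \<bar>SB\<bar>"
  define y where "y = (vector [x $ 1 - k t, x $ 2 - l t] :: real^2)"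
  have y2: "(norm y)\<^sup>2 = rad2 k l (t, x)"
    by (simp add: norm_power2_real2 y_def vector_2 rad2_def rel1_def rel2_def)
  have "norm x \<le> norm y + norm (x - y)"
    using norm_triangle_ineq[of y "x - y"] by simp
  moreover have "norm (x - y) \<le> 2 * \<rho>"
    using norm_real2_le[of "x - y"] kl by (simp add: y_def vector_2)
  ultimately have "norm y \<ge> S + 1" using x by (simp add: K_def S_def)
  moreover have "S \<ge> 0" by (simp add: S_def)
  ultimately have "(norm y)\<^sup>2 \<ge> (S + 1)\<^sup>2" by (intro power_mono) auto
  moreover have "(S + 1)\<^sup>2 > S" using \<open>S \<ge> 0\<close> by (simp add: power2_eq_square algebra_simps add_nonneg_pos add_pos_nonneg)
  ultimately show ?thesis unfolding S_def[symmetric] y2[symmetric] by linarith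
qed

lemma vanish:
  assumes x: "norm x \<ge> K"
  shows "W (t, x) = 0" "U (t, x) = 0" "V (t, x) = 0"
proof -
  have 1: "rad2 (\<lambda>t. c1) (\<lambda>t. c2) (t, x) > SA"
    using rad2_large[OF x, of "\<lambda>t. c1" t "\<lambda>t. c2"] path_bound by auto
  have 2: "rad2 a b (t, x) > SB"
    using rad2_large[OF x, of a t b] path_bound by auto
  have "deriv A s = 0" if "s > SA" for s
    by (rule deriv_locally_const[of "{SA<..}" s A 0]) (use that A_supp in auto)
  moreover have "deriv B s = 0" if "s > SB" for s
    by (rule deriv_locally_const[of "{SB<..}" s B 0]) (use that B_supp in auto)
  ultimately show "W (t, x) = 0" "U (t, x) = 0" "V (t, x) = 0"
    using 1 2 A_supp B_supp
    by (auto simp: W_def U_def V_def vort_def vort_profile_def vel1_def vel2_def)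
qed

lemma test_slices: "test_function (Wt t)" "test_function (\<lambda>x. U (t, x))" "test_function (\<lambda>x. V (t, x))"
proof -
  show "test_function (Wt t)"
    using smooth_Wt compactly_supportedI[of K "Wt t"] vanish(1) by (auto simp: test_function_def Wt_def)
  show "test_function (\<lambda>x. U (t, x))"
    using smooth_slice[OF smooth_WUV(2)] compactly_supportedI[of K "\<lambda>x. U (t, x)"] vanish(2)
    by (auto simp: test_function_def)
  show "test_function (\<lambda>x. V (t, x))"
    using smooth_slice[OF smooth_WUV(3)] compactly_supportedI[of K "\<lambda>x. V (t, x)"] vanish(3)
    by (auto simp: test_function_def)
qed

lemma biot_savart_Wt: "biot_savart (Wt t) = (\<lambda>x. vector [U (t, x), V (t, x)])"
proof
  fix x
  show "biot_savart (Wt t) x = vector [U (t, x), V (t, x)]"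
  proof (rule biot_savart_of_velocity(1)[OF test_slices(2,3)])
    fix x
    show "partial 1 (\<lambda>x. U (t, x)) x + partial 2 (\<lambda>x. V (t, x)) x = 0"
      by (simp add: partial_slice smooth_WUV div_curl(1))
    show "Wt t x = partial 1 (\<lambda>x. V (t, x)) x - partial 2 (\<lambda>x. U (t, x)) x"
      by (simp add: partial_slice smooth_WUV div_curl(2) Wt_def)
  qed
qed

lemma weak_Wt: "weak_vorticity_eq (Wt 0) Wt (\<lambda>t. biot_savart (Wt t))"
  using classical_solution_weak[OF smooth_WUV div_curl(1) transport]
  unfolding biot_savart_Wt unfolding Wt_def[abs_def] .

text \<open>The function is a fixed profile plus a translate of a second fixed profile, so time
  enters only through the translation and the bounds do not depend on it.\<close>

lemma uniform_bound:
  assumes f: "smooth f" "smooth g"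
    and eq: "\<And>t x. h t x = f (x - vector [c1, c2]) + g (x - vector [a t, b t])"
    and z: "\<And>x. norm x \<ge> K \<Longrightarrow> f x = 0" "\<And>x. norm x \<ge> K \<Longrightarrow> g x = 0"
  obtains D where "\<And>t x. \<bar>h t x\<bar> \<le> D" "\<And>t x j. \<bar>partial j (h t) x\<bar> \<le> D"
proof -
  have t: "test_function f" "test_function g"
    using f compactly_supportedI[of K f] compactly_supportedI[of K g] z by (auto simp: test_function_def)
  obtain F0 where F0: "\<And>x. \<bar>f x\<bar> \<le> F0" using test_function_boundedE[OF t(1)] by metis
  obtain F1 where F1: "\<And>x. \<bar>partial 1 f x\<bar> \<le> F1" using test_function_boundedE[OF test_function_partial[OF t(1)]] by metis
  obtain F2 where F2: "\<And>x. \<bar>partial 2 f x\<bar> \<le> F2" using test_function_boundedE[OF test_function_partial[OF t(1)]] by metis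
  obtain G0 where G0: "\<And>x. \<bar>g x\<bar> \<le> G0" using test_function_boundedE[OF t(2)] by metis
  obtain G1 where G1: "\<And>x. \<bar>partial 1 g x\<bar> \<le> G1" using test_function_boundedE[OF test_function_partial[OF t(2)]] by metis
  obtain G2 where G2: "\<And>x. \<bar>partial 2 g x\<bar> \<le> G2" using test_function_boundedE[OF test_function_partial[OF t(2)]] by metis
  have st: "smooth (\<lambda>x. k (x - q))" if "smooth k" for k :: "real^2 \<Rightarrow> real" and q
    using smooth_affine[OF bounded_linear_ident that, of "- q"] by simp
  have ph: "partial j (h t) x = partial j f (x - vector [c1, c2]) + partial j g (x - vector [a t, b t])" for j t x
    unfolding eq[abs_def] by (simp add: partial_add st f partial_translate)
  show ?thesis
  proof (rule that[of "F0 + G0 + (F1 + G1) + (F2 + G2)"])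
    have n: "F0 \<ge> 0" "F1 \<ge> 0" "F2 \<ge> 0" "G0 \<ge> 0" "G1 \<ge> 0" "G2 \<ge> 0"
      using order_trans[OF abs_ge_zero F0] order_trans[OF abs_ge_zero F1] order_trans[OF abs_ge_zero F2]
        order_trans[OF abs_ge_zero G0] order_trans[OF abs_ge_zero G1] order_trans[OF abs_ge_zero G2] by auto
    show "\<bar>h t x\<bar> \<le> F0 + G0 + (F1 + G1) + (F2 + G2)" for t x
      unfolding eq using F0[of "x - vector [c1, c2]"] G0[of "x - vector [a t, b t]"] n by linarith
    show "\<bar>partial j (h t) x\<bar> \<le> F0 + G0 + (F1 + G1) + (F2 + G2)" for t x j
      unfolding ph using exhaust_2[of j] F1[of "x - vector [c1, c2]"] G1[of "x - vector [a t, b t]"]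
        F2[of "x - vector [c1, c2]"] G2[of "x - vector [a t, b t]"] n by auto
  qed
qed

lemma static:
  defines "o0 \<equiv> (\<lambda>t::real. 0::real)"
  shows "vort \<beta> k l (t, x) = vort \<beta> o0 o0 (0, x - vector [k t, l t])"
    "vel1 \<beta> k l (t, x) = vel1 \<beta> o0 o0 (0, x - vector [k t, l t])"
    "vel2 \<beta> k l (t, x) = vel2 \<beta> o0 o0 (0, x - vector [k t, l t])"
  by (simp_all add: o0_def vort_def vel1_def vel2_def rad2_def rel1_def rel2_def vector_2)

lemma static_vanish:
  defines "o0 \<equiv> (\<lambda>t::real. 0::real)"
  assumes x: "norm x \<ge> K" and \<beta>: "\<And>s. s \<ge> S \<Longrightarrow> \<beta> s = 0" "S \<le> \<bar>SA\<bar> + \<bar>SB\<bar>"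
  shows "vort \<beta> o0 o0 (0, x) = 0" "vel1 \<beta> o0 o0 (0, x) = 0" "vel2 \<beta> o0 o0 (0, x) = 0"
proof -
  have "rad2 o0 o0 (0, x) > S"
    using rad2_large[OF x, of o0 0 o0] path_bound(3) abs_ge_zero[of c1] \<beta>(2) unfolding o0_def by fastforce
  moreover have "deriv \<beta> s = 0" if "s > S" for s
    by (rule deriv_locally_const[of "{S<..}" s \<beta> 0]) (use that \<beta> in auto)
  ultimately show "vort \<beta> o0 o0 (0, x) = 0" "vel1 \<beta> o0 o0 (0, x) = 0" "vel2 \<beta> o0 o0 (0, x) = 0"
    using \<beta>(1) by (auto simp: vort_def vort_profile_def vel1_def vel2_def)
qed

lemma bounds:
  obtains C L where "\<And>t. L1_Linf_bound C (Wt t)"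
    "\<And>t i j x. \<bar>partial j (\<lambda>x. biot_savart (Wt t) x $ i) x\<bar> \<le> L"
proof -
  define o0 where "o0 = (\<lambda>t::real. 0::real)"
  have so: "smooth o0" unfolding o0_def by (rule smooth_const)
  note st = smooth_slice[OF smooth_vort[OF _ so so]] smooth_slice[OF smooth_vel1[OF _ so so]] smooth_slice[OF smooth_vel2[OF _ so so]]
  have ALL: "SA \<le> \<bar>SA\<bar> + \<bar>SB\<bar>" "SB \<le> \<bar>SA\<bar> + \<bar>SB\<bar>" by auto
  have zA: "vort A o0 o0 (0, x) = 0" "vel1 A o0 o0 (0, x) = 0" "vel2 A o0 o0 (0, x) = 0" if "norm x \<ge> K" for x
    using static_vanish[of x SA A] that A_supp ALL(1) unfolding o0_def by auto
  have zB: "vort B o0 o0 (0, x) = 0" "vel1 B o0 o0 (0, x) = 0" "vel2 B o0 o0 (0, x) = 0" if "norm x \<ge> K" for x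
    using static_vanish[of x SB B] that B_supp ALL(2) unfolding o0_def by auto
  have eW: "Wt t x = vort A o0 o0 (0, x - vector [c1, c2]) + vort B o0 o0 (0, x - vector [a t, b t])" for t x
    unfolding Wt_def W_def o0_def by (intro arg_cong2[where f = "(+)"] static)
  have eU: "U (t, x) = vel1 A o0 o0 (0, x - vector [c1, c2]) + vel1 B o0 o0 (0, x - vector [a t, b t])" for t x
    unfolding U_def o0_def by (intro arg_cong2[where f = "(+)"] static)
  have eV: "V (t, x) = vel2 A o0 o0 (0, x - vector [c1, c2]) + vel2 B o0 o0 (0, x - vector [a t, b t])" for t x
    unfolding V_def o0_def by (intro arg_cong2[where f = "(+)"] static)
  obtain D0 where D0: "\<And>t x. \<bar>Wt t x\<bar> \<le> D0"
    by (rule uniform_bound[where h = Wt, OF st(1)[OF smooth_data(1)] st(1)[OF smooth_data(2)] eW], rule zA(1), assumption, rule zB(1), assumption, rule that, blast)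
  obtain D1 where D1: "\<And>t x j. \<bar>partial j (\<lambda>x. U (t, x)) x\<bar> \<le> D1"
    by (rule uniform_bound[where h = "\<lambda>t x. U (t, x)", OF st(2)[OF smooth_data(1)] st(2)[OF smooth_data(2)] eU], rule zA(2), assumption, rule zB(2), assumption, rule that, blast)
  obtain D2 where D2: "\<And>t x j. \<bar>partial j (\<lambda>x. V (t, x)) x\<bar> \<le> D2"
    by (rule uniform_bound[where h = "\<lambda>t x. V (t, x)", OF st(3)[OF smooth_data(1)] st(3)[OF smooth_data(2)] eV], rule zA(3), assumption, rule zB(3), assumption, rule that, blast)
  show ?thesis
  proof (rule that[of "max D0 (D0 * (pi * K\<^sup>2))" "max D1 D2"])
    show "L1_Linf_bound (max D0 (D0 * (pi * K\<^sup>2))) (Wt t)" for t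
      by (rule L1_Linf_bound_cs[OF smooth_continuous_on[OF smooth_Wt] D0])
        (use vanish(1) K_pos in \<open>auto simp: Wt_def\<close>)
    show "\<bar>partial j (\<lambda>x. biot_savart (Wt t) x $ i) x\<bar> \<le> max D1 D2" for t i j x
      using exhaust_2[of i] D1[of j t x] D2[of j t x] by (auto simp: biot_savart_Wt vector_2)
  qed
qed

lemma yudovich: "yudovich_solution (Wt 0) Wt"
proof -
  obtain C L where CL: "\<And>t. L1_Linf_bound C (Wt t)"
    "\<And>t i j x. \<bar>partial j (\<lambda>x. biot_savart (Wt t) x $ i) x\<bar> \<le> L"
    using bounds by blast
  have strong: "test_field (biot_savart (Wt t))" for t
    using test_slices(2,3)[of t] by (simp add: test_field_def forall_2 biot_savart_Wt vector_2)
  have "AE x in lborel. \<omega>' t x = Wt t x" if cl: "in_yudovich_class (Wt 0) \<omega>'" and t: "t \<ge> 0" for \<omega>' t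
  proof -
    obtain C' where C': "\<And>t. t \<ge> 0 \<Longrightarrow> L1_Linf_bound C' (\<omega>' t)"
      and w': "weak_vorticity_eq (Wt 0) \<omega>' (\<lambda>t. biot_savart (\<omega>' t))"
      using cl unfolding in_yudovich_class_def by blast
    \<comment> \<open>The two solutions may come with different class bounds; the larger one serves
      both.\<close>
    interpret weak_strong "Wt 0" Wt \<omega>' "max C C'" L
      by unfold_locales
        (use CL(2) w' weak_Wt strong L1_Linf_bound_mono[OF CL(1) max.cobounded1]
          L1_Linf_bound_mono[OF C' max.cobounded2] in auto)
    show ?thesis using uniqueness[OF t] .
  qed
  then show ?thesis
    unfolding yudovich_solution_def in_yudovich_class_def using CL(1) weak_Wt by blast
qed

lemma smooth_compact_solution: "smooth_compact_euler_solution Wt"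
proof -
  obtain C where C: "\<And>t. L1_Linf_bound C (Wt t)"
    by (rule bounds, rule that, blast)
  have "compact (cball (0::real^2) K) \<and> (\<forall>t\<in>{0..T}. \<forall>x. x \<notin> cball 0 K \<longrightarrow> Wt t x = 0)" for T :: real
    using vanish(1) by (auto simp: Wt_def)
  then have "\<forall>T\<ge>0. \<exists>K. compact K \<and> (\<forall>t\<in>{0..T}. \<forall>x. x \<notin> K \<longrightarrow> Wt t x = 0)"
    by blast
  moreover have "\<exists>X. smooth X \<and> (\<forall>t\<ge>0. \<forall>x. Wt t x = X (t, x))"
    using smooth_WUV(1) by (auto simp: Wt_def)
  ultimately have "smooth_compact_vorticity Wt"
    unfolding smooth_compact_vorticity_def by blast
  then show ?thesis
    unfolding smooth_compact_euler_solution_def euler_weak_solution_def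
    using weak_Wt biot_savart_distr[OF C] by simp
qed

lemma initial_data: "L1_Linf (Wt t)" "compactly_supported (Wt t)"
proof -
  show "L1_Linf (Wt t)"
    unfolding L1_Linf_def by (rule bounds, rule exI, blast)
  show "compactly_supported (Wt t)" using test_slices(1)[of t] by (simp add: test_function_def)
qed

end

subsection \<open>The approximating solutions and their limit\<close>

text \<open>Vorticity \<open>2 * v / m\<close> in the core means angular velocity
  \<open>v / m\<close>, hence speed \<open>v\<close> at distance \<open>m\<close> from the centre.
  The step leaves the profile constant for squared radius up to \<open>6 * m\<^sup>2 + 3\<close>,
  enough to contain the moving vortex on its whole circle.\<close>

definition background :: "real \<Rightarrow> real \<Rightarrow> real \<Rightarrow> real" where
  "background v m s = 2 * v / m * smooth_step (s - (6 * m\<^sup>2 + 4))"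

text \<open>Up to smoothing, \<open>s * patch m s\<close> is \<open>min s (m\<^sup>2)\<close> for \<open>s < 2 m\<^sup>2\<close>: the vorticity is \<open>1\<close> in the disc of
  radius \<open>m\<close>, it is compensated only at distance \<open>sqrt 2 m\<close>, and the total circulation is \<open>0\<close>.
  The added \<open>smooth_step\<close> in the denominator only avoids the pole at \<open>s = 0\<close>.\<close>

definition patch :: "real \<Rightarrow> real \<Rightarrow> real" where
  "patch m s = (smooth_step (s - m\<^sup>2) + (1 - smooth_step (s - m\<^sup>2)) *
    (m\<^sup>2 * s / (s * s + smooth_step (s - m\<^sup>2 + 1)))) * smooth_step (s - 2 * m\<^sup>2)"

text \<open>With \<open>path2\<close> this is the circle of radius \<open>m\<close> about
  \<open>(- m, m)\<close>, left from \<open>(0, m)\<close> with velocity \<open>(0, v)\<close>; a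
  disc of radius \<open>m\<close> around the starting point touches the horizontal axis at the
  origin.\<close>

definition path1 :: "real \<Rightarrow> real \<Rightarrow> real \<Rightarrow> real" where
  "path1 v m t = m * cos (v / m * t) - m"

definition path2 :: "real \<Rightarrow> real \<Rightarrow> real \<Rightarrow> real" where
  "path2 v m t = m + m * sin (v / m * t)"

text \<open>The offset gives \<open>m \<ge> 2\<close>, and \<open>m\<^sup>2 \<ge> 4\<close> leaves
  room for transition layers of width \<open>1\<close> in the squared radius.\<close>

definition approx_sol :: "real \<Rightarrow> nat \<Rightarrow> real \<Rightarrow> real^2 \<Rightarrow> real" where
  "approx_sol v n t x = (let m = real n + 2 in
    vort (background v m) (\<lambda>t. - m) (\<lambda>t. m) (t, x) + vort (patch m) (path1 v m) (path2 v m) (t, x))"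

lemma smooth_background: "smooth (background v m)"
  unfolding background_def[abs_def]
  by (intro smooth_mult smooth_const smooth_compose[OF smooth_smooth_step smooth_diff[OF smooth_ident smooth_const]])

lemma smooth_patch:
  assumes m: "m \<ge> 2"
  shows "smooth (patch m)"
proof -
  have s1: "smooth (\<lambda>s::real. smooth_step (s - c))" for c
    by (rule smooth_compose[OF smooth_smooth_step smooth_diff[OF smooth_ident smooth_const]])
  have "m\<^sup>2 \<ge> 2\<^sup>2" using m by (intro power_mono) auto
  \<comment> \<open>At \<open>s = 0\<close> the step has argument
    \<open>1 - m\<^sup>2 \<le> - 1\<close> and thus the value \<open>1\<close>; at every other
    \<open>s\<close> the square is positive.\<close>
  have "s * s + smooth_step (s - (m\<^sup>2 - 1)) \<noteq> 0" for s
  proof (cases "s = 0")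
    case True
    then show ?thesis using \<open>m\<^sup>2 \<ge> 2\<^sup>2\<close> by (simp add: smooth_step_eq_1)
  next
    case False
    then have "s * s > 0" by (simp add: zero_less_mult_iff) linarith
    then show ?thesis using smooth_step_bounds(1)[of "s - (m\<^sup>2 - 1)"] by linarith
  qed
  then have "smooth (\<lambda>s::real. m\<^sup>2 * s / (s * s + smooth_step (s - (m\<^sup>2 - 1))))"
    by (intro smooth_divide smooth_mult smooth_const smooth_ident smooth_add s1)
  then have "smooth (\<lambda>s::real. (smooth_step (s - m\<^sup>2) + (1 - smooth_step (s - m\<^sup>2)) *
      (m\<^sup>2 * s / (s * s + smooth_step (s - (m\<^sup>2 - 1))))) * smooth_step (s - 2 * m\<^sup>2))"
    by (intro smooth_mult[of _ "\<lambda>s. smooth_step (s - 2 * m\<^sup>2)"] smooth_add smooth_mult smooth_diff smooth_const s1)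
  moreover have e: "s - m\<^sup>2 + 1 = s - (m\<^sup>2 - 1)" for s :: real by simp
  ultimately show ?thesis
    unfolding patch_def[abs_def] e by simp
qed

lemma background_core:
  assumes "s < 6 * m\<^sup>2 + 3"
  shows "background v m s = 2 * v / m" "vort_profile (background v m) s = 2 * v / m"
    "deriv (vort_profile (background v m)) s = 0"
proof -
  have c: "background v m s = 2 * v / m" if "s \<in> {..<6 * m\<^sup>2 + 3}" for s
    using that by (simp add: background_def smooth_step_eq_1)
  then show "background v m s = 2 * v / m" using assms by simp
  have vp: "vort_profile (background v m) s = 2 * v / m" if "s \<in> {..<6 * m\<^sup>2 + 3}" for s
    using c[OF that] deriv_locally_const[OF open_lessThan that c] by (simp add: vort_profile_def)
  then show "vort_profile (background v m) s = 2 * v / m" using assms by simp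
  show "deriv (vort_profile (background v m)) s = 0"
    using deriv_locally_const[OF open_lessThan _ vp] assms by simp
qed

text \<open>\<open>vort_profile\<close> is the derivative of \<open>s * patch m s\<close>. Before
  the outer cutoff acts, this product is exactly
  \<open>m\<^sup>2 + (s - m\<^sup>2) * smooth_step (s - m\<^sup>2)\<close>, so the vorticity depends
  only on \<open>s - m\<^sup>2\<close>.\<close>

lemma patch_core:
  assumes m: "m \<ge> 2" and s: "s < 2 * m\<^sup>2 - 1"
  shows "vort_profile (patch m) s = smooth_step (s - m\<^sup>2) + (s - m\<^sup>2) * deriv smooth_step (s - m\<^sup>2)"
proof -
  have "m\<^sup>2 \<ge> 2\<^sup>2" using m by (intro power_mono) auto
  then have m2: "m\<^sup>2 \<ge> 4" by simp
  \<comment> \<open>For \<open>s < m\<^sup>2 - 1\<close> the inner step is \<open>1\<close> and the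
    quotient is switched off; from there on the auxiliary step in the denominator is
    \<open>0\<close> and the quotient is \<open>m\<^sup>2 / s\<close>.\<close>
  have eq: "m\<^sup>2 + (s - m\<^sup>2) * smooth_step (s - m\<^sup>2) = s * patch m s" if "s \<in> {..<2 * m\<^sup>2 - 1}" for s
  proof (cases "s < m\<^sup>2 - 1")
    case True
    then show ?thesis using m2 by (simp add: patch_def smooth_step_eq_1)
  next
    case False
    then have "s > 0" using m2 by linarith
    then show ?thesis
      using False that by (simp add: patch_def smooth_step_eq_0 smooth_step_eq_1 field_simps)
  qed
  have "((\<lambda>s. m\<^sup>2 + (s - m\<^sup>2) * smooth_step (s - m\<^sup>2)) has_field_derivative
      smooth_step (s - m\<^sup>2) + (s - m\<^sup>2) * deriv smooth_step (s - m\<^sup>2)) (at s)"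
    by (auto intro!: derivative_eq_intros DERIV_chain2[OF smooth_DERIV(1)[OF smooth_smooth_step]])
  then have "((\<lambda>s. s * patch m s) has_field_derivative
      smooth_step (s - m\<^sup>2) + (s - m\<^sup>2) * deriv smooth_step (s - m\<^sup>2)) (at s)"
    by (rule has_field_derivative_transform_within_open[OF _ open_lessThan[of "2 * m\<^sup>2 - 1"]]) (use s eq in auto)
  moreover have "((\<lambda>s. s * patch m s) has_field_derivative patch m s + s * deriv (patch m) s) (at s)"
    by (auto intro!: derivative_eq_intros smooth_DERIV(1)[OF smooth_patch[OF m]])
  ultimately show ?thesis
    unfolding vort_profile_def by (rule DERIV_unique[symmetric])
qed

lemma vortex_pair_approx:
  assumes m: "m \<ge> 2"
  shows "vortex_pair (background v m) (patch m) (2 * v / m) (- m) m (6 * m\<^sup>2 + 4) (2 * m\<^sup>2) (2 * m)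
    (path1 v m) (path2 v m)"
proof
  show "smooth (background v m)" "smooth (patch m)"
    by (intro smooth_background smooth_patch m)+
  have l: "smooth (\<lambda>t::real. v / m * t)"
    by (intro smooth_mult smooth_const smooth_ident)
  show "smooth (path1 v m)" "smooth (path2 v m)"
    unfolding path1_def[abs_def] path2_def[abs_def]
    by (intro smooth_add smooth_diff smooth_mult[of "\<lambda>t. m"] smooth_const smooth_sin smooth_cos l)+
  show "background v m s = 0" if "6 * m\<^sup>2 + 4 \<le> s" for s
    using that by (simp add: background_def smooth_step_eq_0)
  show "patch m s = 0" if "2 * m\<^sup>2 \<le> s" for s
    using that by (simp add: patch_def smooth_step_eq_0)
  have "(path1 v m has_field_derivative - (2 * v / m / 2) * (path2 v m t - m)) (at t)" for t
    unfolding path1_def[abs_def] path2_def using m by (auto intro!: derivative_eq_intros)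
  then show "deriv (path1 v m) t = - (2 * v / m / 2) * (path2 v m t - m)" for t
    by (rule DERIV_imp_deriv)
  have "(path2 v m has_field_derivative 2 * v / m / 2 * (path1 v m t - - m)) (at t)" for t
    unfolding path2_def[abs_def] path1_def using m by (auto intro!: derivative_eq_intros)
  then show "deriv (path2 v m) t = 2 * v / m / 2 * (path1 v m t - - m)" for t
    by (rule DERIV_imp_deriv)
  have cs: "\<bar>m * cos y\<bar> \<le> m" "\<bar>m * sin y\<bar> \<le> m" for y
    using m by (simp_all add: abs_mult mult_left_le)
  show "\<bar>path1 v m t\<bar> \<le> 2 * m" "\<bar>path2 v m t\<bar> \<le> 2 * m" for t
    using m cs[of "v / m * t"] unfolding path1_def path2_def by linarith+
  show "\<bar>- m\<bar> \<le> 2 * m" "\<bar>m\<bar> \<le> 2 * m" using m by auto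
  \<comment> \<open>Source of the constant \<open>6\<close>: for a point at offset \<open>r\<close>
    from the moving centre, itself at offset \<open>d\<close> of length \<open>m\<close>,
    \<open>(r + d)\<^sup>2 \<le> 2 * r\<^sup>2 + 2 * d\<^sup>2\<close> is below
    \<open>2 * (2 * m\<^sup>2 + 1) + 2 * m\<^sup>2\<close>.\<close>
  have "rad2 (\<lambda>t. - m) (\<lambda>t. m) p < 6 * m\<^sup>2 + 3" if "rad2 (path1 v m) (path2 v m) p < 2 * m\<^sup>2 + 1" for p
  proof -
    define r1 where "r1 = rel1 (path1 v m) p"
    define r2 where "r2 = rel2 (path2 v m) p"
    define d1 where "d1 = m * cos (v / m * fst p)"
    define d2 where "d2 = m * sin (v / m * fst p)"
    have "rad2 (\<lambda>t. - m) (\<lambda>t. m) p = (r1 + d1)\<^sup>2 + (r2 + d2)\<^sup>2"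
      by (simp add: rad2_def rel1_def rel2_def r1_def r2_def d1_def d2_def path1_def path2_def power2_eq_square)
    also have "\<dots> \<le> 2 * (r1\<^sup>2 + r2\<^sup>2) + 2 * (d1\<^sup>2 + d2\<^sup>2)"
      using sum_squares_bound[of r1 d1] sum_squares_bound[of r2 d2] by (simp add: power2_sum)
    also have "d1\<^sup>2 + d2\<^sup>2 = m\<^sup>2"
      unfolding d1_def d2_def power_mult_distrib distrib_left[symmetric] by simp
    also have "r1\<^sup>2 + r2\<^sup>2 = rad2 (path1 v m) (path2 v m) p"
      by (simp add: rad2_def r1_def r2_def power2_eq_square)
    finally show ?thesis using that by linarith
  qed
  then show "background v m (rad2 (\<lambda>t. - m) (\<lambda>t. m) p) = 2 * v / m"
    "deriv (vort_profile (background v m)) (rad2 (\<lambda>t. - m) (\<lambda>t. m) p) = 0"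
    if "rad2 (path1 v m) (path2 v m) p < 2 * m\<^sup>2 + 1" for p
    using background_core that by auto
qed

lemma approx_sol_properties:
  shows "yudovich_solution (approx_sol v n 0) (approx_sol v n)"
    and "smooth_compact_euler_solution (approx_sol v n)"
    and "L1_Linf (approx_sol v n t)" "compactly_supported (approx_sol v n t)" "continuous_on UNIV (approx_sol v n t)"
proof -
  define m where "m = real n + 2"
  interpret vp: vortex_pair "background v m" "patch m" "2 * v / m" "- m" m "6 * m\<^sup>2 + 4" "2 * m\<^sup>2" "2 * m"
    "path1 v m" "path2 v m"
    by (rule vortex_pair_approx) (simp add: m_def)
  have eq: "approx_sol v n = vp.Wt"
    unfolding fun_eq_iff approx_sol_def Let_def m_def[symmetric] vp.Wt_def vp.W_def by simp
  show "yudovich_solution (approx_sol v n 0) (approx_sol v n)"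
    unfolding eq by (rule vp.yudovich)
  show "smooth_compact_euler_solution (approx_sol v n)"
    unfolding eq by (rule vp.smooth_compact_solution)
  show "L1_Linf (approx_sol v n t)" "compactly_supported (approx_sol v n t)"
    unfolding eq by (rule vp.initial_data)+
  show "continuous_on UNIV (approx_sol v n t)"
    unfolding eq by (rule smooth_continuous_on[OF vp.smooth_Wt])
qed

section \<open>Convergence to the shifted half-plane\<close>

definition half_plane_above :: "real \<Rightarrow> real^2 \<Rightarrow> real" where
  "half_plane_above h = indicator {x. x $ 2 \<ge> h}"

lemma half_plane_above_measurable [measurable]: "half_plane_above h \<in> borel_measurable borel"
  unfolding half_plane_above_def
  by (intro borel_measurable_indicator borel_closed closed_Collect_le continuous_intros)

lemma smooth_step_deriv_eq_0: "x < - 1 \<or> x > 0 \<Longrightarrow> deriv smooth_step x = 0"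
  using deriv_locally_const[of "{..<-1}" x smooth_step 1] deriv_locally_const[of "{0<..}" x smooth_step 0]
  by (auto simp: smooth_step_eq_1 smooth_step_eq_0)

text \<open>Gives a bound for the vorticity in the smoothed rim of the disc that does not depend on
  \<open>m\<close>, as domination requires. The derivative of the step lives on a compact
  interval.\<close>

lemma transition_bound:
  obtains M where "M > 0" "\<And>x. \<bar>smooth_step x + x * deriv smooth_step x\<bar> \<le> M"
proof -
  have "compact (deriv smooth_step ` {-1..0})"
    by (intro compact_continuous_image smooth_continuous_on smooth_deriv smooth_smooth_step) simp
  then obtain N where N: "N > 0" "\<And>x. -1 \<le> x \<Longrightarrow> x \<le> 0 \<Longrightarrow> \<bar>deriv smooth_step x\<bar> \<le> N"
    using compact_imp_bounded[of "deriv smooth_step ` {-1..0}"] by (auto simp: bounded_pos)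
  have "\<bar>smooth_step x + x * deriv smooth_step x\<bar> \<le> 1 + N" for x
  proof -
    have "\<bar>x * deriv smooth_step x\<bar> \<le> N"
    proof (cases "-1 \<le> x \<and> x \<le> 0")
      case True
      then have "\<bar>x\<bar> * \<bar>deriv smooth_step x\<bar> \<le> 1 * N"
        using N by (intro mult_mono) auto
      then show ?thesis by (simp add: abs_mult)
    next
      case False
      then show ?thesis using smooth_step_deriv_eq_0[of x] N(1) by auto
    qed
    then show ?thesis using smooth_step_bounds[of x] by linarith
  qed
  then show ?thesis using that[of "1 + N"] N(1) by auto
qed

text \<open>The power of the point \<open>x\<close> with respect to the moving disc: negative inside
  the circle, positive outside. The smoothed rim is \<open>- 1 \<le> depth \<le> 0\<close>.\<close>

definition depth :: "real \<Rightarrow> real \<Rightarrow> nat \<Rightarrow> real^2 \<Rightarrow> real" where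
  "depth v t n x = (let m = real n + 2 in rad2 (path1 v m) (path2 v m) (t, x) - m\<^sup>2)"

text \<open>The height of the lowest point of the moving disc, the centre being at
  \<open>m + m * sin (v / m * t)\<close> and the radius being \<open>m\<close>.\<close>

definition drift :: "real \<Rightarrow> real \<Rightarrow> nat \<Rightarrow> real" where
  "drift v t n = (real n + 2) * sin (v / (real n + 2) * t)"

lemma drift_tendsto: "drift v t \<longlonglongrightarrow> v * t"
proof (cases "v * t = 0")
  case True
  then have eq: "drift v t = (\<lambda>n. v * t)"
    by (auto simp: drift_def fun_eq_iff)
  show ?thesis unfolding eq by (rule tendsto_const)
next
  case False
  define h where "h n = v * t / (real n + 2)" for n :: nat
  have "filterlim (\<lambda>n. real n + 2) at_top sequentially"
    by (rule filterlim_tendsto_add_at_top[OF tendsto_const filterlim_real_sequentially, of 2, unfolded add.commute[of 2]])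
  then have "h \<longlonglongrightarrow> 0"
    unfolding h_def[abs_def] by (intro tendsto_divide_0[OF tendsto_const] filterlim_at_top_imp_at_infinity)
  moreover have hn: "h n \<noteq> 0" for n using False by (simp add: h_def)
  ultimately have "filterlim h (at 0) sequentially"
    by (intro filterlim_atI) auto
  moreover have "((\<lambda>h. (sin (0 + h) - sin 0) / h) \<longlongrightarrow> (1::real)) (at 0)"
    using DERIV_sin[of "0::real"] unfolding DERIV_def by simp
  ultimately have "(\<lambda>n. (sin (0 + h n) - sin 0) / h n) \<longlonglongrightarrow> 1"
    by (rule filterlim_compose[rotated])
  then have "(\<lambda>n. v * t * ((sin (0 + h n) - sin 0) / h n)) \<longlonglongrightarrow> v * t * 1"
    by (intro tendsto_mult_left)
  moreover have "v * t * ((sin (0 + h n) - sin 0) / h n) = drift v t n" for n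
    using False by (simp add: h_def drift_def)
  ultimately show ?thesis by simp
qed

text \<open>Expanding the squared distance leaves the linear term
  \<open>- 2 * m * (x $ 2 - drift v t n)\<close> and two squares that are bounded on a ball
  independently of \<open>n\<close>. For large \<open>m\<close> the rim is therefore almost a
  horizontal line at height \<open>drift\<close>.\<close>

lemma depth_estimate:
  fixes v t R :: real
  assumes x: "norm x \<le> R"
  defines "P \<equiv> (R + (v * t)\<^sup>2)\<^sup>2 + (R + \<bar>v * t\<bar>)\<^sup>2"
  shows "0 \<le> depth v t n x + 2 * (real n + 2) * (x $ 2 - drift v t n)"
    and "depth v t n x + 2 * (real n + 2) * (x $ 2 - drift v t n) \<le> P"
    and "\<bar>x $ 2 - drift v t n\<bar> \<le> R + \<bar>v * t\<bar>"
proof -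
  define m where "m = real n + 2"
  define \<theta> where "\<theta> = v / m * t"
  have m: "m \<ge> 2" by (simp add: m_def)
  have dr: "drift v t n = m * sin \<theta>" by (simp add: drift_def m_def \<theta>_def)
  have comp: "\<bar>x $ 1\<bar> \<le> R" "\<bar>x $ 2\<bar> \<le> R"
    using x component_le_norm_cart[of x] by (auto intro: order_trans)
  have m\<theta>: "m * \<bar>\<theta>\<bar> = \<bar>v * t\<bar>"
    using m by (simp add: \<theta>_def abs_mult)
  have "\<bar>m * sin \<theta>\<bar> \<le> m * \<bar>\<theta>\<bar>"
    using m abs_sin_x_le_abs_x[of \<theta>] by (simp add: abs_mult)
  then have d: "\<bar>drift v t n\<bar> \<le> \<bar>v * t\<bar>" using dr m\<theta> by simp
  then show 3: "\<bar>x $ 2 - drift v t n\<bar> \<le> R + \<bar>v * t\<bar>" using comp by linarith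
  \<comment> \<open>The displacement of the centre to the left, \<open>- path1\<close>. The
    half-angle formula bounds it by \<open>m * \<theta>\<^sup>2 / 2\<close>, and this by the square
    of \<open>m * \<bar>\<theta>\<bar> = \<bar>v * t\<bar>\<close>.\<close>
  define g where "g = m - m * cos \<theta>"
  have g: "0 \<le> g" "g \<le> (v * t)\<^sup>2"
  proof -
    show "0 \<le> g" using m by (simp add: g_def mult_left_le)
    have "cos \<theta> = 1 - 2 * (sin (\<theta> / 2))\<^sup>2"
      using cos_double_sin[of "\<theta> / 2"] by simp
    then have "g = m - m * (1 - 2 * (sin (\<theta> / 2))\<^sup>2)"
      unfolding g_def by (rule arg_cong)
    also have "\<dots> = 2 * m * (sin (\<theta> / 2))\<^sup>2"
      by (simp add: algebra_simps)
    finally have "g = 2 * m * (sin (\<theta> / 2))\<^sup>2" .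
    also have "2 * m * (sin (\<theta> / 2))\<^sup>2 \<le> 2 * m * (\<theta> / 2)\<^sup>2"
      using m by (intro mult_left_mono abs_le_square_iff[THEN iffD1] abs_sin_x_le_abs_x) simp
    also have "\<dots> = m * \<theta>\<^sup>2 / 2" by (simp add: power2_eq_square)
    also have "\<dots> \<le> m * \<theta>\<^sup>2 * m"
      using m mult_left_mono[of "1 / 2" m "m * \<theta>\<^sup>2"] by simp
    also have "\<dots> = (m * \<bar>\<theta>\<bar>)\<^sup>2" by (simp add: power2_eq_square)
    finally show "g \<le> (v * t)\<^sup>2" unfolding m\<theta> by simp
  qed
  have eq: "depth v t n x + 2 * (real n + 2) * (x $ 2 - drift v t n) = (x $ 1 + g)\<^sup>2 + (x $ 2 - drift v t n)\<^sup>2"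
    unfolding depth_def Let_def m_def[symmetric] dr
    by (simp add: rad2_def rel1_def rel2_def path1_def path2_def g_def \<theta>_def power2_eq_square algebra_simps)
  show "0 \<le> depth v t n x + 2 * (real n + 2) * (x $ 2 - drift v t n)"
    unfolding eq by simp
  have "\<bar>x $ 1 + g\<bar> \<le> R + (v * t)\<^sup>2" using comp g by linarith
  then have "\<bar>x $ 1 + g\<bar> \<le> \<bar>R + (v * t)\<^sup>2\<bar>" by linarith
  then have "(x $ 1 + g)\<^sup>2 \<le> (R + (v * t)\<^sup>2)\<^sup>2" by (simp only: abs_le_square_iff)
  moreover have "\<bar>x $ 2 - drift v t n\<bar> \<le> \<bar>R + \<bar>v * t\<bar>\<bar>" using 3 by linarith
  then have "(x $ 2 - drift v t n)\<^sup>2 \<le> (R + \<bar>v * t\<bar>)\<^sup>2" by (simp only: abs_le_square_iff)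
  ultimately show "depth v t n x + 2 * (real n + 2) * (x $ 2 - drift v t n) \<le> P"
    unfolding eq P_def by linarith
qed

lemma shift_at_top: "filterlim (\<lambda>n. real n + 2) at_top sequentially"
  by (rule filterlim_tendsto_add_at_top[OF tendsto_const filterlim_real_sequentially, of 2, unfolded add.commute[of 2]])

text \<open>For large \<open>m\<close> a given ball lies in the core of the background and inside
  the outer cutoff of \<open>patch\<close>, so only the constant background and the rim of the disc
  are visible there.\<close>

lemma approx_sol_local:
  obtains N where "\<And>n x. n \<ge> N \<Longrightarrow> norm x \<le> R \<Longrightarrow> approx_sol v n t x =
    2 * v / (real n + 2) + (smooth_step (depth v t n x) + depth v t n x * deriv smooth_step (depth v t n x))"
proof -
  define P where "P = (R + (v * t)\<^sup>2)\<^sup>2 + (R + \<bar>v * t\<bar>)\<^sup>2"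
  \<comment> \<open>Chosen so that \<open>Q \<le> m\<close> implies both
    \<open>P + 2 * m * (R + \<bar>v * t\<bar>) < m\<^sup>2 - 1\<close>, which avoids the outer
    cutoff of \<open>patch\<close>, and \<open>R \<le> m\<close>, which places the ball in the core.
    The modulus of \<open>R\<close> appears because its sign is known only once the ball contains a
    point.\<close>
  define Q where "Q = P + 2 * \<bar>R\<bar> + 2 * \<bar>v * t\<bar> + R\<^sup>2 + 2"
  have P: "P \<ge> 0" by (simp add: P_def)
  obtain N where N: "\<And>n. n \<ge> N \<Longrightarrow> real n + 2 \<ge> Q"
    using shift_at_top unfolding filterlim_at_top eventually_sequentially by blast
  show ?thesis
  proof (rule that[of N])
    fix n and x :: "real^2" assume n: "n \<ge> N" and x: "norm x \<le> R"
    define m where "m = real n + 2"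
    have m: "m \<ge> 2" "m \<ge> Q" using N[OF n] by (auto simp: m_def)
    have R: "R \<ge> 0" using x norm_ge_zero[of x] by linarith
    have est: "depth v t n x + 2 * m * (x $ 2 - drift v t n) \<le> P" "\<bar>x $ 2 - drift v t n\<bar> \<le> R + \<bar>v * t\<bar>"
      unfolding m_def P_def by (rule depth_estimate[OF x])+
    have Q: "Q = P + 2 * R + 2 * \<bar>v * t\<bar> + R\<^sup>2 + 2"
      unfolding Q_def using R by (simp only: abs_of_nonneg)
    have "depth v t n x \<le> P + 2 * m * (R + \<bar>v * t\<bar>)"
    proof -
      have "2 * m * (drift v t n - x $ 2) \<le> 2 * m * (R + \<bar>v * t\<bar>)"
        using est(2) m by (intro mult_left_mono) auto
      moreover have "2 * m * (drift v t n - x $ 2) = - (2 * m * (x $ 2 - drift v t n))"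
        by (simp add: algebra_simps)
      ultimately show ?thesis using est(1) by linarith
    qed
    moreover have "P + 2 * m * (R + \<bar>v * t\<bar>) < m\<^sup>2 - 1"
    proof -
      have "Q * m \<le> m\<^sup>2" using m by (simp add: power2_eq_square)
      moreover have "P * 1 \<le> P * m" using m P by (intro mult_left_mono) auto
      moreover have "Q * m = P * m + 2 * m * (R + \<bar>v * t\<bar>) + R\<^sup>2 * m + 2 * m"
        unfolding Q by (simp add: algebra_simps)
      moreover have "R\<^sup>2 * m \<ge> 0" using m by simp
      ultimately show ?thesis using m by linarith
    qed
    ultimately have dep: "rad2 (path1 v m) (path2 v m) (t, x) < 2 * m\<^sup>2 - 1"
      by (simp add: depth_def m_def Let_def)
    have "rad2 (\<lambda>t. - m) (\<lambda>t. m) (t, x) < 6 * m\<^sup>2 + 3"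
    proof -
      have "rad2 (\<lambda>t. - m) (\<lambda>t. m) (t, x) = (x $ 1 + m)\<^sup>2 + (x $ 2 - m)\<^sup>2"
        by (simp add: rad2_def rel1_def rel2_def power2_eq_square)
      also have "\<dots> \<le> 2 * (norm x)\<^sup>2 + 4 * m\<^sup>2"
        using sum_squares_bound[of "x $ 1" m] sum_squares_bound[of "x $ 2" "- m"] norm_power2_real2[of x]
        by (simp add: power2_eq_square algebra_simps)
      also have "(norm x)\<^sup>2 \<le> R\<^sup>2" using x by (intro power_mono) auto
      also have "R\<^sup>2 \<le> m\<^sup>2"
      proof (rule power_mono[OF _ R])
        show "R \<le> m" using m R P zero_le_power2[of R] abs_ge_zero[of "v * t"] unfolding Q by linarith
      qed
      finally show ?thesis by linarith
    qed
    from background_core(2)[OF this, of v] patch_core[OF m(1) dep]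
    show "approx_sol v n t x = 2 * v / (real n + 2) +
        (smooth_step (depth v t n x) + depth v t n x * deriv smooth_step (depth v t n x))"
      by (simp add: approx_sol_def vort_def depth_def Let_def m_def)
  qed
qed

text \<open>Off the limiting line \<open>depth\<close> grows like \<open>m\<close> with the sign of
  \<open>v * t - x $ 2\<close>, so the point leaves the rim of fixed width and the disc contributes
  exactly \<open>0\<close> or \<open>1\<close>; the background contributes
  \<open>2 * v / m\<close>.\<close>

lemma approx_sol_pointwise:
  assumes x: "x $ 2 \<noteq> v * t"
  shows "(\<lambda>n. approx_sol v n t x) \<longlonglongrightarrow> half_plane_above (v * t) x"
proof -
  define R where "R = norm x"
  define P where "P = (R + (v * t)\<^sup>2)\<^sup>2 + (R + \<bar>v * t\<bar>)\<^sup>2"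
  have est1: "0 \<le> depth v t n x + 2 * (real n + 2) * (x $ 2 - drift v t n)" for n
    by (rule depth_estimate(1)[of x R]) (simp add: R_def)
  have est2: "depth v t n x + 2 * (real n + 2) * (x $ 2 - drift v t n) \<le> P" for n
    unfolding P_def by (rule depth_estimate(2)) (simp add: R_def)
  obtain N where N: "\<And>n x. n \<ge> N \<Longrightarrow> norm x \<le> R \<Longrightarrow> approx_sol v n t x =
    2 * v / (real n + 2) + (smooth_step (depth v t n x) + depth v t n x * deriv smooth_step (depth v t n x))"
    using approx_sol_local by blast
  \<comment> \<open>Half the distance to the limiting line: once \<open>drift\<close> is within
    \<open>\<eta>\<close> of \<open>v * t\<close>, the point is still at least \<open>\<eta>\<close>
    away from height \<open>drift\<close> on the correct side, and
    \<open>m * \<eta> \<ge> P + 2\<close> decides the sign of \<open>depth\<close>.\<close>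
  define \<eta> where "\<eta> = \<bar>x $ 2 - v * t\<bar> / 2"
  have \<eta>: "\<eta> > 0" using x by (simp add: \<eta>_def)
  have "eventually (\<lambda>n. dist (drift v t n) (v * t) < \<eta>) sequentially"
    using drift_tendsto \<eta> by (rule tendstoD)
  moreover have "eventually (\<lambda>n. real n + 2 \<ge> (P + 2) / \<eta>) sequentially"
    using shift_at_top unfolding filterlim_at_top by blast
  ultimately have "eventually (\<lambda>n. approx_sol v n t x = 2 * v / (real n + 2) + half_plane_above (v * t) x) sequentially"
    using eventually_ge_at_top[of N]
  proof eventually_elim
    case (elim n)
    define m where "m = real n + 2"
    have m: "m \<ge> 2" by (simp add: m_def)
    have P2: "P + 2 \<le> m * \<eta>" using elim(2) \<eta> by (simp add: m_def field_simps)
    have P0: "P \<ge> 0" by (simp add: P_def)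
    have close: "drift v t n - v * t < \<eta>" "v * t - drift v t n < \<eta>"
      using elim(1) by (simp_all add: dist_real_def abs_less_iff)
    define dp where "dp = depth v t n x"
    have "smooth_step dp + dp * deriv smooth_step dp = half_plane_above (v * t) x"
    proof (cases "x $ 2 > v * t")
      case True
      then have "x $ 2 - drift v t n \<ge> \<eta>"
      proof -
        have "\<eta> = (x $ 2 - v * t) / 2" using True by (simp add: \<eta>_def)
        then have "2 * \<eta> = x $ 2 - v * t" by (simp only: field_sum_of_halves mult_2)
        then show ?thesis using close by linarith
      qed
      then have "2 * m * (x $ 2 - drift v t n) \<ge> 2 * m * \<eta>" using m by (intro mult_left_mono) auto
      then have "dp < - 1"
        using est2[of n] P2 P0 unfolding m_def[symmetric] dp_def by linarith
      then show ?thesis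
        using True by (simp add: smooth_step_eq_1 smooth_step_deriv_eq_0 half_plane_above_def)
    next
      case False
      then have "x $ 2 < v * t" using x by simp
      then have "drift v t n - x $ 2 \<ge> \<eta>"
      proof -
        have "\<eta> = (v * t - x $ 2) / 2" using \<open>x $ 2 < v * t\<close> by (simp add: \<eta>_def)
        then have "2 * \<eta> = v * t - x $ 2" by (simp only: field_sum_of_halves mult_2)
        then show ?thesis using close by linarith
      qed
      then have "2 * m * (drift v t n - x $ 2) \<ge> 2 * m * \<eta>" using m by (intro mult_left_mono) auto
      moreover have "2 * m * (drift v t n - x $ 2) = - (2 * m * (x $ 2 - drift v t n))"
        by (simp add: algebra_simps)
      ultimately have "dp > 0"
        using est1[of n] P2 P0 unfolding m_def[symmetric] dp_def by linarith
      then show ?thesis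
        using \<open>x $ 2 < v * t\<close> by (simp add: smooth_step_eq_0 smooth_step_deriv_eq_0 half_plane_above_def)
    qed
    then show ?case using N[OF elim(3), of x] by (simp add: R_def dp_def)
  qed
  moreover have "(\<lambda>n. 2 * v / (real n + 2)) \<longlonglongrightarrow> 0"
    by (intro tendsto_divide_0[OF tendsto_const] filterlim_at_top_imp_at_infinity shift_at_top)
  then have "(\<lambda>n. 2 * v / (real n + 2) + half_plane_above (v * t) x) \<longlonglongrightarrow> 0 + half_plane_above (v * t) x"
    by (intro tendsto_add tendsto_const)
  then have "(\<lambda>n. 2 * v / (real n + 2) + half_plane_above (v * t) x) \<longlonglongrightarrow> half_plane_above (v * t) x"
    by simp
  ultimately show ?thesis
    by (simp only: tendsto_cong)
qed

lemma AE_off_horizontal_line: "AE x::real^2 in lborel. x $ 2 \<noteq> h"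
proof -
  have "negligible {x::real^2. x $ 2 = h}"
    by (rule negligible_subset[OF negligible_standard_hyperplane[of "axis 2 1" h]])
      (auto simp: inner_axis axis_in_Basis_iff)
  then have "{x::real^2. x $ 2 = h} \<in> null_sets lebesgue"
    by (simp add: negligible_iff_null_sets)
  moreover have "closed {x::real^2. x $ 2 = h}"
    by (intro closed_Collect_eq continuous_intros)
  ultimately have "{x::real^2. x $ 2 = h} \<in> null_sets lborel"
    by (simp add: null_sets_completion_iff)
  then show ?thesis
    by (rule AE_I') auto
qed

text \<open>Dominated convergence on a compact set. In \<open>\<bar>v\<bar> + M + 1\<close> the
  first summand bounds the background since \<open>m \<ge> 2\<close>, the second the smoothed disc
  and the third the half-plane.\<close>

lemma approx_sol_tendsto: "L2_loc_tendsto (\<lambda>n. approx_sol v n t) (half_plane_above (v * t))"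
  unfolding L2_loc_tendsto_def
proof (intro conjI allI impI)
  fix n
  show "L2_loc (approx_sol v n t)"
    unfolding L2_loc_def
    by (intro conjI continuous_imp_locally_integrable continuous_intros approx_sol_properties)
      (simp add: borel_measurable_continuous_onI approx_sol_properties)
next
  have i: "integrable lborel (\<lambda>x::real^2. indicator K x *\<^sub>R c)" if "compact K" for K and c :: real
    by (rule borel_integrable_compact[OF that]) auto
  have bi: "integrable lborel (\<lambda>x. indicator K x *\<^sub>R (half_plane_above h x)\<^sup>2)" if K: "compact K" for K h
  proof (rule Bochner_Integration.integrable_bound[OF i[OF K, of 1]])
    have "K \<in> sets borel" using K by (simp add: borel_compact)
    then show "(\<lambda>x. indicator K x *\<^sub>R (half_plane_above h x)\<^sup>2) \<in> borel_measurable lborel" by simp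
    show "AE x in lborel. norm (indicator K x *\<^sub>R (half_plane_above h x)\<^sup>2) \<le> norm (indicator K x *\<^sub>R (1::real))"
      by (auto simp: half_plane_above_def indicator_def)
  qed
  then show "L2_loc (half_plane_above (v * t))"
    by (simp add: L2_loc_def locally_integrable_on_def set_integrable_def)
  fix K :: "(real^2) set" assume K: "compact K"
  have [measurable]: "K \<in> sets borel" using K by (simp add: borel_compact)
  obtain R where R: "\<And>x. x \<in> K \<Longrightarrow> norm x \<le> R"
    using compact_imp_bounded[OF K] by (auto simp: bounded_iff)
  obtain N where N: "\<And>n x. n \<ge> N \<Longrightarrow> norm x \<le> R \<Longrightarrow> approx_sol v n t x =
    2 * v / (real n + 2) + (smooth_step (depth v t n x) + depth v t n x * deriv smooth_step (depth v t n x))"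
    using approx_sol_local by blast
  obtain M where M: "M > 0" "\<And>x. \<bar>smooth_step x + x * deriv smooth_step x\<bar> \<le> M"
    using transition_bound by blast
  have [measurable]: "approx_sol v n t \<in> borel_measurable borel" for n
    by (intro borel_measurable_continuous_onI approx_sol_properties)
  \<comment> \<open>The shift by \<open>N\<close> makes the local formula, and with it the
    domination, valid for every index.\<close>
  have "(\<lambda>n. LINT x|lborel. indicator K x *\<^sub>R (approx_sol v (n + N) t x - half_plane_above (v * t) x)\<^sup>2)
      \<longlonglongrightarrow> (LINT x::real^2|lborel. 0)"
  proof (rule integral_dominated_convergence[where w = "\<lambda>x. indicator K x *\<^sub>R (\<bar>v\<bar> + M + 1)\<^sup>2"])
    show "integrable lborel (\<lambda>x. indicator K x *\<^sub>R (\<bar>v\<bar> + M + 1)\<^sup>2)" by (rule i[OF K])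
    show "AE x in lborel. (\<lambda>n. indicator K x *\<^sub>R (approx_sol v (n + N) t x - half_plane_above (v * t) x)\<^sup>2) \<longlonglongrightarrow> 0"
      using AE_off_horizontal_line[of "v * t"]
    proof eventually_elim
      case (elim x)
      have "(\<lambda>n. approx_sol v (n + N) t x) \<longlonglongrightarrow> half_plane_above (v * t) x"
        by (rule LIMSEQ_ignore_initial_segment[OF approx_sol_pointwise[OF elim]])
      then have "(\<lambda>n. indicator K x *\<^sub>R (approx_sol v (n + N) t x - half_plane_above (v * t) x)\<^sup>2) \<longlonglongrightarrow>
          indicator K x *\<^sub>R (half_plane_above (v * t) x - half_plane_above (v * t) x)\<^sup>2"
        by (intro tendsto_intros)
      then show ?case by simp
    qed
    show "AE x in lborel. norm (indicator K x *\<^sub>R (approx_sol v (n + N) t x - half_plane_above (v * t) x)\<^sup>2) \<le>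
        indicator K x *\<^sub>R (\<bar>v\<bar> + M + 1)\<^sup>2" for n
    proof (rule AE_I2)
      fix x :: "real^2"
      show "norm (indicator K x *\<^sub>R (approx_sol v (n + N) t x - half_plane_above (v * t) x)\<^sup>2) \<le>
        indicator K x *\<^sub>R (\<bar>v\<bar> + M + 1)\<^sup>2"
      proof (cases "x \<in> K")
        case True
        have "\<bar>2 * v / (real (n + N) + 2)\<bar> \<le> 2 * \<bar>v\<bar> / 2"
          unfolding abs_divide abs_mult by (intro frac_le) auto
        then have A: "\<bar>2 * v / (real (n + N) + 2)\<bar> \<le> \<bar>v\<bar>" by simp
        have e: "approx_sol v (n + N) t x = 2 * v / (real (n + N) + 2) +
          (smooth_step (depth v t (n + N) x) + depth v t (n + N) x * deriv smooth_step (depth v t (n + N) x))"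
          by (rule N[OF _ R[OF True]]) simp
        have "\<bar>approx_sol v (n + N) t x\<bar> \<le> \<bar>v\<bar> + M"
          unfolding e by (rule order_trans[OF abs_triangle_ineq add_mono[OF A M(2)]])
        moreover have "\<bar>half_plane_above (v * t) x\<bar> \<le> 1"
          by (simp add: half_plane_above_def indicator_def)
        ultimately have "\<bar>approx_sol v (n + N) t x - half_plane_above (v * t) x\<bar> \<le> \<bar>\<bar>v\<bar> + M + 1\<bar>"
          by linarith
        then have "(approx_sol v (n + N) t x - half_plane_above (v * t) x)\<^sup>2 \<le> (\<bar>v\<bar> + M + 1)\<^sup>2"
          by (simp only: abs_le_square_iff)
        then show ?thesis using True by simp
      qed simp
    qed
  qed simp_all
  then have "(\<lambda>n. LINT x:K|lborel. (approx_sol v (n + N) t x - half_plane_above (v * t) x)\<^sup>2) \<longlonglongrightarrow> 0"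
    by (simp add: set_lebesgue_integral_def)
  then show "(\<lambda>n. LINT x:K|lborel. (approx_sol v n t x - half_plane_above (v * t) x)\<^sup>2) \<longlonglongrightarrow> 0"
    by (rule LIMSEQ_offset)
qed

subsection \<open>The moving half-plane\<close>

lemma half_plane_above_distinct:
  assumes "a < b"
  shows "\<not> (AE x in lborel. half_plane_above a x = half_plane_above b x)"
proof
  let ?U = "{x::real^2. a < x $ 2} \<inter> {x. x $ 2 < b}"
  have o: "open ?U"
    by (intro open_Int open_Collect_less continuous_intros)
  assume "AE x in lborel. half_plane_above a x = half_plane_above b x"
  then have "AE x in lborel. x \<notin> ?U"
    by eventually_elim (auto simp: half_plane_above_def indicator_def split: if_splits)
  then have "?U \<in> null_sets lborel"
    using o by (subst AE_iff_null_sets) auto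
  then have "negligible ?U"
    by (simp add: negligible_iff_null_sets null_sets_completionI)
  moreover have "axis 2 ((a + b) / 2) \<in> ?U" using assms by simp
  ultimately show False using open_not_negligible[OF o] by blast
qed

section \<open>The limiting shear flow as a weak solution\<close>

definition ramp :: "real \<Rightarrow> real^2 \<Rightarrow> real" where
  "ramp h x = max 0 (x $ 2 - h)"

lemma continuous_on_ramp: "continuous_on S (ramp h)"
  unfolding ramp_def[abs_def] by (intro continuous_intros)

lemma half_plane_above_mult_ramp: "half_plane_above h x * ramp h x = ramp h x"
  by (auto simp: half_plane_above_def ramp_def indicator_def)

text \<open>The ramp is a primitive in the vertical direction of the indicator of the half-plane and
  is constant horizontally; its Lipschitz constants in the two directions are \<open>0\<close> and
  \<open>1\<close>.\<close>

lemma integral_ramp_partial: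
  assumes \<psi>: "test_function \<psi>"
  shows "(LINT x|lborel. ramp h x * partial 1 \<psi> x) = 0"
    and "(LINT x|lborel. ramp h x * partial 2 \<psi> x) = - (LINT x|lborel. half_plane_above h x * \<psi> x)"
proof -
  have "(LINT x|lborel. ramp h x * frechet_derivative \<psi> (at x) (axis 1 1)) = - (LINT x|lborel. 0 * \<psi> x)"
    by (rule integral_by_parts_lipschitz[OF \<psi> continuous_on_ramp, where L = 0])
      (auto simp: ramp_def axis_def)
  then show "(LINT x|lborel. ramp h x * partial 1 \<psi> x) = 0"
    by (simp add: partial_def)
  have "(LINT x|lborel. ramp h x * frechet_derivative \<psi> (at x) (axis 2 1)) =
      - (LINT x|lborel. half_plane_above h x * \<psi> x)"
  proof (rule integral_by_parts_lipschitz[OF \<psi> continuous_on_ramp, where L = 1])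
    show "\<bar>ramp h (x + s *\<^sub>R axis 2 1) - ramp h x\<bar> \<le> 1 * \<bar>s\<bar>" for x s
      by (simp add: ramp_def max_def)
    show "half_plane_above h \<in> borel_measurable borel" by simp
    show "AE x in lborel. ((\<lambda>s. (ramp h (x + s *\<^sub>R axis 2 1) - ramp h x) / s) \<longlongrightarrow> half_plane_above h x) (at 0)"
      using AE_off_horizontal_line[of h]
    proof eventually_elim
      case (elim x)
      have "eventually (\<lambda>s. dist s 0 < \<bar>x $ 2 - h\<bar>) (at (0::real))"
        using elim by (intro tendstoD[OF tendsto_ident_at]) simp
      moreover have "eventually (\<lambda>s. s \<noteq> 0) (at (0::real))"
        by (simp add: eventually_at_filter)
      ultimately have "eventually (\<lambda>s. half_plane_above h x = (ramp h (x + s *\<^sub>R axis 2 1) - ramp h x) / s) (at 0)"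
      proof eventually_elim
        case (elim s)
        show ?case
        proof (cases "x $ 2 > h")
          case True
          then have "ramp h (x + s *\<^sub>R axis 2 1) - ramp h x = s"
            using elim(1) by (auto simp: ramp_def max_def)
          then show ?thesis using elim(2) True by (simp add: half_plane_above_def)
        next
          case False
          then have "ramp h (x + s *\<^sub>R axis 2 1) - ramp h x = 0" "x $ 2 < h"
            using elim(1) \<open>x $ 2 \<noteq> h\<close> by (auto simp: ramp_def max_def)
          then show ?thesis by (simp add: half_plane_above_def)
        qed
      qed
      from Lim_transform_eventually[OF tendsto_const this] show ?case .
    qed
  qed
  then show "(LINT x|lborel. ramp h x * partial 2 \<psi> x) = - (LINT x|lborel. half_plane_above h x * \<psi> x)"
    by (simp add: partial_def)
qed

text \<open>A uniform rise with speed \<open>v\<close> plus a horizontal shear above the interface.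
  The shear carries the whole vorticity and slides along the interface without moving it; divergence
  and curl do not see the rise, which is why \<open>v\<close> is free.\<close>

definition shear_velocity :: "real \<Rightarrow> real \<Rightarrow> real^2 \<Rightarrow> real^2" where
  "shear_velocity v t x = (- ramp (v * t) x) *\<^sub>R axis 1 1 + v *\<^sub>R axis 2 1"

lemma shear_velocity_components [simp]:
  "shear_velocity v t x $ 1 = - ramp (v * t) x" "shear_velocity v t x $ 2 = v"
  by (simp_all add: shear_velocity_def axis_def)

lemma shear_velocity_inner_grad:
  "shear_velocity v t x \<bullet> grad \<psi> x = v * partial 2 \<psi> x - ramp (v * t) x * partial 1 \<psi> x"
  by (simp add: inner_vec_def sum_2 grad_def)

lemma continuous_on_shear_velocity:
  "continuous_on S (\<lambda>(t, x). shear_velocity v t x)" "continuous_on T (shear_velocity v t)"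
  unfolding shear_velocity_def[abs_def] ramp_def split_beta'
  by (intro continuous_intros)+

lemma integrable_ramp_partial:
  assumes \<psi>: "test_function \<psi>"
  shows "integrable lborel (\<lambda>x. ramp h x * partial j \<psi> x)"
proof -
  note tp = test_function_partial[OF \<psi>, of j]
  obtain R where "\<And>x. norm x \<ge> R \<Longrightarrow> partial j \<psi> x = 0"
    using test_function_supportE[OF tp] by metis
  then show ?thesis
    by (intro integrable_continuous_cs[of _ R] continuous_intros continuous_on_ramp test_function_continuous[OF tp]) simp
qed

lemma shear_velocity_div_free: "distr_div_free (shear_velocity v t)"
  unfolding distr_div_free_def shear_velocity_inner_grad
proof (intro allI impI)
  fix \<psi> :: "real^2 \<Rightarrow> real" assume \<psi>: "test_function \<psi>"
  have "(LINT x|lborel. partial 2 \<psi> x) = 0"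
    using integral_partial_eq_0[OF \<psi>] by (simp add: partial_def)
  then show "(LINT x|lborel. v * partial 2 \<psi> x - ramp (v * t) x * partial 1 \<psi> x) = 0"
    using integral_ramp_partial(1)[OF \<psi>] integrable_ramp_partial[OF \<psi>]
      test_function_integrable[OF test_function_partial[OF \<psi>]]
    by simp
qed

lemma shear_velocity_curl: "distr_curl (shear_velocity v t) (half_plane_above (v * t))"
  unfolding distr_curl_def shear_velocity_components
proof (intro allI impI)
  fix \<psi> :: "real^2 \<Rightarrow> real" assume \<psi>: "test_function \<psi>"
  have "(LINT x|lborel. partial 1 \<psi> x) = 0"
    using integral_partial_eq_0[OF \<psi>] by (simp add: partial_def)
  then show "(LINT x|lborel. - ramp (v * t) x * partial 2 \<psi> x - v * partial 1 \<psi> x) =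
      (LINT x|lborel. half_plane_above (v * t) x * \<psi> x)"
    using integral_ramp_partial(2)[OF \<psi>] integrable_ramp_partial[OF \<psi>]
      test_function_integrable[OF test_function_partial[OF \<psi>]]
    by simp
qed

lemma set_integrable_indicator_continuous:
  fixes f :: "'a::euclidean_space \<Rightarrow> 'b::euclidean_space"
  assumes "compact K" "closed A" "continuous_on UNIV f"
  shows "set_integrable lborel K (\<lambda>x. indicator A x *\<^sub>R f x)"
proof -
  have "integrable lborel (\<lambda>x. indicator (K \<inter> A) x *\<^sub>R f x)"
    using assms by (intro borel_integrable_compact compact_Int_closed continuous_on_subset[OF assms(3)]) auto
  then show ?thesis
    by (simp add: set_integrable_def indicator_inter_arith)
qed

lemma closed_moving_half_plane: "closed {(t, x::real^2). x $ 2 \<ge> v * t}"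
  unfolding split_beta' by (intro closed_Collect_le continuous_intros)

lemma half_plane_above_eq_indicator:
  "half_plane_above (v * t) x = indicator {(t, x). x $ 2 \<ge> v * t} (t, x)"
  by (simp add: half_plane_above_def indicator_def)

lemma half_plane_above_moving:
  "half_plane_above (v * t) ((v * t) *\<^sub>R axis 2 1 + x) = half_plane_above 0 x"
  by (simp add: half_plane_above_def indicator_def)

text \<open>In the frame moving with the interface the half-plane is at rest: composing
  \<open>\<phi>\<close> with \<open>L\<close> turns time derivative plus vertical transport into
  \<open>time_deriv \<Phi>\<close>. The shear contributes nothing, since the ramp does not depend on
  \<open>x $ 1\<close>.\<close>

lemma moving_half_plane_weak:
  assumes \<phi>: "test_function \<phi>" and T: "T \<ge> 0"
  shows "(LINT x|lborel. half_plane_above (v * T) x * \<phi> (T, x)) -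
      (LINT x|lborel. half_plane_above (v * 0) x * \<phi> (0, x)) =
    (LINT (t, x):{0..T} \<times> UNIV|lborel. half_plane_above (v * t) x *
      (deriv (\<lambda>s. \<phi> (s, x)) t + shear_velocity v t x \<bullet> grad (\<lambda>y. \<phi> (t, y)) x))"
proof -
  note sm = test_function_smooth[OF \<phi>]
  define e :: "real^2" where "e = axis 2 1"
  define L :: "real \<times> (real^2) \<Rightarrow> real \<times> (real^2)" where "L p = (fst p, (v * fst p) *\<^sub>R e + snd p)" for p
  define \<Phi> where "\<Phi> p = \<phi> (L p)" for p
  have L: "bounded_linear L"
    unfolding L_def[abs_def]
    by (intro bounded_linear_Pair bounded_linear_add bounded_linear_fst bounded_linear_snd
        bounded_linear_compose[OF bounded_linear_scaleR_left] bounded_linear_compose[OF bounded_linear_mult_right])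
  obtain R where R: "R > 0" "\<And>p. norm p \<ge> R \<Longrightarrow> \<phi> p = 0" "\<And>p w. norm p \<ge> R \<Longrightarrow> frechet_derivative \<phi> (at p) w = 0"
    using test_function_supportE[OF \<phi>] by metis
  have "smooth \<Phi>"
    using smooth_affine[OF L sm, of 0] by (simp add: \<Phi>_def[abs_def])
  moreover have "compactly_supported \<Phi>"
  \<comment> \<open>If \<open>norm (L p) < R\<close>, then the time is below \<open>R\<close> in
    modulus and undoing the translation adds at most \<open>\<bar>v\<bar> * R\<close> to the
    position, so \<open>norm p\<close> stays below \<open>R * (2 + \<bar>v\<bar>)\<close>.\<close>
  proof (rule compactly_supportedI[of "R * (2 + \<bar>v\<bar>)"])
    fix p :: "real \<times> (real^2)" assume p: "norm p \<ge> R * (2 + \<bar>v\<bar>)"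
    have "norm (L p) \<ge> R"
    proof (rule ccontr)
      assume "\<not> norm (L p) \<ge> R"
      then have "norm (fst (L p)) < R" "norm (snd (L p)) < R"
        using norm_fst_le[of "fst (L p)" "snd (L p)"] norm_snd_le[of "snd (L p)" "fst (L p)"] by auto
      then have a: "\<bar>fst p\<bar> < R" and b: "norm ((v * fst p) *\<^sub>R e + snd p) < R" by (simp_all add: L_def)
      have "norm (snd p) \<le> norm ((v * fst p) *\<^sub>R e + snd p) + norm ((v * fst p) *\<^sub>R e)"
        using norm_triangle_ineq4[of "(v * fst p) *\<^sub>R e + snd p" "(v * fst p) *\<^sub>R e"] by simp
      moreover have "norm ((v * fst p) *\<^sub>R e) = \<bar>v\<bar> * \<bar>fst p\<bar>"
        by (simp add: e_def abs_mult)
      moreover have "\<bar>v\<bar> * \<bar>fst p\<bar> \<le> \<bar>v\<bar> * R" using a by (intro mult_left_mono) auto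
      moreover have "norm p \<le> norm (fst p) + norm (snd p)"
        using norm_Pair_le[of "fst p" "snd p"] by simp
      ultimately show False using a b p by (simp add: algebra_simps)
    qed
    then show "\<Phi> p = 0" by (simp add: \<Phi>_def R(2))
  qed
  ultimately have \<Phi>: "test_function \<Phi>" by (simp add: test_function_def)
  have lin: "frechet_derivative \<phi> (at p) (1, v *\<^sub>R e) = time_deriv \<phi> p + v * space_deriv 2 \<phi> p" for p
  proof -
    have l: "linear (frechet_derivative \<phi> (at p))"
      by (rule has_derivative_linear[OF smooth_has_derivative[OF sm]])
    have "(1::real, v *\<^sub>R e) = (1, 0) + v *\<^sub>R (0, e)" by simp
    then have "frechet_derivative \<phi> (at p) (1, v *\<^sub>R e) =
        frechet_derivative \<phi> (at p) ((1, 0) + v *\<^sub>R (0, e))"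
      by (rule arg_cong)
    then show ?thesis
      unfolding time_deriv_def space_deriv_def e_def[symmetric] linear_add[OF l] linear_scale[OF l]
        real_scaleR_def .
  qed
  have td: "time_deriv \<Phi> p = time_deriv \<phi> (L p) + v * space_deriv 2 \<phi> (L p)" for p
  proof -
    have "(\<Phi> has_derivative (\<lambda>w. frechet_derivative \<phi> (at (L p)) (L w))) (at p)"
      unfolding \<Phi>_def[abs_def]
      by (rule has_derivative_compose[OF bounded_linear_imp_has_derivative[OF L] smooth_has_derivative[OF sm]])
    then have "time_deriv \<Phi> p = frechet_derivative \<phi> (at (L p)) (L (1, 0))"
      by (simp add: time_deriv_def frechet_derivative_at[symmetric])
    then show ?thesis by (simp add: L_def lin)
  qed
  define D where "D t x = time_deriv \<phi> (t, x) + v * space_deriv 2 \<phi> (t, x)" for t x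
  define F where "F t x = time_deriv \<phi> (t, x) + (v * space_deriv 2 \<phi> (t, x) - ramp (v * t) x * space_deriv 1 \<phi> (t, x))" for t x
  have F: "deriv (\<lambda>s. \<phi> (s, x)) t + shear_velocity v t x \<bullet> grad (\<lambda>y. \<phi> (t, y)) x = F t x" for t x
    by (simp add: F_def deriv_time_slice[OF sm] shear_velocity_inner_grad partial_slice[OF sm])
  have cont: "continuous_on UNIV (time_deriv \<phi>)" "continuous_on UNIV (space_deriv j \<phi>)" for j
    by (intro smooth_continuous_on smooth_time_deriv smooth_space_deriv sm)+
  have contF: "continuous_on UNIV (\<lambda>p. F (fst p) (snd p))"
    unfolding F_def ramp_def prod.collapse by (intro continuous_intros cont)
  have zF: "F t x = 0" if "norm x \<ge> R" for t x
    by (simp add: F_def time_deriv_def space_deriv_def R(3)[OF order_trans[OF that norm_snd_le]])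
  have "set_integrable lborel ({0..T} \<times> cball 0 R)
      (\<lambda>p. indicator {(t, x). x $ 2 \<ge> v * t} p *\<^sub>R F (fst p) (snd p))"
    by (intro set_integrable_indicator_continuous closed_moving_half_plane contF compact_Times) auto
  moreover have "(\<lambda>p. indicator ({0..T} \<times> cball 0 R) p *\<^sub>R (indicator {(t, x). x $ 2 \<ge> v * t} p *\<^sub>R F (fst p) (snd p))) =
      (\<lambda>p. indicator ({0..T} \<times> UNIV) p *\<^sub>R (case p of (t, x) \<Rightarrow> half_plane_above (v * t) x * F t x))"
    by (auto simp: fun_eq_iff half_plane_above_eq_indicator indicator_def zF split: if_splits)
  ultimately have int: "set_integrable lborel ({0..T} \<times> UNIV) (\<lambda>(t, x). half_plane_above (v * t) x * F t x)"
    by (simp only: set_integrable_def)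
  have slice: "(LINT x|lborel. half_plane_above (v * t) x * F t x) =
      (LINT x|lborel. half_plane_above 0 x * time_deriv \<Phi> (t, x))" for t
  proof -
    note ts = test_function_slice[OF \<phi>, of t]
    have tD: "integrable lborel (\<lambda>x. half_plane_above (v * t) x * D t x)"
    proof (rule Bochner_Integration.integrable_bound)
      show "integrable lborel (D t)"
      proof (rule integrable_continuous_cs[of _ R])
        show "continuous_on UNIV (D t)"
          unfolding D_def[abs_def]
          by (intro continuous_intros continuous_on_compose2[OF cont(1)] continuous_on_compose2[OF cont(2)]) auto
        show "D t x = 0" if "norm x \<ge> R" for x
          by (simp add: D_def time_deriv_def space_deriv_def R(3)[OF order_trans[OF that norm_snd_le]])
      qed
      then have "D t \<in> borel_measurable borel" by simp
      then show "(\<lambda>x. half_plane_above (v * t) x * D t x) \<in> borel_measurable lborel"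
        unfolding measurable_lborel2 by (rule borel_measurable_times[OF half_plane_above_measurable])
      show "AE x in lborel. norm (half_plane_above (v * t) x * D t x) \<le> norm (D t x)"
        by (auto simp: half_plane_above_def indicator_def)
    qed
    have "(LINT x|lborel. half_plane_above (v * t) x * F t x) =
        (LINT x|lborel. half_plane_above (v * t) x * D t x - ramp (v * t) x * partial 1 (\<lambda>y. \<phi> (t, y)) x)"
    proof (rule Bochner_Integration.integral_cong[OF refl])
      fix x
      have "half_plane_above (v * t) x * F t x = half_plane_above (v * t) x * D t x -
          (half_plane_above (v * t) x * ramp (v * t) x) * partial 1 (\<lambda>y. \<phi> (t, y)) x"
        by (simp add: F_def D_def partial_slice[OF sm] algebra_simps)
      then show "half_plane_above (v * t) x * F t x =
          half_plane_above (v * t) x * D t x - ramp (v * t) x * partial 1 (\<lambda>y. \<phi> (t, y)) x"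
        by (simp only: half_plane_above_mult_ramp)
    qed
    also have "\<dots> = (LINT x|lborel. half_plane_above (v * t) x * D t x)"
      using tD integrable_ramp_partial[OF ts] integral_ramp_partial(1)[OF ts] by simp
    also have "\<dots> = (LINT x|lborel. half_plane_above (v * t) ((v * t) *\<^sub>R e + x) * D t ((v * t) *\<^sub>R e + x))"
      using tD by (intro integral_translation[symmetric]) simp
    also have "\<dots> = (LINT x|lborel. half_plane_above 0 x * time_deriv \<Phi> (t, x))"
      unfolding e_def half_plane_above_moving td by (simp add: D_def L_def e_def)
    finally show ?thesis .
  qed
  have tr: "(LINT x|lborel. half_plane_above (v * t) x * \<phi> (t, x)) = (LINT x|lborel. half_plane_above 0 x * \<Phi> (t, x))" for t
  proof -
    have "(LINT x|lborel. half_plane_above (v * t) x * \<phi> (t, x)) =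
        (LINT x|lborel. half_plane_above (v * t) ((v * t) *\<^sub>R e + x) * \<phi> (t, (v * t) *\<^sub>R e + x))"
      by (rule integral_translation[symmetric])
        (intro borel_measurable_times half_plane_above_measurable test_function_measurable test_function_slice[OF \<phi>])
    then show ?thesis unfolding e_def half_plane_above_moving by (simp add: \<Phi>_def L_def e_def)
  qed
  have intP: "integrable lborel (\<lambda>x. half_plane_above 0 x * \<Phi> (t, x))" for t
  proof (rule Bochner_Integration.integrable_bound)
    show i: "integrable lborel (\<lambda>x. \<Phi> (t, x))"
      by (rule test_function_integrable[OF test_function_slice[OF \<Phi>]])
    then have "(\<lambda>x. \<Phi> (t, x)) \<in> borel_measurable borel" by simp
    then show "(\<lambda>x. half_plane_above 0 x * \<Phi> (t, x)) \<in> borel_measurable lborel"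
      unfolding measurable_lborel2 by (rule borel_measurable_times[OF half_plane_above_measurable])
    show "AE x in lborel. norm (half_plane_above 0 x * \<Phi> (t, x)) \<le> norm (\<Phi> (t, x))"
      by (auto simp: half_plane_above_def indicator_def)
  qed
  have "(LINT (t, x):{0..T} \<times> UNIV|lborel. half_plane_above (v * t) x * F t x) =
      (LINT t|lborel. indicator {0..T} t * (LINT x|lborel. half_plane_above 0 x * time_deriv \<Phi> (t, x)))"
    using set_integral_iterated[OF int] by (simp add: slice)
  also have "\<dots> = (LINT x|lborel. half_plane_above 0 x * (\<Phi> (T, x) - \<Phi> (0, x)))"
    by (rule ftc_fubini[OF \<Phi> half_plane_above_measurable _ T, of _ 1])
      (simp add: half_plane_above_def indicator_def)
  also have "\<dots> = (LINT x|lborel. half_plane_above 0 x * \<Phi> (T, x)) - (LINT x|lborel. half_plane_above 0 x * \<Phi> (0, x))"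
    by (simp add: right_diff_distrib intP)
  also have "\<dots> = (LINT x|lborel. half_plane_above (v * T) x * \<phi> (T, x)) -
      (LINT x|lborel. half_plane_above (v * 0) x * \<phi> (0, x))"
    by (simp only: tr)
  finally show ?thesis by (simp add: F)
qed

lemma half_plane_eq: "half_plane = half_plane_above 0"
  by (simp add: half_plane_def half_plane_above_def)

lemma moving_half_plane_euler:
  "euler_weak_solution half_plane (\<lambda>t. half_plane_above (v * t)) (shear_velocity v)"
  unfolding euler_weak_solution_def weak_vorticity_eq_def
proof (intro conjI allI impI)
  let ?A = "{(t, x::real^2). x $ 2 \<ge> v * t}"
  show "locally_integrable_on ({0..} \<times> UNIV) (\<lambda>(t, x). half_plane_above (v * t) x)"
    unfolding locally_integrable_on_def half_plane_above_eq_indicator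
    using set_integrable_indicator_continuous[OF _ closed_moving_half_plane[of v], of _ "\<lambda>p. 1::real"]
    by (simp add: split_beta')
  show "locally_integrable_on ({0..} \<times> UNIV) (\<lambda>(t, x). shear_velocity v t x)"
    by (intro continuous_imp_locally_integrable continuous_on_shear_velocity)
  show "locally_integrable_on ({0..} \<times> UNIV) (\<lambda>(t, x). half_plane_above (v * t) x *\<^sub>R shear_velocity v t x)"
    unfolding locally_integrable_on_def half_plane_above_eq_indicator
    using set_integrable_indicator_continuous[OF _ closed_moving_half_plane[of v] continuous_on_shear_velocity(1)[of _ v]]
    by (simp add: split_beta')
  show "locally_integrable_on UNIV (half_plane_above (v * t))" for t
  proof -
    have "closed {x::real^2. x $ 2 \<ge> v * t}" by (intro closed_Collect_le continuous_intros)
    from set_integrable_indicator_continuous[OF _ this, of _ "\<lambda>p. 1::real"] show ?thesis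
      by (simp add: locally_integrable_on_def half_plane_above_def)
  qed
  show "locally_integrable_on UNIV (shear_velocity v t)" for t
    by (intro continuous_imp_locally_integrable continuous_on_shear_velocity)
  show "AE x in lborel. half_plane_above (v * 0) x = half_plane x"
    by (simp add: half_plane_eq)
qed (rule moving_half_plane_weak shear_velocity_div_free shear_velocity_curl; assumption)+

theorem proposition1p2:
  shows "(\<exists>(w0 :: nat \<Rightarrow> nat \<Rightarrow> real^2 \<Rightarrow> real) (\<omega> :: nat \<Rightarrow> nat \<Rightarrow> real \<Rightarrow> real^2 \<Rightarrow> real)
            (f :: nat \<Rightarrow> real^2 \<Rightarrow> real).
            (\<forall>i\<in>{1, 2}.
               (\<forall>n. L1_Linf (w0 i n) \<and> compactly_supported (w0 i n) \<and>
                    yudovich_solution (w0 i n) (\<omega> i n)) \<and>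
               L2_loc_tendsto (w0 i) half_plane \<and>
               L2_loc_tendsto (\<lambda>n. \<omega> i n 1) (f i)) \<and>
            \<not> (AE x in lborel. f 1 x = f 2 x))
       \<and>
         (\<exists>S :: (real \<Rightarrow> real^2 \<Rightarrow> real) set.
            infinite S \<and>
            pairwise (\<lambda>\<omega> \<omega>'. \<exists>t\<ge>0. \<not> (AE x in lborel. \<omega> t x = \<omega>' t x)) S \<and>
            (\<forall>\<omega>\<in>S.
               (\<exists>u. euler_weak_solution half_plane \<omega> u) \<and>
               (\<exists>\<omega>n :: nat \<Rightarrow> real \<Rightarrow> real^2 \<Rightarrow> real.
                  (\<forall>n. smooth_compact_euler_solution (\<omega>n n)) \<and>
                  (\<forall>t\<ge>0. L2_loc_tendsto (\<lambda>n. \<omega>n n t) (\<omega> t)))))"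
proof (rule conjI, goal_cases)
  case 1
  \<comment> \<open>For the indices \<open>1\<close> and \<open>2\<close> the speeds are
    \<open>0\<close> and \<open>1\<close>: one half-plane stays at rest, the other has risen to
    height \<open>1\<close> at time \<open>1\<close>.\<close>
  let ?v = "\<lambda>i::nat. real i - 1"
  have "L2_loc_tendsto (\<lambda>n. approx_sol v n 0) half_plane" for v
    using approx_sol_tendsto[of v 0] by (simp add: half_plane_eq)
  moreover have "L2_loc_tendsto (\<lambda>n. approx_sol v n 1) (half_plane_above v)" for v
    using approx_sol_tendsto[of v 1] by simp
  moreover have "\<not> (AE x in lborel. half_plane_above (?v 1) x = half_plane_above (?v 2) x)"
    by (rule half_plane_above_distinct) simp
  ultimately show ?case
    by (intro exI[of _ "\<lambda>i n. approx_sol (?v i) n 0"] exI[of _ "\<lambda>i n. approx_sol (?v i) n"]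
        exI[of _ "\<lambda>i. half_plane_above (?v i)"] conjI ballI allI approx_sol_properties)
next
  case 2
  \<comment> \<open>Natural numbers serve as speeds; two different ones are told apart at time
    \<open>1\<close>, where the interfaces are at heights \<open>real j\<close> and
    \<open>real k\<close>.\<close>
  define \<Omega> where "\<Omega> k t = half_plane_above (real k * t)" for k :: nat and t
  have dist: "\<not> (AE x in lborel. \<Omega> j 1 x = \<Omega> k 1 x)" if "j \<noteq> k" for j k
  proof (cases "j < k")
    case True
    then show ?thesis using half_plane_above_distinct[of "real j" "real k"] by (simp add: \<Omega>_def)
  next
    case False
    then have "\<not> (AE x in lborel. \<Omega> k 1 x = \<Omega> j 1 x)"
      using half_plane_above_distinct[of "real k" "real j"] that by (simp add: \<Omega>_def)
    then show ?thesis by (simp add: eq_commute)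
  qed
  have "inj \<Omega>"
  proof (rule injI, rule ccontr)
    fix j k assume "\<Omega> j = \<Omega> k" "j \<noteq> k"
    then show False using dist[of j k] by simp
  qed
  then have "infinite (range \<Omega>)" by (rule range_inj_infinite)
  moreover have "pairwise (\<lambda>\<omega> \<omega>'. \<exists>t\<ge>0. \<not> (AE x in lborel. \<omega> t x = \<omega>' t x)) (range \<Omega>)"
  proof (rule pairwiseI)
    fix a b assume "a \<in> range \<Omega>" "b \<in> range \<Omega>" "a \<noteq> b"
    then obtain j k where "a = \<Omega> j" "b = \<Omega> k" "j \<noteq> k" by blast
    then show "\<exists>t\<ge>0. \<not> (AE x in lborel. a t x = b t x)"
      using dist by (intro exI[of _ 1]) simp
  qed
  moreover have "euler_weak_solution half_plane (\<Omega> k) (shear_velocity (real k))" for k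
    unfolding \<Omega>_def[abs_def] by (rule moving_half_plane_euler)
  moreover have "L2_loc_tendsto (\<lambda>n. approx_sol (real k) n t) (\<Omega> k t)" for k t
    unfolding \<Omega>_def by (rule approx_sol_tendsto)
  ultimately have "infinite (range \<Omega>) \<and>
      pairwise (\<lambda>\<omega> \<omega>'. \<exists>t\<ge>0. \<not> (AE x in lborel. \<omega> t x = \<omega>' t x)) (range \<Omega>) \<and>
      (\<forall>\<omega>\<in>range \<Omega>. (\<exists>u. euler_weak_solution half_plane \<omega> u) \<and>
        (\<exists>\<omega>n :: nat \<Rightarrow> real \<Rightarrow> real^2 \<Rightarrow> real.
          (\<forall>n. smooth_compact_euler_solution (\<omega>n n)) \<and>
          (\<forall>t\<ge>0. L2_loc_tendsto (\<lambda>n. \<omega>n n t) (\<omega> t))))"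
  proof (intro conjI ballI)
    fix w assume "w \<in> range \<Omega>"
    then obtain k where w: "w = \<Omega> k" by blast
    show "\<exists>u. euler_weak_solution half_plane w u"
      unfolding w by (rule exI) fact
    show "\<exists>\<omega>n :: nat \<Rightarrow> real \<Rightarrow> real^2 \<Rightarrow> real. (\<forall>n. smooth_compact_euler_solution (\<omega>n n)) \<and>
        (\<forall>t\<ge>0. L2_loc_tendsto (\<lambda>n. \<omega>n n t) (w t))"
      unfolding w using \<open>\<And>k t. L2_loc_tendsto (\<lambda>n. approx_sol (real k) n t) (\<Omega> k t)\<close>
      by (intro exI[of _ "approx_sol (real k)"] conjI allI impI approx_sol_properties(2))
  qed
  then show ?case by (rule exI)
qed

end
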